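(* Let $G$ and $H$ be hierarchically hyperbolic groups whose Morse boundaries $\partial G$ and $\partial H$ each have at least three points. A homeomorphism $h:\partial G\to\partial H$ is induced by a quasi-isometry $G\to H$ if and only if both $h$ and $h^{-1}$ are $2$-stable and quasi-möbius.
   Context: **Groups as metric spaces.** A finitely generated group is identified with its Cayley graph with respect to some finite generating set, a proper geodesic metric space; $\partial G$, $2$-stability, cross-ratios, etc. are those of this space. **Quasi-geodesics, Morse.** $f:X\to Y$ is a $(\lambda,\varepsilon)$-quasi-isometric embedding ($\lambda\ge1,\varepsilon\ge0$) if $\frac1\lambda d_X(x,y)-\varepsilon\le d_Y(f(x),f(y))\le\lambda d_X(x,y)+\varepsilon$ for all $x,y$; it is a quasi-isometry if moreover there are $\hat f:Y\to X$ and $D\ge0$ with $d_X(\hat f f(x),x)\le D$, $d_Y(f\hat f(y),y)\le D$ for all $x,y$. A $(\lambda,\varepsilon)$-quasi-geodesic is a $(\lambda,\varepsilon)$-quasi-isometric embedding of a closed interval $I\subseteq\mathbb R$. A Morse gauge is a function $N:[1,\infty)\times[0,\infty)\to[0,\infty)$; a quasi-geodesic $\gamma$ is $N$-Morse if every $(\lambda,\varepsilon)$-quasi-geodesic with endpoints on $\gamma$ lies in the $N(\lambda,\varepsilon)$-neighborhood of $\gamma$. Convention: when a geodesic is said to be $N$-Morse, $N$ is assumed large enough that all its subgeodesics are also $N$-Morse. **Morse boundary.** Let $X$ be a proper geodesic metric space, $p\in X$. Rays are asymptotic if their images have finite Hausdorff distance. $\partial_vX_p$ is the set of asymptotism classes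 of geodesic rays based at $p$; $B\subseteq\partial_vX_p$ is closed iff: whenever $(b_n)$ is a sequence in $B$, $\beta_n$ are rays based at $p$ with $[\beta_n]=b_n$, $b\in\partial_vX_p$, and every subsequence of $(\beta_n)$ has a further subsequence converging uniformly on compact sets to a ray in $b$, then $b\in B$. For a Morse gauge $N$, $\partial^NX_p\subseteq\partial_vX_p$ is the set of classes containing an $N$-Morse geodesic ray based at $p$, with the subspace topology. Gauges are partially ordered pointwise, and the Morse boundary is $\partial X=\partial_MX_p=\varinjlim_N\partial^NX_p=\bigcup_N\partial^NX_p$ with the direct limit topology. Changing the basepoint gives canonically homeomorphic boundaries (asymptotic rays correspond). A quasi-isometry $f:X\to Y$ induces a homeomorphism $f_*:\partial X\to\partial Y$ sending $[\gamma]$ to the class of geodesic rays at finite Hausdorff distance from $f(\gamma)$; $h$ is induced by $f$ if $h=f_*$. A bi-infinite (quasi-)geodesic $\gamma$ is from $a$ to $b$ ($a,b\in\partial X$) if $\gamma|_{(-\infty,0]}$ is asymptotic to a representative of $a$ and $\gamma|_{[0,\infty)}$ to a representative of $b$. **Centers, cross-ratio.** $\partial X^{(n,N)}$ is the set of $n$-tuples of pairwise distinct points of $\partial X$ such that every geodesic between any two of them is $N$-Morse. For $K>0$ and $(a,b,c)\in\partial X^{(3,N)}$, $m_X^{N,K}(a,b,c)$ is the set of $x\in X$ within $K$ of all three sides of some geodesic triangle with vertices $a,b,c$. For each gauge $N$, $K_N$ denotes a fixed constant such that every geodesic triangle (with vertices in the space or its Morse boundary) all of whose sides are $N$-Morse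 has points $q_1,q_2,q_3$, one on each side, pairwise at distance at most $K_N$ (such constants exist); so $m_X^{N,K}$ takes non-empty values for $K\ge K_N$. The $N$-cross-ratio of $(a,b,c,d)\in\partial X^{(4,N)}$ is $[a,b,c,d]_N=\operatorname{diam}\big(m_X^{N,K_N}(a,b,c)\cup m_X^{N,K_N}(a,d,c)\big)$. **2-stable, quasi-möbius.** $h:\partial X\to\partial Y$ is $2$-stable if for every $N$ there is $N'$ with $h(\partial X^{(2,N)})\subseteq\partial Y^{(2,N')}$. A $2$-stable $h$ is quasi-möbius if for every pair of gauges $N,N'$ with $h(\partial X^{(2,N)})\subseteq\partial Y^{(2,N')}$ there is a continuous increasing $\psi:[0,\infty)\to[0,\infty)$ with $[h(a),h(b),h(c),h(d)]_{N'}\le\psi([a,b,c,d]_N)$ for all $(a,b,c,d)\in\partial X^{(4,N)}$. **Hierarchically hyperbolic space (HHS).** A (quasi-)geodesic metric space $(\mathcal X,d)$ with an index set $\mathfrak S$ and $\delta$-hyperbolic spaces $\{CW\}_{W\in\mathfrak S}$ (one $\delta$ for all; distances $d_W$; $d_W(x,y)$ for $x,y\in\mathcal X$ means $d_W(\pi_W(x),\pi_W(y))$; distances between sets are infima) such that, for some constants $\xi,\kappa_0\ge0$, $\lambda\ge1$, $E\ge\max\{\xi,\kappa_0\}$, $\alpha$, $n$, $K$: (1) Projections: maps $\pi_W:\mathcal X\to2^{CW}$ with non-empty values of diameter $\le\xi$, each $(K,K)$-coarsely Lipschitz, with $\pi_W(\mathcal X)$ $K$-quasiconvex. (2) Nesting: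 a partial order $\sqsubseteq$ on $\mathfrak S$ with a unique maximal element $S$; $\mathfrak S_W=\{V:V\sqsubseteq W\}$; for $V\sqsubsetneq W$ a specified $\rho^V_W\subseteq CW$ of diameter $\le\xi$ and a map $\rho^W_V:CW\to2^{CV}$. (3) Orthogonality: a symmetric anti-reflexive relation $\perp$; $V\sqsubseteq W$ and $W\perp U$ imply $V\perp U$; for each $T\in\mathfrak S$ and $U\in\mathfrak S_T$ with $\{V\in\mathfrak S_T:V\perp U\}\ne\emptyset$ there is $W\in\mathfrak S_T\setminus\{T\}$ such that $V\perp U$, $V\sqsubseteq T$ imply $V\sqsubseteq W$; if $V\perp W$ then $V,W$ are not $\sqsubseteq$-comparable. (4) Transversality and consistency: $V,W$ are transverse ($V\pitchfork W$) if not orthogonal and not $\sqsubseteq$-comparable; then there are sets $\rho^V_W\subseteq CW$, $\rho^W_V\subseteq CV$ of diameter $\le\xi$ with $\min\{d_W(\pi_W(x),\rho^V_W),d_V(\pi_V(x),\rho^W_V)\}\le\kappa_0$ for all $x\in\mathcal X$. If $V\sqsubsetneq W$, then $\min\{d_W(\pi_W(x),\rho^V_W),\operatorname{diam}_{CV}(\pi_V(x)\cup\rho^W_V(\pi_W(x)))\}\le\kappa_0$ for all $x$. If $U\sqsubseteq V$, then $d_W(\rho^U_W,\rho^V_W)\le\kappa_0$ whenever $V\sqsubsetneq W$, or $V\pitchfork W$ and $W\not\perp U$. (5) Finite complexity: sets of pairwise $\sqsubseteq$-comparable elements have at most $n$ elements. (6) Large links: for $W\in\mathfrak S$, $x,x'\in\mathcal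 X$, with $P=\lambda d_W(\pi_W(x),\pi_W(x'))+\lambda$, there are $T_1,\dots,T_{\lfloor P\rfloor}\in\mathfrak S_W\setminus\{W\}$ such that every $T\in\mathfrak S_W\setminus\{W\}$ lies in some $\mathfrak S_{T_i}$ or satisfies $d_T(\pi_T(x),\pi_T(x'))<E$; and $d_W(\pi_W(x),\rho^{T_i}_W)\le P$ for each $i$. (7) Bounded geodesic image: for $V\sqsubsetneq W$ and every geodesic $\gamma$ of $CW$, $\operatorname{diam}_{CV}(\rho^W_V(\gamma))\le E$ or $\gamma$ meets the $E$-neighborhood of $\rho^V_W$. (8) Partial realization: for pairwise orthogonal $V_j$ and $p_j\in\pi_{V_j}(\mathcal X)$ there is $x\in\mathcal X$ with $d_{V_j}(\pi_{V_j}(x),p_j)\le\alpha$ for all $j$, and $d_V(\pi_V(x),\rho^{V_j}_V)\le\alpha$ whenever $V_j\sqsubsetneq V$ or $V\pitchfork V_j$. (9) Uniqueness: for each $\kappa\ge0$ there is $\theta(\kappa)$ such that $d(x,y)\ge\theta(\kappa)$ implies $d_V(\pi_V(x),\pi_V(y))\ge\kappa$ for some $V\in\mathfrak S$. **Hierarchically hyperbolic group (HHG).** A finitely generated group $G$ is an HHG if there is an HHS $(\mathcal X,\mathfrak S)$ with a proper, cobounded quasi-action of $G$ on $\mathcal X$ by uniform quasi-isometries, an action of $G$ on $\mathfrak S$ with finitely many orbits preserving $\sqsubseteq,\perp,\pitchfork$, and isometries $g^*_U:CU\to C(gU)$ for all $g\in G,U\in\mathfrak S$ (compatible with composition) such that,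 up to uniformly bounded error independent of $g$, $g^*_U\circ\pi_U$ agrees with $\pi_{gU}\circ g$; $g^*_V(\rho^U_V)$ agrees with $\rho^{gU}_{gV}$ whenever $U\pitchfork V$ or $U\sqsubsetneq V$; and $g^*_V\circ\rho^W_V$ agrees with $\rho^{gW}_{gV}\circ g^*_W$ whenever $V\sqsubsetneq W$. *)

theory Defs
  imports "HOL-Analysis.Analysis" "HOL-Algebra.Generated_Groups" "HOL-Algebra.Group_Action"
begin

section \<open>Coarse geometry of metric spaces\<close>

text \<open>Suprema and infima are taken in \<^typ>\<open>ennreal\<close>, so the empty set has diameter 0 and
  infinite distance from every set.\<close>

definition set_diam :: "'a metric \<Rightarrow> 'a set \<Rightarrow> ennreal" where
  "set_diam X A = (SUP x\<in>A. SUP y\<in>A. ennreal (mdist X x y))"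

definition set_dist :: "'a metric \<Rightarrow> 'a set \<Rightarrow> 'a set \<Rightarrow> ennreal" where
  "set_dist X A B = (INF x\<in>A. INF y\<in>B. ennreal (mdist X x y))"

definition nbhd :: "'a metric \<Rightarrow> real \<Rightarrow> 'a set \<Rightarrow> 'a set" where
  "nbhd X r A = {x \<in> mspace X. \<exists>a\<in>A. mdist X x a \<le> r}"

definition hausdorff_within :: "'a metric \<Rightarrow> real \<Rightarrow> 'a set \<Rightarrow> 'a set \<Rightarrow> bool" where
  "hausdorff_within X r A B \<longleftrightarrow> A \<subseteq> nbhd X r B \<and> B \<subseteq> nbhd X r A"

definition finite_hausdorff_dist :: "'a metric \<Rightarrow> 'a set \<Rightarrow> 'a set \<Rightarrow> bool" where
  "finite_hausdorff_dist X A B \<longleftrightarrow> (\<exists>r. hausdorff_within X r A B)"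

definition qi_embedding :: "real \<Rightarrow> real \<Rightarrow> 'a metric \<Rightarrow> 'b metric \<Rightarrow> ('a \<Rightarrow> 'b) \<Rightarrow> bool" where
  "qi_embedding L e X Y f \<longleftrightarrow>
     L \<ge> 1 \<and> e \<ge> 0 \<and> f \<in> mspace X \<rightarrow> mspace Y \<and>
     (\<forall>x\<in>mspace X. \<forall>y\<in>mspace X.
        (1 / L) * mdist X x y - e \<le> mdist Y (f x) (f y) \<and>
        mdist Y (f x) (f y) \<le> L * mdist X x y + e)"

definition quasi_isometry_with ::
    "real \<Rightarrow> real \<Rightarrow> real \<Rightarrow> 'a metric \<Rightarrow> 'b metric \<Rightarrow> ('a \<Rightarrow> 'b) \<Rightarrow> bool" where
  "quasi_isometry_with L e D X Y f \<longleftrightarrow>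
     qi_embedding L e X Y f \<and> D \<ge> 0 \<and>
     (\<exists>f' \<in> mspace Y \<rightarrow> mspace X.
        (\<forall>x\<in>mspace X. mdist X (f' (f x)) x \<le> D) \<and>
        (\<forall>y\<in>mspace Y. mdist Y (f (f' y)) y \<le> D))"

definition quasi_isometry :: "'a metric \<Rightarrow> 'b metric \<Rightarrow> ('a \<Rightarrow> 'b) \<Rightarrow> bool" where
  "quasi_isometry X Y f \<longleftrightarrow> (\<exists>L e D. quasi_isometry_with L e D X Y f)"

definition closed_interval :: "real set \<Rightarrow> bool" where
  "closed_interval I \<longleftrightarrow> I \<noteq> {} \<and> closed I \<and> is_interval I"

definition quasi_geodesic :: "'a metric \<Rightarrow> real \<Rightarrow> real \<Rightarrow> real set \<Rightarrow> (real \<Rightarrow> 'a) \<Rightarrow> bool" where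
  "quasi_geodesic X L e I q \<longleftrightarrow>
     closed_interval I \<and> qi_embedding L e (submetric euclidean_metric I) X q"

definition geodesic :: "'a metric \<Rightarrow> real set \<Rightarrow> (real \<Rightarrow> 'a) \<Rightarrow> bool" where
  "geodesic X I \<gamma> \<longleftrightarrow>
     closed_interval I \<and> \<gamma> \<in> I \<rightarrow> mspace X \<and>
     (\<forall>s\<in>I. \<forall>t\<in>I. mdist X (\<gamma> s) (\<gamma> t) = \<bar>s - t\<bar>)"

definition geodesic_segment :: "'a metric \<Rightarrow> 'a \<Rightarrow> 'a \<Rightarrow> 'a set \<Rightarrow> bool" where
  "geodesic_segment X x y A \<longleftrightarrow>
     (\<exists>l \<gamma>. geodesic X {0..l} \<gamma> \<and> \<gamma> 0 = x \<and> \<gamma> l = y \<and> A = \<gamma> ` {0..l})"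

definition geodesic_space :: "'a metric \<Rightarrow> bool" where
  "geodesic_space X \<longleftrightarrow> (\<forall>x\<in>mspace X. \<forall>y\<in>mspace X. \<exists>A. geodesic_segment X x y A)"

definition quasi_geodesic_space :: "'a metric \<Rightarrow> bool" where
  "quasi_geodesic_space X \<longleftrightarrow>
     (\<exists>L e. \<forall>x\<in>mspace X. \<forall>y\<in>mspace X.
        \<exists>l q. quasi_geodesic X L e {0..l} q \<and> q 0 = x \<and> q l = y)"

definition quasiconvex :: "'a metric \<Rightarrow> real \<Rightarrow> 'a set \<Rightarrow> bool" where
  "quasiconvex X K A \<longleftrightarrow>
     (\<forall>x\<in>A. \<forall>y\<in>A. \<forall>B. geodesic_segment X x y B \<longrightarrow> B \<subseteq> nbhd X K A)"

text \<open>Hyperbolicity: geodesic spaces with slim triangles. Permuting the vertices gives the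
  condition for the other two sides.\<close>

definition hyperbolic_space :: "real \<Rightarrow> 'a metric \<Rightarrow> bool" where
  "hyperbolic_space \<delta> X \<longleftrightarrow>
     geodesic_space X \<and>
     (\<forall>x y z A B C. geodesic_segment X x y A \<longrightarrow> geodesic_segment X y z B \<longrightarrow>
        geodesic_segment X z x C \<longrightarrow> A \<subseteq> nbhd X \<delta> (B \<union> C))"


section \<open>Morse geodesics\<close>

text \<open>Gauges are extensional functions, so two gauges are equal as soon as they agree on
  \<open>[1,\<infinity>) \<times> [0,\<infinity>)\<close>.\<close>

type_synonym gauge = "real \<times> real \<Rightarrow> real"

definition morse_gauges :: "gauge set" where
  "morse_gauges = ({1..} \<times> {0..}) \<rightarrow>\<^sub>E {0..}"

definition morse_quasi_geodesic :: "'a metric \<Rightarrow> gauge \<Rightarrow> real set \<Rightarrow> (real \<Rightarrow> 'a) \<Rightarrow> bool" where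
  "morse_quasi_geodesic X N I \<gamma> \<longleftrightarrow>
     (\<exists>L e. quasi_geodesic X L e I \<gamma>) \<and>
     (\<forall>L\<ge>1. \<forall>e\<ge>0. \<forall>a b q. quasi_geodesic X L e {a..b} q \<longrightarrow> q a \<in> \<gamma> ` I \<longrightarrow> q b \<in> \<gamma> ` I \<longrightarrow>
        q ` {a..b} \<subseteq> nbhd X (N (L, e)) (\<gamma> ` I))"

text \<open>For geodesics, being \<open>N\<close>-Morse is by convention required of all subgeodesics as well.\<close>

definition morse_geodesic :: "'a metric \<Rightarrow> gauge \<Rightarrow> real set \<Rightarrow> (real \<Rightarrow> 'a) \<Rightarrow> bool" where
  "morse_geodesic X N I \<gamma> \<longleftrightarrow>
     geodesic X I \<gamma> \<and> (\<forall>J\<subseteq>I. closed_interval J \<longrightarrow> morse_quasi_geodesic X N J \<gamma>)"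


section \<open>The Morse boundary\<close>

definition rays :: "'a metric \<Rightarrow> 'a \<Rightarrow> (real \<Rightarrow> 'a) set" where
  "rays X p = {\<gamma>. geodesic X {0..} \<gamma> \<and> \<gamma> 0 = p}"

definition asymptotic :: "'a metric \<Rightarrow> (real \<Rightarrow> 'a) \<Rightarrow> (real \<Rightarrow> 'a) \<Rightarrow> bool" where
  "asymptotic X \<alpha> \<beta> \<longleftrightarrow> finite_hausdorff_dist X (\<alpha> ` {0..}) (\<beta> ` {0..})"

type_synonym 'a bdpoint = "(real \<Rightarrow> 'a) set"

definition visual_boundary :: "'a metric \<Rightarrow> 'a \<Rightarrow> 'a bdpoint set" where
  "visual_boundary X p =
     rays X p // {(\<alpha>, \<beta>). \<alpha> \<in> rays X p \<and> \<beta> \<in> rays X p \<and> asymptotic X \<alpha> \<beta>}"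

definition converges_uoc :: "'a metric \<Rightarrow> (nat \<Rightarrow> real \<Rightarrow> 'a) \<Rightarrow> (real \<Rightarrow> 'a) \<Rightarrow> bool" where
  "converges_uoc X \<beta> \<gamma> \<longleftrightarrow>
     (\<forall>T. \<forall>e>0. \<forall>\<^sub>F n in sequentially. \<forall>t\<in>{0..T}. mdist X (\<beta> n t) (\<gamma> t) < e)"

definition visual_closed :: "'a metric \<Rightarrow> 'a \<Rightarrow> 'a bdpoint set \<Rightarrow> bool" where
  "visual_closed X p B \<longleftrightarrow>
     B \<subseteq> visual_boundary X p \<and>
     (\<forall>\<beta> b. (\<forall>n. \<exists>b'\<in>B. \<beta> n \<in> b') \<longrightarrow> b \<in> visual_boundary X p \<longrightarrow>
        (\<forall>r. strict_mono (r :: nat \<Rightarrow> nat) \<longrightarrow>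
           (\<exists>s. strict_mono (s :: nat \<Rightarrow> nat) \<and>
              (\<exists>\<gamma>\<in>b. converges_uoc X (\<lambda>n. \<beta> (r (s n))) \<gamma>))) \<longrightarrow>
        b \<in> B)"

definition visual_topology :: "'a metric \<Rightarrow> 'a \<Rightarrow> 'a bdpoint topology" where
  "visual_topology X p =
     topology (\<lambda>U. U \<subseteq> visual_boundary X p \<and> visual_closed X p (visual_boundary X p - U))"

lemma visual_closedD:
  assumes "visual_closed X p B" "\<forall>n. \<exists>b'\<in>B. \<beta> n \<in> b'" "b \<in> visual_boundary X p"
    and "\<And>r. strict_mono (r :: nat \<Rightarrow> nat) \<Longrightarrow> \<exists>s. strict_mono (s :: nat \<Rightarrow> nat) \<and>
           (\<exists>\<gamma>\<in>b. converges_uoc X (\<lambda>n. \<beta> (r (s n))) \<gamma>)"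
  shows "b \<in> B"
  using assms(1)[unfolded visual_closed_def, THEN conjunct2, rule_format, of \<beta> b] assms(2-4)
  by simp

lemma istopology_visual:
  "istopology (\<lambda>U. U \<subseteq> visual_boundary X p \<and> visual_closed X p (visual_boundary X p - U))"
proof -
  let ?V = "visual_boundary X p"
  have un: "visual_closed X p (B \<union> C)" if B: "visual_closed X p B" and C: "visual_closed X p C" for B C
    unfolding visual_closed_def
  proof (intro conjI allI impI)
    show "B \<union> C \<subseteq> ?V" using B C by (auto simp: visual_closed_def)
    fix \<beta> b
    assume \<beta>: "\<forall>n. \<exists>b'\<in>B \<union> C. \<beta> n \<in> b'" and b: "b \<in> ?V"
      and sub: "\<forall>r. strict_mono (r :: nat \<Rightarrow> nat) \<longrightarrow> (\<exists>s. strict_mono (s :: nat \<Rightarrow> nat) \<and>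
              (\<exists>\<gamma>\<in>b. converges_uoc X (\<lambda>n. \<beta> (r (s n))) \<gamma>))"
    have *: "b \<in> D" if D: "visual_closed X p D" and inf: "infinite {n. \<exists>b'\<in>D. \<beta> n \<in> b'}" for D
    proof -
      obtain r :: "nat \<Rightarrow> nat" where r: "strict_mono r" "\<And>n. \<exists>b'\<in>D. \<beta> (r n) \<in> b'"
        using infinite_enumerate[OF inf] by auto
      have "\<exists>s'. strict_mono s' \<and> (\<exists>\<gamma>\<in>b. converges_uoc X (\<lambda>n. (\<beta> \<circ> r) (s (s' n))) \<gamma>)"
        if s: "strict_mono s" for s :: "nat \<Rightarrow> nat"
        using sub[rule_format, OF strict_mono_o[OF r(1) s]] by simp
      moreover have "\<forall>n. \<exists>b'\<in>D. (\<beta> \<circ> r) n \<in> b'" using r by simp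
      ultimately show "b \<in> D" using visual_closedD[OF D _ b, of "\<beta> \<circ> r"] by simp
    qed
    have U: "{n. \<exists>b'\<in>B. \<beta> n \<in> b'} \<union> {n. \<exists>b'\<in>C. \<beta> n \<in> b'} = UNIV" (is "?P \<union> ?Q = _")
      using \<beta> by blast
    show "b \<in> B \<union> C"
    proof (cases "finite ?P")
      case True
      have "infinite (?P \<union> ?Q)" unfolding U by simp
      with True have "infinite ?Q" unfolding finite_Un by simp
      from *[OF C this] show ?thesis by simp
    next
      case False
      from *[OF B this] show ?thesis by simp
    qed
  qed
  have int: "visual_closed X p (?V - \<Union>\<U>)"
    if "\<forall>U\<in>\<U>. U \<subseteq> ?V \<and> visual_closed X p (?V - U)" for \<U>
    unfolding visual_closed_def
  proof (intro conjI allI impI)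
    fix \<beta> b
    assume \<beta>: "\<forall>n. \<exists>b'\<in>?V - \<Union>\<U>. \<beta> n \<in> b'" and b: "b \<in> ?V"
      and sub: "\<forall>r. strict_mono (r :: nat \<Rightarrow> nat) \<longrightarrow> (\<exists>s. strict_mono (s :: nat \<Rightarrow> nat) \<and>
              (\<exists>\<gamma>\<in>b. converges_uoc X (\<lambda>n. \<beta> (r (s n))) \<gamma>))"
    have "b \<in> ?V - U" if U: "U \<in> \<U>" for U
    proof -
      have "visual_closed X p (?V - U)" using \<open>\<forall>U\<in>\<U>. _\<close> U by blast
      moreover have "\<forall>n. \<exists>b'\<in>?V - U. \<beta> n \<in> b'" using \<beta> U by blast
      ultimately show ?thesis
        by (rule visual_closedD[OF _ _ b]) (use sub in simp)
    qed
    then show "b \<in> ?V - \<Union>\<U>" using b by blast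
  qed auto
  show ?thesis
    unfolding istopology_def
  proof (intro conjI allI impI)
    fix U W
    assume "U \<subseteq> ?V \<and> visual_closed X p (?V - U)" "W \<subseteq> ?V \<and> visual_closed X p (?V - W)"
    then show "visual_closed X p (?V - U \<inter> W)" using un[of "?V - U" "?V - W"] by (simp add: Diff_Int)
  qed (use int in auto)
qed

definition morse_stratum :: "'a metric \<Rightarrow> 'a \<Rightarrow> gauge \<Rightarrow> 'a bdpoint set" where
  "morse_stratum X p N = {b \<in> visual_boundary X p. \<exists>\<gamma>\<in>b. morse_geodesic X N {0..} \<gamma>}"

definition morse_boundary :: "'a metric \<Rightarrow> 'a \<Rightarrow> 'a bdpoint set" where
  "morse_boundary X p = (\<Union>N\<in>morse_gauges. morse_stratum X p N)"

definition morse_topology :: "'a metric \<Rightarrow> 'a \<Rightarrow> 'a bdpoint topology" where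
  "morse_topology X p =
     topology (\<lambda>U. U \<subseteq> morse_boundary X p \<and>
       (\<forall>N\<in>morse_gauges.
          openin (subtopology (visual_topology X p) (morse_stratum X p N))
                 (U \<inter> morse_stratum X p N)))"

lemma istopology_morse:
  "istopology (\<lambda>U. U \<subseteq> morse_boundary X p \<and>
     (\<forall>N\<in>morse_gauges. openin (subtopology (visual_topology X p) (morse_stratum X p N))
        (U \<inter> morse_stratum X p N)))"
proof -
  have 1: "openin \<T> (U \<inter> W \<inter> A)" if "openin \<T> (U \<inter> A)" "openin \<T> (W \<inter> A)"
    for \<T> and U W A :: "'a bdpoint set"
    using openin_Int[OF that] by (simp add: Int_ac)
  have 2: "openin \<T> (\<Union>\<U> \<inter> A)" if "\<And>U. U \<in> \<U> \<Longrightarrow> openin \<T> (U \<inter> A)"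
    for \<T> \<U> and A :: "'a bdpoint set"
    using openin_Union[of "(\<lambda>U. U \<inter> A) ` \<U>" \<T>] that by auto
  show ?thesis unfolding istopology_def by (intro conjI allI impI ballI 1 2) blast+
qed

lemma topspace_visual: "topspace (visual_topology X p) = visual_boundary X p"
proof -
  have "openin (visual_topology X p) (visual_boundary X p)"
    unfolding visual_topology_def topology_inverse'[OF istopology_visual]
    by (auto simp: visual_closed_def)
  moreover have "U \<subseteq> visual_boundary X p" if "openin (visual_topology X p) U" for U
    using that unfolding visual_topology_def topology_inverse'[OF istopology_visual] by blast
  ultimately show ?thesis unfolding topspace_def by blast
qed

lemma topspace_morse: "topspace (morse_topology X p) = morse_boundary X p"
proof -
  have "morse_boundary X p \<inter> morse_stratum X p N =
      topspace (subtopology (visual_topology X p) (morse_stratum X p N))"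
    if "N \<in> morse_gauges" for N
    using that by (auto simp: topspace_visual morse_boundary_def morse_stratum_def)
  then have "openin (morse_topology X p) (morse_boundary X p)"
    unfolding morse_topology_def topology_inverse'[OF istopology_morse] by (metis openin_topspace order_refl)
  moreover have "U \<subseteq> morse_boundary X p" if "openin (morse_topology X p) U" for U
    using that unfolding morse_topology_def topology_inverse'[OF istopology_morse] by blast
  ultimately show ?thesis unfolding topspace_def by blast
qed

definition induced_map ::
    "'a metric \<Rightarrow> 'b metric \<Rightarrow> 'b \<Rightarrow> ('a \<Rightarrow> 'b) \<Rightarrow> 'a bdpoint \<Rightarrow> 'b bdpoint" where
  "induced_map X Y q f b =
     {\<eta> \<in> rays Y q. \<exists>\<gamma>\<in>b. finite_hausdorff_dist Y (\<eta> ` {0..}) (f ` \<gamma> ` {0..})}"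

definition induced_by ::
    "'a metric \<Rightarrow> 'a \<Rightarrow> 'b metric \<Rightarrow> 'b \<Rightarrow> ('a bdpoint \<Rightarrow> 'b bdpoint) \<Rightarrow> ('a \<Rightarrow> 'b) \<Rightarrow> bool" where
  "induced_by X p Y q h f \<longleftrightarrow> (\<forall>b\<in>morse_boundary X p. h b = induced_map X Y q f b)"


section \<open>Centers and cross-ratios\<close>

text \<open>A vertex \<open>Inl x\<close> is a point of the space, a vertex \<open>Inr a\<close> a point of the boundary.\<close>

type_synonym 'a vertex = "'a + 'a bdpoint"

fun starts_at :: "'a metric \<Rightarrow> real set \<Rightarrow> (real \<Rightarrow> 'a) \<Rightarrow> 'a vertex \<Rightarrow> bool" where
  "starts_at X I \<gamma> (Inl x) \<longleftrightarrow> (\<exists>m\<in>I. (\<forall>t\<in>I. m \<le> t) \<and> \<gamma> m = x)"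
| "starts_at X I \<gamma> (Inr a) \<longleftrightarrow>
     \<not> bdd_below I \<and> (\<exists>\<alpha>\<in>a. finite_hausdorff_dist X (\<gamma> ` (I \<inter> {..0})) (\<alpha> ` {0..}))"

fun ends_at :: "'a metric \<Rightarrow> real set \<Rightarrow> (real \<Rightarrow> 'a) \<Rightarrow> 'a vertex \<Rightarrow> bool" where
  "ends_at X I \<gamma> (Inl y) \<longleftrightarrow> (\<exists>m\<in>I. (\<forall>t\<in>I. t \<le> m) \<and> \<gamma> m = y)"
| "ends_at X I \<gamma> (Inr b) \<longleftrightarrow>
     \<not> bdd_above I \<and> (\<exists>\<beta>\<in>b. finite_hausdorff_dist X (\<gamma> ` (I \<inter> {0..})) (\<beta> ` {0..}))"

definition geodesic_between ::
    "'a metric \<Rightarrow> 'a vertex \<Rightarrow> 'a vertex \<Rightarrow> real set \<Rightarrow> (real \<Rightarrow> 'a) \<Rightarrow> bool" where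
  "geodesic_between X u v I \<gamma> \<longleftrightarrow> geodesic X I \<gamma> \<and> starts_at X I \<gamma> u \<and> ends_at X I \<gamma> v"

definition line_between ::
    "'a metric \<Rightarrow> 'a bdpoint \<Rightarrow> 'a bdpoint \<Rightarrow> (real \<Rightarrow> 'a) \<Rightarrow> bool" where
  "line_between X a b \<gamma> \<longleftrightarrow> geodesic_between X (Inr a) (Inr b) UNIV \<gamma>"

definition morse_tuples :: "'a metric \<Rightarrow> 'a \<Rightarrow> nat \<Rightarrow> gauge \<Rightarrow> 'a bdpoint list set" where
  "morse_tuples X p n N =
     {as. length as = n \<and> distinct as \<and> set as \<subseteq> morse_boundary X p \<and>
          (\<forall>a\<in>set as. \<forall>b\<in>set as. a \<noteq> b \<longrightarrow>
             (\<forall>\<gamma>. line_between X a b \<gamma> \<longrightarrow> morse_geodesic X N UNIV \<gamma>))}"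

text \<open>The set \<open>m\<^bsub>X\<^esub>\<^bsup>N,K\<^esup>(a,b,c)\<close>; the gauge only restricts the triples \<open>(a,b,c)\<close> considered.\<close>

definition centers ::
    "'a metric \<Rightarrow> real \<Rightarrow> 'a bdpoint \<Rightarrow> 'a bdpoint \<Rightarrow> 'a bdpoint \<Rightarrow> 'a set" where
  "centers X K a b c =
     {x \<in> mspace X. \<exists>\<gamma>1 \<gamma>2 \<gamma>3.
        line_between X a b \<gamma>1 \<and> line_between X b c \<gamma>2 \<and> line_between X c a \<gamma>3 \<and>
        x \<in> nbhd X K (range \<gamma>1) \<and> x \<in> nbhd X K (range \<gamma>2) \<and> x \<in> nbhd X K (range \<gamma>3)}"

text \<open>Admissible choices of the constants \<open>K\<^sub>N\<close>.\<close>

definition center_constants :: "'a metric \<Rightarrow> 'a \<Rightarrow> (gauge \<Rightarrow> real) \<Rightarrow> bool" where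
  "center_constants X p K \<longleftrightarrow>
     (\<forall>N\<in>morse_gauges. K N > 0 \<and>
       (\<forall>u v w I1 I2 I3 \<gamma>1 \<gamma>2 \<gamma>3.
          {u, v, w} \<subseteq> Inl ` mspace X \<union> Inr ` morse_boundary X p \<longrightarrow>
          geodesic_between X u v I1 \<gamma>1 \<longrightarrow> morse_geodesic X N I1 \<gamma>1 \<longrightarrow>
          geodesic_between X v w I2 \<gamma>2 \<longrightarrow> morse_geodesic X N I2 \<gamma>2 \<longrightarrow>
          geodesic_between X w u I3 \<gamma>3 \<longrightarrow> morse_geodesic X N I3 \<gamma>3 \<longrightarrow>
          (\<exists>q1\<in>\<gamma>1 ` I1. \<exists>q2\<in>\<gamma>2 ` I2. \<exists>q3\<in>\<gamma>3 ` I3.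
             mdist X q1 q2 \<le> K N \<and> mdist X q2 q3 \<le> K N \<and> mdist X q3 q1 \<le> K N)))"

definition cross_ratio ::
    "'a metric \<Rightarrow> (gauge \<Rightarrow> real) \<Rightarrow> gauge \<Rightarrow>
     'a bdpoint \<Rightarrow> 'a bdpoint \<Rightarrow> 'a bdpoint \<Rightarrow> 'a bdpoint \<Rightarrow> ennreal" where
  "cross_ratio X K N a b c d = set_diam X (centers X (K N) a b c \<union> centers X (K N) a d c)"

definition two_stable ::
    "'a metric \<Rightarrow> 'a \<Rightarrow> 'b metric \<Rightarrow> 'b \<Rightarrow> ('a bdpoint \<Rightarrow> 'b bdpoint) \<Rightarrow> bool" where
  "two_stable X p Y q h \<longleftrightarrow>
     (\<forall>N\<in>morse_gauges. \<exists>N'\<in>morse_gauges.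
        map h ` morse_tuples X p 2 N \<subseteq> morse_tuples Y q 2 N')"

text \<open>Cross-ratios of tuples in \<^term>\<open>morse_tuples X p 4 N\<close> are finite, so \<^const>\<open>enn2real\<close>
  loses nothing.\<close>

definition quasi_moebius ::
    "'a metric \<Rightarrow> 'a \<Rightarrow> (gauge \<Rightarrow> real) \<Rightarrow> 'b metric \<Rightarrow> 'b \<Rightarrow> (gauge \<Rightarrow> real) \<Rightarrow>
     ('a bdpoint \<Rightarrow> 'b bdpoint) \<Rightarrow> bool" where
  "quasi_moebius X p KX Y q KY h \<longleftrightarrow>
     (\<forall>N\<in>morse_gauges. \<forall>N'\<in>morse_gauges.
        map h ` morse_tuples X p 2 N \<subseteq> morse_tuples Y q 2 N' \<longrightarrow>
        (\<exists>\<psi> :: real \<Rightarrow> real.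
           continuous_on {0..} \<psi> \<and> mono_on {0..} \<psi> \<and> \<psi> ` {0..} \<subseteq> {0..} \<and>
           (\<forall>a b c d. [a, b, c, d] \<in> morse_tuples X p 4 N \<longrightarrow>
              cross_ratio Y KY N' (h a) (h b) (h c) (h d)
                \<le> ennreal (\<psi> (enn2real (cross_ratio X KX N a b c d))))))"


section \<open>Cayley graphs\<close>

definition finite_generating_set :: "('g, 'm) monoid_scheme \<Rightarrow> 'g set \<Rightarrow> bool" where
  "finite_generating_set G S \<longleftrightarrow> finite S \<and> S \<subseteq> carrier G \<and> generate G S = carrier G"

text \<open>Geometric realization of the simplicial Cayley graph (edges \<open>{g, g \<otimes> s}\<close> of length 1) in
  barycentric coordinates: a point is a function assigning weights to the vertices.\<close>

definition edge_point :: "'g \<Rightarrow> 'g \<Rightarrow> real \<Rightarrow> 'g \<Rightarrow> real" where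
  "edge_point g h t = (\<lambda>v. (1 - t) * of_bool (v = g) + t * of_bool (v = h))"

definition cayley_points :: "('g, 'm) monoid_scheme \<Rightarrow> 'g set \<Rightarrow> ('g \<Rightarrow> real) set" where
  "cayley_points G S =
     {edge_point g g 0 | g. g \<in> carrier G} \<union>
     {edge_point g (g \<otimes>\<^bsub>G\<^esub> s) t | g s t. g \<in> carrier G \<and> s \<in> S \<and> t \<in> {0..1}}"

text \<open>\<open>cayley_path G S x y l\<close>: some finite chain of segments, each contained in a single edge,
  leads from \<open>x\<close> to \<open>y\<close> and has total length \<open>l\<close>.\<close>

inductive cayley_path ::
    "('g, 'm) monoid_scheme \<Rightarrow> 'g set \<Rightarrow> ('g \<Rightarrow> real) \<Rightarrow> ('g \<Rightarrow> real) \<Rightarrow> real \<Rightarrow> bool"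
  for G S where
  refl: "x \<in> cayley_points G S \<Longrightarrow> cayley_path G S x x 0"
| step: "\<lbrakk>cayley_path G S x (edge_point g (g \<otimes>\<^bsub>G\<^esub> s) t) l; g \<in> carrier G; s \<in> S;
          t \<in> {0..1}; u \<in> {0..1}\<rbrakk>
         \<Longrightarrow> cayley_path G S x (edge_point g (g \<otimes>\<^bsub>G\<^esub> s) u) (l + \<bar>t - u\<bar>)"

definition cayley_dist ::
    "('g, 'm) monoid_scheme \<Rightarrow> 'g set \<Rightarrow> ('g \<Rightarrow> real) \<Rightarrow> ('g \<Rightarrow> real) \<Rightarrow> real" where
  "cayley_dist G S x y =
     (if x \<in> cayley_points G S \<and> y \<in> cayley_points G S
      then Inf {l. cayley_path G S x y l} else 0)"

definition cayley_graph :: "('g, 'm) monoid_scheme \<Rightarrow> 'g set \<Rightarrow> ('g \<Rightarrow> real) metric" where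
  "cayley_graph G S = metric (cayley_points G S, cayley_dist G S)"

lemma cayley_path_points:
  "cayley_path G S x y l \<Longrightarrow> x \<in> cayley_points G S \<and> y \<in> cayley_points G S \<and> 0 \<le> l"
  by (induction rule: cayley_path.induct) (auto simp: cayley_points_def)

lemma cayley_path_trans:
  assumes "cayley_path G S y z m" "cayley_path G S x y l"
  shows "cayley_path G S x z (l + m)"
  using assms
proof (induction rule: cayley_path.induct)
  case (step x' g s t m u)
  show ?case using cayley_path.step[OF step.IH[OF step.prems] step.hyps(2-5)]
    by (simp add: add.assoc)
qed simp

lemma cayley_path_edge:
  assumes "g \<in> carrier G" "s \<in> S" "t \<in> {0..1}" "u \<in> {0..1}"
  shows "cayley_path G S (edge_point g (g \<otimes>\<^bsub>G\<^esub> s) t) (edge_point g (g \<otimes>\<^bsub>G\<^esub> s) u) \<bar>t - u\<bar>"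
proof -
  have "edge_point g (g \<otimes>\<^bsub>G\<^esub> s) t \<in> cayley_points G S"
    using assms by (auto simp: cayley_points_def)
  from cayley_path.step[OF cayley_path.refl[OF this] assms] show ?thesis by simp
qed

lemma cayley_path_sym: "cayley_path G S x y l \<Longrightarrow> cayley_path G S y x l"
proof (induction rule: cayley_path.induct)
  case (step x g s t l u)
  have "cayley_path G S (edge_point g (g \<otimes>\<^bsub>G\<^esub> s) u) (edge_point g (g \<otimes>\<^bsub>G\<^esub> s) t) \<bar>u - t\<bar>"
    using step.hyps by (intro cayley_path_edge)
  from cayley_path_trans[OF step.IH this] show ?case
    by (simp add: add.commute abs_minus_commute)
qed (rule cayley_path.refl)

lemma edge_point_0: "edge_point g h 0 = edge_point g g 0"
  by (simp add: edge_point_def)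

lemma edge_point_1: "edge_point g h 1 = edge_point h h 0"
  by (simp add: edge_point_def)

lemma cayley_path_coord: "cayley_path G S x y l \<Longrightarrow> \<bar>x v - y v\<bar> \<le> l"
proof (induction rule: cayley_path.induct)
  case (step x g s t l u)
  have "\<bar>edge_point g (g \<otimes>\<^bsub>G\<^esub> s) t v - edge_point g (g \<otimes>\<^bsub>G\<^esub> s) u v\<bar> \<le> \<bar>t - u\<bar>"
    by (auto simp: edge_point_def of_bool_def)
  with step.IH show ?case by linarith
qed simp

lemma (in group) cayley_path_vertices:
  assumes S: "S \<subseteq> carrier G" and k: "k \<in> generate G S" and g: "g \<in> carrier G"
  shows "\<exists>l. cayley_path G S (edge_point g g 0) (edge_point (g \<otimes> k) (g \<otimes> k) 0) l"
  using k g
proof (induction arbitrary: g rule: generate.induct)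
  case one
  then show ?case by (auto simp: cayley_points_def intro!: exI cayley_path.refl)
next
  case (incl s)
  have "cayley_path G S (edge_point g (g \<otimes> s) 0) (edge_point g (g \<otimes> s) 1) \<bar>0 - 1\<bar>"
    using incl by (intro cayley_path_edge) auto
  then show ?case by (auto simp: edge_point_0[of g "g \<otimes> s"] edge_point_1)
next
  case (inv s)
  let ?g = "g \<otimes> inv s"
  have s: "s \<in> carrier G" using inv S by auto
  have e: "?g \<otimes> s = g" using s inv by (simp add: m_assoc)
  have "cayley_path G S (edge_point ?g (?g \<otimes> s) 1) (edge_point ?g (?g \<otimes> s) 0) \<bar>1 - 0\<bar>"
    using inv s by (intro cayley_path_edge) auto
  then show ?case unfolding e by (auto simp: edge_point_0[of ?g g] edge_point_1)
next
  case (eng a b)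
  have ab: "a \<in> carrier G" "b \<in> carrier G"
    using eng.hyps generate_in_carrier[OF S] by auto
  obtain l m where "cayley_path G S (edge_point g g 0) (edge_point (g \<otimes> a) (g \<otimes> a) 0) l"
    and "cayley_path G S (edge_point (g \<otimes> a) (g \<otimes> a) 0)
           (edge_point (g \<otimes> a \<otimes> b) (g \<otimes> a \<otimes> b) 0) m"
    using eng.IH(1)[OF eng.prems] eng.IH(2)[of "g \<otimes> a"] eng.prems ab by auto
  from cayley_path_trans[OF this(2,1)] show ?case
    using ab eng.prems by (auto simp: m_assoc)
qed

lemma (in group) cayley_path_exists:
  assumes S: "finite_generating_set G S"
    and x: "x \<in> cayley_points G S" and y: "y \<in> cayley_points G S"
  shows "\<exists>l. cayley_path G S x y l"
proof -
  have to_vertex: "\<exists>g\<in>carrier G. \<exists>l. cayley_path G S z (edge_point g g 0) l"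
    if "z \<in> cayley_points G S" for z
    using that unfolding cayley_points_def
  proof (elim UnE CollectE exE conjE)
    fix g assume "z = edge_point g g 0" "g \<in> carrier G"
    with that show ?thesis by (blast intro: cayley_path.refl)
  next
    fix g s t assume z: "z = edge_point g (g \<otimes> s) t" and g: "g \<in> carrier G" "s \<in> S" "t \<in> {0..1}"
    have "cayley_path G S z (edge_point g (g \<otimes> s) 0) \<bar>t - 0\<bar>"
      unfolding z using g by (intro cayley_path_edge) auto
    then show ?thesis using g edge_point_0[of g "g \<otimes> s"] by auto
  qed
  obtain g k l m where g: "g \<in> carrier G" "cayley_path G S x (edge_point g g 0) l"
    and k: "k \<in> carrier G" "cayley_path G S y (edge_point k k 0) m"
    using to_vertex[OF x] to_vertex[OF y] by blast
  have "inv g \<otimes> k \<in> generate G S" "g \<otimes> (inv g \<otimes> k) = k"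
    using S g k by (auto simp: finite_generating_set_def m_assoc[symmetric])
  then obtain r where "cayley_path G S (edge_point g g 0) (edge_point k k 0) r"
    using cayley_path_vertices[of S "inv g \<otimes> k" g] S g by (auto simp: finite_generating_set_def)
  from cayley_path_trans[OF cayley_path_sym[OF k(2)] cayley_path_trans[OF this g(2)]]
  show ?thesis by blast
qed

lemma (in group) Metric_space_cayley:
  assumes S: "finite_generating_set G S"
  shows "Metric_space (cayley_points G S) (cayley_dist G S)"
proof
  have bdd: "bdd_below {l. cayley_path G S x y l}" for x y
    using cayley_path_points[of G S] by (intro bdd_belowI[of _ 0]) auto
  have ne: "{l. cayley_path G S x y l} \<noteq> {}"
    if "x \<in> cayley_points G S" "y \<in> cayley_points G S" for x y
    using cayley_path_exists[OF S that] by auto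
  fix x y
  show "0 \<le> cayley_dist G S x y"
    unfolding cayley_dist_def using cayley_path_points[of G S] ne[of x y]
    by (auto intro!: cInf_greatest)
  show "cayley_dist G S x y = cayley_dist G S y x"
  proof -
    have "cayley_path G S x y = cayley_path G S y x"
      using cayley_path_sym[of G S] by blast
    then show ?thesis by (simp add: cayley_dist_def)
  qed
  assume x: "x \<in> cayley_points G S" and y: "y \<in> cayley_points G S"
  show "(cayley_dist G S x y = 0) = (x = y)"
  proof
    assume 0: "cayley_dist G S x y = 0"
    show "x = y"
    proof
      fix v
      have "\<bar>x v - y v\<bar> \<le> Inf {l. cayley_path G S x y l}"
        using ne[OF x y] cayley_path_coord[of G S x y _ v] by (intro cInf_greatest) auto
      then show "x v = y v" using 0 x y by (auto simp: cayley_dist_def)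
    qed
  next
    assume "x = y"
    then have "Inf {l. cayley_path G S x y l} \<le> 0"
      using cayley_path.refl[OF x] by (auto intro!: cInf_lower bdd)
    moreover have "0 \<le> Inf {l. cayley_path G S x y l}"
      using ne[OF x y] cayley_path_points[of G S] by (auto intro!: cInf_greatest)
    ultimately show "cayley_dist G S x y = 0" using x y by (auto simp: cayley_dist_def)
  qed
  fix z assume z: "z \<in> cayley_points G S"
  have "Inf {l. cayley_path G S x z l} - m \<le> l"
    if "cayley_path G S x y l" "cayley_path G S y z m" for l m
    using cInf_lower[OF _ bdd[of x z], of "l + m"] cayley_path_trans[OF that(2,1)] by auto
  then have "Inf {l. cayley_path G S x z l} - m \<le> Inf {l. cayley_path G S x y l}"
    if "cayley_path G S y z m" for m
    using ne[OF x y] that by (intro cInf_greatest) auto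
  then have "Inf {l. cayley_path G S x z l} - Inf {l. cayley_path G S x y l} \<le> m"
    if "cayley_path G S y z m" for m
    using that by fastforce
  then have "Inf {l. cayley_path G S x z l} - Inf {l. cayley_path G S x y l}
      \<le> Inf {m. cayley_path G S y z m}"
    using ne[OF y z] by (intro cInf_greatest) auto
  then show "cayley_dist G S x z \<le> cayley_dist G S x y + cayley_dist G S y z"
    using x y z by (simp add: cayley_dist_def)
qed

lemma (in group) cayley_graph_simps:
  assumes "finite_generating_set G S"
  shows "mspace (cayley_graph G S) = cayley_points G S"
    and "mdist (cayley_graph G S) = cayley_dist G S"
  unfolding cayley_graph_def
  using Metric_space.mspace_metric[OF Metric_space_cayley[OF assms]]
    Metric_space.mdist_metric[OF Metric_space_cayley[OF assms]] by auto


section \<open>Hierarchically hyperbolic spaces\<close>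

text \<open>Field conventions: \<open>hrho V W\<close> is the set \<open>\<rho>\<^sup>V\<^sub>W \<subseteq> CW\<close> (for \<open>V\<close> properly nested in or
  transverse to \<open>W\<close>), and \<open>hrho_map W V\<close> is the map \<open>\<rho>\<^sup>W\<^sub>V : CW \<rightarrow> 2\<^bsup>CV\<^esup>\<close> (for \<open>V\<close> properly
  nested in \<open>W\<close>).\<close>

record ('x, 'i, 'c) hhs_data =
  hspace :: "'x metric"
  hindex :: "'i set"
  hcurve :: "'i \<Rightarrow> 'c metric"
  hproj :: "'i \<Rightarrow> 'x \<Rightarrow> 'c set"
  hnest :: "'i \<Rightarrow> 'i \<Rightarrow> bool"
  horth :: "'i \<Rightarrow> 'i \<Rightarrow> bool"
  hrho :: "'i \<Rightarrow> 'i \<Rightarrow> 'c set"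
  hrho_map :: "'i \<Rightarrow> 'i \<Rightarrow> 'c \<Rightarrow> 'c set"

definition hpnest :: "('x, 'i, 'c) hhs_data \<Rightarrow> 'i \<Rightarrow> 'i \<Rightarrow> bool" where
  "hpnest \<H> V W \<longleftrightarrow> hnest \<H> V W \<and> V \<noteq> W"

definition htrans :: "('x, 'i, 'c) hhs_data \<Rightarrow> 'i \<Rightarrow> 'i \<Rightarrow> bool" where
  "htrans \<H> V W \<longleftrightarrow> \<not> horth \<H> V W \<and> \<not> hnest \<H> V W \<and> \<not> hnest \<H> W V"

definition hbelow :: "('x, 'i, 'c) hhs_data \<Rightarrow> 'i \<Rightarrow> 'i set" where
  "hbelow \<H> W = {V \<in> hindex \<H>. hnest \<H> V W}"

definition hdist :: "('x, 'i, 'c) hhs_data \<Rightarrow> 'i \<Rightarrow> 'x \<Rightarrow> 'x \<Rightarrow> ennreal" where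
  "hdist \<H> W x y = set_dist (hcurve \<H> W) (hproj \<H> W x) (hproj \<H> W y)"

text \<open>In \<open>large_links\<close> the list \<open>T\<^sub>1, \<dots>, T\<^bsub>\<lfloor>P\<rfloor>\<^esub>\<close> is a set of at most \<open>\<lfloor>P\<rfloor>\<close> elements: as
  \<open>P \<ge> 1\<close>, demanding exactly \<open>\<lfloor>P\<rfloor>\<close> entries would fail for every \<open>\<sqsubseteq>\<close>-minimal \<open>W\<close>.\<close>

locale hhs =
  fixes \<H> :: "('x, 'i, 'c) hhs_data"
    and \<delta> \<xi> \<kappa>0 \<Lambda> E \<alpha> K :: real
    and n :: nat
  assumes constants: "\<xi> \<ge> 0" "\<kappa>0 \<ge> 0" "\<Lambda> \<ge> 1" "E \<ge> max \<xi> \<kappa>0"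
    and quasi_geodesic_space: "quasi_geodesic_space (hspace \<H>)"
    and hyperbolic: "\<And>W. W \<in> hindex \<H> \<Longrightarrow> hyperbolic_space \<delta> (hcurve \<H> W)"
    and proj: "\<And>W x. \<lbrakk>W \<in> hindex \<H>; x \<in> mspace (hspace \<H>)\<rbrakk> \<Longrightarrow>
        hproj \<H> W x \<subseteq> mspace (hcurve \<H> W) \<and> hproj \<H> W x \<noteq> {} \<and>
        set_diam (hcurve \<H> W) (hproj \<H> W x) \<le> ennreal \<xi>"
    and proj_lipschitz:
      "\<And>W x y. \<lbrakk>W \<in> hindex \<H>; x \<in> mspace (hspace \<H>); y \<in> mspace (hspace \<H>)\<rbrakk> \<Longrightarrow>
        hdist \<H> W x y \<le> ennreal (K * mdist (hspace \<H>) x y + K)"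
    and proj_quasiconvex: "\<And>W. W \<in> hindex \<H> \<Longrightarrow>
        quasiconvex (hcurve \<H> W) K (\<Union>x\<in>mspace (hspace \<H>). hproj \<H> W x)"
    and nest_order: "reflp_on (hindex \<H>) (hnest \<H>)" "transp_on (hindex \<H>) (hnest \<H>)"
      "antisymp_on (hindex \<H>) (hnest \<H>)"
    and nest_maximal:
      "\<exists>!S. S \<in> hindex \<H> \<and> (\<forall>V\<in>hindex \<H>. hnest \<H> S V \<longrightarrow> V = S)"
    and nest_rho: "\<And>V W. \<lbrakk>V \<in> hindex \<H>; W \<in> hindex \<H>; hpnest \<H> V W\<rbrakk> \<Longrightarrow>
        hrho \<H> V W \<subseteq> mspace (hcurve \<H> W) \<and>
        set_diam (hcurve \<H> W) (hrho \<H> V W) \<le> ennreal \<xi> \<and>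
        (\<forall>c\<in>mspace (hcurve \<H> W). hrho_map \<H> W V c \<subseteq> mspace (hcurve \<H> V))"
    and orth_sym: "symp_on (hindex \<H>) (horth \<H>)"
    and orth_irrefl: "irreflp_on (hindex \<H>) (horth \<H>)"
    and orth_nest: "\<And>U V W. \<lbrakk>U \<in> hindex \<H>; V \<in> hindex \<H>; W \<in> hindex \<H>;
        hnest \<H> V W; horth \<H> W U\<rbrakk> \<Longrightarrow> horth \<H> V U"
    and orth_container: "\<And>T U. \<lbrakk>T \<in> hindex \<H>; U \<in> hbelow \<H> T;
        {V \<in> hbelow \<H> T. horth \<H> V U} \<noteq> {}\<rbrakk> \<Longrightarrow>
        \<exists>W\<in>hbelow \<H> T - {T}. \<forall>V\<in>hbelow \<H> T. horth \<H> V U \<longrightarrow> hnest \<H> V W"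
    and orth_incomparable: "\<And>V W. \<lbrakk>V \<in> hindex \<H>; W \<in> hindex \<H>; horth \<H> V W\<rbrakk> \<Longrightarrow>
        \<not> hnest \<H> V W \<and> \<not> hnest \<H> W V"
    and trans_rho: "\<And>V W. \<lbrakk>V \<in> hindex \<H>; W \<in> hindex \<H>; htrans \<H> V W\<rbrakk> \<Longrightarrow>
        hrho \<H> V W \<subseteq> mspace (hcurve \<H> W) \<and>
        set_diam (hcurve \<H> W) (hrho \<H> V W) \<le> ennreal \<xi>"
    and trans_consistency:
      "\<And>V W x. \<lbrakk>V \<in> hindex \<H>; W \<in> hindex \<H>; htrans \<H> V W; x \<in> mspace (hspace \<H>)\<rbrakk> \<Longrightarrow>
        min (set_dist (hcurve \<H> W) (hproj \<H> W x) (hrho \<H> V W))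
            (set_dist (hcurve \<H> V) (hproj \<H> V x) (hrho \<H> W V)) \<le> ennreal \<kappa>0"
    and nest_consistency:
      "\<And>V W x. \<lbrakk>V \<in> hindex \<H>; W \<in> hindex \<H>; hpnest \<H> V W; x \<in> mspace (hspace \<H>)\<rbrakk> \<Longrightarrow>
        min (set_dist (hcurve \<H> W) (hproj \<H> W x) (hrho \<H> V W))
            (set_diam (hcurve \<H> V)
               (hproj \<H> V x \<union> (\<Union>c\<in>hproj \<H> W x. hrho_map \<H> W V c))) \<le> ennreal \<kappa>0"
    and rho_consistency:
      "\<And>U V W. \<lbrakk>U \<in> hindex \<H>; V \<in> hindex \<H>; W \<in> hindex \<H>; hnest \<H> U V;
        hpnest \<H> V W \<or> (htrans \<H> V W \<and> \<not> horth \<H> W U)\<rbrakk> \<Longrightarrow>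
        set_dist (hcurve \<H> W) (hrho \<H> U W) (hrho \<H> V W) \<le> ennreal \<kappa>0"
    and finite_complexity:
      "\<And>C. \<lbrakk>C \<subseteq> hindex \<H>; \<forall>V\<in>C. \<forall>W\<in>C. hnest \<H> V W \<or> hnest \<H> W V\<rbrakk> \<Longrightarrow>
        finite C \<and> card C \<le> n"
    and large_links: "\<And>W x x' P. \<lbrakk>W \<in> hindex \<H>; x \<in> mspace (hspace \<H>); x' \<in> mspace (hspace \<H>);
        P = \<Lambda> * enn2real (hdist \<H> W x x') + \<Lambda>\<rbrakk> \<Longrightarrow>
        \<exists>\<T>. finite \<T> \<and> card \<T> \<le> nat \<lfloor>P\<rfloor> \<and> \<T> \<subseteq> hbelow \<H> W - {W} \<and>
          (\<forall>T\<in>hbelow \<H> W - {W}. (\<exists>T'\<in>\<T>. T \<in> hbelow \<H> T') \<or> hdist \<H> T x x' < ennreal E) \<and>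
          (\<forall>T'\<in>\<T>. set_dist (hcurve \<H> W) (hproj \<H> W x) (hrho \<H> T' W) \<le> ennreal P)"
    and bounded_geodesic_image:
      "\<And>V W I \<gamma>. \<lbrakk>V \<in> hindex \<H>; W \<in> hindex \<H>; hpnest \<H> V W; geodesic (hcurve \<H> W) I \<gamma>\<rbrakk> \<Longrightarrow>
        set_diam (hcurve \<H> V) (\<Union>c\<in>\<gamma> ` I. hrho_map \<H> W V c) \<le> ennreal E \<or>
        \<gamma> ` I \<inter> nbhd (hcurve \<H> W) E (hrho \<H> V W) \<noteq> {}"
    and partial_realization:
      "\<And>\<V> p. \<lbrakk>\<V> \<subseteq> hindex \<H>; pairwise (horth \<H>) \<V>;
        \<forall>V\<in>\<V>. p V \<in> (\<Union>x\<in>mspace (hspace \<H>). hproj \<H> V x)\<rbrakk> \<Longrightarrow>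
        \<exists>x\<in>mspace (hspace \<H>). \<forall>V\<in>\<V>.
          set_dist (hcurve \<H> V) (hproj \<H> V x) {p V} \<le> ennreal \<alpha> \<and>
          (\<forall>W\<in>hindex \<H>. hpnest \<H> V W \<or> htrans \<H> W V \<longrightarrow>
             set_dist (hcurve \<H> W) (hproj \<H> W x) (hrho \<H> V W) \<le> ennreal \<alpha>)"
    and uniqueness: "\<And>\<kappa>. \<kappa> \<ge> 0 \<Longrightarrow> \<exists>\<theta>. \<forall>x\<in>mspace (hspace \<H>). \<forall>y\<in>mspace (hspace \<H>).
        mdist (hspace \<H>) x y \<ge> \<theta> \<longrightarrow> (\<exists>V\<in>hindex \<H>. hdist \<H> V x y \<ge> ennreal \<kappa>)"

definition hierarchically_hyperbolic_space :: "('x, 'i, 'c) hhs_data \<Rightarrow> bool" where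
  "hierarchically_hyperbolic_space \<H> \<longleftrightarrow> (\<exists>\<delta> \<xi> \<kappa>0 \<Lambda> E \<alpha> K n. hhs \<H> \<delta> \<xi> \<kappa>0 \<Lambda> E \<alpha> K n)"


section \<open>Hierarchically hyperbolic groups\<close>



definition quasi_action :: "('g, 'm) monoid_scheme \<Rightarrow> 'x metric \<Rightarrow> ('g \<Rightarrow> 'x \<Rightarrow> 'x) \<Rightarrow> bool" where
  "quasi_action G X \<phi> \<longleftrightarrow>
     (\<exists>L e D. (\<forall>g\<in>carrier G. quasi_isometry_with L e D X X (\<phi> g)) \<and>
        (\<forall>x\<in>mspace X. mdist X (\<phi> \<one>\<^bsub>G\<^esub> x) x \<le> D) \<and>
        (\<forall>g\<in>carrier G. \<forall>g'\<in>carrier G. \<forall>x\<in>mspace X.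
           mdist X (\<phi> g (\<phi> g' x)) (\<phi> (g \<otimes>\<^bsub>G\<^esub> g') x) \<le> D))"

definition proper_quasi_action ::
    "('g, 'm) monoid_scheme \<Rightarrow> 'x metric \<Rightarrow> ('g \<Rightarrow> 'x \<Rightarrow> 'x) \<Rightarrow> bool" where
  "proper_quasi_action G X \<phi> \<longleftrightarrow>
     (\<forall>x\<in>mspace X. \<forall>r. finite {g \<in> carrier G. \<phi> g ` mcball_of X x r \<inter> mcball_of X x r \<noteq> {}})"

definition cobounded_quasi_action ::
    "('g, 'm) monoid_scheme \<Rightarrow> 'x metric \<Rightarrow> ('g \<Rightarrow> 'x \<Rightarrow> 'x) \<Rightarrow> bool" where
  "cobounded_quasi_action G X \<phi> \<longleftrightarrow>
     (\<exists>x\<in>mspace X. \<exists>r. \<forall>y\<in>mspace X. \<exists>g\<in>carrier G. mdist X (\<phi> g x) y \<le> r)"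

definition isometry_between :: "'a metric \<Rightarrow> 'b metric \<Rightarrow> ('a \<Rightarrow> 'b) \<Rightarrow> bool" where
  "isometry_between X Y f \<longleftrightarrow>
     bij_betw f (mspace X) (mspace Y) \<and>
     (\<forall>x\<in>mspace X. \<forall>y\<in>mspace X. mdist Y (f x) (f y) = mdist X x y)"

text \<open>\<open>hhg_structure G \<H>\<close>: the HHS \<open>\<H>\<close> makes \<open>G\<close> a hierarchically hyperbolic group. Here
  \<open>\<phi>\<close> is the quasi-action on the space, \<open>act\<close> the action on the index set and \<open>star g U\<close> the
  isometry \<open>g\<^sup>*\<^sub>U : CU \<rightarrow> C(gU)\<close>.\<close>

definition hhg_structure :: "('g, 'm) monoid_scheme \<Rightarrow> ('x, 'i, 'c) hhs_data \<Rightarrow> bool" where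
  "hhg_structure G \<H> \<longleftrightarrow>
     group G \<and> (\<exists>S. finite_generating_set G S) \<and>
     hierarchically_hyperbolic_space \<H> \<and>
     (\<exists>\<phi> act star.
        quasi_action G (hspace \<H>) \<phi> \<and> proper_quasi_action G (hspace \<H>) \<phi> \<and>
        cobounded_quasi_action G (hspace \<H>) \<phi> \<and>
        group_action G (hindex \<H>) act \<and> finite (orbits G (hindex \<H>) act) \<and>
        (\<forall>g\<in>carrier G. \<forall>U\<in>hindex \<H>. \<forall>V\<in>hindex \<H>.
           (hnest \<H> (act g U) (act g V) \<longleftrightarrow> hnest \<H> U V) \<and>
           (horth \<H> (act g U) (act g V) \<longleftrightarrow> horth \<H> U V) \<and>
           (htrans \<H> (act g U) (act g V) \<longleftrightarrow> htrans \<H> U V)) \<and>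
        (\<forall>g\<in>carrier G. \<forall>U\<in>hindex \<H>.
           isometry_between (hcurve \<H> U) (hcurve \<H> (act g U)) (star g U)) \<and>
        (\<forall>g\<in>carrier G. \<forall>g'\<in>carrier G. \<forall>U\<in>hindex \<H>. \<forall>c\<in>mspace (hcurve \<H> U).
           star (g \<otimes>\<^bsub>G\<^esub> g') U c = star g (act g' U) (star g' U c)) \<and>
        (\<exists>r. \<forall>g\<in>carrier G. \<forall>V\<in>hindex \<H>.
           (\<forall>x\<in>mspace (hspace \<H>).
              hausdorff_within (hcurve \<H> (act g V)) r
                (star g V ` hproj \<H> V x) (hproj \<H> (act g V) (\<phi> g x))) \<and>
           (\<forall>U\<in>hindex \<H>. htrans \<H> U V \<or> hpnest \<H> U V \<longrightarrow>
              hausdorff_within (hcurve \<H> (act g V)) r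
                (star g V ` hrho \<H> U V) (hrho \<H> (act g U) (act g V))) \<and>
           (\<forall>W\<in>hindex \<H>. hpnest \<H> V W \<longrightarrow>
              (\<forall>c\<in>mspace (hcurve \<H> W).
                 hausdorff_within (hcurve \<H> (act g V)) r
                   (star g V ` hrho_map \<H> W V c)
                   (hrho_map \<H> (act g W) (act g V) (star g W c))))))"

end

(* The Morse property is replaced by a quasi-isometry invariant one, stability: any two
   quasi-geodesics with endpoints near two given points are uniformly close. If two sides of a
   triangle are stable, so is the third. In a proper geodesic space it follows that distinct points
   of the Morse boundary are joined by a line, with a gauge controlled by rays from a common point,
   and that the centers of an ideal Morse triangle form a bounded set.

   A quasi-isometry moves centers of triples to coarse centers of the image triples; hence it is
   2-stable and distorts cross-ratios linearly. Conversely, translates of one ideal triangle have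
   centers near every point x, and f x is chosen as a center of the image of such a triangle. Two
   triangles with the common center x are connected by at most three exchanges of a vertex with
   bounded cross-ratio, so f x is well defined up to a bounded error, and the map built in the same
   way from the inverse of h is a quasi-inverse of f. Points of a line from u to b are centers of
   triangles u, b, w, so f maps the line near the line from h u to h b, and f sends b to h u or h b.
   Since this holds for two different choices of u, it sends b to h b. *)

theory Submission
  imports Defs
begin

section \<open>Quasi-geodesics\<close>

text \<open>The obstacle is uniformity: bounds have to depend on the gauge and not on the points,
  since \<open>two_stable\<close> and \<open>quasi_moebius\<close> only control tuples of a fixed
  gauge. A common boundary point merely provides a finite, unknown Hausdorff distance; it is
  upgraded to an explicit function of the stability function (\<open>ray_bound\<close>,
  \<open>triangle_bound\<close>, \<open>morse_bound\<close>). The upgrade rests on one operation: a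
  point is joined by a geodesic to an almost nearest point of a quasi-geodesic. Each joining turns
  constants \<open>(L, e)\<close> into \<open>(3 * L, e + 1)\<close>, whence \<open>9 * L\<close>
  and \<open>e + 2\<close> after joining at both ends. Almost nearest means up to 1, because
  quasi-geodesics need not be continuous and no nearest point need exist; for the same reason a
  coarse intermediate value property replaces continuity. A cross-ratio compares two triples that
  share two points, which is why vertices are exchanged one at a time. All triples met on the way
  get a common gauge because their vertices are seen from \<open>x\<close> along uniformly stable
  rays.\<close>

lemma mdist_self [simp]: "x \<in> mspace X \<Longrightarrow> mdist X x x = 0"
  by simp

text \<open>The lower bound of a quasi-isometric embedding is written without division.\<close>

definition qgeo :: "'a metric \<Rightarrow> real \<Rightarrow> real \<Rightarrow> real set \<Rightarrow> (real \<Rightarrow> 'a) \<Rightarrow> bool" where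
  "qgeo X L e I q \<longleftrightarrow> L \<ge> 1 \<and> e \<ge> 0 \<and> q ` I \<subseteq> mspace X \<and>
     (\<forall>s\<in>I. \<forall>t\<in>I. \<bar>s - t\<bar> \<le> L * (mdist X (q s) (q t) + e) \<and>
        mdist X (q s) (q t) \<le> L * \<bar>s - t\<bar> + e)"

lemma quasi_geodesic_iff_qgeo:
  "quasi_geodesic X L e I q \<longleftrightarrow> closed_interval I \<and> qgeo X L e I q"
proof -
  have "(1 / L) * a - e \<le> b \<longleftrightarrow> a \<le> L * (b + e)" if "L \<ge> 1" for a b
    using that by (auto simp: field_simps)
  then show ?thesis
    unfolding quasi_geodesic_def qi_embedding_def qgeo_def by (auto simp: dist_real_def)
qed

lemma qgeo_in: "qgeo X L e I q \<Longrightarrow> t \<in> I \<Longrightarrow> q t \<in> mspace X"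
  by (auto simp: qgeo_def)

lemma qgeo_le: "qgeo X L e I q \<Longrightarrow> s \<in> I \<Longrightarrow> t \<in> I \<Longrightarrow> mdist X (q s) (q t) \<le> L * \<bar>s - t\<bar> + e"
  by (auto simp: qgeo_def)

lemma qgeo_ge: "qgeo X L e I q \<Longrightarrow> s \<in> I \<Longrightarrow> t \<in> I \<Longrightarrow> \<bar>s - t\<bar> \<le> L * (mdist X (q s) (q t) + e)"
  by (auto simp: qgeo_def)

lemma qgeo_consts: "qgeo X L e I q \<Longrightarrow> L \<ge> 1 \<and> e \<ge> 0"
  by (auto simp: qgeo_def)

lemma qgeo_mono:
  assumes q: "qgeo X L e I q" and "L \<le> L'" "e \<le> e'" "J \<subseteq> I"
  shows "qgeo X L' e' J q"
proof -
  have L: "L \<ge> 1" "e \<ge> 0" using qgeo_consts[OF q] by auto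
  have "\<bar>s - t\<bar> \<le> L' * (mdist X (q s) (q t) + e') \<and> mdist X (q s) (q t) \<le> L' * \<bar>s - t\<bar> + e'"
    if "s \<in> J" "t \<in> J" for s t
  proof -
    have st: "s \<in> I" "t \<in> I" using that assms by auto
    have "L * (mdist X (q s) (q t) + e) \<le> L' * (mdist X (q s) (q t) + e')"
      using assms L by (intro mult_mono) auto
    moreover have "L * \<bar>s - t\<bar> \<le> L' * \<bar>s - t\<bar>" using assms by (intro mult_right_mono) auto
    ultimately show ?thesis using qgeo_le[OF q st] qgeo_ge[OF q st] assms by linarith
  qed
  moreover have "q ` J \<subseteq> mspace X" using assms unfolding qgeo_def by blast
  ultimately show ?thesis using assms L unfolding qgeo_def by auto
qed

lemma qgeo_reparam:
  assumes q: "qgeo X L e I q" and "\<phi> ` J \<subseteq> I"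
    and "\<And>s t. s \<in> J \<Longrightarrow> t \<in> J \<Longrightarrow> \<bar>\<phi> s - \<phi> t\<bar> = \<bar>s - t\<bar>"
    and "\<And>t. t \<in> J \<Longrightarrow> q' t = q (\<phi> t)"
  shows "qgeo X L e J q'"
proof -
  have "\<bar>s - t\<bar> \<le> L * (mdist X (q' s) (q' t) + e)" "mdist X (q' s) (q' t) \<le> L * \<bar>s - t\<bar> + e"
    if "s \<in> J" "t \<in> J" for s t
    using qgeo_ge[OF q, of "\<phi> s" "\<phi> t"] qgeo_le[OF q, of "\<phi> s" "\<phi> t"] assms that
    by (auto simp: image_subset_iff)
  then show ?thesis using assms unfolding qgeo_def by (auto simp: image_subset_iff)
qed

lemma qgeo_reflect: "qgeo X L e I q \<Longrightarrow> qgeo X L e (uminus ` I) (\<lambda>t. q (- t))"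
  by (rule qgeo_reparam[where \<phi> = uminus]) auto

lemma geodesic_iff_qgeo: "geodesic X I \<gamma> \<longleftrightarrow> closed_interval I \<and> qgeo X 1 0 I \<gamma>"
  unfolding geodesic_def qgeo_def by (auto intro: antisym)

lemma geodesic_qgeo: "geodesic X I \<gamma> \<Longrightarrow> qgeo X 1 0 I \<gamma>"
  by (simp add: geodesic_iff_qgeo)

lemma geodesic_dist: "geodesic X I \<gamma> \<Longrightarrow> s \<in> I \<Longrightarrow> t \<in> I \<Longrightarrow> mdist X (\<gamma> s) (\<gamma> t) = \<bar>s - t\<bar>"
  by (simp add: geodesic_def)

lemma geodesic_in: "geodesic X I \<gamma> \<Longrightarrow> t \<in> I \<Longrightarrow> \<gamma> t \<in> mspace X"
  by (auto simp: geodesic_def)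

lemma closed_interval_simps [simp]:
  "closed_interval {a..b :: real} \<longleftrightarrow> a \<le> b"
  "closed_interval {a..}" "closed_interval {..b}" "closed_interval UNIV"
  by (auto simp: closed_interval_def is_interval_cc is_interval_ci is_interval_ic)

lemma geodesic_reparam:
  assumes "geodesic X I q" "closed_interval J" "\<phi> ` J \<subseteq> I"
    and "\<And>s t. s \<in> J \<Longrightarrow> t \<in> J \<Longrightarrow> \<bar>\<phi> s - \<phi> t\<bar> = \<bar>s - t\<bar>"
    and "\<And>t. t \<in> J \<Longrightarrow> q' t = q (\<phi> t)"
  shows "geodesic X J q'"
  using assms qgeo_reparam[of X 1 0 I q \<phi> J q'] by (auto simp: geodesic_iff_qgeo)

text \<open>The infimum of distances along a quasi-geodesic need not be attained, as no continuity
  is available; losing 1 is harmless in coarse estimates.\<close>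

lemma near_minimum:
  fixes \<phi> :: "'b \<Rightarrow> real"
  assumes "I \<noteq> {}" "\<And>t. t \<in> I \<Longrightarrow> 0 \<le> \<phi> t"
  shows "\<exists>t0\<in>I. \<forall>t\<in>I. \<phi> t0 \<le> \<phi> t + 1"
proof -
  have "Inf (\<phi> ` I) < Inf (\<phi> ` I) + 1" by simp
  then obtain t0 where t0: "t0 \<in> I" "\<phi> t0 < Inf (\<phi> ` I) + 1"
    using cInf_lessD[of "\<phi> ` I"] assms(1) by blast
  have "bdd_below (\<phi> ` I)" using assms(2) by (intro bdd_belowI[of _ 0]) auto
  then have "\<phi> t0 \<le> \<phi> t + 1" if "t \<in> I" for t
    using cInf_lower[of "\<phi> t" "\<phi> ` I"] that t0 by fastforce
  with t0 show ?thesis by blast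
qed

lemma near_nearest_point:
  assumes "I \<noteq> {}"
  shows "\<exists>t0\<in>I. \<forall>t\<in>I. mdist X x (q t0) \<le> mdist X x (q t) + 1"
  using near_minimum[of I "\<lambda>t. mdist X x (q t)"] assms by auto

text \<open>A geodesic from \<open>x\<close> to an almost nearest point cannot run back along
  \<open>q\<close>: from a point of it at distance \<open>k\<close> to \<open>q t0\<close>, every
  point of \<open>q\<close> is at least \<open>k - 1\<close> away. So the distance \<open>?d\<close>
  between a point of the geodesic and a point of \<open>q\<close> controls both legs of the
  concatenation, one by \<open>?d + 1\<close> and the other by \<open>2 * ?d + 1\<close>; their sum
  gives the factor 3. The segment is parametrized on \<open>{c..t0}\<close>, which leaves the
  parameter of \<open>q\<close> unchanged.\<close>

lemma qgeo_prepend_geodesic: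
  assumes X: "geodesic_space X" and q: "qgeo X L e J q" and t0: "t0 \<in> J" "\<And>t. t \<in> J \<Longrightarrow> t0 \<le> t"
    and x: "x \<in> mspace X" and near: "\<And>t. t \<in> J \<Longrightarrow> mdist X x (q t0) \<le> mdist X x (q t) + 1"
  obtains r c where "c = t0 - mdist X x (q t0)" "qgeo X (3 * L) (e + 1) ({c..t0} \<union> J) r" "r c = x"
    "\<And>t. t \<in> J \<Longrightarrow> r t = q t"
    "\<And>t. c \<le> t \<Longrightarrow> t \<le> t0 \<Longrightarrow> mdist X x (r t) = t - c \<and> mdist X (r t) (q t0) = t0 - t"
proof -
  have L: "L \<ge> 1" "e \<ge> 0" using qgeo_consts[OF q] by auto
  have inX: "q t \<in> mspace X" if "t \<in> J" for t using qgeo_in[OF q that] .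
  obtain l \<gamma> where g: "geodesic X {0..l} \<gamma>" "\<gamma> 0 = x" "\<gamma> l = q t0"
    using X x inX[OF t0(1)] unfolding geodesic_space_def geodesic_segment_def by meson
  have l0: "0 \<le> l" using g(1) by (simp add: geodesic_def)
  have ld: "mdist X x (q t0) = l" using geodesic_dist[OF g(1), of 0 l] g l0 by auto
  define c where "c = t0 - l"
  define r where "r = (\<lambda>t. if t \<in> J then q t else \<gamma> (t - c))"
  have rJ: "r t = q t" if "t \<in> J" for t using that by (simp add: r_def)
  have rc: "r t = \<gamma> (t - c)" if "c \<le> t" "t \<le> t0" for t
  proof (cases "t \<in> J")
    case True
    then have "t = t0" using t0(2)[of t] that by auto
    then show ?thesis using t0 g by (simp add: r_def c_def)
  qed (simp add: r_def)
  have gin: "\<gamma> (t - c) \<in> mspace X" if "c \<le> t" "t \<le> t0" for t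
    using geodesic_in[OF g(1)] that by (auto simp: c_def)
  have seg: "mdist X x (r t) = t - c \<and> mdist X (r t) (q t0) = t0 - t" if "c \<le> t" "t \<le> t0" for t
    using geodesic_dist[OF g(1), of 0 "t - c"] geodesic_dist[OF g(1), of "t - c" l] that g rc[OF that]
    by (auto simp: c_def)
  have mixed: "\<bar>s - t\<bar> \<le> 3 * L * (mdist X (r s) (r t) + (e + 1)) \<and>
      mdist X (r s) (r t) \<le> 3 * L * \<bar>s - t\<bar> + (e + 1)"
    if s: "c \<le> s" "s \<le> t0" and t: "t \<in> J" for s t
  proof -
    let ?d = "mdist X (r s) (q t)"
    have rs: "r s \<in> mspace X" using gin[OF s] rc[OF s] by simp
    have st: "s \<le> t" "t0 \<le> t" using t0(2)[OF t] s by auto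
    have a: "mdist X (r s) (q t0) = t0 - s" "mdist X x (r s) = s - c" using seg[OF s] by auto
    have b: "mdist X (q t0) (q t) \<le> L * (t - t0) + e" "t - t0 \<le> L * (mdist X (q t0) (q t) + e)"
      using qgeo_le[OF q t0(1) t] qgeo_ge[OF q t0(1) t] st by auto
    have "?d \<le> (t0 - s) + mdist X (q t0) (q t)"
      using mdist_triangle[OF rs inX[OF t0(1)] inX[OF t]] a by simp
    also have "\<dots> \<le> (t0 - s) + (L * (t - t0) + e)" using b by simp
    also have "\<dots> \<le> L * (t0 - s) + (L * (t - t0) + e)"
      using L s mult_right_mono[of 1 L "t0 - s"] by simp
    also have "\<dots> = L * (t - s) + e" by (simp add: algebra_simps)
    also have "\<dots> \<le> 3 * L * (t - s) + (e + 1)"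
      using L st mult_right_mono[of L "3 * L" "t - s"] by simp
    finally have 1: "?d \<le> 3 * L * (t - s) + (e + 1)" .
    \<comment> \<open>A route to \<open>q t\<close> through \<open>r s\<close> is at most 1 shorter
      than the almost minimal distance \<open>t0 - c\<close>, so the part \<open>t0 - s\<close>
      still missing at \<open>r s\<close> is at most \<open>?d + 1\<close>.\<close>
    have "mdist X x (q t) \<le> (s - c) + ?d"
      using mdist_triangle[OF x rs inX[OF t]] a by simp
    then have k: "t0 - s \<le> ?d + 1" using near[OF t] ld by (simp add: c_def)
    have "mdist X (q t0) (q t) \<le> (t0 - s) + ?d"
      using mdist_triangle[OF inX[OF t0(1)] rs inX[OF t]] a by (simp add: mdist_commute)
    then have "L * (mdist X (q t0) (q t) + e) \<le> L * (2 * ?d + 1 + e)"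
      using k L by (intro mult_left_mono) auto
    then have "t - t0 \<le> L * (2 * ?d + 1 + e)" using b(2) by linarith
    moreover have "?d + 1 \<le> L * (?d + 1)" using L mult_right_mono[of 1 L "?d + 1"] by simp
    ultimately have "t - s \<le> L * (2 * ?d + 1 + e) + L * (?d + 1)" using k by linarith
    also have "\<dots> = L * (3 * ?d + 2 + e)" by (simp add: algebra_simps)
    also have "\<dots> \<le> L * (3 * (?d + (e + 1)))" using L by (intro mult_left_mono) auto
    finally have "t - s \<le> 3 * L * (?d + (e + 1))" by (simp add: algebra_simps)
    with 1 show ?thesis using st rJ[OF t] by simp
  qed
  have inner: "\<bar>s - t\<bar> \<le> 3 * L * (mdist X (r s) (r t) + (e + 1)) \<and>
      mdist X (r s) (r t) \<le> 3 * L * \<bar>s - t\<bar> + (e + 1)"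
    if s: "c \<le> s" "s \<le> t0" and t: "c \<le> t" "t \<le> t0" for s t
  proof -
    have eq: "mdist X (r s) (r t) = \<bar>s - t\<bar>"
      using geodesic_dist[OF g(1), of "s - c" "t - c"] s t rc[OF s] rc[OF t] by (auto simp: c_def)
    have "a \<le> 3 * L * (a + (e + 1)) \<and> a \<le> 3 * L * a + (e + 1)" if "0 \<le> a" for a
    proof -
      have "1 * (a + (e + 1)) \<le> 3 * L * (a + (e + 1))" "1 * a \<le> 3 * L * a"
        using L that by (intro mult_right_mono; simp)+
      then show ?thesis using L by auto
    qed
    then show ?thesis unfolding eq by simp
  qed
  have outer: "\<bar>s - t\<bar> \<le> 3 * L * (mdist X (r s) (r t) + (e + 1)) \<and>
      mdist X (r s) (r t) \<le> 3 * L * \<bar>s - t\<bar> + (e + 1)"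
    if s: "s \<in> J" and t: "t \<in> J" for s t
  proof -
    have "qgeo X (3 * L) (e + 1) J q" using q L by (intro qgeo_mono[OF q]) auto
    from qgeo_le[OF this s t] qgeo_ge[OF this s t] show ?thesis by (simp add: rJ[OF s] rJ[OF t])
  qed
  have "qgeo X (3 * L) (e + 1) ({c..t0} \<union> J) r"
    unfolding qgeo_def
  proof (intro conjI ballI)
    show "r ` ({c..t0} \<union> J) \<subseteq> mspace X" using gin rc rJ inX by auto
    fix s t assume st: "s \<in> {c..t0} \<union> J" "t \<in> {c..t0} \<union> J"
    have "\<bar>s - t\<bar> \<le> 3 * L * (mdist X (r s) (r t) + (e + 1)) \<and>
      mdist X (r s) (r t) \<le> 3 * L * \<bar>s - t\<bar> + (e + 1)"
      using st mixed[of s t] mixed[of t s] inner[of s t] outer[of s t]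
      by (auto simp: mdist_commute[of X "r t" "r s"] abs_minus_commute[of t s])
    then show "\<bar>s - t\<bar> \<le> 3 * L * (mdist X (r s) (r t) + (e + 1))"
      "mdist X (r s) (r t) \<le> 3 * L * \<bar>s - t\<bar> + (e + 1)" by auto
  qed (use L in auto)
  moreover have "r c = x" using rc[of c] g l0 by (simp add: c_def)
  ultimately show ?thesis using that[of c r] rJ seg ld by (simp add: c_def)
qed

lemma qgeo_append_geodesic:
  assumes X: "geodesic_space X" and q: "qgeo X L e J q" and t0: "t0 \<in> J" "\<And>t. t \<in> J \<Longrightarrow> t \<le> t0"
    and x: "x \<in> mspace X" and near: "\<And>t. t \<in> J \<Longrightarrow> mdist X x (q t0) \<le> mdist X x (q t) + 1"
  obtains r c where "c = t0 + mdist X x (q t0)" "qgeo X (3 * L) (e + 1) (J \<union> {t0..c}) r" "r c = x"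
    "\<And>t. t \<in> J \<Longrightarrow> r t = q t"
    "\<And>t. t0 \<le> t \<Longrightarrow> t \<le> c \<Longrightarrow> mdist X x (r t) = c - t \<and> mdist X (r t) (q t0) = t - t0"
proof -
  have q': "qgeo X L e (uminus ` J) (\<lambda>t. q (- t))" by (rule qgeo_reflect[OF q])
  obtain r c where r: "c = - t0 - mdist X x (q t0)"
    "qgeo X (3 * L) (e + 1) ({c..- t0} \<union> uminus ` J) r" "r c = x"
    "\<And>t. t \<in> uminus ` J \<Longrightarrow> r t = q (- t)"
    "\<And>t. c \<le> t \<Longrightarrow> t \<le> - t0 \<Longrightarrow> mdist X x (r t) = t - c \<and> mdist X (r t) (q t0) = - t0 - t"
    by (rule qgeo_prepend_geodesic[OF X q', of "- t0" x]) (use assms in auto)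
  have "qgeo X (3 * L) (e + 1) (J \<union> {t0..- c}) (\<lambda>t. r (- t))"
    by (rule qgeo_reparam[OF r(2), where \<phi> = uminus]) auto
  then show ?thesis
  proof (rule that[rotated])
    show "mdist X x (r (- t)) = - c - t \<and> mdist X (r (- t)) (q t0) = t - t0" if "t0 \<le> t" "t \<le> - c" for t
      using r(5)[of "- t"] that by auto
    show "r (- (- c)) = x" using r(3) by simp
  qed (use r in auto)
qed

text \<open>\<open>\<tau>\<close> may jump, but by at most \<open>c\<close> within unit parameter
  steps, so its values shortly before the last moment below \<open>v\<close> and one step later
  enclose \<open>v\<close>.\<close>

lemma coarse_ivt:
  fixes \<tau> :: "real \<Rightarrow> real"
  assumes "A \<le> B" and step: "\<And>s t. s \<in> {A..B} \<Longrightarrow> t \<in> {A..B} \<Longrightarrow> \<bar>s - t\<bar> \<le> 1 \<Longrightarrow> \<bar>\<tau> s - \<tau> t\<bar> \<le> c"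
    and v: "\<tau> A \<le> v" "v \<le> \<tau> B"
  shows "\<exists>u\<in>{A..B}. \<bar>\<tau> u - v\<bar> \<le> c"
proof -
  let ?S = "{u \<in> {A..B}. \<tau> u \<le> v}"
  have A: "A \<in> ?S" using assms by auto
  have bdd: "bdd_above ?S" by (rule bdd_aboveI[of _ B]) auto
  \<comment> \<open>With \<open>u\<close> less than 1 below the supremum, \<open>u + 1\<close> lies
    beyond it and cannot satisfy \<open>\<tau> (u + 1) \<le> v\<close>; the minimum with
    \<open>B\<close> handles the end of the interval.\<close>
  have "Sup ?S - 1/2 < Sup ?S" by simp
  then obtain u where u: "u \<in> ?S" "Sup ?S - 1/2 < u"
    using less_cSup_iff[of ?S "Sup ?S - 1/2"] A bdd by blast
  let ?w = "min B (u + 1)"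
  have w: "?w \<in> {A..B}" "\<bar>u - ?w\<bar> \<le> 1" using u by auto
  have "\<tau> ?w \<ge> v"
  proof (rule ccontr)
    assume n: "\<not> ?thesis"
    then have "?w \<noteq> B" using v by auto
    then have "?w = u + 1" by auto
    moreover have "?w \<in> ?S" using n w by auto
    ultimately have "u + 1 \<le> Sup ?S" using cSup_upper[OF _ bdd] by auto
    then show False using u by simp
  qed
  moreover have "\<bar>\<tau> u - \<tau> ?w\<bar> \<le> c" using step[of u ?w] u w by auto
  ultimately have "\<bar>\<tau> u - v\<bar> \<le> c" using u by auto
  then show ?thesis using u by (intro bexI[of _ u]) auto
qed

lemma coarse_ivt_between:
  fixes \<tau> :: "real \<Rightarrow> real"
  assumes "A \<le> B" and step: "\<And>s t. s \<in> {A..B} \<Longrightarrow> t \<in> {A..B} \<Longrightarrow> \<bar>s - t\<bar> \<le> 1 \<Longrightarrow> \<bar>\<tau> s - \<tau> t\<bar> \<le> c"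
    and v: "min (\<tau> A) (\<tau> B) \<le> v" "v \<le> max (\<tau> A) (\<tau> B)"
  shows "\<exists>u\<in>{A..B}. \<bar>\<tau> u - v\<bar> \<le> c"
proof (cases "\<tau> A \<le> \<tau> B")
  case True
  then show ?thesis using coarse_ivt[of A B \<tau> c v] assms by auto
next
  case False
  have "\<exists>u\<in>{A..B}. \<bar>- \<tau> u - (- v)\<bar> \<le> c"
    by (rule coarse_ivt[OF assms(1)]) (use step v False in \<open>auto simp: abs_minus_commute\<close>)
  then show ?thesis by (auto simp: abs_minus_commute)
qed

section \<open>Neighbourhoods and finite Hausdorff distance\<close>

lemma nbhdI: "x \<in> mspace X \<Longrightarrow> a \<in> A \<Longrightarrow> mdist X x a \<le> r \<Longrightarrow> x \<in> nbhd X r A"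
  by (auto simp: nbhd_def)

lemma nbhdE:
  assumes "x \<in> nbhd X r A" obtains a where "a \<in> A" "mdist X x a \<le> r" "x \<in> mspace X"
  using assms by (auto simp: nbhd_def)

lemma nbhd_mono: "r \<le> r' \<Longrightarrow> A \<subseteq> B \<Longrightarrow> nbhd X r A \<subseteq> nbhd X r' B"
  unfolding nbhd_def by (blast intro: order_trans)

lemma nbhd_trans:
  assumes "A \<subseteq> nbhd X r B" "B \<subseteq> nbhd X s C" "C \<subseteq> mspace X"
  shows "A \<subseteq> nbhd X (r + s) C"
proof
  fix a assume "a \<in> A"
  then obtain b where b: "b \<in> B" "mdist X a b \<le> r" "a \<in> mspace X" using assms by (blast elim: nbhdE)
  then obtain c where c: "c \<in> C" "mdist X b c \<le> s" "b \<in> mspace X" using assms by (blast elim: nbhdE)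
  then show "a \<in> nbhd X (r + s) C"
    using mdist_triangle[of a X b c] b assms(3) by (intro nbhdI[of _ _ c]) auto
qed

lemma nbhd_refl: "A \<subseteq> mspace X \<Longrightarrow> 0 \<le> r \<Longrightarrow> A \<subseteq> nbhd X r A"
proof
  fix a assume "A \<subseteq> mspace X" "0 \<le> r" "a \<in> A"
  moreover from this have "mdist X a a = 0" by (subst mdist_zero) auto
  ultimately show "a \<in> nbhd X r A" by (intro nbhdI[of _ _ a]) auto
qed

lemma fhdI: "A \<subseteq> nbhd X r B \<Longrightarrow> B \<subseteq> nbhd X s A \<Longrightarrow> finite_hausdorff_dist X A B"
  unfolding finite_hausdorff_dist_def hausdorff_within_def
  using nbhd_mono[of r "max r s" B B X] nbhd_mono[of s "max r s" A A X] by (intro exI[of _ "max r s"]) auto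

lemma fhd_sym: "finite_hausdorff_dist X A B \<Longrightarrow> finite_hausdorff_dist X B A"
  by (auto simp: finite_hausdorff_dist_def hausdorff_within_def)

lemma fhd_in: "finite_hausdorff_dist X A B \<Longrightarrow> A \<subseteq> mspace X \<and> B \<subseteq> mspace X"
  by (auto simp: finite_hausdorff_dist_def hausdorff_within_def nbhd_def)

lemma fhd_refl: "A \<subseteq> mspace X \<Longrightarrow> finite_hausdorff_dist X A A"
  using nbhd_refl[of A X 0] by (auto intro: fhdI)

lemma fhd_trans:
  assumes "finite_hausdorff_dist X A B" "finite_hausdorff_dist X B C"
  shows "finite_hausdorff_dist X A C"
proof -
  obtain r s where "A \<subseteq> nbhd X r B" "B \<subseteq> nbhd X r A" "B \<subseteq> nbhd X s C" "C \<subseteq> nbhd X s B"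
    using assms by (auto simp: finite_hausdorff_dist_def hausdorff_within_def)
  then show ?thesis using fhd_in[OF assms(1)] fhd_in[OF assms(2)] by (meson nbhd_trans fhdI)
qed

lemma fhdE:
  assumes "finite_hausdorff_dist X A B"
  obtains r where "r \<ge> 0" "A \<subseteq> nbhd X r B" "B \<subseteq> nbhd X r A"
proof -
  obtain r where "A \<subseteq> nbhd X r B" "B \<subseteq> nbhd X r A"
    using assms by (auto simp: finite_hausdorff_dist_def hausdorff_within_def)
  then show ?thesis using that[of "max 0 r"] nbhd_mono[of r "max 0 r" B B X] nbhd_mono[of r "max 0 r" A A X] by auto
qed

lemma fhd_coarse_image:
  assumes f: "\<And>x y. x \<in> mspace X \<Longrightarrow> y \<in> mspace X \<Longrightarrow> mdist Y (f x) (f y) \<le> L * mdist X x y + e"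
    and "0 \<le> L" "f ` mspace X \<subseteq> mspace Y" "finite_hausdorff_dist X A B"
  shows "finite_hausdorff_dist Y (f ` A) (f ` B)"
proof -
  obtain r where r: "A \<subseteq> nbhd X r B" "B \<subseteq> nbhd X r A" using fhdE[OF assms(4)] by metis
  have *: "f ` A' \<subseteq> nbhd Y (L * r + e) (f ` B')"
    if AB: "A' \<subseteq> nbhd X r B'" "B' \<subseteq> mspace X" for A' B'
  proof (rule image_subsetI)
    fix a assume "a \<in> A'"
    then obtain b where b: "b \<in> B'" "mdist X a b \<le> r" "a \<in> mspace X" using AB by (blast elim: nbhdE)
    have "L * mdist X a b \<le> L * r" using b assms by (intro mult_left_mono) auto
    then show "f a \<in> nbhd Y (L * r + e) (f ` B')"
      using f[of a b] b AB assms by (intro nbhdI[of _ _ "f b"]) (fastforce simp: image_subset_iff)+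
  qed
  show ?thesis using *[OF r(1)] *[OF r(2)] fhd_in[OF assms(4)] by (intro fhdI) auto
qed

text \<open>A quasi-geodesic ray moves to infinity coarsely continuously, so when it stays near a
  second quasi-geodesic ray it also comes near every point of that ray.\<close>

lemma qgeo_ray_fhd:
  assumes \<eta>: "qgeo X L e {0..} \<eta>" and \<tau>: "qgeo X L e {0..} \<tau>"
    and near: "\<eta> ` {0..} \<subseteq> nbhd X R (\<tau> ` {0..})"
  shows "finite_hausdorff_dist X (\<eta> ` {0..}) (\<tau> ` {0..})"
proof -
  have L: "L \<ge> 1" "e \<ge> 0" using qgeo_consts[OF \<eta>] by auto
  have "\<exists>u. t \<ge> 0 \<longrightarrow> u \<ge> 0 \<and> mdist X (\<eta> t) (\<tau> u) \<le> R" for t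
    using near by (force elim!: nbhdE simp: image_subset_iff)
  then obtain u where u: "\<And>t. t \<ge> 0 \<Longrightarrow> u t \<ge> 0 \<and> mdist X (\<eta> t) (\<tau> (u t)) \<le> R" by metis
  have in\<eta>: "\<eta> t \<in> mspace X" "\<tau> t \<in> mspace X" if "t \<ge> 0" for t
    using qgeo_in[OF \<eta>] qgeo_in[OF \<tau>] that by auto
  have up: "mdist X (\<tau> (u s)) (\<tau> (u t)) \<le> 2 * R + mdist X (\<eta> s) (\<eta> t)"
    and dn: "mdist X (\<eta> s) (\<eta> t) \<le> 2 * R + mdist X (\<tau> (u s)) (\<tau> (u t))" if "s \<ge> 0" "t \<ge> 0" for s t
    using that u[OF that(1)] u[OF that(2)] in\<eta>[of s] in\<eta>[of t] in\<eta>[of "u s"] in\<eta>[of "u t"]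
      mdist_triangle[of "\<tau> (u s)" X "\<eta> s" "\<tau> (u t)"] mdist_triangle[of "\<eta> s" X "\<eta> t" "\<tau> (u t)"]
      mdist_triangle[of "\<eta> s" X "\<tau> (u s)" "\<eta> t"] mdist_triangle[of "\<tau> (u s)" X "\<tau> (u t)" "\<eta> t"]
    by (auto simp: mdist_commute)
  \<comment> \<open>A unit step moves \<open>\<eta>\<close> by at most \<open>L + e\<close>, hence
    the chosen points on \<open>\<tau>\<close> by at most \<open>2 * R + L + e\<close> and their
    parameters by at most \<open>c\<close>.\<close>
  define c where "c = L * (2 * R + L + e + e)"
  have step: "\<bar>u s - u t\<bar> \<le> c" if "s \<ge> 0" "t \<ge> 0" "\<bar>s - t\<bar> \<le> 1" for s t
  proof -
    have "\<bar>u s - u t\<bar> \<le> L * (mdist X (\<tau> (u s)) (\<tau> (u t)) + e)"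
      using qgeo_ge[OF \<tau>] u that by auto
    also have "mdist X (\<tau> (u s)) (\<tau> (u t)) \<le> 2 * R + (L * \<bar>s - t\<bar> + e)"
      using up[OF that(1,2)] qgeo_le[OF \<eta>, of s t] that by auto
    also have "L * \<bar>s - t\<bar> \<le> L" using that L mult_left_mono[of "\<bar>s - t\<bar>" 1 L] by simp
    finally show ?thesis unfolding c_def using L by (simp add: mult_left_mono algebra_simps)
  qed
  \<comment> \<open>The summand \<open>u 0\<close> covers the initial points with
    \<open>v \<le> u 0\<close>, which the intermediate value argument does not reach.\<close>
  define Z where "Z = L * (c + u 0) + e + R"
  have c0: "c \<ge> 0" using step[of 0 0] by simp
  have u0: "u 0 \<ge> 0" using u[of 0] by simp
  have key: "mdist X (\<tau> v) (\<eta> t) \<le> Z" if "v \<ge> 0" "t \<ge> 0" "\<bar>v - u t\<bar> \<le> c + u 0" for v t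
  proof -
    have "mdist X (\<tau> v) (\<eta> t) \<le> mdist X (\<tau> v) (\<tau> (u t)) + mdist X (\<eta> t) (\<tau> (u t))"
      using mdist_triangle[of "\<tau> v" X "\<tau> (u t)" "\<eta> t"] in\<eta> u that by (auto simp: mdist_commute)
    also have "\<dots> \<le> L * \<bar>v - u t\<bar> + e + R" using qgeo_le[OF \<tau>, of v "u t"] u that by force
    also have "\<dots> \<le> Z" unfolding Z_def using that L by (simp add: mult_left_mono)
    finally show ?thesis .
  qed
  have "\<tau> ` {0..} \<subseteq> nbhd X Z (\<eta> ` {0..})"
  proof (rule image_subsetI)
    fix v :: real assume "v \<in> {0..}"
    then have v: "v \<ge> 0" by simp
    show "\<tau> v \<in> nbhd X Z (\<eta> ` {0..})"
    proof (cases "v \<le> u 0")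
      case True
      then have "mdist X (\<tau> v) (\<eta> 0) \<le> Z" using key[OF v, of 0] c0 v by auto
      then show ?thesis using in\<eta>[OF v] by (intro nbhdI[of _ _ "\<eta> 0"]) auto
    next
      case False
      \<comment> \<open>At this time \<open>\<eta>\<close> is so far from \<open>\<eta> 0\<close>
        that \<open>u t\<close> must have passed \<open>v\<close>: otherwise \<open>u t\<close> and
        \<open>u 0\<close> would differ by less than \<open>v\<close>, and \<open>\<eta> t\<close>
        would be within \<open>2 * R + L * v + e\<close> of \<open>\<eta> 0\<close>.\<close>
      define t where "t = L * (2 * R + L * v + e + e)"
      have R0: "R \<ge> 0" using u[of 0] mdist_nonneg[of X "\<eta> 0" "\<tau> (u 0)"] by linarith
      have t0: "t \<ge> 0" unfolding t_def using L R0 v by auto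
      have "u t \<ge> v"
      proof (rule ccontr)
        assume "\<not> ?thesis"
        then have lt: "\<bar>u t - u 0\<bar> < v" using u[OF t0] False u0 by auto
        have "t \<le> L * (mdist X (\<eta> t) (\<eta> 0) + e)" using qgeo_ge[OF \<eta>, of t 0] t0 by simp
        also have "mdist X (\<eta> t) (\<eta> 0) \<le> 2 * R + (L * \<bar>u t - u 0\<bar> + e)"
          using dn[of t 0] qgeo_le[OF \<tau>, of "u t" "u 0"] u[of 0] u[of t] t0 by auto
        also have "L * \<bar>u t - u 0\<bar> < L * v" using lt L by simp
        finally show False unfolding t_def using L by (simp add: algebra_simps)
      qed
      then obtain s where "s \<in> {0..t}" "\<bar>u s - v\<bar> \<le> c"
        using coarse_ivt[of 0 t u c v] step t0 False by auto
      then have "mdist X (\<tau> v) (\<eta> s) \<le> Z" using key[OF v, of s] u0 by auto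
      then show ?thesis using in\<eta>[OF v] \<open>s \<in> {0..t}\<close> by (intro nbhdI[of _ _ "\<eta> s"]) auto
    qed
  qed
  with near show ?thesis by (rule fhdI)
qed

lemma qgeo_bounded_part_nbhd:
  assumes q: "qgeo X L e {a..} q" and "a \<le> c"
  shows "\<exists>R. q ` {a..} \<subseteq> nbhd X R (q ` {c..})"
proof -
  have L: "L \<ge> 1" "e \<ge> 0" using qgeo_consts[OF q] by auto
  have "q ` {a..} \<subseteq> nbhd X (L * (c - a) + e) (q ` {c..})"
  proof (rule image_subsetI)
    fix t assume t: "t \<in> {a..}"
    have "mdist X (q t) (q (max c t)) \<le> L * \<bar>t - max c t\<bar> + e"
      by (rule qgeo_le[OF q]) (use t assms in auto)
    moreover have "L * \<bar>t - max c t\<bar> \<le> L * (c - a)" using L t assms by (intro mult_left_mono) auto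
    ultimately show "q t \<in> nbhd X (L * (c - a) + e) (q ` {c..})"
      using qgeo_in[OF q t] by (intro nbhdI[of _ _ "q (max c t)"]) auto
  qed
  then show ?thesis by blast
qed

lemma qgeo_tail_fhd:
  assumes q: "qgeo X L e {a..} q" and "a \<le> c"
  shows "finite_hausdorff_dist X (q ` {a..}) (q ` {c..})"
proof -
  obtain R where "q ` {a..} \<subseteq> nbhd X R (q ` {c..})" using qgeo_bounded_part_nbhd[OF assms] by blast
  moreover have "q ` {c..} \<subseteq> nbhd X 0 (q ` {a..})"
    using nbhd_refl[of "q ` {c..}" X 0] nbhd_mono[of 0 0 "q ` {c..}" "q ` {a..}" X] qgeo_in[OF q] assms(2)
    by fastforce
  ultimately show ?thesis by (rule fhdI)
qed

text \<open>A quasi-geodesic ray near a geodesic line eventually stays on one side of it.\<close>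

lemma qgeo_ray_near_line:
  assumes \<rho>: "qgeo X L e {0..} \<rho>" and \<eta>: "geodesic X UNIV \<eta>" and near: "\<rho> ` {0..} \<subseteq> nbhd X R (range \<eta>)"
  shows "finite_hausdorff_dist X (\<rho> ` {0..}) (\<eta> ` {0..}) \<or> finite_hausdorff_dist X (\<rho> ` {0..}) (\<eta> ` {..0})"
proof -
  have L: "L \<ge> 1" "e \<ge> 0" using qgeo_consts[OF \<rho>] by auto
  have "\<exists>u. t \<ge> 0 \<longrightarrow> mdist X (\<rho> t) (\<eta> u) \<le> R" for t
    using near by (force elim!: nbhdE simp: image_subset_iff)
  then obtain u where u: "\<And>t. t \<ge> 0 \<Longrightarrow> mdist X (\<rho> t) (\<eta> (u t)) \<le> R" by metis
  have in\<rho>: "\<rho> t \<in> mspace X" if "t \<ge> 0" for t using qgeo_in[OF \<rho>] that by auto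
  have in\<eta>: "\<eta> t \<in> mspace X" for t using geodesic_in[OF \<eta>] by auto
  have d\<eta>: "mdist X (\<eta> s) (\<eta> t) = \<bar>s - t\<bar>" for s t using geodesic_dist[OF \<eta>] by auto
  have up: "\<bar>u s - u t\<bar> \<le> 2 * R + mdist X (\<rho> s) (\<rho> t)"
    and dn: "mdist X (\<rho> s) (\<rho> t) \<le> 2 * R + \<bar>u s - u t\<bar>" if "s \<ge> 0" "t \<ge> 0" for s t
    using that u[OF that(1)] u[OF that(2)] in\<rho>[of s] in\<rho>[of t] in\<eta>[of "u s"] in\<eta>[of "u t"] d\<eta>[of "u s" "u t"]
      mdist_triangle[of "\<eta> (u s)" X "\<rho> s" "\<eta> (u t)"] mdist_triangle[of "\<rho> s" X "\<rho> t" "\<eta> (u t)"]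
      mdist_triangle[of "\<rho> s" X "\<eta> (u s)" "\<rho> t"] mdist_triangle[of "\<eta> (u s)" X "\<eta> (u t)" "\<rho> t"]
    by (auto simp: mdist_commute)
  define c where "c = 2 * R + L + e"
  have step: "\<bar>u s - u t\<bar> \<le> c" if "s \<ge> 0" "t \<ge> 0" "\<bar>s - t\<bar> \<le> 1" for s t
  proof -
    have "L * \<bar>s - t\<bar> \<le> L * 1" using that L by (intro mult_left_mono) auto
    then show ?thesis using up[OF that(1,2)] qgeo_le[OF \<rho>, of s t] that by (auto simp: c_def)
  qed
  \<comment> \<open>After time \<open>t0\<close> the ray is too far away for
    \<open>\<bar>u t\<bar> \<le> c\<close>. Since \<open>u\<close> jumps by at most
    \<open>c\<close>, it can no longer change sign.\<close>
  define t0 where "t0 = L * (2 * R + c + 1 + \<bar>u 0\<bar> + e)"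
  have R0: "R \<ge> 0" using u[of 0] mdist_nonneg[of X "\<rho> 0" "\<eta> (u 0)"] by linarith
  have c0: "c \<ge> 0" using step[of 0 0] by simp
  have t00: "t0 \<ge> 0" unfolding t0_def using L R0 c0 by simp
  have big: "\<bar>u t\<bar> > c" if "t \<ge> t0" for t
  proof (rule ccontr)
    assume "\<not> ?thesis"
    then have "mdist X (\<rho> t) (\<rho> 0) \<le> 2 * R + c + \<bar>u 0\<bar>" using dn[of t 0] that t00 by auto
    then have "L * (mdist X (\<rho> t) (\<rho> 0) + e) < t0" unfolding t0_def using L by (intro mult_strict_left_mono) auto
    then show False using qgeo_ge[OF \<rho>, of t 0] that t00 by auto
  qed
  have const: "\<not> (u s > 0 \<and> u t < 0)" if "s \<ge> t0" "t \<ge> t0" for s t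
  proof
    assume a: "u s > 0 \<and> u t < 0"
    have "\<exists>w\<in>{min s t..max s t}. \<bar>u w - 0\<bar> \<le> c"
      by (rule coarse_ivt_between) (use step that t00 a in \<open>auto simp: min_def max_def split: if_splits\<close>)
    then obtain w where "w \<in> {min s t..max s t}" "\<bar>u w\<bar> \<le> c" by auto
    moreover from this have "t0 \<le> w" using that by auto
    ultimately show False using big[of w] by simp
  qed
  let ?\<rho> = "\<lambda>t. \<rho> (t0 + t)"
  have \<rho>': "qgeo X L e {0..} ?\<rho>" by (rule qgeo_reparam[OF \<rho>, of "\<lambda>t. t0 + t"]) (use t00 in auto)
  have im: "?\<rho> ` {0..} = \<rho> ` {t0..}"
  proof
    show "\<rho> ` {t0..} \<subseteq> ?\<rho> ` {0..}"
    proof (rule image_subsetI)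
      fix t assume "t \<in> {t0..}"
      then show "\<rho> t \<in> ?\<rho> ` {0..}" by (intro image_eqI[of _ _ "t - t0"]) auto
    qed
  qed auto
  have tail: "finite_hausdorff_dist X (\<rho> ` {0..}) (?\<rho> ` {0..})" unfolding im by (rule qgeo_tail_fhd[OF \<rho> t00])
  have \<eta>q: "qgeo X L e I \<eta>" for I using L by (intro qgeo_mono[OF geodesic_qgeo[OF \<eta>]]) auto
  consider "\<forall>t\<ge>t0. u t \<ge> 0" | "\<forall>t\<ge>t0. u t \<le> 0" using const by (meson le_less_linear less_le)
  then show ?thesis
  proof cases
    case 1
    have "?\<rho> ` {0..} \<subseteq> nbhd X R (\<eta> ` {0..})"
    proof (rule image_subsetI)
      fix t :: real assume "t \<in> {0..}"
      then show "?\<rho> t \<in> nbhd X R (\<eta> ` {0..})" 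
        using u[of "t0 + t"] in\<rho> t00 1 by (intro nbhdI[of _ _ "\<eta> (u (t0 + t))"]) auto
    qed
    from qgeo_ray_fhd[OF \<rho>' \<eta>q this] tail fhd_trans show ?thesis by blast
  next
    case 2
    have e: "(\<lambda>t. \<eta> (- t)) ` {0..} = \<eta> ` {..0}" by (auto simp: image_iff intro!: bexI[of _ "- _"])
    have q: "qgeo X L e {0..} (\<lambda>t. \<eta> (- t))" by (rule qgeo_reparam[OF \<eta>q[of UNIV], of uminus]) auto
    have "?\<rho> ` {0..} \<subseteq> nbhd X R ((\<lambda>t. \<eta> (- t)) ` {0..})"
    proof (rule image_subsetI)
      fix t :: real assume "t \<in> {0..}"
      then show "?\<rho> t \<in> nbhd X R ((\<lambda>t. \<eta> (- t)) ` {0..})" unfolding e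
        using u[of "t0 + t"] in\<rho> t00 2 by (intro nbhdI[of _ _ "\<eta> (u (t0 + t))"]) auto
    qed
    from qgeo_ray_fhd[OF \<rho>' q this] tail fhd_trans show ?thesis unfolding e by blast
  qed
qed

section \<open>Stable pairs and stable sets\<close>

text \<open>A quasi-isometry invariant substitute for the Morse property: no geodesics occur, and the
  additive constant also serves as the tolerance at the endpoints. A geodesic is Morse if and only
  if its image is a stable set.\<close>

definition stable_pair :: "'a metric \<Rightarrow> (real \<Rightarrow> real \<Rightarrow> real) \<Rightarrow> 'a \<Rightarrow> 'a \<Rightarrow> bool" where
  "stable_pair X D x y \<longleftrightarrow>
     (\<forall>L e a b q a' b' q'. a \<le> b \<longrightarrow> a' \<le> b' \<longrightarrow> qgeo X L e {a..b} q \<longrightarrow> qgeo X L e {a'..b'} q' \<longrightarrow>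
        mdist X (q a) x \<le> e \<longrightarrow> mdist X (q b) y \<le> e \<longrightarrow>
        mdist X (q' a') x \<le> e \<longrightarrow> mdist X (q' b') y \<le> e \<longrightarrow>
        q ` {a..b} \<subseteq> nbhd X (D L e) (q' ` {a'..b'}))"

definition stable_set :: "'a metric \<Rightarrow> (real \<Rightarrow> real \<Rightarrow> real) \<Rightarrow> 'a set \<Rightarrow> bool" where
  "stable_set X D A \<longleftrightarrow> A \<subseteq> mspace X \<and> (\<forall>x\<in>A. \<forall>y\<in>A. stable_pair X D x y)"

lemma stable_pairD:
  assumes "stable_pair X D x y" "a \<le> b" "a' \<le> b'" "qgeo X L e {a..b} q" "qgeo X L e {a'..b'} q'"
    "mdist X (q a) x \<le> e" "mdist X (q b) y \<le> e" "mdist X (q' a') x \<le> e" "mdist X (q' b') y \<le> e"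
    "t \<in> {a..b}"
  shows "q t \<in> nbhd X (D L e) (q' ` {a'..b'})"
proof -
  have "q ` {a..b} \<subseteq> nbhd X (D L e) (q' ` {a'..b'})"
    using assms(1)[unfolded stable_pair_def, rule_format, OF assms(2-9)] .
  with assms(10) show ?thesis by blast
qed

lemma stable_pairI:
  assumes "\<And>L e a b q a' b' q' t. a \<le> b \<Longrightarrow> a' \<le> b' \<Longrightarrow> L \<ge> 1 \<Longrightarrow> e \<ge> 0 \<Longrightarrow>
     qgeo X L e {a..b} q \<Longrightarrow> qgeo X L e {a'..b'} q' \<Longrightarrow>
     mdist X (q a) x \<le> e \<Longrightarrow> mdist X (q b) y \<le> e \<Longrightarrow> mdist X (q' a') x \<le> e \<Longrightarrow> mdist X (q' b') y \<le> e \<Longrightarrow>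
     a \<le> t \<Longrightarrow> t \<le> b \<Longrightarrow> q t \<in> nbhd X (D L e) (q' ` {a'..b'})"
  shows "stable_pair X D x y"
  unfolding stable_pair_def
proof (intro allI impI image_subsetI)
  fix L e a b q a' b' q' t
  assume "a \<le> b" "a' \<le> b'" and q: "qgeo X L e {a..b} q" and "qgeo X L e {a'..b'} q'"
    "mdist X (q a) x \<le> e" "mdist X (q b) y \<le> e" "mdist X (q' a') x \<le> e" "mdist X (q' b') y \<le> e"
    "t \<in> {a..b}"
  then show "q t \<in> nbhd X (D L e) (q' ` {a'..b'})"
    using qgeo_consts[OF q] by (intro assms) auto
qed

lemma stable_pair_sym:
  assumes "stable_pair X D x y" shows "stable_pair X D y x"
proof (rule stable_pairI)
  fix L e a b q a' b' q' and t :: real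
  assume *: "a \<le> b" "a' \<le> b'" "qgeo X L e {a..b} q" "qgeo X L e {a'..b'} q'"
    "mdist X (q a) y \<le> e" "mdist X (q b) x \<le> e" "mdist X (q' a') y \<le> e" "mdist X (q' b') x \<le> e"
    "a \<le> t" "t \<le> b"
  have q: "qgeo X L e {- b..- a} (\<lambda>t. q (- t))" "qgeo X L e {- b'..- a'} (\<lambda>t. q' (- t))"
    using qgeo_reflect[OF *(3)] qgeo_reflect[OF *(4)] by simp_all
  have "(\<lambda>t. q (- t)) (- t) \<in> nbhd X (D L e) ((\<lambda>t. q' (- t)) ` {- b'..- a'})"
    by (rule stable_pairD[OF assms _ _ q]) (simp_all add: *)
  then obtain u where "u \<in> {- b'..- a'}" "mdist X (q t) (q' (- u)) \<le> D L e" "q t \<in> mspace X"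
    unfolding nbhd_def by auto
  then show "q t \<in> nbhd X (D L e) (q' ` {a'..b'})" by (intro nbhdI[of _ _ "q' (- u)"]) auto
qed

lemma stable_pair_mono:
  assumes "stable_pair X D x y" "\<And>L e. L \<ge> 1 \<Longrightarrow> e \<ge> 0 \<Longrightarrow> D L e \<le> D' L e"
  shows "stable_pair X D' x y"
proof (rule stable_pairI)
  fix L e a b q a' b' q' and t :: real
  assume *: "a \<le> b" "a' \<le> b'" "L \<ge> 1" "e \<ge> 0" "qgeo X L e {a..b} q" "qgeo X L e {a'..b'} q'"
    "mdist X (q a) x \<le> e" "mdist X (q b) y \<le> e" "mdist X (q' a') x \<le> e" "mdist X (q' b') y \<le> e"
    "a \<le> t" "t \<le> b"
  have "q t \<in> nbhd X (D L e) (q' ` {a'..b'})"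
    by (rule stable_pairD[OF assms(1) *(1,2,5,6)]) (simp_all add: *)
  with nbhd_mono[OF assms(2)[OF *(3,4)] order_refl]
  show "q t \<in> nbhd X (D' L e) (q' ` {a'..b'})" by (rule subsetD)
qed

lemma stable_set_mono:
  assumes A: "stable_set X D A" and BA: "B \<subseteq> A" and D: "\<And>L e. L \<ge> 1 \<Longrightarrow> e \<ge> 0 \<Longrightarrow> D L e \<le> D' L e"
  shows "stable_set X D' B"
  unfolding stable_set_def
proof (intro conjI ballI)
  show "B \<subseteq> mspace X" using A BA by (auto simp: stable_set_def)
  fix x y assume "x \<in> B" "y \<in> B"
  then have "stable_pair X D x y" using A BA by (auto simp: stable_set_def)
  then show "stable_pair X D' x y" by (rule stable_pair_mono) (rule D)
qed

lemma stable_set_pair: "stable_set X D A \<Longrightarrow> x \<in> A \<Longrightarrow> y \<in> A \<Longrightarrow> stable_pair X D x y"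
  by (auto simp: stable_set_def)

lemma stable_set_in: "stable_set X D A \<Longrightarrow> A \<subseteq> mspace X"
  by (auto simp: stable_set_def)

text \<open>This is what the tolerance \<open>e\<close> at the endpoints is for: paths ending near
  the moved pair end near the old one once \<open>e\<close> is raised by \<open>C\<close>.\<close>

lemma stable_pair_perturb:
  assumes st: "stable_pair X D x y" and d: "mdist X x' x \<le> C" "mdist X y' y \<le> C"
    and X: "x \<in> mspace X" "y \<in> mspace X" "x' \<in> mspace X" "y' \<in> mspace X"
  shows "stable_pair X (\<lambda>L e. D L (e + C)) x' y'"
proof (rule stable_pairI)
  fix L e a b q a' b' q' and t :: real
  assume *: "a \<le> b" "a' \<le> b'" and q: "qgeo X L e {a..b} q" "qgeo X L e {a'..b'} q'"
    and e: "mdist X (q a) x' \<le> e" "mdist X (q b) y' \<le> e" "mdist X (q' a') x' \<le> e" "mdist X (q' b') y' \<le> e"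
    and t: "a \<le> t" "t \<le> b"
  have C: "0 \<le> C" using d(1) mdist_nonneg[of X x' x] by linarith
  have q2: "qgeo X L (e + C) {a..b} q" "qgeo X L (e + C) {a'..b'} q'"
    using C by (auto intro: qgeo_mono[OF q(1)] qgeo_mono[OF q(2)])
  have "mdist X z x \<le> e + C" if "z \<in> mspace X" "mdist X z x' \<le> e" for z
    using mdist_triangle[of z X x' x] that d X by auto
  moreover have "mdist X z y \<le> e + C" if "z \<in> mspace X" "mdist X z y' \<le> e" for z
    using mdist_triangle[of z X y' y] that d X by auto
  ultimately show "q t \<in> nbhd X (D L (e + C)) (q' ` {a'..b'})"
    using * e t qgeo_in[OF q(1)] qgeo_in[OF q(2)] by (intro stable_pairD[OF st _ _ q2]) auto
qed

lemma stable_set_perturb: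
  assumes "stable_set X D A" "B \<subseteq> nbhd X C A"
  shows "stable_set X (\<lambda>L e. D L (e + C)) B"
proof -
  have "stable_pair X (\<lambda>L e. D L (e + C)) x y" if xy: "x \<in> B" "y \<in> B" for x y
  proof -
    obtain x' y' where "x' \<in> A" "mdist X x x' \<le> C" "x \<in> mspace X" "y' \<in> A" "mdist X y y' \<le> C" "y \<in> mspace X"
      using subsetD[OF assms(2) xy(1)] subsetD[OF assms(2) xy(2)] unfolding nbhd_def by blast
    then show ?thesis using stable_set_in[OF assms(1)]
      by (intro stable_pair_perturb[OF stable_set_pair[OF assms(1), of x' y']]) auto
  qed
  moreover have "B \<subseteq> mspace X" using assms(2) by (auto elim: nbhdE)
  ultimately show ?thesis unfolding stable_set_def by blast
qed

text \<open>Paths in \<open>Y\<close> are pulled back by \<open>f'\<close>, compared in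
  \<open>X\<close>, and the distance is carried back through the lower bound of \<open>f'\<close>.
  The pulled back paths have constants \<open>L1 * L\<close> and \<open>L1 * e + e1 + D0\<close>,
  where \<open>D0\<close> pays for \<open>f' (f x)\<close> missing \<open>x\<close>.\<close>

lemma stable_set_qi_image:
  assumes f: "f ` mspace X \<subseteq> mspace Y" and f': "qi_embedding L1 e1 Y X f'"
    and ff': "\<And>x. x \<in> mspace X \<Longrightarrow> mdist X (f' (f x)) x \<le> D0"
    and A: "stable_set X D A"
  shows "stable_set Y (\<lambda>L e. L1 * (D (L1 * L) (L1 * e + e1 + D0) + e1)) (f ` A)"
proof -
  have fX: "f x \<in> mspace Y" if "x \<in> mspace X" for x using f that by auto
  have f'Y: "f' y \<in> mspace X" if "y \<in> mspace Y" for y using f' that by (auto simp: qi_embedding_def)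
  have L: "L1 \<ge> 1" "e1 \<ge> 0" using f' by (auto simp: qi_embedding_def)
  have f'u: "mdist X (f' y) (f' z) \<le> L1 * mdist Y y z + e1"
    and f'l: "mdist Y y z \<le> L1 * (mdist X (f' y) (f' z) + e1)" if "y \<in> mspace Y" "z \<in> mspace Y" for y z
    using f' that L by (auto simp: qi_embedding_def field_simps)
  have "stable_pair Y (\<lambda>L e. L1 * (D (L1 * L) (L1 * e + e1 + D0) + e1)) (f x) (f y)"
    if xy: "x \<in> A" "y \<in> A" for x y
  proof (rule stable_pairI)
    fix L e a b q a' b' q' and t :: real
    assume *: "a \<le> b" "a' \<le> b'" "L \<ge> 1" "e \<ge> 0" and q: "qgeo Y L e {a..b} q" "qgeo Y L e {a'..b'} q'"
      and e: "mdist Y (q a) (f x) \<le> e" "mdist Y (q b) (f y) \<le> e" "mdist Y (q' a') (f x) \<le> e"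
        "mdist Y (q' b') (f y) \<le> e"
      and t: "a \<le> t" "t \<le> b"
    define e2 where "e2 = L1 * e + e1 + D0"
    have X: "x \<in> mspace X" "y \<in> mspace X" using xy stable_set_in[OF A] by auto
    have D0: "D0 \<ge> 0" using ff'[OF X(1)] mdist_nonneg[of X "f' (f x)" x] by linarith
    have Le: "L1 * e \<ge> e" "L1 * e \<ge> 0" using L *(4) mult_right_mono[of 1 L1 e] by auto
    have pull: "qgeo X (L1 * L) e2 I (\<lambda>t. f' (p t))" if p: "qgeo Y L e I p" for p I
      unfolding qgeo_def
    proof (intro conjI ballI)
      show "1 \<le> L1 * L" using L * mult_mono[of 1 L1 1 L] by auto
      show "0 \<le> e2" using Le L D0 by (simp add: e2_def)
      show "(\<lambda>t. f' (p t)) ` I \<subseteq> mspace X" using qgeo_in[OF p] f'Y by auto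
      fix s t assume st: "s \<in> I" "t \<in> I"
      have pY: "p s \<in> mspace Y" "p t \<in> mspace Y" using qgeo_in[OF p] st by auto
      have "\<bar>s - t\<bar> \<le> L * (mdist Y (p s) (p t) + e)" by (rule qgeo_ge[OF p st])
      also have "\<dots> \<le> L * (L1 * (mdist X (f' (p s)) (f' (p t)) + e1) + L1 * e)"
        using f'l[OF pY] Le *(3) by (intro mult_left_mono) auto
      also have "\<dots> = L1 * L * (mdist X (f' (p s)) (f' (p t)) + (e + e1))" by (simp add: algebra_simps)
      also have "\<dots> \<le> L1 * L * (mdist X (f' (p s)) (f' (p t)) + e2)"
        using L * Le D0 by (intro mult_left_mono) (auto simp: e2_def)
      finally show "\<bar>s - t\<bar> \<le> L1 * L * (mdist X (f' (p s)) (f' (p t)) + e2)" .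
      have "mdist X (f' (p s)) (f' (p t)) \<le> L1 * mdist Y (p s) (p t) + e1" by (rule f'u[OF pY])
      also have "\<dots> \<le> L1 * (L * \<bar>s - t\<bar> + e) + e1" using qgeo_le[OF p st] L by simp
      also have "\<dots> \<le> L1 * L * \<bar>s - t\<bar> + e2" using D0 by (simp add: e2_def algebra_simps)
      finally show "mdist X (f' (p s)) (f' (p t)) \<le> L1 * L * \<bar>s - t\<bar> + e2" .
    qed
    have ends: "mdist X (f' z) w \<le> e2" if z: "z \<in> mspace Y" "w \<in> mspace X" "mdist Y z (f w) \<le> e" for z w
    proof -
      have "mdist X (f' z) w \<le> mdist X (f' z) (f' (f w)) + mdist X (f' (f w)) w"
        using mdist_triangle[of "f' z" X "f' (f w)" w] f'Y fX z by auto
      also have "\<dots> \<le> L1 * mdist Y z (f w) + e1 + D0" using f'u[of z "f w"] ff' fX z by fastforce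
      also have "L1 * mdist Y z (f w) \<le> L1 * e" using z L by (intro mult_left_mono) auto
      finally show ?thesis by (simp add: e2_def)
    qed
    have "f' (q t) \<in> nbhd X (D (L1 * L) e2) ((\<lambda>t. f' (q' t)) ` {a'..b'})"
      by (rule stable_pairD[OF stable_set_pair[OF A xy] *(1,2) pull[OF q(1)] pull[OF q(2)]])
        (use e t * X qgeo_in[OF q(1)] qgeo_in[OF q(2)] in \<open>auto intro!: ends\<close>)
    then obtain t' where t': "t' \<in> {a'..b'}" "mdist X (f' (q t)) (f' (q' t')) \<le> D (L1 * L) e2"
      by (blast elim: nbhdE)
    have "mdist Y (q t) (q' t') \<le> L1 * (mdist X (f' (q t)) (f' (q' t')) + e1)"
      using f'l qgeo_in[OF q(1)] qgeo_in[OF q(2)] t t' by auto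
    also have "\<dots> \<le> L1 * (D (L1 * L) e2 + e1)" using t' L by (intro mult_left_mono) auto
    finally show "q t \<in> nbhd Y (L1 * (D (L1 * L) (L1 * e + e1 + D0) + e1)) (q' ` {a'..b'})"
      using qgeo_in[OF q(1)] t t' unfolding e2_def by (intro nbhdI) auto
  qed
  then show ?thesis using stable_set_in[OF A] fX unfolding stable_set_def by blast
qed

text \<open>Given two quasi-geodesics from \<open>y\<close> to \<open>z\<close>, both stable pairs locate their almost nearest points
  to \<open>x\<close>: such a point on one of them is near both of its halves after joining them to \<open>x\<close>,
  and the two halves meet only near the almost nearest point.\<close>

definition triangle_bound :: "(real \<Rightarrow> real \<Rightarrow> real) \<Rightarrow> real \<Rightarrow> real \<Rightarrow> real" where
  "triangle_bound D L e = (let M = max 0 (D (3 * L) (e + 1)) in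
     (M + L * (L * (2 * M + e)) + e) + 1 + 2 * M)"

lemma stable_pair_triangle:
  assumes X: "geodesic_space X" and xX: "x \<in> mspace X"
    and xy: "stable_pair X D x y" and xz: "stable_pair X D x z"
  shows "stable_pair X (triangle_bound D) y z"
proof (rule stable_pairI)
  fix L e a b q a' b' q' and t :: real
  assume ab: "a \<le> b" "a' \<le> b'" and L: "L \<ge> 1" "e \<ge> 0"
    and q: "qgeo X L e {a..b} q" "qgeo X L e {a'..b'} q'"
    and e: "mdist X (q a) y \<le> e" "mdist X (q b) z \<le> e" "mdist X (q' a') y \<le> e" "mdist X (q' b') z \<le> e"
    and t: "a \<le> t" "t \<le> b"
  define M where "M = max 0 (D (3 * L) (e + 1))"
  \<comment> \<open>\<open>Z\<close> bounds by how much the distances from \<open>x\<close> to the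
    two paths differ (\<open>close\<close> below): points of one path at distance
    \<open>2 * M\<close> have parameters at most \<open>L * (2 * M + e)\<close> apart, which the
    upper bound turns back into a distance.\<close>
  define Z where "Z = M + L * (L * (2 * M + e)) + e"
  have M: "0 \<le> M" "D (3 * L) (e + 1) \<le> M" by (auto simp: M_def)
  have LLe: "0 \<le> L * (L * (2 * M + e))" using L M by simp
  then have Z: "M \<le> Z" "Z = M + L * (L * (2 * M + e)) + e" using L by (auto simp: Z_def)
  have bnd: "triangle_bound D L e = Z + 1 + 2 * M"
    by (simp add: triangle_bound_def M_def Z_def Let_def)
  \<comment> \<open>a path with an almost nearest point and its two halves joined to \<open>x\<close>\<close>
  define split where "split = (\<lambda>p c d u r1 c1 r2 c2. u \<in> {c..d} \<and> c1 \<le> u \<and> u \<le> c2 \<and>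
      qgeo X L e {c..d} p \<and> (\<forall>s\<in>{c..d}. mdist X x (p u) \<le> mdist X x (p s) + 1) \<and>
      qgeo X (3 * L) (e + 1) {c1..d} r1 \<and> r1 c1 = x \<and> (\<forall>s\<in>{u..d}. r1 s = p s) \<and>
      (\<forall>s\<in>{c1..u}. mdist X x (r1 s) \<le> mdist X x (p u) \<and>
         mdist X (r1 s) (p u) = mdist X x (p u) - mdist X x (r1 s)) \<and>
      qgeo X (3 * L) (e + 1) {c..c2} r2 \<and> r2 c2 = x \<and> (\<forall>s\<in>{c..u}. r2 s = p s) \<and>
      (\<forall>s\<in>{u..c2}. mdist X x (r2 s) \<le> mdist X x (p u) \<and>
         mdist X (r2 s) (p u) = mdist X x (p u) - mdist X x (r2 s)) \<and>
      mdist X (p c) y \<le> e \<and> mdist X (p d) z \<le> e)"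
  have ex: "\<exists>u r1 c1 r2 c2. split p c d u r1 c1 r2 c2"
    if p: "qgeo X L e {c..d} p" "c \<le> d" "mdist X (p c) y \<le> e" "mdist X (p d) z \<le> e" for p c d
  proof -
    obtain u where u: "u \<in> {c..d}" "\<And>s. s \<in> {c..d} \<Longrightarrow> mdist X x (p u) \<le> mdist X x (p s) + 1"
      using near_nearest_point[of "{c..d}" X x p] p(2) by auto
    have h: "qgeo X L e {u..d} p" "qgeo X L e {c..u} p" using u by (auto intro: qgeo_mono[OF p(1)])
    obtain r1 c1 where r1: "c1 = u - mdist X x (p u)" "qgeo X (3 * L) (e + 1) ({c1..u} \<union> {u..d}) r1" "r1 c1 = x"
      "\<And>s. s \<in> {u..d} \<Longrightarrow> r1 s = p s"
      "\<And>s. c1 \<le> s \<Longrightarrow> s \<le> u \<Longrightarrow> mdist X x (r1 s) = s - c1 \<and> mdist X (r1 s) (p u) = u - s"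
      by (rule qgeo_prepend_geodesic[OF X h(1), of u x]) (use u xX in auto)
    obtain r2 c2 where r2: "c2 = u + mdist X x (p u)" "qgeo X (3 * L) (e + 1) ({c..u} \<union> {u..c2}) r2" "r2 c2 = x"
      "\<And>s. s \<in> {c..u} \<Longrightarrow> r2 s = p s"
      "\<And>s. u \<le> s \<Longrightarrow> s \<le> c2 \<Longrightarrow> mdist X x (r2 s) = c2 - s \<and> mdist X (r2 s) (p u) = s - u"
      by (rule qgeo_append_geodesic[OF X h(2), of u x]) (use u xX in auto)
    have c12: "c1 \<le> u" "u \<le> c2" using r1(1) r2(1) by auto
    have "{c1..u} \<union> {u..d} = {c1..d}" "{c..u} \<union> {u..c2} = {c..c2}" using u c12 by auto
    then have "split p c d u r1 c1 r2 c2"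
      unfolding split_def using u p r1(2-4) r2(2-4) r1(1,5) r2(1,5) c12 by auto
    then show ?thesis by blast
  qed
  have sD: "u \<in> {c..d}" "c1 \<le> u" "u \<le> c2" "qgeo X L e {c..d} p"
      "qgeo X (3 * L) (e + 1) {c1..d} r1" "r1 c1 = x" "qgeo X (3 * L) (e + 1) {c..c2} r2" "r2 c2 = x"
      "mdist X (p c) y \<le> e" "mdist X (p d) z \<le> e"
    and sD': "\<And>s. s \<in> {c..d} \<Longrightarrow> mdist X x (p u) \<le> mdist X x (p s) + 1"
      "\<And>s. s \<in> {u..d} \<Longrightarrow> r1 s = p s" "\<And>s. s \<in> {c1..u} \<Longrightarrow> mdist X x (r1 s) \<le> mdist X x (p u)"
      "\<And>s. s \<in> {c1..u} \<Longrightarrow> mdist X (r1 s) (p u) = mdist X x (p u) - mdist X x (r1 s)"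
      "\<And>s. s \<in> {c..u} \<Longrightarrow> r2 s = p s" "\<And>s. s \<in> {u..c2} \<Longrightarrow> mdist X x (r2 s) \<le> mdist X x (p u)"
      "\<And>s. s \<in> {u..c2} \<Longrightarrow> mdist X (r2 s) (p u) = mdist X x (p u) - mdist X x (r2 s)"
    if "split p c d u r1 c1 r2 c2" for p c d u r1 c1 r2 c2
    using that unfolding split_def by blast+
  have ends: "mdist X (r1 c1) x \<le> e + 1" "mdist X (r1 d) z \<le> e + 1" "mdist X (r2 c) y \<le> e + 1"
      "mdist X (r2 c2) x \<le> e + 1" "c1 \<le> d" "c \<le> c2"
    if sp: "split p c d u r1 c1 r2 c2" for p c d u r1 c1 r2 c2
  proof -
    have "mdist X x x = 0" using xX by simp
    moreover have "r1 d = p d" "r2 c = p c" using sD(1)[OF sp] sD'(2,5)[OF sp] by auto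
    ultimately show "mdist X (r1 c1) x \<le> e + 1" "mdist X (r1 d) z \<le> e + 1" "mdist X (r2 c) y \<le> e + 1"
      "mdist X (r2 c2) x \<le> e + 1" "c1 \<le> d" "c \<le> c2"
      using sD(1-3,6,8-10)[OF sp] L by simp_all
  qed
  \<comment> \<open>The half from the almost nearest point to \<open>z\<close>, prolonged back to
    \<open>x\<close>, is a path from \<open>x\<close> to \<open>z\<close>, so stability of this pair
    compares it with the corresponding half of the other path; \<open>bwd\<close> treats the halves
    towards \<open>y\<close>.\<close>
  have fwd: "p s \<in> nbhd X M (r1' ` {c1'..d'})"
    if sp: "split p c d u r1 c1 r2 c2" and sp': "split p' c' d' u' r1' c1' r2' c2'" and s: "u \<le> s" "s \<le> d"
    for p c d u r1 c1 r2 c2 p' c' d' u' r1' c1' r2' c2' s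
  proof -
    have "r1 s \<in> nbhd X (D (3 * L) (e + 1)) (r1' ` {c1'..d'})"
      using sD(2)[OF sp] s
      by (intro stable_pairD[OF xz ends(5)[OF sp] ends(5)[OF sp'] sD(5)[OF sp] sD(5)[OF sp']
          ends(1,2)[OF sp] ends(1,2)[OF sp']]) simp
    moreover have "r1 s = p s" using sD'(2)[OF sp] s by simp
    ultimately show ?thesis using nbhd_mono[OF M(2)] by fastforce
  qed
  have bwd: "p s \<in> nbhd X M (r2' ` {c'..c2'})"
    if sp: "split p c d u r1 c1 r2 c2" and sp': "split p' c' d' u' r1' c1' r2' c2'" and s: "c \<le> s" "s \<le> u"
    for p c d u r1 c1 r2 c2 p' c' d' u' r1' c1' r2' c2' s
  proof -
    have "r2 s \<in> nbhd X (D (3 * L) (e + 1)) (r2' ` {c'..c2'})"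
      using sD(3)[OF sp] s
      by (intro stable_pairD[OF stable_pair_sym[OF xy] ends(6)[OF sp] ends(6)[OF sp'] sD(7)[OF sp] sD(7)[OF sp']
          ends(3,4)[OF sp] ends(3,4)[OF sp']]) simp
    moreover have "r2 s = p s" using sD'(5)[OF sp] s by simp
    ultimately show ?thesis using nbhd_mono[OF M(2)] by fastforce
  qed
  have inX: "p s \<in> mspace X" if "split p c d u r1 c1 r2 c2" "s \<in> {c..d}" for p c d u r1 c1 r2 c2 s
    by (rule qgeo_in[OF sD(4)[OF that(1)] that(2)])
  \<comment> \<open>\<open>p u\<close> is near both prolonged halves of \<open>p'\<close>. A nearby
    point on one of the added geodesics is no farther from \<open>x\<close> than
    \<open>p' u'\<close>. Otherwise \<open>p'\<close> passes near \<open>p u\<close> both before and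
    after \<open>u'\<close>, and \<open>u'\<close> is trapped in between.\<close>
  have close: "mdist X x (p u) \<le> mdist X x (p' u') + Z"
    if sp: "split p c d u r1 c1 r2 c2" and sp': "split p' c' d' u' r1' c1' r2' c2'"
    for p c d u r1 c1 r2 c2 p' c' d' u' r1' c1' r2' c2'
  proof -
    have u: "u \<in> {c..d}" "u' \<in> {c'..d'}" using sD(1)[OF sp] sD(1)[OF sp'] .
    have pu: "p u \<in> mspace X" "p' u' \<in> mspace X" using inX[OF sp u(1)] inX[OF sp' u(2)] .
    have near_seg: ?thesis if "v \<in> mspace X" "mdist X (p u) v \<le> M" "mdist X x v \<le> mdist X x (p' u')" for v
      using mdist_triangle[of x X v "p u"] that pu xX Z(1) by (auto simp: mdist_commute)
    obtain t1 where t1: "t1 \<in> {c1'..d'}" "mdist X (p u) (r1' t1) \<le> M"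
      using fwd[OF sp sp', of u] u by (auto elim: nbhdE)
    obtain t2 where t2: "t2 \<in> {c'..c2'}" "mdist X (p u) (r2' t2) \<le> M"
      using bwd[OF sp sp', of u] u by (auto elim: nbhdE)
    have r: "r1' t1 \<in> mspace X" "r2' t2 \<in> mspace X"
      using qgeo_in[OF sD(5)[OF sp'] t1(1)] qgeo_in[OF sD(7)[OF sp'] t2(1)] .
    consider "t1 \<le> u'" | "t2 \<ge> u'" | "t2 \<le> u'" "u' \<le> t1" by linarith
    then show ?thesis
    proof cases
      case 1 then show ?thesis using near_seg[OF r(1) t1(2)] sD'(3)[OF sp', of t1] t1 by simp
    next
      case 2 then show ?thesis using near_seg[OF r(2) t2(2)] sD'(6)[OF sp', of t2] t2 by simp
    next
      case 3
      have p': "qgeo X L e {c'..d'} p'" "r1' t1 = p' t1" "r2' t2 = p' t2"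
        using sD(4)[OF sp'] sD'(2)[OF sp', of t1] sD'(5)[OF sp', of t2] 3 t1(1) t2(1) by simp_all
      have t12: "t1 \<in> {c'..d'}" "t2 \<in> {c'..d'}" using 3 u t1 t2 by auto
      have "mdist X (p' t1) (p' t2) \<le> 2 * M"
        using mdist_triangle[OF r(1) pu(1) r(2)] t1 t2 p' by (auto simp: mdist_commute)
      then have "L * (mdist X (p' t1) (p' t2) + e) \<le> L * (2 * M + e)" using L by (intro mult_left_mono) auto
      then have "\<bar>t1 - u'\<bar> \<le> L * (2 * M + e)" using qgeo_ge[OF p'(1) t12] 3 by auto
      then have "L * \<bar>t1 - u'\<bar> \<le> L * (L * (2 * M + e))" using L by (intro mult_left_mono) auto
      then have "mdist X (p' t1) (p' u') \<le> L * (L * (2 * M + e)) + e"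
        using qgeo_le[OF p'(1) t12(1) u(2)] by simp
      moreover have "mdist X x (p u) \<le> mdist X x (p' u') + (mdist X (p' t1) (p' u') + M)"
        using mdist_triangle[of x X "p' u'" "p u"] mdist_triangle[of "p' u'" X "p' t1" "p u"] xX pu
          inX[OF sp' t12(1)] t1(2) p'(2) by (auto simp: mdist_commute)
      ultimately show ?thesis using Z(2) by simp
    qed
  qed
  \<comment> \<open>A point \<open>w\<close> on an added geodesic has to be replaced by a point of
    \<open>p'\<close>. Up to 1, \<open>v\<close> is at least as far from \<open>x\<close> as
    \<open>p u\<close>, and the two paths are about equally far from \<open>x\<close>, so
    \<open>w\<close> is near the end \<open>p' u'\<close> of that geodesic.\<close>
  have fin: "v \<in> nbhd X (Z + 1 + 2 * M) (p' ` {c'..d'})"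
    if sp: "split p c d u r1 c1 r2 c2" and sp': "split p' c' d' u' r1' c1' r2' c2'"
      and v: "v = p s" "s \<in> {c..d}" and w: "w \<in> mspace X" "mdist X v w \<le> M"
      "mdist X w (p' u') = mdist X x (p' u') - mdist X x w"
    for p c d u r1 c1 r2 c2 p' c' d' u' r1' c1' r2' c2' s v w
  proof -
    have u: "u' \<in> {c'..d'}" by (rule sD(1)[OF sp'])
    have vX: "v \<in> mspace X" "p' u' \<in> mspace X" using inX[OF sp v(2)] inX[OF sp' u] v by auto
    have "mdist X x (p u) \<le> mdist X x v + 1" using sD'(1)[OF sp v(2)] v(1) by simp
    moreover have "mdist X x v \<le> mdist X x w + M"
      using mdist_triangle[of x X w v] xX w vX by (auto simp: mdist_commute)
    ultimately have "mdist X w (p' u') \<le> Z + 1 + M" using close[OF sp' sp] w(3) by simp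
    then have "mdist X v (p' u') \<le> Z + 1 + 2 * M" using mdist_triangle[OF vX(1) w(1) vX(2)] w(2) by simp
    then show ?thesis using vX u by (intro nbhdI) auto
  qed
  obtain u r1 c1 r2 c2 where sp: "split q a b u r1 c1 r2 c2" using ex[OF q(1) ab(1) e(1,2)] by blast
  obtain u' r1' c1' r2' c2' where sp': "split q' a' b' u' r1' c1' r2' c2'" using ex[OF q(2) ab(2) e(3,4)] by blast
  show "q t \<in> nbhd X (triangle_bound D L e) (q' ` {a'..b'})"
    unfolding bnd
  proof (cases "u \<le> t")
    case True
    obtain s where s: "s \<in> {c1'..b'}" "mdist X (q t) (r1' s) \<le> M"
      using fwd[OF sp sp' True] t by (auto elim: nbhdE)
    have rX: "r1' s \<in> mspace X" by (rule qgeo_in[OF sD(5)[OF sp'] s(1)])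
    show "q t \<in> nbhd X (Z + 1 + 2 * M) (q' ` {a'..b'})"
    proof (cases "s \<le> u'")
      case True
      then have "mdist X (r1' s) (q' u') = mdist X x (q' u') - mdist X x (r1' s)"
        using sD'(4)[OF sp', of s] s(1) by simp
      then show ?thesis using t by (intro fin[OF sp sp' HOL.refl _ rX s(2)]) simp_all
    next
      case False
      then have "r1' s = q' s" "s \<in> {a'..b'}" using sD'(2)[OF sp', of s] sD(1)[OF sp'] s(1) by simp_all
      then show ?thesis using s inX[OF sp, of t] t Z M by (intro nbhdI[of _ _ "q' s"]) auto
    qed
  next
    case False
    obtain s where s: "s \<in> {a'..c2'}" "mdist X (q t) (r2' s) \<le> M"
      using bwd[OF sp sp', of t] t False by (auto elim: nbhdE)
    have rX: "r2' s \<in> mspace X" by (rule qgeo_in[OF sD(7)[OF sp'] s(1)])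
    show "q t \<in> nbhd X (Z + 1 + 2 * M) (q' ` {a'..b'})"
    proof (cases "s \<ge> u'")
      case True
      then have "mdist X (r2' s) (q' u') = mdist X x (q' u') - mdist X x (r2' s)"
        using sD'(7)[OF sp', of s] s(1) by simp
      then show ?thesis using t by (intro fin[OF sp sp' HOL.refl _ rX s(2)]) simp_all
    next
      case False
      then have "r2' s = q' s" "s \<in> {a'..b'}" using sD'(5)[OF sp', of s] sD(1)[OF sp'] s(1) by simp_all
      then show ?thesis using s inX[OF sp, of t] t Z M by (intro nbhdI[of _ _ "q' s"]) auto
    qed
  qed
qed

text \<open>A pair \<open>y\<close>, \<open>z\<close> is the third side of a triangle whose apex is
  the common point \<open>x\<close>.\<close>

lemma stable_set_union:
  assumes X: "geodesic_space X" and "stable_set X D A" "stable_set X D B" "x \<in> A" "x \<in> B"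
  shows "stable_set X (\<lambda>L e. max (D L e) (triangle_bound D L e)) (A \<union> B)"
proof -
  have x: "x \<in> mspace X" using assms stable_set_in by blast
  have "stable_pair X (\<lambda>L e. max (D L e) (triangle_bound D L e)) y z" if "y \<in> A \<union> B" "z \<in> A \<union> B" for y z
  proof -
    have "stable_pair X D x y" "stable_pair X D x z" using that assms by (auto simp: stable_set_def)
    from stable_pair_triangle[OF X x this] show ?thesis by (rule stable_pair_mono) auto
  qed
  then show ?thesis using assms unfolding stable_set_def by auto
qed

section \<open>Morse geodesics and stable sets\<close>

text \<open>The Morse property tests only paths that end exactly on the geodesic. A constant stretch
  of unit length is attached at each end: replacing values costs \<open>2 * e\<close>, on top of the
  old \<open>e\<close>, and the two extra units of parameter give the \<open>+ 2\<close>.\<close>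

lemma qgeo_exact_ends:
  assumes q: "qgeo X L e {a..b} q" and ab: "a \<le> b" and x: "x \<in> mspace X" "mdist X (q a) x \<le> e"
    and y: "y \<in> mspace X" "mdist X (q b) y \<le> e"
  shows "qgeo X L (3 * e + 2) {a - 1..b + 1} (\<lambda>t. if t < a then x else if b < t then y else q t)"
    (is "qgeo X L _ ?I ?q")
proof -
  have L: "L \<ge> 1" "e \<ge> 0" using qgeo_consts[OF q] by auto
  define c where "c = (\<lambda>t. max a (min b t))"
  have c: "c t \<in> {a..b}" for t using ab by (auto simp: c_def)
  have qc: "q (c t) \<in> mspace X" for t using qgeo_in[OF q c] .
  have inX: "?q t \<in> mspace X" if "t \<in> ?I" for t using qgeo_in[OF q, of t] x y by auto
  have near: "mdist X (?q t) (q (c t)) \<le> e" if "t \<in> ?I" for t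
    using x y ab L qc[of t] by (auto simp: c_def mdist_commute)
  show ?thesis
    unfolding qgeo_def
  proof (intro conjI ballI)
    show "?q ` ?I \<subseteq> mspace X" using inX by blast
    fix s t assume st: "s \<in> ?I" "t \<in> ?I"
    have d: "mdist X (?q s) (?q t) \<le> mdist X (q (c s)) (q (c t)) + 2 * e"
      "mdist X (q (c s)) (q (c t)) \<le> mdist X (?q s) (?q t) + 2 * e"
      using mdist_triangle[OF inX[OF st(1)] qc inX[OF st(2)], of s] mdist_triangle[OF qc qc inX[OF st(2)], of s t]
        mdist_triangle[OF qc inX[OF st(1)] qc, of s t] mdist_triangle[OF inX[OF st(1)] inX[OF st(2)] qc, of t]
        near[OF st(1)] near[OF st(2)] by (simp_all add: mdist_commute)
    have cc: "\<bar>c s - c t\<bar> \<le> \<bar>s - t\<bar>" "\<bar>s - t\<bar> \<le> \<bar>c s - c t\<bar> + 2" using st ab by (auto simp: c_def)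
    have "L * \<bar>c s - c t\<bar> \<le> L * \<bar>s - t\<bar>" using cc L by (intro mult_left_mono) auto
    then show "mdist X (?q s) (?q t) \<le> L * \<bar>s - t\<bar> + (3 * e + 2)"
      using d(1) qgeo_le[OF q c c, of s t] L by linarith
    have "\<bar>c s - c t\<bar> \<le> L * (mdist X (q (c s)) (q (c t)) + e)" by (rule qgeo_ge[OF q c c])
    also have "\<dots> \<le> L * (mdist X (?q s) (?q t) + 3 * e)" using d(2) L by (intro mult_left_mono) auto
    finally have "\<bar>s - t\<bar> \<le> L * (mdist X (?q s) (?q t) + 3 * e) + 2 * L" using cc(2) L by linarith
    then show "\<bar>s - t\<bar> \<le> L * (mdist X (?q s) (?q t) + (3 * e + 2))" by (simp add: algebra_simps)
  qed (use L in auto)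
qed

text \<open>Length of the detour in \<open>morse_geodesic_stable\<close>: from one path to the
  geodesic and from there to the other path, \<open>N (L, 3 * e + 2)\<close> each; along the
  geodesic, the step size \<open>2 * N (L, 3 * e + 2) + L + 3 * e + 2\<close>; and \<open>e\<close>
  for undoing the exact endpoints.\<close>

definition morse_bound :: "gauge \<Rightarrow> real \<Rightarrow> real \<Rightarrow> real" where
  "morse_bound N L e = 4 * N (L, 3 * e + 2) + L + 4 * e + 2"

text \<open>Both paths are near the geodesic; the difficulty is to return from the geodesic to the
  second path. Its shadow on the geodesic runs from \<open>s\<close> to \<open>t\<close> with
  bounded jumps, so it comes near every parameter in between.\<close>

lemma morse_geodesic_stable:
  assumes m: "morse_geodesic X N I \<gamma>"
  shows "stable_set X (morse_bound N) (\<gamma> ` I)"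
proof -
  have g: "geodesic X I \<gamma>" using m by (simp add: morse_geodesic_def)
  have I: "is_interval I" using g by (simp add: geodesic_def closed_interval_def)
  have gX: "\<gamma> v \<in> mspace X" if "v \<in> I" for v using geodesic_in[OF g that] .
  have "stable_pair X (morse_bound N) (\<gamma> s) (\<gamma> t)" if st: "s \<in> I" "t \<in> I" for s t
  proof (rule stable_pairI)
    fix L e a b q a' b' q' and w :: real
    assume ab: "a \<le> b" "a' \<le> b'" and L: "L \<ge> 1" "e \<ge> 0" and q: "qgeo X L e {a..b} q" "qgeo X L e {a'..b'} q'"
      and e: "mdist X (q a) (\<gamma> s) \<le> e" "mdist X (q b) (\<gamma> t) \<le> e" "mdist X (q' a') (\<gamma> s) \<le> e" "mdist X (q' b') (\<gamma> t) \<le> e"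
      and w: "a \<le> w" "w \<le> b"
    \<comment> \<open>The Morse property is used for the subgeodesic on \<open>J\<close>, so that
      the points found near it have parameters between \<open>s\<close> and
      \<open>t\<close>.\<close>
    define J where "J = {min s t..max s t}"
    have "v \<in> I" if "min s t \<le> v" "v \<le> max s t" for v
      using mem_is_interval_1_I[OF I st, of v] mem_is_interval_1_I[OF I st(2,1), of v] that by linarith
    then have J: "J \<subseteq> I" "closed_interval J" "s \<in> J" "t \<in> J" by (auto simp: J_def)
    define M where "M = N (L, 3 * e + 2)"
    have morse: "p u \<in> nbhd X M (\<gamma> ` J)"
      if "qgeo X L (3 * e + 2) {c..d} p" "c \<le> d" "p c = \<gamma> s" "p d = \<gamma> t" "u \<in> {c..d}" for p c d u
    proof -
      have "morse_quasi_geodesic X N J \<gamma>" using m J by (simp add: morse_geodesic_def)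
      moreover have "quasi_geodesic X L (3 * e + 2) {c..d} p" using that by (simp add: quasi_geodesic_iff_qgeo)
      moreover have "p c \<in> \<gamma> ` J" "p d \<in> \<gamma> ` J" using that J by auto
      ultimately have "p ` {c..d} \<subseteq> nbhd X (N (L, 3 * e + 2)) (\<gamma> ` J)"
        using L unfolding morse_quasi_geodesic_def by simp
      then show ?thesis using that unfolding M_def by blast
    qed
    define p where "p = (\<lambda>u. if u < a then \<gamma> s else if b < u then \<gamma> t else q u)"
    define p' where "p' = (\<lambda>u. if u < a' then \<gamma> s else if b' < u then \<gamma> t else q' u)"
    have p: "qgeo X L (3 * e + 2) {a - 1..b + 1} p" unfolding p_def
      by (rule qgeo_exact_ends[OF q(1) ab(1)]) (use e gX st in auto)
    have p': "qgeo X L (3 * e + 2) {a' - 1..b' + 1} p'" unfolding p'_def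
      by (rule qgeo_exact_ends[OF q(2) ab(2)]) (use e gX st in auto)
    have pe: "p (a - 1) = \<gamma> s" "p (b + 1) = \<gamma> t" "p' (a' - 1) = \<gamma> s" "p' (b' + 1) = \<gamma> t"
      using ab by (auto simp: p_def p'_def)
    have "p w \<in> nbhd X M (\<gamma> ` J)" by (rule morse[OF p _ pe(1,2)]) (use ab w in auto)
    then obtain v where v: "v \<in> J" "mdist X (q w) (\<gamma> v) \<le> M" using w by (auto simp: p_def elim: nbhdE)
    have "\<exists>k. u \<in> {a' - 1..b' + 1} \<longrightarrow> k \<in> J \<and> mdist X (p' u) (\<gamma> k) \<le> M" for u
      using morse[OF p' _ pe(3,4), of u] ab by (auto elim: nbhdE)
    then obtain k where k: "\<And>u. u \<in> {a' - 1..b' + 1} \<Longrightarrow> k u \<in> J \<and> mdist X (p' u) (\<gamma> (k u)) \<le> M" by metis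
    \<comment> \<open>The ends are set by hand to make the shadow start exactly at \<open>s\<close>
      and finish exactly at \<open>t\<close>.\<close>
    define \<tau> where "\<tau> = (\<lambda>u. if u = a' - 1 then s else if u = b' + 1 then t else k u)"
    have M0: "M \<ge> 0" using v(2) mdist_nonneg[of X "q w" "\<gamma> v"] by linarith
    have \<tau>: "\<tau> u \<in> J \<and> mdist X (p' u) (\<gamma> (\<tau> u)) \<le> M" if "u \<in> {a' - 1..b' + 1}" for u
    proof -
      have "mdist X (\<gamma> s) (\<gamma> s) = 0" "mdist X (\<gamma> t) (\<gamma> t) = 0" using gX st by simp_all
      then show ?thesis using k[OF that] J pe M0 by (auto simp: \<tau>_def)
    qed
    define c where "c = 2 * M + L + 3 * e + 2"
    have step: "\<bar>\<tau> u - \<tau> u'\<bar> \<le> c"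
      if u: "u \<in> {a' - 1..b' + 1}" "u' \<in> {a' - 1..b' + 1}" "\<bar>u - u'\<bar> \<le> 1" for u u'
    proof -
      have "L * \<bar>u - u'\<bar> \<le> L * 1" using u L by (intro mult_left_mono) auto
      then have "mdist X (p' u) (p' u') \<le> L + (3 * e + 2)" using qgeo_le[OF p' u(1,2)] by simp
      moreover have "\<gamma> (\<tau> u) \<in> mspace X" "\<gamma> (\<tau> u') \<in> mspace X" "p' u \<in> mspace X" "p' u' \<in> mspace X"
        using \<tau>[OF u(1)] \<tau>[OF u(2)] J(1) gX qgeo_in[OF p'] u by blast+
      moreover from this have "mdist X (\<gamma> (\<tau> u)) (\<gamma> (\<tau> u')) \<le> mdist X (p' u) (\<gamma> (\<tau> u)) + mdist X (p' u) (p' u') + mdist X (p' u') (\<gamma> (\<tau> u'))"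
        using mdist_triangle[of "\<gamma> (\<tau> u)" X "p' u" "\<gamma> (\<tau> u')"] mdist_triangle[of "p' u" X "p' u'" "\<gamma> (\<tau> u')"]
        by (simp add: mdist_commute)
      moreover have "\<tau> u \<in> I" "\<tau> u' \<in> I" using \<tau>[OF u(1)] \<tau>[OF u(2)] J(1) by auto
      ultimately show ?thesis using \<tau>[OF u(1)] \<tau>[OF u(2)] geodesic_dist[OF g, of "\<tau> u" "\<tau> u'"] by (simp add: c_def)
    qed
    have "\<exists>u\<in>{a' - 1..b' + 1}. \<bar>\<tau> u - v\<bar> \<le> c"
      by (rule coarse_ivt_between) (use ab step v in \<open>auto simp: \<tau>_def J_def\<close>)
    then obtain u where u: "u \<in> {a' - 1..b' + 1}" "\<bar>\<tau> u - v\<bar> \<le> c" by blast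
    \<comment> \<open>Clamping leads from the attached stretches back to the domain of
      \<open>q'\<close>.\<close>
    define z where "z = max a' (min b' u)"
    have z: "z \<in> {a'..b'}" using ab by (auto simp: z_def)
    have qz: "q' z \<in> mspace X" "q w \<in> mspace X" using qgeo_in[OF q(2) z] qgeo_in[OF q(1)] w by auto
    have "mdist X (q' z) (q' z) = 0" using qz by simp
    then have pz: "mdist X (p' u) (q' z) \<le> e"
      using e(3,4) ab L by (auto simp: p'_def z_def mdist_commute)
    have uI: "\<tau> u \<in> I" "v \<in> I" using \<tau>[OF u(1)] J v by auto
    have pu: "p' u \<in> mspace X" using qgeo_in[OF p' u(1)] .
    have "mdist X (q w) (q' z) \<le> mdist X (q w) (\<gamma> v) + mdist X (\<gamma> v) (q' z)"
      by (rule mdist_triangle) (use qz gX uI in auto)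
    moreover have "mdist X (\<gamma> v) (q' z) \<le> mdist X (\<gamma> v) (\<gamma> (\<tau> u)) + mdist X (\<gamma> (\<tau> u)) (q' z)"
      by (rule mdist_triangle) (use qz gX uI in auto)
    moreover have "mdist X (\<gamma> (\<tau> u)) (q' z) \<le> mdist X (\<gamma> (\<tau> u)) (p' u) + mdist X (p' u) (q' z)"
      by (rule mdist_triangle) (use qz gX uI pu in auto)
    moreover have "mdist X (\<gamma> v) (\<gamma> (\<tau> u)) \<le> c" using geodesic_dist[OF g uI(2,1)] u(2) by simp
    moreover have "mdist X (\<gamma> (\<tau> u)) (p' u) \<le> M" using \<tau>[OF u(1)] by (simp add: mdist_commute)
    ultimately have "mdist X (q w) (q' z) \<le> morse_bound N L e"
      using v(2) pz unfolding morse_bound_def M_def[symmetric] c_def by linarith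
    then show "q w \<in> nbhd X (morse_bound N L e) (q' ` {a'..b'})" using qz z by (intro nbhdI) auto
  qed
  then show ?thesis using gX unfolding stable_set_def by blast
qed

definition gauge_of :: "(real \<Rightarrow> real \<Rightarrow> real) \<Rightarrow> gauge" where
  "gauge_of D = restrict (\<lambda>(L, e). max 0 (D L e)) ({1..} \<times> {0..})"

lemma gauge_of_in: "gauge_of D \<in> morse_gauges"
  by (auto simp: gauge_of_def morse_gauges_def)

text \<open>The second path in the definition of stability is taken to be the subgeodesic between
  the two endpoints, reversed if they occur in the opposite order.\<close>

lemma stable_morse_geodesic:
  assumes g: "geodesic X I \<gamma>" and st: "stable_set X D (\<gamma> ` I)"
  shows "morse_geodesic X (gauge_of D) I \<gamma>"
  unfolding morse_geodesic_def
proof (intro conjI allI impI g)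
  fix J assume J: "J \<subseteq> I" "closed_interval J"
  have gJ: "qgeo X L e K \<gamma>" if "K \<subseteq> J" "L \<ge> 1" "e \<ge> 0" for K L e
    by (rule qgeo_mono[OF geodesic_qgeo[OF g]]) (use that J in auto)
  show "morse_quasi_geodesic X (gauge_of D) J \<gamma>"
    unfolding morse_quasi_geodesic_def
  proof (intro conjI allI impI)
    show "\<exists>L e. quasi_geodesic X L e J \<gamma>"
      using gJ[of J 1 0] J(2) by (auto simp: quasi_geodesic_iff_qgeo)
    fix L e a b q
    assume L: "1 \<le> (L::real)" "0 \<le> (e::real)" and q: "quasi_geodesic X L e {a..b} q"
      and ends: "q a \<in> \<gamma> ` J" "q b \<in> \<gamma> ` J"
    have ab: "a \<le> b" "qgeo X L e {a..b} q" using q by (auto simp: quasi_geodesic_iff_qgeo)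
    obtain s t where s: "s \<in> J" "q a = \<gamma> s" and t: "t \<in> J" "q b = \<gamma> t" using ends by auto
    have sub: "{s..t} \<subseteq> J" "{t..s} \<subseteq> J"
      using J(2) mem_is_interval_1_I[OF _ s(1) t(1)] mem_is_interval_1_I[OF _ t(1) s(1)]
      by (simp_all add: closed_interval_def subset_iff)
    have X: "\<gamma> s \<in> mspace X" "\<gamma> t \<in> mspace X" using geodesic_in[OF g] s t J by auto
    then have z: "mdist X (\<gamma> s) (\<gamma> s) \<le> e" "mdist X (\<gamma> t) (\<gamma> t) \<le> e" using L by simp_all
    have sp: "stable_pair X D (\<gamma> s) (\<gamma> t)" using stable_set_pair[OF st] s t J by blast
    have le: "D L e \<le> gauge_of D (L, e)" using L by (simp add: gauge_of_def)
    show "q ` {a..b} \<subseteq> nbhd X (gauge_of D (L, e)) (\<gamma> ` J)"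
    proof (rule image_subsetI)
      fix u assume u: "u \<in> {a..b}"
      show "q u \<in> nbhd X (gauge_of D (L, e)) (\<gamma> ` J)"
      proof (cases "s \<le> t")
        case True
        have "q u \<in> nbhd X (D L e) (\<gamma> ` {s..t})"
          by (rule stable_pairD[OF sp ab(1) True ab(2) gJ[OF sub(1) L]]) (use z s t u in auto)
        then show ?thesis by (rule subsetD[OF nbhd_mono[OF le image_mono[OF sub(1)]]])
      next
        case False
        have r: "qgeo X L e {- s..- t} (\<lambda>u. \<gamma> (- u))" using qgeo_reflect[OF gJ[OF sub(2) L]] by simp
        have mem: "q u \<in> nbhd X (D L e) ((\<lambda>u. \<gamma> (- u)) ` {- s..- t})"
          by (rule stable_pairD[OF sp ab(1) _ ab(2) r]) (use z s t u False in auto)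
        have "(\<lambda>u. \<gamma> (- u)) ` {- s..- t} \<subseteq> \<gamma> ` J"
        proof (rule image_subsetI)
          fix u assume "u \<in> {- s..- t}"
          then have "- u \<in> J" by (intro subsetD[OF sub(2)]) auto
          then show "\<gamma> (- u) \<in> \<gamma> ` J" by blast
        qed
        from subsetD[OF nbhd_mono[OF le this] mem] show ?thesis .
      qed
    qed
  qed
qed

text \<open>The ends of \<open>\<eta>\<close> may be arbitrarily far from \<open>x\<close> and
  \<open>y\<close>, yet the bound does not involve \<open>R\<close> and \<open>R'\<close>. Cutting
  \<open>\<eta>\<close> at almost nearest points and joining these to \<open>x\<close> and
  \<open>y\<close> yields a path with exact ends and constants \<open>9 * L\<close> and
  \<open>e + 2\<close>; the distances \<open>R\<close> and \<open>R'\<close> only determine how much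
  of \<open>\<eta>\<close> is cut off.\<close>

lemma stable_pair_fellow_travel:
  assumes X: "geodesic_space X" and xy: "x \<in> mspace X" "y \<in> mspace X" and st: "stable_pair X D x y"
    and \<sigma>: "qgeo X L e {c..d} \<sigma>" "c \<le> d" "\<sigma> c = x" "\<sigma> d = y"
    and \<eta>: "qgeo X L e {a..b} \<eta>" and R: "mdist X (\<eta> a) x \<le> R" "mdist X (\<eta> b) y \<le> R'"
    and t: "a + L * (2 * R + 1 + e) \<le> t" "t \<le> b - 3 * L * (2 * R' + 1 + (e + 1))"
  shows "\<eta> t \<in> nbhd X (D (9 * L) (e + 2)) (\<sigma> ` {c..d})"
proof -
  have L: "L \<ge> 1" "e \<ge> 0" using qgeo_consts[OF \<eta>] by auto
  have R0: "R \<ge> 0" "R' \<ge> 0" using R mdist_nonneg[of X "\<eta> a" x] mdist_nonneg[of X "\<eta> b" y] by linarith+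
  have "0 \<le> L * (2 * R + 1 + e)" "0 \<le> 3 * L * (2 * R' + 1 + (e + 1))" using L R0 by auto
  then have at: "a \<le> t" "t \<le> b" using t by linarith+
  have \<eta>X: "\<eta> s \<in> mspace X" if "s \<in> {a..b}" for s using qgeo_in[OF \<eta> that] .
  obtain t0 where t0: "t0 \<in> {a..b}" "\<forall>s\<in>{a..b}. mdist X x (\<eta> t0) \<le> mdist X x (\<eta> s) + 1"
    using near_nearest_point[of "{a..b}" X x \<eta>] at by auto
  \<comment> \<open>The almost nearest point to \<open>x\<close> is within \<open>2 * R + 1\<close>
    of \<open>\<eta> a\<close>, so its parameter \<open>t0\<close> is at most
    \<open>a + L * (2 * R + 1 + e)\<close> and \<open>\<eta> t\<close> is not cut off.\<close>
  have "mdist X (\<eta> a) (\<eta> t0) \<le> 2 * R + 1"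
    using mdist_triangle[of "\<eta> a" X x "\<eta> t0"] t0(2)[rule_format, of a] at R \<eta>X[of a] \<eta>X[OF t0(1)] xy
    by (auto simp: mdist_commute)
  then have "L * (mdist X (\<eta> a) (\<eta> t0) + e) \<le> L * (2 * R + 1 + e)" using L by (intro mult_left_mono) auto
  then have t0t: "t0 \<le> t" using qgeo_ge[OF \<eta>, of a t0] t0 t at by auto
  have \<eta>0: "qgeo X L e {t0..b} \<eta>" using t0 by (intro qgeo_mono[OF \<eta>]) auto
  obtain r c1 where r: "c1 = t0 - mdist X x (\<eta> t0)" "qgeo X (3 * L) (e + 1) ({c1..t0} \<union> {t0..b}) r" "r c1 = x"
      "\<And>s. s \<in> {t0..b} \<Longrightarrow> r s = \<eta> s"
    by (rule qgeo_prepend_geodesic[OF X \<eta>0, of t0 x]) (use t0 xy in auto)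
  have c1: "c1 \<le> t0" using r(1) by simp
  have r': "qgeo X (3 * L) (e + 1) {c1..b} r" using c1 t0 by (intro qgeo_mono[OF r(2)]) auto
  have rX: "r s \<in> mspace X" if "s \<in> {c1..b}" for s using qgeo_in[OF r' that] .
  obtain t1 where t1: "t1 \<in> {c1..b}" "\<forall>s\<in>{c1..b}. mdist X y (r t1) \<le> mdist X y (r s) + 1"
    using near_nearest_point[of "{c1..b}" X y r] c1 at t0t by auto
  have rb: "r b = \<eta> b" using r(4)[of b] t0t at by simp
  have "mdist X (r b) (r t1) \<le> 2 * R' + 1"
    using mdist_triangle[of "r b" X y "r t1"] t1(2)[rule_format, of b] at R rX[of b] rX[OF t1(1)] xy c1 t0t rb
    by (auto simp: mdist_commute)
  then have "3 * L * (mdist X (r b) (r t1) + (e + 1)) \<le> 3 * L * (2 * R' + 1 + (e + 1))"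
    using L by (intro mult_left_mono) auto
  then have t1t: "t \<le> t1" using qgeo_ge[OF r', of b t1] t1 t at c1 t0t by auto
  have r1: "qgeo X (3 * L) (e + 1) {c1..t1} r" using t1 by (intro qgeo_mono[OF r']) auto
  obtain r2 c2 where r2: "c2 = t1 + mdist X y (r t1)"
      "qgeo X (3 * (3 * L)) (e + 1 + 1) ({c1..t1} \<union> {t1..c2}) r2" "r2 c2 = y"
      "\<And>s. s \<in> {c1..t1} \<Longrightarrow> r2 s = r s"
    by (rule qgeo_append_geodesic[OF X r1, of t1 y]) (use t1 xy in auto)
  have c2: "t1 \<le> c2" using r2(1) by simp
  have r2': "qgeo X (9 * L) (e + 2) {c1..c2} r2" using c2 t1 L by (intro qgeo_mono[OF r2(2)]) auto
  have \<sigma>': "qgeo X (9 * L) (e + 2) {c..d} \<sigma>" using L by (intro qgeo_mono[OF \<sigma>(1)]) auto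
  have z: "mdist X x x \<le> e + 2" "mdist X y y \<le> e + 2" using xy L by simp_all
  have "r2 t \<in> nbhd X (D (9 * L) (e + 2)) (\<sigma> ` {c..d})"
    by (rule stable_pairD[OF st _ \<sigma>(2) r2' \<sigma>']) (use z \<sigma>(3,4) r(3) r2(3,4) c1 c2 t0t t1t t1 in auto)
  moreover have "r2 t = \<eta> t" using r2(4)[of t] r(4)[of t] c1 t0t t1t at by auto
  ultimately show ?thesis by simp
qed

text \<open>The first term applies once the starting points at distance \<open>C\<close> no longer
  matter; the second bounds the distance to the starting point of the other ray on the initial
  stretch up to parameter \<open>L * (2 * C + 1 + e)\<close>.\<close>

definition ray_bound :: "(real \<Rightarrow> real \<Rightarrow> real) \<Rightarrow> real \<Rightarrow> real \<Rightarrow> real \<Rightarrow> real" where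
  "ray_bound D L e C = max (D (9 * L) (e + 2)) (L * (L * (2 * C + 1 + e)) + e + C)"

text \<open>The unknown \<open>R\<close> disappears from the bound because the rays can be compared
  at an arbitrarily late time, where \<open>R\<close> has no influence on the earlier point
  \<open>\<eta> t\<close>.\<close>

lemma stable_ray_fellow_travel:
  assumes X: "geodesic_space X" and \<sigma>: "qgeo X L e {0..} \<sigma>" and st: "stable_set X D (\<sigma> ` {0..})"
    and \<eta>: "qgeo X L e {0..} \<eta>" and C: "mdist X (\<eta> 0) (\<sigma> 0) \<le> C"
    and near: "\<eta> ` {0..} \<subseteq> nbhd X R (\<sigma> ` {0..})"
  shows "\<eta> ` {0..} \<subseteq> nbhd X (ray_bound D L e C) (\<sigma> ` {0..})"
proof (rule image_subsetI)
  fix t :: real assume "t \<in> {0..}"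
  then have t: "t \<ge> 0" by simp
  have L: "L \<ge> 1" "e \<ge> 0" using qgeo_consts[OF \<eta>] by auto
  have C0: "C \<ge> 0" using C mdist_nonneg[of X "\<eta> 0" "\<sigma> 0"] by linarith
  have X0: "\<sigma> s \<in> mspace X" "\<eta> s \<in> mspace X" if "s \<ge> 0" for s using qgeo_in[OF \<sigma>] qgeo_in[OF \<eta>] that by auto
  show "\<eta> t \<in> nbhd X (ray_bound D L e C) (\<sigma> ` {0..})"
  proof (cases "L * (2 * C + 1 + e) \<le> t")
    case True
    define b where "b = t + \<bar>3 * L * (2 * R + 1 + (e + 1))\<bar>"
    have b: "b \<ge> 0" "t \<le> b - 3 * L * (2 * R + 1 + (e + 1))" using t by (auto simp: b_def)
    obtain u where u: "u \<ge> 0" "mdist X (\<eta> b) (\<sigma> u) \<le> R" using near b by (auto simp: image_subset_iff elim!: nbhdE)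
    have q: "qgeo X L e {0..u} \<sigma>" "qgeo X L e {0..b} \<eta>" by (auto intro: qgeo_mono[OF \<sigma>] qgeo_mono[OF \<eta>])
    have sp: "stable_pair X D (\<sigma> 0) (\<sigma> u)" using u by (intro stable_set_pair[OF st]) auto
    have "\<eta> t \<in> nbhd X (D (9 * L) (e + 2)) (\<sigma> ` {0..u})"
      by (rule stable_pair_fellow_travel[OF X _ _ sp q(1) u(1) _ _ q(2) C u(2)]) (use X0 u True b in auto)
    moreover have "nbhd X (D (9 * L) (e + 2)) (\<sigma> ` {0..u}) \<subseteq> nbhd X (ray_bound D L e C) (\<sigma> ` {0..})"
      by (rule nbhd_mono) (auto simp: ray_bound_def)
    ultimately show ?thesis by blast
  next
    case False
    have "mdist X (\<eta> t) (\<eta> 0) \<le> L * t + e" using qgeo_le[OF \<eta>, of t 0] t by simp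
    also have "L * t \<le> L * (L * (2 * C + 1 + e))" using False L by (intro mult_left_mono) auto
    finally have "mdist X (\<eta> t) (\<sigma> 0) \<le> ray_bound D L e C"
      using mdist_triangle[of "\<eta> t" X "\<eta> 0" "\<sigma> 0"] X0 t C by (auto simp: ray_bound_def)
    then show ?thesis using X0 t by (intro nbhdI) auto
  qed
qed

lemma stable_line_fellow_travel:
  assumes X: "geodesic_space X" and \<sigma>: "qgeo X L e UNIV \<sigma>" and st: "stable_set X D (range \<sigma>)"
    and \<eta>: "qgeo X L e UNIV \<eta>"
    and near: "\<eta> ` {0..} \<subseteq> nbhd X R (\<sigma> ` {0..})" "\<eta> ` {..0} \<subseteq> nbhd X R' (\<sigma> ` {..0})"
  shows "range \<eta> \<subseteq> nbhd X (D (9 * L) (e + 2)) (range \<sigma>)"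
proof (rule image_subsetI)
  fix t :: real
  define b where "b = \<bar>t\<bar> + \<bar>3 * L * (2 * R + 1 + (e + 1))\<bar>"
  define a where "a = - \<bar>t\<bar> - \<bar>L * (2 * R' + 1 + e)\<bar>"
  have b: "b \<ge> 0" "t \<le> b - 3 * L * (2 * R + 1 + (e + 1))" by (auto simp: b_def)
  have a: "a \<le> 0" "a + L * (2 * R' + 1 + e) \<le> t" by (auto simp: a_def)
  obtain u where u: "u \<ge> 0" "mdist X (\<eta> b) (\<sigma> u) \<le> R" using near(1) b by (auto simp: image_subset_iff elim!: nbhdE)
  obtain v where v: "v \<le> 0" "mdist X (\<eta> a) (\<sigma> v) \<le> R'" using near(2) a by (auto simp: image_subset_iff elim!: nbhdE)
  have q: "qgeo X L e {v..u} \<sigma>" "qgeo X L e {a..b} \<eta>" by (auto intro: qgeo_mono[OF \<sigma>] qgeo_mono[OF \<eta>])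
  have sp: "stable_pair X D (\<sigma> v) (\<sigma> u)" by (intro stable_set_pair[OF st]) auto
  have "\<eta> t \<in> nbhd X (D (9 * L) (e + 2)) (\<sigma> ` {v..u})"
    by (rule stable_pair_fellow_travel[OF X _ _ sp q(1) _ _ _ q(2) v(2) u(2)])
      (use qgeo_in[OF \<sigma>] u v a b in auto)
  moreover have "nbhd X (D (9 * L) (e + 2)) (\<sigma> ` {v..u}) \<subseteq> nbhd X (D (9 * L) (e + 2)) (range \<sigma>)"
    by (rule nbhd_mono) auto
  ultimately show "\<eta> t \<in> nbhd X (D (9 * L) (e + 2)) (range \<sigma>)" by blast
qed

section \<open>Limits of geodesics in proper spaces\<close>

definition proper_space :: "'a metric \<Rightarrow> bool" where
  "proper_space X \<longleftrightarrow> (\<forall>x\<in>mspace X. \<forall>r. compactin (mtopology_of X) (mcball_of X x r))"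

lemma openin_mball_of: "openin (mtopology_of X) (mball_of X x r)"
  unfolding mtopology_of_def mball_of_def by (rule Metric_space.openin_mball) simp

text \<open>By Tychonoff a sequence of functions into compact sets has a cluster point for pointwise
  convergence; this replaces the theorem of Arzela and Ascoli.\<close>

lemma cluster_function:
  fixes c :: "nat \<Rightarrow> 't \<Rightarrow> 'a"
  assumes B: "\<And>t. compactin (mtopology_of X) (B t)" and c: "\<And>n t. c n t \<in> B t"
  obtains \<gamma> where "\<And>t. \<gamma> t \<in> B t"
    "\<And>F \<epsilon> n. finite F \<Longrightarrow> \<epsilon> > 0 \<Longrightarrow> \<exists>m\<ge>n. \<forall>t\<in>F. mdist X (\<gamma> t) (c m t) < \<epsilon>"
proof -
  have BX: "B t \<subseteq> mspace X" for t using compactin_subset_topspace[OF B] by simp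
  define T where "T = product_topology (\<lambda>t. subtopology (mtopology_of X) (B t)) UNIV"
  have T: "compact_space T"
    unfolding T_def compact_space_product_topology using compact_space_subtopology[OF B] by simp
  have top: "topspace T = (\<Pi>\<^sub>E t\<in>UNIV. B t)"
    unfolding T_def using BX by (simp add: topspace_subtopology Int_absorb1)
  define K where "K = (\<lambda>n. T closure_of {c m | m. n \<le> m})"
  have cT: "c m \<in> topspace T" for m using c by (simp add: top PiE_iff)
  have "K n \<noteq> {}" for n
    using closure_of_subset[of "{c m | m. n \<le> m}" T] cT unfolding K_def by auto
  moreover have "decseq K" unfolding K_def by (intro decseq_SucI closure_of_mono) (auto dest: Suc_leD)
  ultimately have "(\<Inter>n. K n) \<noteq> {}" by (intro compact_space_imp_nest[OF T]) (auto simp: K_def)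
  then obtain \<gamma> where \<gamma>: "\<And>n. \<gamma> \<in> K n" by auto
  have \<gamma>B: "\<gamma> t \<in> B t" for t
  proof -
    have "\<gamma> \<in> topspace T" using \<gamma>[of 0] unfolding K_def by (rule subsetD[OF closure_of_subset_topspace])
    then show ?thesis by (auto simp: top PiE_iff)
  qed
  have "\<exists>m\<ge>n. \<forall>t\<in>F. mdist X (\<gamma> t) (c m t) < \<epsilon>" if "finite F" "\<epsilon> > 0" for F \<epsilon> n
  proof -
    define S where "S = (\<lambda>t. if t \<in> F then mball_of X (\<gamma> t) \<epsilon> \<inter> B t else B t)"
    have "openin T (PiE UNIV S)"
      unfolding T_def openin_PiE_gen
    proof (intro disjI2 conjI ballI)
      show "finite {t \<in> UNIV. S t \<noteq> topspace (subtopology (mtopology_of X) (B t))}"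
        using BX by (intro finite_subset[OF _ that(1)]) (auto simp: S_def topspace_subtopology)
      fix t
      have "openin (subtopology (mtopology_of X) (B t)) (B t)"
        using openin_topspace[of "subtopology (mtopology_of X) (B t)"] BX
        by (simp add: topspace_subtopology Int_absorb1)
      then show "openin (subtopology (mtopology_of X) (B t)) (S t)"
        by (auto simp: S_def openin_subtopology intro: openin_mball_of)
    qed
    moreover have "\<gamma> t \<in> mspace X" for t using subsetD[OF BX \<gamma>B] .
    then have "\<gamma> \<in> PiE UNIV S" using \<gamma>B that(2) by (simp add: S_def PiE_iff)
    ultimately obtain f where "f \<in> {c m | m. n \<le> m}" "f \<in> PiE UNIV S"
      using \<gamma>[of n] unfolding K_def in_closure_of by blast
    then obtain m where m: "n \<le> m" "c m \<in> PiE UNIV S" by blast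
    have "mdist X (\<gamma> t) (c m t) < \<epsilon>" if "t \<in> F" for t
    proof -
      have "c m t \<in> S t" using m(2) by (auto simp: PiE_iff)
      then show ?thesis using that by (simp add: S_def)
    qed
    with m(1) show ?thesis by blast
  qed
  with \<gamma>B show ?thesis by (rule that)
qed

text \<open>The domains \<open>J n\<close> only exhaust \<open>I\<close>, so each curve is extended
  by the constant \<open>z\<close> to fit into one product of balls. A cluster point for pointwise
  convergence is enough: being a geodesic is tested on two parameters at a time.\<close>

lemma geodesic_limit:
  fixes c :: "nat \<Rightarrow> real \<Rightarrow> 'a"
  assumes X: "proper_space X" and o: "z \<in> mspace X" and I: "closed_interval I"
    and c: "\<And>n. qgeo X 1 0 (J n) (c n)" and ev: "\<And>t. t \<in> I \<Longrightarrow> \<exists>n0. \<forall>n\<ge>n0. t \<in> J n"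
    and bd: "\<And>n t. t \<in> J n \<Longrightarrow> mdist X z (c n t) \<le> R + \<bar>t\<bar>"
  obtains \<gamma> where "geodesic X I \<gamma>" "\<And>t n. t \<in> I \<Longrightarrow> \<exists>m\<ge>n. t \<in> J m \<and> mdist X (\<gamma> t) (c m t) \<le> 1"
    "\<And>t. mdist X z (\<gamma> t) \<le> \<bar>R\<bar> + \<bar>t\<bar>"
proof -
  \<comment> \<open>The absolute value of \<open>R\<close> makes the filler \<open>z\<close> belong
    to every ball.\<close>
  define B where "B = (\<lambda>t. mcball_of X z (\<bar>R\<bar> + \<bar>t :: real\<bar>))"
  define c' where "c' = (\<lambda>n t. if t \<in> J n then c n t else z)"
  have cX: "c n t \<in> mspace X" if "t \<in> J n" for n t using qgeo_in[OF c that] .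
  have B: "compactin (mtopology_of X) (B t)" for t using X o by (simp add: proper_space_def B_def)
  have "c' n t \<in> B t" for n t
    using bd[of t n] cX[of t n] o by (auto simp: c'_def B_def)
  then obtain \<gamma> where \<gamma>: "\<And>t. \<gamma> t \<in> B t"
    "\<And>F \<epsilon> n. finite F \<Longrightarrow> \<epsilon> > 0 \<Longrightarrow> \<exists>m\<ge>n. \<forall>t\<in>F. mdist X (\<gamma> t) (c' m t) < \<epsilon>"
    using cluster_function[of X B c', OF B] by metis
  have \<gamma>X: "\<gamma> t \<in> mspace X" for t using \<gamma>(1)[of t] by (auto simp: B_def)
  have "mdist X (\<gamma> s) (\<gamma> t) = \<bar>s - t\<bar>" if st: "s \<in> I" "t \<in> I" for s t
  proof -
    obtain n1 n2 where n: "\<And>n. n \<ge> n1 \<Longrightarrow> s \<in> J n" "\<And>n. n \<ge> n2 \<Longrightarrow> t \<in> J n" using ev st by meson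
    have "\<bar>mdist X (\<gamma> s) (\<gamma> t) - \<bar>s - t\<bar>\<bar> \<le> 0 + \<epsilon>" if \<epsilon>: "\<epsilon> > 0" for \<epsilon>
    proof -
      obtain m where m: "m \<ge> max n1 n2" "\<forall>u\<in>{s, t}. mdist X (\<gamma> u) (c' m u) < \<epsilon> / 2"
        using \<gamma>(2)[of "{s, t}" "\<epsilon> / 2" "max n1 n2"] \<epsilon> by auto
      have J: "s \<in> J m" "t \<in> J m" using n m by auto
      have "mdist X (c m s) (c m t) = \<bar>s - t\<bar>"
        using qgeo_le[OF c J] qgeo_ge[OF c J] by auto
      then show ?thesis
        using m(2) J cX \<gamma>X mdist_triangle[of "\<gamma> s" X "c m s" "\<gamma> t"] mdist_triangle[of "c m s" X "c m t" "\<gamma> t"]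
          mdist_triangle[of "c m s" X "\<gamma> s" "c m t"] mdist_triangle[of "\<gamma> s" X "\<gamma> t" "c m t"]
        by (auto simp: c'_def mdist_commute)
    qed
    then have "\<bar>mdist X (\<gamma> s) (\<gamma> t) - \<bar>s - t\<bar>\<bar> \<le> 0" by (rule field_le_epsilon)
    then show ?thesis by simp
  qed
  then have "geodesic X I \<gamma>" using I \<gamma>X by (auto simp: geodesic_def)
  moreover have "\<exists>m\<ge>n. t \<in> J m \<and> mdist X (\<gamma> t) (c m t) \<le> 1" if t: "t \<in> I" for t n
  proof -
    obtain n1 where n: "\<And>n. n \<ge> n1 \<Longrightarrow> t \<in> J n" using ev t by meson
    obtain m where m: "m \<ge> max n n1" "mdist X (\<gamma> t) (c' m t) < 1"
      using \<gamma>(2)[of "{t}" 1 "max n n1"] by auto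
    then show ?thesis using n by (intro exI[of _ m]) (auto simp: c'_def)
  qed
  moreover have "mdist X z (\<gamma> t) \<le> \<bar>R\<bar> + \<bar>t\<bar>" for t using \<gamma>(1)[of t] by (simp add: B_def)
  ultimately show ?thesis by (rule that)
qed

section \<open>Points of the Morse boundary\<close>

text \<open>Stated for arbitrary sets, in order to treat rays with any starting point, halves of
  lines and images of rays alike, whereas boundary points consist of rays from the base
  point.\<close>

definition heads_to :: "'a metric \<Rightarrow> 'a bdpoint \<Rightarrow> 'a set \<Rightarrow> bool" where
  "heads_to X b A \<longleftrightarrow> (\<exists>\<beta>\<in>b. finite_hausdorff_dist X A (\<beta> ` {0..}))"

lemma ray_in: "\<alpha> \<in> rays X p \<Longrightarrow> \<alpha> ` {0..} \<subseteq> mspace X"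
  by (auto simp: rays_def dest: geodesic_in)

lemma visual_boundaryE:
  assumes "b \<in> visual_boundary X p"
  obtains \<alpha> where "\<alpha> \<in> rays X p" "b = {\<beta> \<in> rays X p. asymptotic X \<alpha> \<beta>}"
  using assms unfolding visual_boundary_def quotient_def by auto

lemma visual_boundary_mem:
  assumes "b \<in> visual_boundary X p" "\<alpha> \<in> b"
  shows "\<alpha> \<in> rays X p" "b = {\<beta> \<in> rays X p. asymptotic X \<alpha> \<beta>}"
proof -
  obtain \<alpha>0 where a: "\<alpha>0 \<in> rays X p" "b = {\<beta> \<in> rays X p. asymptotic X \<alpha>0 \<beta>}" by (rule visual_boundaryE[OF assms(1)])
  then show r: "\<alpha> \<in> rays X p" using assms by auto
  have "asymptotic X \<alpha>0 \<alpha>" using a assms by auto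
  then show "b = {\<beta> \<in> rays X p. asymptotic X \<alpha> \<beta>}"
    unfolding a(2) asymptotic_def by (blast intro: fhd_trans fhd_sym)
qed

lemma visual_boundary_nonempty: "b \<in> visual_boundary X p \<Longrightarrow> \<exists>\<alpha>. \<alpha> \<in> b"
  by (erule visual_boundaryE) (auto simp: asymptotic_def intro!: fhd_refl dest: ray_in)

lemma heads_to_ray: "b \<in> visual_boundary X p \<Longrightarrow> \<beta> \<in> b \<Longrightarrow> heads_to X b (\<beta> ` {0..})"
  unfolding heads_to_def by (rule bexI[of _ \<beta>], rule fhd_refl, rule ray_in, rule visual_boundary_mem(1))

lemma heads_to_fhd:
  assumes "heads_to X b A" "finite_hausdorff_dist X A B"
  shows "heads_to X b B"
proof -
  obtain \<beta> where \<beta>: "\<beta> \<in> b" "finite_hausdorff_dist X A (\<beta> ` {0..})" using assms(1) by (auto simp: heads_to_def)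
  from fhd_trans[OF fhd_sym[OF assms(2)] \<beta>(2)] \<beta>(1) show ?thesis by (auto simp: heads_to_def)
qed

lemma heads_to_unique_set:
  assumes b: "b \<in> visual_boundary X p" and "heads_to X b A" "heads_to X b B"
  shows "finite_hausdorff_dist X A B"
proof -
  obtain \<alpha> \<beta> where \<alpha>: "\<alpha> \<in> b" "finite_hausdorff_dist X A (\<alpha> ` {0..})"
    and \<beta>: "\<beta> \<in> b" "finite_hausdorff_dist X B (\<beta> ` {0..})" using assms by (auto simp: heads_to_def)
  have "asymptotic X \<alpha> \<beta>" using visual_boundary_mem(2)[OF b \<alpha>(1)] \<beta>(1) by auto
  then have "finite_hausdorff_dist X (\<alpha> ` {0..}) (\<beta> ` {0..})" by (simp add: asymptotic_def)
  from fhd_trans[OF \<alpha>(2) fhd_trans[OF this fhd_sym[OF \<beta>(2)]]] show ?thesis .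
qed

lemma heads_to_mem:
  assumes b: "b \<in> visual_boundary X p" and "heads_to X b (\<beta> ` {0..})" "\<beta> \<in> rays X p"
  shows "\<beta> \<in> b"
proof -
  obtain \<alpha> where \<alpha>: "\<alpha> \<in> b" "finite_hausdorff_dist X (\<beta> ` {0..}) (\<alpha> ` {0..})" using assms by (auto simp: heads_to_def)
  have "asymptotic X \<alpha> \<beta>" using fhd_sym[OF \<alpha>(2)] by (simp add: asymptotic_def)
  then show ?thesis by (subst visual_boundary_mem(2)[OF b \<alpha>(1)]) (use assms in auto)
qed

lemma heads_to_unique_point:
  assumes a: "a \<in> visual_boundary X p" and b: "b \<in> visual_boundary X p" and "heads_to X a A" "heads_to X b A"
  shows "a = b"
proof -
  have sub: "c \<subseteq> d" if c: "c \<in> visual_boundary X p" "heads_to X c A" and d: "d \<in> visual_boundary X p" "heads_to X d A" for c d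
  proof
    fix \<gamma> assume \<gamma>: "\<gamma> \<in> c"
    have "finite_hausdorff_dist X A (\<gamma> ` {0..})"
      by (rule heads_to_unique_set[OF c(1) c(2) heads_to_ray[OF c(1) \<gamma>]])
    from heads_to_mem[OF d(1) heads_to_fhd[OF d(2) this] visual_boundary_mem(1)[OF c(1) \<gamma>]] show "\<gamma> \<in> d" .
  qed
  show ?thesis using sub[OF a assms(3) b assms(4)] sub[OF b assms(4) a assms(3)] by blast
qed

lemma morse_boundary_visual: "b \<in> morse_boundary X p \<Longrightarrow> b \<in> visual_boundary X p"
  by (auto simp: morse_boundary_def morse_stratum_def)

lemma morse_boundary_ray:
  assumes "b \<in> morse_boundary X p"
  obtains \<beta> D where "\<beta> \<in> b" "geodesic X {0..} \<beta>" "\<beta> 0 = p" "stable_set X D (\<beta> ` {0..})"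
    "heads_to X b (\<beta> ` {0..})"
proof -
  obtain N \<beta> where \<beta>: "\<beta> \<in> b" "morse_geodesic X N {0..} \<beta>" and b: "b \<in> visual_boundary X p"
    using assms by (auto simp: morse_boundary_def morse_stratum_def)
  have "\<beta> \<in> rays X p" using visual_boundary_mem(1)[OF b \<beta>(1)] .
  then show ?thesis
    using that[OF \<beta>(1) _ _ morse_geodesic_stable[OF \<beta>(2)] heads_to_ray[OF b \<beta>(1)]] by (auto simp: rays_def)
qed

lemma stable_ray_point:
  assumes "\<beta> \<in> rays X p" "stable_set X D (\<beta> ` {0..})"
  obtains b where "b \<in> morse_boundary X p" "\<beta> \<in> b"
proof -
  define b where "b = {\<beta>' \<in> rays X p. asymptotic X \<beta> \<beta>'}"
  have "b \<in> visual_boundary X p" unfolding visual_boundary_def quotient_def b_def using assms(1) by auto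
  moreover have "\<beta> \<in> b" using assms(1) ray_in[OF assms(1)] by (auto simp: b_def asymptotic_def intro: fhd_refl)
  moreover have "morse_geodesic X (gauge_of D) {0..} \<beta>"
    using assms by (intro stable_morse_geodesic) (auto simp: rays_def)
  ultimately have "b \<in> morse_boundary X p"
    using gauge_of_in[of D] by (auto simp: morse_boundary_def morse_stratum_def intro!: bexI[of _ "gauge_of D"])
  then show ?thesis using \<open>\<beta> \<in> b\<close> by (rule that)
qed

section \<open>Lines between boundary points and their halves\<close>

lemma line_between_iff:
  "line_between X a b \<gamma> \<longleftrightarrow> geodesic X UNIV \<gamma> \<and> heads_to X a (\<gamma> ` {..0}) \<and> heads_to X b (\<gamma> ` {0..})"
proof -
  have "\<not> bdd_below (UNIV :: real set)" "\<not> bdd_above (UNIV :: real set)"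
    by (auto simp: bdd_below_def bdd_above_def intro: gt_ex lt_ex simp flip: not_less)
  then show ?thesis by (simp add: line_between_def geodesic_between_def heads_to_def)
qed

lemma image_uminus_half: "(\<lambda>t. f (- t)) ` {0..} = f ` {..0 :: real}" "(\<lambda>t. f (- t)) ` {..0} = f ` {0 :: real..}"
  using image_image[of f uminus "{0 :: real..}"] image_image[of f uminus "{..0 :: real}"] by simp_all

lemma line_between_reverse:
  assumes "line_between X a b \<gamma>" shows "line_between X b a (\<lambda>t. \<gamma> (- t))"
proof -
  have "geodesic X UNIV (\<lambda>t. \<gamma> (- t))"
    using assms by (auto simp: line_between_iff intro!: geodesic_reparam[where q = \<gamma> and \<phi> = uminus and I = UNIV])
  then show ?thesis using assms by (simp add: line_between_iff image_uminus_half)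
qed

lemma image_shift_half: "(\<lambda>s. f (c + s)) ` {0..} = f ` {c :: real..}"
  using image_image[of f "\<lambda>s. c + s" "{0..}"] by (simp add: image_add_atLeast)

lemma fhd_tail_line:
  assumes "geodesic X UNIV \<gamma>"
  shows "finite_hausdorff_dist X (\<gamma> ` {s..}) (\<gamma> ` {t..})"
proof -
  have "qgeo X 1 0 {min s t..} \<gamma>" using geodesic_qgeo[OF assms] by (rule qgeo_mono) auto
  from qgeo_tail_fhd[OF this, of s] qgeo_tail_fhd[OF this, of t] show ?thesis
    by (meson fhd_trans fhd_sym min.cobounded1 min.cobounded2)
qed

lemma line_half_forward:
  assumes "line_between X a b \<gamma>"
  shows "geodesic X {0..} (\<lambda>s. \<gamma> (t + s))" "heads_to X b ((\<lambda>s. \<gamma> (t + s)) ` {0..})"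
proof -
  have g: "geodesic X UNIV \<gamma>" and h: "heads_to X b (\<gamma> ` {0..})" using assms by (auto simp: line_between_iff)
  show "geodesic X {0..} (\<lambda>s. \<gamma> (t + s))"
    by (rule geodesic_reparam[OF g, of _ "\<lambda>s. t + s"]) auto
  show "heads_to X b ((\<lambda>s. \<gamma> (t + s)) ` {0..})"
    unfolding image_shift_half using heads_to_fhd[OF h fhd_tail_line[OF g]] .
qed

lemma line_half_backward:
  assumes "line_between X a b \<gamma>"
  shows "geodesic X {0..} (\<lambda>s. \<gamma> (t - s))" "heads_to X a ((\<lambda>s. \<gamma> (t - s)) ` {0..})"
  using line_half_forward[OF line_between_reverse[OF assms], of "- t"] by simp_all

lemma heads_to_rays_close:
  assumes X: "geodesic_space X" and b: "b \<in> visual_boundary X p"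
    and \<sigma>: "qgeo X L e {0..} \<sigma>" "stable_set X D (\<sigma> ` {0..})" "heads_to X b (\<sigma> ` {0..})"
    and \<eta>: "qgeo X L e {0..} \<eta>" "heads_to X b (\<eta> ` {0..})" and C: "mdist X (\<eta> 0) (\<sigma> 0) \<le> C"
  shows "\<eta> ` {0..} \<subseteq> nbhd X (ray_bound D L e C) (\<sigma> ` {0..})"
proof -
  obtain R where "\<eta> ` {0..} \<subseteq> nbhd X R (\<sigma> ` {0..})"
    using fhdE[OF heads_to_unique_set[OF b \<eta>(2) \<sigma>(3)]] by metis
  then show ?thesis by (rule stable_ray_fellow_travel[OF X \<sigma>(1,2) \<eta>(1) C])
qed

text \<open>\<open>x\<close> sees \<open>b\<close> along a ray of quality \<open>D\<close>. The ray
  need only start within \<open>C\<close> of \<open>x\<close>, so that halves of lines passing near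
  \<open>x\<close> qualify.\<close>

definition radial :: "'a metric \<Rightarrow> (real \<Rightarrow> real \<Rightarrow> real) \<Rightarrow> real \<Rightarrow> 'a \<Rightarrow> 'a bdpoint \<Rightarrow> bool" where
  "radial X D C x b \<longleftrightarrow> (\<exists>\<sigma>. geodesic X {0..} \<sigma> \<and> stable_set X D (\<sigma> ` {0..}) \<and>
     mdist X x (\<sigma> 0) \<le> C \<and> heads_to X b (\<sigma> ` {0..}))"

lemma radial_mono:
  assumes "radial X D C x b" "\<And>L e. L \<ge> 1 \<Longrightarrow> e \<ge> 0 \<Longrightarrow> D L e \<le> D' L e" "C \<le> C'"
  shows "radial X D' C' x b"
proof -
  obtain \<sigma> where \<sigma>: "geodesic X {0..} \<sigma>" "stable_set X D (\<sigma> ` {0..})" "mdist X x (\<sigma> 0) \<le> C" "heads_to X b (\<sigma> ` {0..})"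
    using assms(1) by (auto simp: radial_def)
  have "stable_set X D' (\<sigma> ` {0..})" by (rule stable_set_mono[OF \<sigma>(2) order_refl assms(2)])
  then show ?thesis unfolding radial_def using \<sigma> assms(3) by (intro exI[of _ \<sigma>]) auto
qed

lemma line_radial:
  assumes "line_between X a b \<gamma>" "stable_set X D (range \<gamma>)" "mdist X x (\<gamma> t) \<le> C"
  shows "radial X D C x a" "radial X D C x b"
proof -
  have "stable_set X D ((\<lambda>s. \<gamma> (t + s)) ` {0..})" "stable_set X D ((\<lambda>s. \<gamma> (t - s)) ` {0..})"
    by (rule stable_set_mono[OF assms(2)]; auto)+
  then show "radial X D C x a" "radial X D C x b"
    unfolding radial_def using line_half_forward[OF assms(1), of t] line_half_backward[OF assms(1), of t] assms(3)
    by auto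
qed

text \<open>Joining \<open>x\<close> to its almost nearest point on the line turns the half towards
  \<open>b\<close> into a quasi-geodesic ray that starts at \<open>x\<close>; \<open>3\<close> and
  \<open>1\<close> are the constants of \<open>qgeo_prepend_geodesic\<close> for a geodesic.\<close>

lemma line_half_near_ray:
  assumes X: "geodesic_space X" and b: "b \<in> visual_boundary X p" and x: "x \<in> mspace X"
    and \<sigma>: "geodesic X {0..} \<sigma>" "stable_set X D (\<sigma> ` {0..})" "mdist X x (\<sigma> 0) \<le> C" "heads_to X b (\<sigma> ` {0..})"
    and \<eta>: "line_between X a b \<eta>" and t0: "\<And>t. mdist X x (\<eta> t0) \<le> mdist X x (\<eta> t) + 1" and t: "t0 \<le> t"
  shows "\<eta> t \<in> nbhd X (ray_bound D 3 1 C) (\<sigma> ` {0..})"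
proof -
  have g: "geodesic X UNIV \<eta>" and h: "heads_to X b (\<eta> ` {0..})" using \<eta> by (auto simp: line_between_iff)
  have q: "qgeo X 1 0 {t0..} \<eta>" using geodesic_qgeo[OF g] by (rule qgeo_mono) auto
  obtain r c where r: "c = t0 - mdist X x (\<eta> t0)" "qgeo X (3 * 1) (0 + 1) ({c..t0} \<union> {t0..}) r" "r c = x"
      "\<And>s. s \<in> {t0..} \<Longrightarrow> r s = \<eta> s"
    by (rule qgeo_prepend_geodesic[OF X q, of t0 x]) (use t0 x in auto)
  have c: "c \<le> t0" using r(1) by simp
  have r2: "qgeo X 3 1 {c..} r" by (rule qgeo_mono[OF r(2)]) (use c in auto)
  have r3: "qgeo X 3 1 {0..} (\<lambda>s. r (c + s))" by (rule qgeo_reparam[OF r2, of "\<lambda>s. c + s"]) auto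
  have "r ` {t0..} = \<eta> ` {t0..}" using r(4) by auto
  then have "finite_hausdorff_dist X (\<eta> ` {0..}) (r ` {c..})"
    using fhd_trans[OF fhd_tail_line[OF g, of 0 t0]] fhd_sym[OF qgeo_tail_fhd[OF r2 c]] by simp
  from heads_to_fhd[OF h this] have r4: "heads_to X b ((\<lambda>s. r (c + s)) ` {0..})" unfolding image_shift_half .
  have \<sigma>3: "qgeo X 3 1 {0..} \<sigma>" by (rule qgeo_mono[OF geodesic_qgeo[OF \<sigma>(1)]]) auto
  have "(\<lambda>s. r (c + s)) ` {0..} \<subseteq> nbhd X (ray_bound D 3 1 C) (\<sigma> ` {0..})"
    by (rule heads_to_rays_close[OF X b \<sigma>3 \<sigma>(2,4) r3 r4]) (use \<sigma>(3) r(3) in auto)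
  moreover have "\<eta> t \<in> (\<lambda>s. r (c + s)) ` {0..}" unfolding image_shift_half using r(4)[of t] t c
    by (intro image_eqI[of _ _ t]) auto
  ultimately show ?thesis by blast
qed

text \<open>Every line from \<open>a\<close> to \<open>b\<close> runs near the two rays from
  \<open>x\<close>, and their union is stable like two sides of a triangle. \<open>D'\<close> is
  chosen before the points, which is the uniformity needed later.\<close>

lemma radial_lines_stable:
  assumes X: "geodesic_space X"
  obtains D' where "\<And>a b x \<eta>. a \<in> visual_boundary X p \<Longrightarrow> b \<in> visual_boundary X p \<Longrightarrow> x \<in> mspace X \<Longrightarrow>
    radial X D C x a \<Longrightarrow> radial X D C x b \<Longrightarrow> line_between X a b \<eta> \<Longrightarrow> stable_set X D' (range \<eta>)"
proof -
  \<comment> \<open>\<open>D1\<close> serves a ray with the point \<open>x\<close> added, which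
    gives the two rays a point in common, \<open>D2\<close> their union and \<open>D3\<close> the
    lines near this union.\<close>
  define D1 where "D1 = (\<lambda>L e. D L (e + C))"
  define D2 where "D2 = (\<lambda>L e. max (D1 L e) (triangle_bound D1 L e))"
  define D3 where "D3 = (\<lambda>L e. D2 L (e + ray_bound D 3 1 C))"
  have "stable_set X D3 (range \<eta>)"
    if a: "a \<in> visual_boundary X p" and b: "b \<in> visual_boundary X p" and x: "x \<in> mspace X"
      and ra: "radial X D C x a" and rb: "radial X D C x b" and \<eta>: "line_between X a b \<eta>" for a b x \<eta>
  proof -
    obtain \<sigma> where \<sigma>: "geodesic X {0..} \<sigma>" "stable_set X D (\<sigma> ` {0..})" "mdist X x (\<sigma> 0) \<le> C" "heads_to X a (\<sigma> ` {0..})"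
      using ra by (auto simp: radial_def)
    obtain \<tau> where \<tau>: "geodesic X {0..} \<tau>" "stable_set X D (\<tau> ` {0..})" "mdist X x (\<tau> 0) \<le> C" "heads_to X b (\<tau> ` {0..})"
      using rb by (auto simp: radial_def)
    have C: "C \<ge> 0" using \<sigma>(3) mdist_nonneg[of X x "\<sigma> 0"] by linarith
    have ins: "stable_set X D1 (insert x (\<rho> ` {0..}))"
      if "stable_set X D (\<rho> ` {0..})" "mdist X x (\<rho> (0::real)) \<le> C" for \<rho>
    proof -
      have "insert x (\<rho> ` {0..}) \<subseteq> nbhd X C (\<rho> ` {0..})"
        using nbhd_refl[OF stable_set_in[OF that(1)] C] nbhdI[OF x _ that(2)] by auto
      from stable_set_perturb[OF that(1) this] show ?thesis unfolding D1_def .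
    qed
    have U: "stable_set X D2 (insert x (\<sigma> ` {0..}) \<union> insert x (\<tau> ` {0..}))"
      unfolding D2_def by (rule stable_set_union[OF X ins[OF \<sigma>(2,3)] ins[OF \<tau>(2,3)], of x]) auto
    obtain t0 where t0: "\<And>t. mdist X x (\<eta> t0) \<le> mdist X x (\<eta> t) + 1"
      using near_nearest_point[of UNIV X x \<eta>] by auto
    have "range \<eta> \<subseteq> nbhd X (ray_bound D 3 1 C) (insert x (\<sigma> ` {0..}) \<union> insert x (\<tau> ` {0..}))"
    proof (rule image_subsetI)
      fix t
      have "\<eta> t \<in> nbhd X (ray_bound D 3 1 C) (\<tau> ` {0..}) \<or> \<eta> t \<in> nbhd X (ray_bound D 3 1 C) (\<sigma> ` {0..})"
      proof (cases "t0 \<le> t")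
        case True
        then show ?thesis using line_half_near_ray[OF X b x \<tau> \<eta> t0] by blast
      next
        case False
        have "(\<lambda>t. \<eta> (- t)) (- t) \<in> nbhd X (ray_bound D 3 1 C) (\<sigma> ` {0..})"
          by (rule line_half_near_ray[OF X a x \<sigma> line_between_reverse[OF \<eta>], of "- t0"]) (use t0 False in auto)
        then show ?thesis by simp
      qed
      then show "\<eta> t \<in> nbhd X (ray_bound D 3 1 C) (insert x (\<sigma> ` {0..}) \<union> insert x (\<tau> ` {0..}))"
        unfolding nbhd_def by auto
    qed
    from stable_set_perturb[OF U this] show ?thesis unfolding D3_def .
  qed
  then show ?thesis by (rule that)
qed

lemma qgeo_nbhd_trans:
  assumes "mdist X x y \<le> 1" "y \<in> nbhd X M A" "x \<in> mspace X" "A \<subseteq> mspace X"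
  shows "x \<in> nbhd X (1 + M) A"
proof -
  have "{x} \<subseteq> nbhd X 1 {y}" using assms by (auto intro: nbhdI)
  moreover have "{y} \<subseteq> nbhd X M A" using assms by simp
  ultimately have "{x} \<subseteq> nbhd X (1 + M) A" using assms(4) by (rule nbhd_trans)
  then show ?thesis by simp
qed

text \<open>Boundary points consist of rays from \<open>p\<close>, while \<open>\<sigma>\<close>
  starts elsewhere. Geodesics from \<open>p\<close> to \<open>\<sigma> (real n)\<close> stay near
  \<open>\<sigma>\<close> by stability, and a limit of them is a ray from \<open>p\<close>
  asymptotic to \<open>\<sigma>\<close>.\<close>

lemma stable_ray_boundary_point:
  assumes X: "geodesic_space X" "proper_space X" and p: "p \<in> mspace X"
    and \<sigma>: "geodesic X {0..} \<sigma>" and st: "stable_set X D (\<sigma> ` {0..})"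
  obtains b where "b \<in> morse_boundary X p" "heads_to X b (\<sigma> ` {0..})"
proof -
  define C where "C = mdist X p (\<sigma> 0)"
  have \<sigma>X: "\<sigma> t \<in> mspace X" if "t \<ge> 0" for t using geodesic_in[OF \<sigma>] that by auto
  have "\<forall>n. \<exists>l c. geodesic X {0..l} c \<and> c 0 = p \<and> c l = \<sigma> (real n)"
    using X(1) p \<sigma>X unfolding geodesic_space_def geodesic_segment_def by (metis of_nat_0_le_iff)
  then obtain l c where c: "\<And>n. geodesic X {0..l n} (c n)" "\<And>n. c n 0 = p" "\<And>n. c n (l n) = \<sigma> (real n)"
    by metis
  have l0: "0 \<le> l n" for n using c(1)[of n] by (simp add: geodesic_def)
  have ln: "l n \<ge> real n - C" for n
  proof -
    have "l n = mdist X p (\<sigma> (real n))" using geodesic_dist[OF c(1), of 0 n "l n"] c(2,3)[of n] l0[of n] by simp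
    moreover have "mdist X (\<sigma> 0) (\<sigma> (real n)) = real n" using geodesic_dist[OF \<sigma>, of 0 "real n"] by simp
    ultimately show ?thesis
      using mdist_triangle[of "\<sigma> 0" X p "\<sigma> (real n)"] \<sigma>X p by (simp add: C_def mdist_commute)
  qed
  \<comment> \<open>\<open>C\<close>, the distance from \<open>p\<close> to
    \<open>\<sigma> 0\<close>, serves as additive constant and thereby as tolerance for geodesics
    that start at \<open>p\<close> instead of \<open>\<sigma> 0\<close>.\<close>
  have near: "c n t \<in> nbhd X (D 1 C) (\<sigma> ` {0..})" if t: "t \<in> {0..l n}" for n t
  proof -
    have sp: "stable_pair X D (\<sigma> 0) (\<sigma> (real n))" by (rule stable_set_pair[OF st]) auto
    have q: "qgeo X 1 C {0..l n} (c n)" by (rule qgeo_mono[OF geodesic_qgeo[OF c(1)]]) (auto simp: C_def)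
    have q': "qgeo X 1 C {0..real n} \<sigma>" by (rule qgeo_mono[OF geodesic_qgeo[OF \<sigma>]]) (auto simp: C_def)
    have "c n t \<in> nbhd X (D 1 C) (\<sigma> ` {0..real n})"
      by (rule stable_pairD[OF sp l0 _ q q']) (use t \<sigma>X c(2,3) in \<open>simp_all add: C_def\<close>)
    moreover have "nbhd X (D 1 C) (\<sigma> ` {0..real n}) \<subseteq> nbhd X (D 1 C) (\<sigma> ` {0..})" by (rule nbhd_mono) auto
    ultimately show ?thesis by blast
  qed
  have ev: "\<exists>n0. \<forall>n\<ge>n0. t \<in> {0..l n}" if "t \<in> {0..}" for t
  proof (intro exI[of _ "nat \<lceil>t + C\<rceil>"] allI impI)
    fix n assume "nat \<lceil>t + C\<rceil> \<le> n"
    then have "t + C \<le> real n" by linarith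
    then show "t \<in> {0..l n}" using ln[of n] that by auto
  qed
  have bd: "mdist X p (c n t) \<le> 0 + \<bar>t\<bar>" if "t \<in> {0..l n}" for n t
    using geodesic_dist[OF c(1), of 0 n t] c(2)[of n] that by simp
  obtain \<gamma> where \<gamma>: "geodesic X {0..} \<gamma>" "\<And>t n. t \<in> {0..} \<Longrightarrow> \<exists>m\<ge>n. t \<in> {0..l m} \<and> mdist X (\<gamma> t) (c m t) \<le> 1"
    "\<And>t. mdist X p (\<gamma> t) \<le> \<bar>0\<bar> + \<bar>t\<bar>"
    by (rule geodesic_limit[OF X(2) p, of "{0..}" "\<lambda>n. {0..l n}" c 0])
      (use ev bd geodesic_qgeo[OF c(1)] in auto)
  have "mdist X p (\<gamma> 0) = 0" using \<gamma>(3)[of 0] mdist_nonneg[of X p "\<gamma> 0"] by simp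
  then have ray: "\<gamma> \<in> rays X p" using \<gamma>(1) p geodesic_in[OF \<gamma>(1), of 0] by (simp add: rays_def)
  have \<gamma>\<sigma>: "\<gamma> ` {0..} \<subseteq> nbhd X (1 + D 1 C) (\<sigma> ` {0..})"
  proof (rule image_subsetI)
    fix t :: real assume t: "t \<in> {0..}"
    then obtain m where "t \<in> {0..l m}" "mdist X (\<gamma> t) (c m t) \<le> 1" using \<gamma>(2)[of t 0] by auto
    then show "\<gamma> t \<in> nbhd X (1 + D 1 C) (\<sigma> ` {0..})"
      using near geodesic_in[OF \<gamma>(1) t] \<sigma>X by (intro qgeo_nbhd_trans) auto
  qed
  obtain b where b: "b \<in> morse_boundary X p" "\<gamma> \<in> b"
    by (rule stable_ray_point[OF ray stable_set_perturb[OF st \<gamma>\<sigma>]])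
  have "finite_hausdorff_dist X (\<gamma> ` {0..}) (\<sigma> ` {0..})"
    by (rule qgeo_ray_fhd[OF geodesic_qgeo[OF \<gamma>(1)] geodesic_qgeo[OF \<sigma>] \<gamma>\<sigma>])
  from heads_to_fhd[OF heads_to_ray[OF morse_boundary_visual[OF b(1)] b(2)] this] b(1) show ?thesis
    by (intro that)
qed

text \<open>Geodesics from \<open>\<alpha> (real n)\<close> to \<open>\<beta> (real n)\<close> pass
  within a bounded distance of \<open>p\<close>, since otherwise \<open>\<alpha>\<close> and
  \<open>\<beta>\<close> would stay together and \<open>a = b\<close>. Parametrized from their
  points almost nearest to \<open>p\<close> they have a limit line, whose halves stay near
  \<open>\<alpha>\<close> and \<open>\<beta>\<close>.\<close>

lemma morse_line_exists:
  assumes X: "geodesic_space X" "proper_space X"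
    and a: "a \<in> morse_boundary X p" and b: "b \<in> morse_boundary X p" and ab: "a \<noteq> b"
  shows "\<exists>\<gamma>. line_between X a b \<gamma>"
proof -
  obtain \<alpha> D1 where \<alpha>: "geodesic X {0..} \<alpha>" "\<alpha> 0 = p" "stable_set X D1 (\<alpha> ` {0..})" "heads_to X a (\<alpha> ` {0..})"
    by (rule morse_boundary_ray[OF a])
  obtain \<beta> D2 where \<beta>: "geodesic X {0..} \<beta>" "\<beta> 0 = p" "stable_set X D2 (\<beta> ` {0..})" "heads_to X b (\<beta> ` {0..})"
    by (rule morse_boundary_ray[OF b])
  define D where "D = (\<lambda>L e. max (D1 L e) (D2 L e))"
  have st: "stable_set X D (\<alpha> ` {0..})" "stable_set X D (\<beta> ` {0..})"
    by (rule stable_set_mono[OF \<alpha>(3)] stable_set_mono[OF \<beta>(3)]; simp add: D_def)+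
  have \<alpha>X: "\<alpha> t \<in> mspace X" and \<beta>X: "\<beta> t \<in> mspace X" if "t \<ge> 0" for t
    using geodesic_in[OF \<alpha>(1)] geodesic_in[OF \<beta>(1)] that by auto
  have p: "p \<in> mspace X" using \<alpha>X[of 0] \<alpha>(2) by simp
  have "\<forall>n. \<exists>l z. geodesic X {0..l} z \<and> z 0 = \<alpha> (real n) \<and> z l = \<beta> (real n)"
    using X(1) \<alpha>X \<beta>X unfolding geodesic_space_def geodesic_segment_def by (metis of_nat_0_le_iff)
  then obtain l z where z: "\<And>n. geodesic X {0..l n} (z n)" "\<And>n. z n 0 = \<alpha> (real n)" "\<And>n. z n (l n) = \<beta> (real n)"
    by metis
  have l0: "0 \<le> l n" for n using z(1)[of n] by (simp add: geodesic_def)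
  have "\<forall>n. \<exists>k\<in>{0..l n}. \<forall>t\<in>{0..l n}. mdist X p (z n k) \<le> mdist X p (z n t) + 1"
    by (intro allI near_nearest_point) (use l0 in simp)
  then obtain k where k: "\<And>n. k n \<in> {0..l n}" "\<And>n t. t \<in> {0..l n} \<Longrightarrow> mdist X p (z n (k n)) \<le> mdist X p (z n t) + 1"
    by metis
  define w where "w = (\<lambda>n. z n (k n))"
  have zX: "z n t \<in> mspace X" if "t \<in> {0..l n}" for n t using geodesic_in[OF z(1) that] .
  have wX: "w n \<in> mspace X" for n using zX[OF k(1)] by (simp add: w_def)
  have dp: "mdist X p p \<le> 1" using p by simp
  define M where "M = D 3 1"
  \<comment> \<open>The part of \<open>z n\<close> up to \<open>w n\<close>, prolonged to
    \<open>p\<close>, is a quasi-geodesic with constants \<open>3\<close> and \<open>1\<close> from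
    \<open>\<alpha> (real n)\<close> to \<open>p\<close>; it is compared with
    \<open>\<alpha>\<close> run backwards.\<close>
  have left: "z n u \<in> nbhd X M (\<alpha> ` {0..})" if u: "0 \<le> u" "u \<le> k n" for n u
  proof -
    have q: "qgeo X 1 0 {0..k n} (z n)" using k(1)[of n] by (intro qgeo_mono[OF geodesic_qgeo[OF z(1)]]) auto
    obtain r c where r: "c = k n + mdist X p (z n (k n))" "qgeo X (3 * 1) (0 + 1) ({0..k n} \<union> {k n..c}) r" "r c = p"
      "\<And>t. t \<in> {0..k n} \<Longrightarrow> r t = z n t"
      by (rule qgeo_append_geodesic[OF X(1) q, of "k n" p]) (use k(1)[of n] k(2)[of _ n] p in auto)
    have c: "k n \<le> c" "0 \<le> k n" using r(1) k(1)[of n] by auto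
    have r': "qgeo X 3 1 {0..c} r" by (rule qgeo_mono[OF r(2)]) (use c in auto)
    have q': "qgeo X 3 1 {- real n..0} (\<lambda>t. \<alpha> (- t))"
      by (rule qgeo_mono[OF qgeo_reparam[OF geodesic_qgeo[OF \<alpha>(1)], of uminus "{- real n..0}" "\<lambda>t. \<alpha> (- t)"]]) auto
    have sp: "stable_pair X D (\<alpha> (real n)) (\<alpha> 0)" by (rule stable_set_pair[OF st(1)]) auto
    have "r u \<in> nbhd X M ((\<lambda>t. \<alpha> (- t)) ` {- real n..0})"
      unfolding M_def
      by (rule stable_pairD[OF sp _ _ r' q']) (use u c r(3) r(4)[of 0] z(2)[of n] \<alpha>(2) \<alpha>X dp in simp_all)
    moreover have "nbhd X M ((\<lambda>t. \<alpha> (- t)) ` {- real n..0}) \<subseteq> nbhd X M (\<alpha> ` {0..})" by (rule nbhd_mono) auto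
    ultimately show ?thesis using r(4)[of u] u by auto
  qed
  have right: "z n u \<in> nbhd X M (\<beta> ` {0..})" if u: "k n \<le> u" "u \<le> l n" for n u
  proof -
    have q: "qgeo X 1 0 {k n..l n} (z n)" using k(1)[of n] by (intro qgeo_mono[OF geodesic_qgeo[OF z(1)]]) auto
    obtain r c where r: "c = k n - mdist X p (z n (k n))" "qgeo X (3 * 1) (0 + 1) ({c..k n} \<union> {k n..l n}) r" "r c = p"
      "\<And>t. t \<in> {k n..l n} \<Longrightarrow> r t = z n t"
      by (rule qgeo_prepend_geodesic[OF X(1) q, of "k n" p]) (use k(1)[of n] k(2)[of _ n] p in auto)
    have c: "c \<le> k n" "k n \<le> l n" using r(1) k(1)[of n] by auto
    have r': "qgeo X 3 1 {c..l n} r" by (rule qgeo_mono[OF r(2)]) (use c in auto)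
    have q': "qgeo X 3 1 {0..real n} \<beta>" by (rule qgeo_mono[OF geodesic_qgeo[OF \<beta>(1)]]) auto
    have sp: "stable_pair X D (\<beta> 0) (\<beta> (real n))" by (rule stable_set_pair[OF st(2)]) auto
    have "r u \<in> nbhd X M (\<beta> ` {0..real n})"
      unfolding M_def
      by (rule stable_pairD[OF sp _ _ r' q']) (use u c r(3) r(4)[of "l n"] z(3)[of n] \<beta>(2) \<beta>X dp in simp_all)
    moreover have "nbhd X M (\<beta> ` {0..real n}) \<subseteq> nbhd X M (\<beta> ` {0..})" by (rule nbhd_mono) auto
    ultimately show ?thesis using r(4)[of u] u by auto
  qed
  have d\<alpha>: "mdist X p (\<alpha> t) = t" and d\<beta>: "mdist X p (\<beta> t) = t" if "t \<ge> 0" for t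
    using geodesic_dist[OF \<alpha>(1), of 0 t] geodesic_dist[OF \<beta>(1), of 0 t] \<alpha>(2) \<beta>(2) that by auto
  have "\<exists>R. \<forall>n. mdist X p (w n) \<le> R"
  proof (rule ccontr)
    assume "\<not> ?thesis"
    then have far: "\<exists>n. mdist X p (w n) > R" for R by (meson not_less)
    \<comment> \<open>If \<open>w n\<close> is farther than \<open>v + M\<close> from
      \<open>p\<close>, it is near points \<open>\<alpha> s\<close> and \<open>\<beta> s'\<close>
      with \<open>s' \<ge> v\<close>, and stability of \<open>\<alpha>\<close> keeps
      \<open>\<beta>\<close> near \<open>\<alpha>\<close> up to time \<open>s'\<close>.\<close>
    have "\<beta> ` {0..} \<subseteq> nbhd X (D 1 (2 * M)) (\<alpha> ` {0..})"
    proof (rule image_subsetI)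
      fix v :: real assume "v \<in> {0..}"
      then have v: "0 \<le> v" by simp
      obtain n where n: "mdist X p (w n) > v + M" using far by blast
      have kn: "0 \<le> k n" "k n \<le> l n" using k(1)[of n] by auto
      obtain s where s: "s \<ge> 0" "mdist X (w n) (\<alpha> s) \<le> M" using left[of "k n" n] kn by (auto simp: w_def elim: nbhdE)
      obtain s' where s': "s' \<ge> 0" "mdist X (w n) (\<beta> s') \<le> M" using right[of n "k n"] kn by (auto simp: w_def elim: nbhdE)
      have M0: "M \<ge> 0" using s(2) mdist_nonneg[of X "w n" "\<alpha> s"] by linarith
      have "v \<le> s'" using mdist_triangle[of p X "\<beta> s'" "w n"] p \<beta>X s' wX d\<beta> n by (simp add: mdist_commute)
      have d: "mdist X (\<beta> s') (\<alpha> s) \<le> 2 * M"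
        using mdist_triangle[of "\<beta> s'" X "w n" "\<alpha> s"] \<beta>X \<alpha>X s s' wX by (simp add: mdist_commute)
      have sp: "stable_pair X D (\<alpha> 0) (\<alpha> s)" by (rule stable_set_pair[OF st(1)]) (use s in auto)
      have q: "qgeo X 1 (2 * M) {0..s'} \<beta>" by (rule qgeo_mono[OF geodesic_qgeo[OF \<beta>(1)]]) (use M0 in auto)
      have q': "qgeo X 1 (2 * M) {0..s} \<alpha>" by (rule qgeo_mono[OF geodesic_qgeo[OF \<alpha>(1)]]) (use M0 in auto)
      have "\<beta> v \<in> nbhd X (D 1 (2 * M)) (\<alpha> ` {0..s})"
        by (rule stable_pairD[OF sp s'(1) s(1) q q'])
          (use d v \<open>v \<le> s'\<close> \<alpha>(2) \<beta>(2) M0 p \<alpha>X s(1) in simp_all)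
      moreover have "nbhd X (D 1 (2 * M)) (\<alpha> ` {0..s}) \<subseteq> nbhd X (D 1 (2 * M)) (\<alpha> ` {0..})" by (rule nbhd_mono) auto
      ultimately show "\<beta> v \<in> nbhd X (D 1 (2 * M)) (\<alpha> ` {0..})" by blast
    qed
    from heads_to_fhd[OF \<beta>(4) qgeo_ray_fhd[OF geodesic_qgeo[OF \<beta>(1)] geodesic_qgeo[OF \<alpha>(1)] this]]
    have "a = b"
      by (intro heads_to_unique_point[OF morse_boundary_visual[OF a] morse_boundary_visual[OF b] \<alpha>(4)])
    with ab show False by simp
  qed
  then obtain R where R: "\<And>n. mdist X p (w n) \<le> R" by blast
  define c where "c = (\<lambda>n t. z n (k n + t))"
  define J where "J = (\<lambda>n. {- k n..l n - k n})"
  \<comment> \<open>As the middle points stay bounded, both sides of the geodesics become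
    arbitrarily long, so their domains exhaust the real line.\<close>
  have ends: "k n \<ge> real n - R" "l n - k n \<ge> real n - R" for n
  proof -
    have "mdist X (z n 0) (z n (k n)) = k n" "mdist X (z n (k n)) (z n (l n)) = l n - k n"
      using geodesic_dist[OF z(1), of 0 n "k n"] geodesic_dist[OF z(1), of "k n" n "l n"] k(1)[of n] l0[of n] by auto
    then show "k n \<ge> real n - R" "l n - k n \<ge> real n - R"
      using R[of n] mdist_triangle[of p X "w n" "\<alpha> (real n)"] mdist_triangle[of p X "w n" "\<beta> (real n)"]
        p wX \<alpha>X \<beta>X d\<alpha>[of "real n"] d\<beta>[of "real n"] z(2,3)[of n] by (auto simp: w_def mdist_commute)
  qed
  have c1: "qgeo X 1 0 (J n) (c n)" for n
    by (rule qgeo_reparam[OF geodesic_qgeo[OF z(1)[of n]], of "\<lambda>t. k n + t"]) (auto simp: J_def c_def)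
  have ev: "\<exists>n0. \<forall>n\<ge>n0. t \<in> J n" for t
  proof (intro exI[of _ "nat \<lceil>\<bar>t\<bar> + R\<rceil>"] allI impI)
    fix n assume "nat \<lceil>\<bar>t\<bar> + R\<rceil> \<le> n"
    then have "\<bar>t\<bar> + R \<le> real n" by linarith
    then show "t \<in> J n" using ends[of n] by (auto simp: J_def)
  qed
  have bd: "mdist X p (c n t) \<le> R + \<bar>t\<bar>" if "t \<in> J n" for n t
  proof -
    have "mdist X (w n) (c n t) = \<bar>t\<bar>"
      using geodesic_dist[OF z(1), of "k n" n "k n + t"] k(1)[of n] that by (auto simp: w_def c_def J_def)
    then show ?thesis
      using mdist_triangle[of p X "w n" "c n t"] p wX qgeo_in[OF c1 that] R[of n] by simp
  qed
  obtain \<gamma> where \<gamma>: "geodesic X UNIV \<gamma>" "\<And>t n. \<exists>m\<ge>n. t \<in> J m \<and> mdist X (\<gamma> t) (c m t) \<le> 1"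
    by (rule geodesic_limit[OF X(2) p, of UNIV J c R]) (use c1 ev bd in auto)
  have \<gamma>X: "\<gamma> t \<in> mspace X" for t using geodesic_in[OF \<gamma>(1)] by simp
  have g0: "qgeo X 1 0 {0..} \<gamma>" by (rule qgeo_mono[OF geodesic_qgeo[OF \<gamma>(1)]]) auto
  have near\<beta>: "\<gamma> ` {0..} \<subseteq> nbhd X (1 + M) (\<beta> ` {0..})"
  proof (rule image_subsetI)
    fix t :: real assume t: "t \<in> {0..}"
    obtain m where "t \<in> J m" "mdist X (\<gamma> t) (c m t) \<le> 1" using \<gamma>(2)[of 0 t] by auto
    then show "\<gamma> t \<in> nbhd X (1 + M) (\<beta> ` {0..})"
      using right[of m "k m + t"] \<gamma>X \<beta>X t by (intro qgeo_nbhd_trans[of X _ "c m t"]) (auto simp: c_def J_def)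
  qed
  have b': "heads_to X b (\<gamma> ` {0..})"
    by (rule heads_to_fhd[OF \<beta>(4) fhd_sym[OF qgeo_ray_fhd[OF g0 geodesic_qgeo[OF \<beta>(1)] near\<beta>]]])
  have near\<alpha>: "(\<lambda>t. \<gamma> (- t)) ` {0..} \<subseteq> nbhd X (1 + M) (\<alpha> ` {0..})"
  proof (rule image_subsetI)
    fix t :: real assume t: "t \<in> {0..}"
    obtain m where "- t \<in> J m" "mdist X (\<gamma> (- t)) (c m (- t)) \<le> 1" using \<gamma>(2)[of 0 "- t"] by auto
    then show "\<gamma> (- t) \<in> nbhd X (1 + M) (\<alpha> ` {0..})"
      using left[of "k m - t" m] \<gamma>X \<alpha>X t by (intro qgeo_nbhd_trans[of X _ "c m (- t)"]) (auto simp: c_def J_def)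
  qed
  have g1: "qgeo X 1 0 {0..} (\<lambda>t. \<gamma> (- t))"
    by (rule qgeo_reparam[OF geodesic_qgeo[OF \<gamma>(1)], of uminus]) auto
  have "heads_to X a ((\<lambda>t. \<gamma> (- t)) ` {0..})"
    by (rule heads_to_fhd[OF \<alpha>(4) fhd_sym[OF qgeo_ray_fhd[OF g1 geodesic_qgeo[OF \<alpha>(1)] near\<alpha>]]])
  then have "heads_to X a (\<gamma> ` {..0})" unfolding image_uminus_half .
  with \<gamma>(1) b' show ?thesis by (auto simp: line_between_iff)
qed

section \<open>Ideal triangles and their centers\<close>

definition near_line :: "'a metric \<Rightarrow> real \<Rightarrow> 'a \<Rightarrow> 'a bdpoint \<Rightarrow> 'a bdpoint \<Rightarrow> bool" where
  "near_line X R x a b \<longleftrightarrow> (\<exists>\<gamma> t. line_between X a b \<gamma> \<and> mdist X x (\<gamma> t) \<le> R)"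

lemma near_line_sym: "near_line X R x a b \<Longrightarrow> near_line X R x b a"
  unfolding near_line_def by (metis line_between_reverse add.inverse_inverse)

lemma near_line_mono: "near_line X R x a b \<Longrightarrow> R \<le> R' \<Longrightarrow> near_line X R' x a b"
  unfolding near_line_def by (meson order_trans)

lemma centers_iff:
  "x \<in> centers X K a b c \<longleftrightarrow> x \<in> mspace X \<and> near_line X K x a b \<and> near_line X K x b c \<and> near_line X K x c a"
  unfolding centers_def near_line_def nbhd_def by auto

lemma centers_rotate: "centers X K a b c = centers X K b c a"
  by (auto simp: centers_iff)

lemma centers_flip: "centers X K a b c = centers X K b a c"
  by (auto simp: centers_iff intro: near_line_sym)

lemma centers_mono: "K \<le> K' \<Longrightarrow> centers X K a b c \<subseteq> centers X K' a b c"
  by (auto simp: centers_iff intro: near_line_mono)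

definition morse_pair :: "'a metric \<Rightarrow> 'a \<Rightarrow> gauge \<Rightarrow> 'a bdpoint \<Rightarrow> 'a bdpoint \<Rightarrow> bool" where
  "morse_pair X p N a b \<longleftrightarrow> [a, b] \<in> morse_tuples X p 2 N"

lemma morse_pair_iff:
  "morse_pair X p N a b \<longleftrightarrow> a \<noteq> b \<and> a \<in> morse_boundary X p \<and> b \<in> morse_boundary X p \<and>
     (\<forall>\<gamma>. line_between X a b \<gamma> \<or> line_between X b a \<gamma> \<longrightarrow> morse_geodesic X N UNIV \<gamma>)"
  unfolding morse_pair_def morse_tuples_def by auto

lemma morse_pair_sym: "morse_pair X p N a b \<Longrightarrow> morse_pair X p N b a"
  by (auto simp: morse_pair_iff)

lemma morse_tuples_iff:
  "as \<in> morse_tuples X p n N \<longleftrightarrow> length as = n \<and> distinct as \<and> set as \<subseteq> morse_boundary X p \<and>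
     (\<forall>a\<in>set as. \<forall>b\<in>set as. a \<noteq> b \<longrightarrow> morse_pair X p N a b)"
  unfolding morse_tuples_def morse_pair_iff by (auto simp: subset_iff)

lemma morse_triple_iff:
  "[a, b, c] \<in> morse_tuples X p 3 N \<longleftrightarrow> morse_pair X p N a b \<and> morse_pair X p N b c \<and> morse_pair X p N c a"
  unfolding morse_tuples_iff by (auto simp: morse_pair_iff)

lemma morse_quadruple_iff:
  "[a, b, c, d] \<in> morse_tuples X p 4 N \<longleftrightarrow> morse_pair X p N a b \<and> morse_pair X p N b c \<and> morse_pair X p N c a \<and>
     morse_pair X p N a d \<and> morse_pair X p N b d \<and> morse_pair X p N c d" (is "?L \<longleftrightarrow> ?R")
proof
  assume ?L
  then show ?R unfolding morse_tuples_iff by auto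
next
  assume R: ?R
  have mem: "u \<noteq> v" "u \<in> morse_boundary X p" "v \<in> morse_boundary X p" if "morse_pair X p N u v" for u v
    using that by (auto simp: morse_pair_iff)
  have "a \<noteq> b" "b \<noteq> c" "c \<noteq> a" "a \<noteq> d" "b \<noteq> d" "c \<noteq> d"
    using mem(1)[of a b] mem(1)[of b c] mem(1)[of c a] mem(1)[of a d] mem(1)[of b d] mem(1)[of c d] R by simp_all
  moreover have "set [a, b, c, d] \<subseteq> morse_boundary X p"
    using mem(2)[of a b] mem(2)[of b c] mem(3)[of b c] mem(3)[of a d] R by simp
  moreover have "morse_pair X p N b a" "morse_pair X p N c b" "morse_pair X p N a c"
    "morse_pair X p N d a" "morse_pair X p N d b" "morse_pair X p N d c"
    using R by (simp_all add: morse_pair_sym[of X p N a b] morse_pair_sym[of X p N b c] morse_pair_sym[of X p N c a]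
      morse_pair_sym[of X p N a d] morse_pair_sym[of X p N b d] morse_pair_sym[of X p N c d])
  ultimately show ?L unfolding morse_tuples_iff using R by simp
qed

locale morse_space =
  fixes X :: "'a metric" and p :: 'a and KX :: "gauge \<Rightarrow> real"
  assumes geodesic: "geodesic_space X" and proper: "proper_space X" and base: "p \<in> mspace X"
    and center_constants: "center_constants X p KX"
begin

section \<open>Morse lines and triangles with uniform bounds\<close>

lemma pair_visual:
  assumes "morse_pair X p N a b"
  shows "a \<in> visual_boundary X p" "b \<in> visual_boundary X p"
  using assms by (auto simp: morse_pair_iff intro: morse_boundary_visual)

lemma pair_line: "morse_pair X p N a b \<Longrightarrow> \<exists>\<gamma>. line_between X a b \<gamma>"
  by (rule morse_line_exists[OF geodesic proper]) (auto simp: morse_pair_iff)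

lemma pair_line_stable:
  assumes "morse_pair X p N a b" "line_between X a b \<gamma>"
  shows "stable_set X (morse_bound N) (range \<gamma>)"
  using assms by (intro morse_geodesic_stable) (auto simp: morse_pair_iff)

lemma line_geodesic: "line_between X a b \<gamma> \<Longrightarrow> geodesic X UNIV \<gamma>"
  by (simp add: line_between_iff)

lemma line_in: "line_between X a b \<gamma> \<Longrightarrow> \<gamma> t \<in> mspace X"
  using geodesic_in[OF line_geodesic, of a b \<gamma> t] by simp

text \<open>\<open>N\<close> depends on \<open>D\<close> and \<open>C\<close> only. Points taken
  from different triples, all seen from one \<open>x\<close>, thereby become pairs of a single
  gauge, to which \<open>two_stable\<close> can be applied.\<close>

lemma radial_pair:
  obtains N where "N \<in> morse_gauges"
    "\<And>a b x. a \<in> morse_boundary X p \<Longrightarrow> b \<in> morse_boundary X p \<Longrightarrow> a \<noteq> b \<Longrightarrow> x \<in> mspace X \<Longrightarrow>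
      radial X D C x a \<Longrightarrow> radial X D C x b \<Longrightarrow> morse_pair X p N a b"
proof -
  obtain D' where D': "\<And>a b x \<eta>. a \<in> visual_boundary X p \<Longrightarrow> b \<in> visual_boundary X p \<Longrightarrow> x \<in> mspace X \<Longrightarrow>
    radial X D C x a \<Longrightarrow> radial X D C x b \<Longrightarrow> line_between X a b \<eta> \<Longrightarrow> stable_set X D' (range \<eta>)"
    using radial_lines_stable[OF geodesic] by metis
  have "morse_pair X p (gauge_of D') a b"
    if "a \<in> morse_boundary X p" "b \<in> morse_boundary X p" "a \<noteq> b" "x \<in> mspace X"
      "radial X D C x a" "radial X D C x b" for a b x
  proof -
    have "morse_geodesic X (gauge_of D') UNIV \<gamma>" if \<gamma>: "line_between X a b \<gamma> \<or> line_between X b a \<gamma>" for \<gamma>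
    proof -
      have "stable_set X D' (range \<gamma>)"
        using \<gamma> D'[of a b x \<gamma>] D'[of b a x \<gamma>] \<open>a \<in> _\<close> \<open>b \<in> _\<close> \<open>x \<in> _\<close> \<open>radial X D C x a\<close> \<open>radial X D C x b\<close>
          morse_boundary_visual[of a X p] morse_boundary_visual[of b X p] by auto
      then show ?thesis using \<gamma> line_geodesic by (intro stable_morse_geodesic) auto
    qed
    then show ?thesis using that by (simp add: morse_pair_iff)
  qed
  then show ?thesis by (rule that[OF gauge_of_in])
qed

text \<open>The distance of lines with common ends is finite by definition and uniform by stability;
  \<open>9\<close> and \<open>2\<close> are the constants \<open>9 * L\<close> and
  \<open>e + 2\<close> for geodesics.\<close>

lemma parallel_lines_close:
  assumes ab: "morse_pair X p N a b" and \<gamma>: "line_between X a b \<gamma>" and \<eta>: "line_between X a b \<eta>"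
  shows "range \<eta> \<subseteq> nbhd X (morse_bound N 9 2) (range \<gamma>)"
proof -
  note v = pair_visual[OF ab]
  have g: "qgeo X 1 0 UNIV \<gamma>" "qgeo X 1 0 UNIV \<eta>"
    using geodesic_qgeo[OF line_geodesic[OF \<gamma>]] geodesic_qgeo[OF line_geodesic[OF \<eta>]] .
  obtain R where R: "\<eta> ` {0..} \<subseteq> nbhd X R (\<gamma> ` {0..})"
    using fhdE[OF heads_to_unique_set[OF v(2), of "\<eta> ` {0..}" "\<gamma> ` {0..}"]] \<gamma> \<eta> unfolding line_between_iff by metis
  obtain R' where R': "\<eta> ` {..0} \<subseteq> nbhd X R' (\<gamma> ` {..0})"
    using fhdE[OF heads_to_unique_set[OF v(1), of "\<eta> ` {..0}" "\<gamma> ` {..0}"]] \<gamma> \<eta> unfolding line_between_iff by metis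
  from stable_line_fellow_travel[OF geodesic g(1) pair_line_stable[OF ab \<gamma>] g(2) R R'] show ?thesis by simp
qed

text \<open>\<open>near_line\<close> provides some line, while positions along a line have to be
  compared on a fixed one.\<close>

lemma near_every_line:
  assumes ab: "morse_pair X p N a b" and \<gamma>: "line_between X a b \<gamma>" and x: "near_line X R x a b" "x \<in> mspace X"
  shows "\<exists>t. mdist X x (\<gamma> t) \<le> R + morse_bound N 9 2"
proof -
  obtain \<eta> s where \<eta>: "line_between X a b \<eta>" "mdist X x (\<eta> s) \<le> R" using x by (auto simp: near_line_def)
  obtain t where t: "mdist X (\<eta> s) (\<gamma> t) \<le> morse_bound N 9 2"
    using subsetD[OF parallel_lines_close[OF ab \<gamma> \<eta>(1)], of "\<eta> s"] by (auto elim: nbhdE)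
  show ?thesis using mdist_triangle[of x X "\<eta> s" "\<gamma> t"] x(2) line_in[OF \<gamma>] line_in[OF \<eta>(1)] \<eta>(2) t by (intro exI[of _ t]) simp
qed

lemma near_line_radial:
  assumes "morse_pair X p N a b" "near_line X R x a b"
  shows "radial X (morse_bound N) R x a" "radial X (morse_bound N) R x b"
proof -
  obtain \<gamma> t where \<gamma>: "line_between X a b \<gamma>" "mdist X x (\<gamma> t) \<le> R" using assms(2) by (auto simp: near_line_def)
  from line_radial[OF \<gamma>(1) pair_line_stable[OF assms(1) \<gamma>(1)] \<gamma>(2)]
  show "radial X (morse_bound N) R x a" "radial X (morse_bound N) R x b" .
qed

text \<open>The second claim allows prescribed sides, because later arguments start from a line that
  is already chosen.\<close>

lemma center_exists:
  assumes N: "N \<in> morse_gauges" and t: "[a, b, c] \<in> morse_tuples X p 3 N"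
  shows "\<exists>x. x \<in> centers X (KX N) a b c"
    and "\<And>\<gamma>1 \<gamma>2 \<gamma>3. line_between X a b \<gamma>1 \<Longrightarrow> line_between X b c \<gamma>2 \<Longrightarrow> line_between X c a \<gamma>3 \<Longrightarrow>
      \<exists>s1 s2 s3. mdist X (\<gamma>1 s1) (\<gamma>2 s2) \<le> KX N \<and> mdist X (\<gamma>2 s2) (\<gamma>3 s3) \<le> KX N \<and> mdist X (\<gamma>3 s3) (\<gamma>1 s1) \<le> KX N"
proof -
  have K: "KX N > 0" using center_constants N by (simp add: center_constants_def)
  have pr: "morse_pair X p N a b" "morse_pair X p N b c" "morse_pair X p N c a"
    using t by (simp_all add: morse_triple_iff)
  show tri: "\<exists>s1 s2 s3. mdist X (\<gamma>1 s1) (\<gamma>2 s2) \<le> KX N \<and> mdist X (\<gamma>2 s2) (\<gamma>3 s3) \<le> KX N \<and> mdist X (\<gamma>3 s3) (\<gamma>1 s1) \<le> KX N"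
    if \<gamma>: "line_between X a b \<gamma>1" "line_between X b c \<gamma>2" "line_between X c a \<gamma>3" for \<gamma>1 \<gamma>2 \<gamma>3
  proof -
    have m: "morse_geodesic X N UNIV \<gamma>1" "morse_geodesic X N UNIV \<gamma>2" "morse_geodesic X N UNIV \<gamma>3"
      using pr \<gamma> by (auto simp: morse_pair_iff)
    have v: "{Inr a, Inr b, Inr c} \<subseteq> Inl ` mspace X \<union> Inr ` morse_boundary X p"
      using pr by (auto simp: morse_pair_iff)
    have "\<exists>q1\<in>range \<gamma>1. \<exists>q2\<in>range \<gamma>2. \<exists>q3\<in>range \<gamma>3.
        mdist X q1 q2 \<le> KX N \<and> mdist X q2 q3 \<le> KX N \<and> mdist X q3 q1 \<le> KX N"
      by (rule center_constants[unfolded center_constants_def, rule_format, OF N, THEN conjunct2, rule_format, OF v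
            \<gamma>(1)[unfolded line_between_def] m(1) \<gamma>(2)[unfolded line_between_def] m(2)
            \<gamma>(3)[unfolded line_between_def] m(3)])
    then show ?thesis by blast
  qed
  obtain \<gamma>1 \<gamma>2 \<gamma>3 where \<gamma>: "line_between X a b \<gamma>1" "line_between X b c \<gamma>2" "line_between X c a \<gamma>3"
    using pair_line pr by meson
  obtain s1 s2 s3 where s: "mdist X (\<gamma>1 s1) (\<gamma>2 s2) \<le> KX N" "mdist X (\<gamma>3 s3) (\<gamma>1 s1) \<le> KX N"
    using tri[OF \<gamma>] by blast
  have "\<gamma>1 s1 \<in> centers X (KX N) a b c"
    unfolding centers_iff
  proof (intro conjI)
    have "mdist X (\<gamma>1 s1) (\<gamma>1 s1) \<le> KX N" using K line_in[OF \<gamma>(1)] by simp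
    then show "near_line X (KX N) (\<gamma>1 s1) a b" using \<gamma>(1) unfolding near_line_def by blast
    show "near_line X (KX N) (\<gamma>1 s1) b c" using \<gamma>(2) s(1) unfolding near_line_def by blast
    have "mdist X (\<gamma>1 s1) (\<gamma>3 s3) \<le> KX N" using s(2) by (simp add: mdist_commute)
    then show "near_line X (KX N) (\<gamma>1 s1) c a" using \<gamma>(3) unfolding near_line_def by blast
  qed (rule line_in[OF \<gamma>(1)])
  then show "\<exists>x. x \<in> centers X (KX N) a b c" by blast
qed

text \<open>From \<open>\<gamma> t\<close> and \<open>\<gamma>' t'\<close> on, the two lines are
  rays to the same boundary point whose starting points are at most \<open>C\<close> apart, so the
  uniform bound for such rays applies.\<close>

lemma common_end_close:
  assumes va: "morse_pair X p N v a" and wa: "line_between X w a \<gamma>" and \<gamma>': "line_between X v a \<gamma>'"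
    and C: "mdist X (\<gamma> t) (\<gamma>' t') \<le> C" and s: "t \<le> s"
  shows "\<exists>s'\<ge>t'. mdist X (\<gamma> s) (\<gamma>' s') \<le> ray_bound (morse_bound N) 1 0 C"
proof -
  note h = line_half_forward[OF wa, of t] and h' = line_half_forward[OF \<gamma>', of t']
  have st: "stable_set X (morse_bound N) ((\<lambda>s. \<gamma>' (t' + s)) ` {0..})"
    by (rule stable_set_mono[OF pair_line_stable[OF va \<gamma>']]) auto
  have "(\<lambda>s. \<gamma> (t + s)) ` {0..} \<subseteq> nbhd X (ray_bound (morse_bound N) 1 0 C) ((\<lambda>s. \<gamma>' (t' + s)) ` {0..})"
    by (rule heads_to_rays_close[OF geodesic pair_visual(2)[OF va] geodesic_qgeo[OF h'(1)] st h'(2) geodesic_qgeo[OF h(1)] h(2)])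
      (use C in simp)
  moreover have "\<gamma> s \<in> (\<lambda>s. \<gamma> (t + s)) ` {0..}" unfolding image_shift_half using s by simp
  ultimately have "\<gamma> s \<in> nbhd X (ray_bound (morse_bound N) 1 0 C) (\<gamma>' ` {t'..})"
    unfolding image_shift_half by blast
  then show ?thesis by (auto elim: nbhdE)
qed

text \<open>The center of the triangle cuts the side from \<open>a\<close> to \<open>b\<close>:
  before the cut this side accompanies the other side at \<open>a\<close>, after it the other side
  at \<open>b\<close>.\<close>

lemma near_line_third:
  assumes N: "N \<in> morse_gauges" and t: "[a, b, d] \<in> morse_tuples X p 3 N"
    and x: "x \<in> mspace X" "near_line X R x a b"
  shows "near_line X (R + ray_bound (morse_bound N) 1 0 (KX N)) x d a \<or>
    near_line X (R + ray_bound (morse_bound N) 1 0 (KX N)) x d b"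
proof -
  have pr: "morse_pair X p N a b" "morse_pair X p N b d" "morse_pair X p N d a"
    using t by (simp_all add: morse_triple_iff)
  obtain \<gamma>1 t1 where \<gamma>1: "line_between X a b \<gamma>1" "mdist X x (\<gamma>1 t1) \<le> R" using x by (auto simp: near_line_def)
  obtain \<gamma>2 \<gamma>3 where \<gamma>: "line_between X b d \<gamma>2" "line_between X d a \<gamma>3"
    using pair_line pr by meson
  obtain s1 s2 s3 where s: "mdist X (\<gamma>1 s1) (\<gamma>2 s2) \<le> KX N" "mdist X (\<gamma>3 s3) (\<gamma>1 s1) \<le> KX N"
    using center_exists(2)[OF N t \<gamma>1(1) \<gamma>] by blast
  have fin: "near_line X (R + ray_bound (morse_bound N) 1 0 (KX N)) x d c"
    if "line_between X d c \<eta>" "mdist X (\<gamma>1 t1) (\<eta> u) \<le> ray_bound (morse_bound N) 1 0 (KX N)" for c \<eta> u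
    unfolding near_line_def using that \<gamma>1(2) mdist_triangle[of x X "\<gamma>1 t1" "\<eta> u"] x line_in[OF \<gamma>1(1)] line_in[OF that(1)]
    by (intro exI[of _ \<eta>] exI[of _ u]) simp
  show ?thesis
  proof (cases "t1 \<le> s1")
    case True
    obtain u where "mdist X (\<gamma>1 (- (- t1))) (\<gamma>3 u) \<le> ray_bound (morse_bound N) 1 0 (KX N)"
      using common_end_close[OF pr(3) line_between_reverse[OF \<gamma>1(1)] \<gamma>(2), of "- s1" s3 "KX N" "- t1"] s True
      by (auto simp: mdist_commute)
    then show ?thesis using fin[OF \<gamma>(2)] by simp
  next
    case False
    obtain u where "mdist X (\<gamma>1 t1) (\<gamma>2 (- u)) \<le> ray_bound (morse_bound N) 1 0 (KX N)"
      using common_end_close[OF morse_pair_sym[OF pr(2)] \<gamma>1(1) line_between_reverse[OF \<gamma>(1)], of s1 "- s2" "KX N" t1] s False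
      by auto
    then show ?thesis using fin[OF line_between_reverse[OF \<gamma>(1)], of u] by simp
  qed
qed

text \<open>Seen from a center \<open>x\<close>, a second center \<open>x'\<close> lies on each side in the direction of one of its two
  vertices. For two of the sides these directions are opposite on a common line, so \<open>x'\<close> is close to \<open>x\<close>.\<close>

lemma centers_bounded:
  obtains B where "B \<ge> 0" "\<And>a b c x x'. [a, b, c] \<in> morse_tuples X p 3 N \<Longrightarrow>
    x \<in> centers X R a b c \<Longrightarrow> x' \<in> centers X R a b c \<Longrightarrow> mdist X x x' \<le> B"
proof -
  define R1 where "R1 = R + morse_bound N 9 2"
  define rb where "rb = ray_bound (morse_bound N) 1 0 (2 * max R R1)"
  define Q where "Q = R1 + \<bar>rb\<bar>"
  define B where "B = \<bar>R\<bar> + 3 * \<bar>Q\<bar> + 3 * \<bar>rb\<bar>"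
  have "mdist X x x' \<le> B"
    if t: "[a, b, c] \<in> morse_tuples X p 3 N" and x: "x \<in> centers X R a b c" and x': "x' \<in> centers X R a b c" for a b c x x'
  proof -
    have pr: "morse_pair X p N v w" if "v \<in> {a, b, c}" "w \<in> {a, b, c}" "v \<noteq> w" for v w
      using t that by (auto simp: morse_triple_iff intro: morse_pair_sym)
    have dist: "a \<noteq> b" "b \<noteq> c" "c \<noteq> a" using t by (auto simp: morse_triple_iff morse_pair_iff)
    have X: "x \<in> mspace X" "x' \<in> mspace X" using x x' by (auto simp: centers_iff)
    have nl: "near_line X R x v w" "near_line X R x' v w" if "v \<in> {a, b, c}" "w \<in> {a, b, c}" "v \<noteq> w" for v w
      using x x' that by (auto simp: centers_iff intro: near_line_sym)
    \<comment> \<open>\<open>H v w q\<close>: along some line from \<open>w\<close> to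
      \<open>v\<close> that passes near \<open>x\<close>, the point \<open>x'\<close> is found in
      the direction of \<open>v\<close>, up to the error \<open>q\<close>.\<close>
    define H where "H = (\<lambda>v w q. \<exists>\<gamma> t s. line_between X w v \<gamma> \<and> mdist X x (\<gamma> t) \<le> R \<and> t \<le> s \<and> mdist X x' (\<gamma> s) \<le> q)"
    have F1: "H v w R1 \<or> H w v R1" if vw: "v \<in> {a, b, c}" "w \<in> {a, b, c}" "v \<noteq> w" for v w
    proof -
      obtain \<gamma> u where \<gamma>: "line_between X w v \<gamma>" "mdist X x (\<gamma> u) \<le> R"
        using nl(1)[OF vw(2,1)] vw(3) by (auto simp: near_line_def)
      obtain s where s: "mdist X x' (\<gamma> s) \<le> R1"
        using near_every_line[OF pr[OF vw(2,1)] \<gamma>(1) nl(2)[OF vw(2,1)] X(2)] vw(3) by (auto simp: R1_def)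
      show ?thesis
      proof (cases "u \<le> s")
        case True then show ?thesis unfolding H_def using \<gamma> s by blast
      next
        case False
        have "H w v R1" unfolding H_def
          by (intro exI[of _ "\<lambda>t. \<gamma> (- t)"] exI[of _ "- u"] exI[of _ "- s"])
            (use \<gamma> s False line_between_reverse[OF \<gamma>(1)] in auto)
        then show ?thesis by blast
      qed
    qed
    \<comment> \<open>Lines with the common end \<open>v\<close> that pass near \<open>x\<close>
      stay together beyond \<open>x\<close>, so being in the direction of \<open>v\<close> does not
      depend on the other end of the line.\<close>
    have move: "\<exists>s'\<ge>t'. mdist X x' (\<gamma>' s') \<le> q + rb"
      if H: "H v w q" and vu: "v \<in> {a, b, c}" "u \<in> {a, b, c}" "v \<noteq> u"
        and \<gamma>': "line_between X u v \<gamma>'" "mdist X x (\<gamma>' t') \<le> max R R1" for v w u q \<gamma>' t'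
    proof -
      obtain \<gamma> t s where \<gamma>: "line_between X w v \<gamma>" "mdist X x (\<gamma> t) \<le> R" "t \<le> s" "mdist X x' (\<gamma> s) \<le> q"
        using H by (auto simp: H_def)
      have "mdist X (\<gamma> t) (\<gamma>' t') \<le> 2 * max R R1"
        using mdist_triangle[of "\<gamma> t" X x "\<gamma>' t'"] X line_in[OF \<gamma>(1)] line_in[OF \<gamma>'(1)] \<gamma>(2) \<gamma>'(2)
        by (simp add: mdist_commute)
      then obtain s' where s': "s' \<ge> t'" "mdist X (\<gamma> s) (\<gamma>' s') \<le> rb"
        using common_end_close[OF pr[OF vu(2,1)] \<gamma>(1) \<gamma>'(1) _ \<gamma>(3)] vu(3) unfolding rb_def by blast
      then show ?thesis
        using mdist_triangle[of x' X "\<gamma> s" "\<gamma>' s'"] X line_in[OF \<gamma>(1)] line_in[OF \<gamma>'(1)] \<gamma>(4) by (intro exI[of _ s']) simp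
    qed
    have F2: "H v u Q" if vu: "H v w R1" "v \<in> {a, b, c}" "u \<in> {a, b, c}" "v \<noteq> u" for v w u
    proof -
      obtain \<gamma>' t' where \<gamma>': "line_between X u v \<gamma>'" "mdist X x (\<gamma>' t') \<le> R"
        using nl(1)[OF vu(3,2)] vu(4) by (auto simp: near_line_def)
      have "mdist X x (\<gamma>' t') \<le> max R R1" using \<gamma>'(2) by simp
      then obtain s' where "s' \<ge> t'" "mdist X x' (\<gamma>' s') \<le> R1 + rb"
        using move[OF vu \<gamma>'(1)] by blast
      then show ?thesis unfolding H_def Q_def using \<gamma>' by (intro exI[of _ \<gamma>'] exI[of _ t'] exI[of _ s']) auto
    qed
    \<comment> \<open>On one line \<open>x'\<close> is near \<open>\<gamma> s\<close> with
      \<open>s \<ge> t\<close> and near \<open>\<gamma> (- s')\<close> with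
      \<open>- s' \<le> t\<close>. These points are at most \<open>2 * Q + rb\<close> apart, so both
      are near \<open>\<gamma> t\<close>, and \<open>x'\<close> is near \<open>x\<close>.\<close>
    have F3: ?thesis if H: "H v w Q" "H w v Q" and vw: "v \<in> {a, b, c}" "w \<in> {a, b, c}" "v \<noteq> w" for v w
    proof -
      obtain \<gamma> t s where \<gamma>: "line_between X w v \<gamma>" "mdist X x (\<gamma> t) \<le> R" "t \<le> s" "mdist X x' (\<gamma> s) \<le> Q"
        using H(1) by (auto simp: H_def)
      have "mdist X x (\<gamma> (- (- t))) \<le> max R R1" using \<gamma>(2) by simp
      then obtain s' where s': "s' \<ge> - t" "mdist X x' (\<gamma> (- s')) \<le> Q + rb"
        using move[OF H(2) vw(2,1) vw(3)[symmetric] line_between_reverse[OF \<gamma>(1)], of "- t"] by blast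
      have g: "mdist X (\<gamma> u) (\<gamma> u') = \<bar>u - u'\<bar>" for u u' using geodesic_dist[OF line_geodesic[OF \<gamma>(1)]] by simp
      have "s + s' \<le> 2 * Q + rb"
        using mdist_triangle[of "\<gamma> s" X x' "\<gamma> (- s')"] g[of s "- s'"] X line_in[OF \<gamma>(1)] \<gamma>(4) s' by (simp add: mdist_commute)
      then have "mdist X (\<gamma> t) (\<gamma> s) \<le> 2 * Q + rb" using g[of t s] \<gamma>(3) s'(1) by simp
      then have "mdist X x x' \<le> R + (2 * Q + rb) + Q"
        using mdist_triangle[of x X "\<gamma> t" x'] mdist_triangle[of "\<gamma> t" X "\<gamma> s" x'] X line_in[OF \<gamma>(1)] \<gamma>(2,4)
        by (simp add: mdist_commute)
      then show ?thesis by (simp add: B_def)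
    qed
    have S: "a \<in> {a, b, c}" "b \<in> {a, b, c}" "c \<in> {a, b, c}" by auto
    have QR: "H v w Q" if "H v w R1" for v w
    proof -
      have "R1 \<le> Q" by (simp add: Q_def)
      then show ?thesis using that unfolding H_def by (meson order_trans)
    qed
    \<comment> \<open>In each case the directions found on two sides can be transferred to one side,
      where they are opposite.\<close>
    from F1[OF S(1,2)] dist consider "H a b R1" | "H b a R1" by blast
    then show ?thesis
    proof cases
      case 1
      from F1[OF S(2,3)] dist consider "H b c R1" | "H c b R1" by blast
      then show ?thesis
      proof cases
        case bc: 1
        then show ?thesis using F3[OF QR[OF 1] F2[OF bc S(2,1)] S(1,2)] dist by blast
      next
        case 2
        then show ?thesis using F3[OF F2[OF 1 S(1,3)] F2[OF 2 S(3,1)] S(1,3)] dist by blast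
      qed
    next
      case 2
      from F1[OF S(3,1)] dist consider "H c a R1" | "H a c R1" by blast
      then show ?thesis
      proof cases
        case 1
        then show ?thesis using F3[OF F2[OF 1 S(3,2)] F2[OF 2 S(2,3)] S(3,2)] dist by blast
      next
        case ac: 2
        then show ?thesis using F3[OF F2[OF ac S(1,2)] QR[OF 2] S(1,2)] dist by blast
      qed
    qed
  qed
  moreover have "B \<ge> 0" by (simp add: B_def)
  ultimately show ?thesis using that by blast
qed

end

section \<open>Maps induced by quasi-isometries\<close>

lemma two_stable_gauges_iff:
  "map h ` morse_tuples X p 2 N \<subseteq> morse_tuples Y q 2 N' \<longleftrightarrow>
     (\<forall>a b. morse_pair X p N a b \<longrightarrow> morse_pair Y q N' (h a) (h b))"
proof -
  have "morse_tuples X p 2 N = {[a, b] | a b. morse_pair X p N a b}"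
    by (auto simp: morse_pair_def morse_tuples_def length_Suc_conv numeral_2_eq_2)
  then have "map h ` morse_tuples X p 2 N = {[h a, h b] | a b. morse_pair X p N a b}" by force
  then show ?thesis by (simp only: morse_pair_def[of Y q]) blast
qed

lemma set_diam_le: "set_diam X A \<le> ennreal r \<longleftrightarrow> (\<forall>x\<in>A. \<forall>y\<in>A. mdist X x y \<le> r)" if "r \<ge> 0"
  using that by (auto simp: set_diam_def SUP_le_iff)

text \<open>The bound \<open>r\<close> excludes the infinite diameter, for which
  \<open>enn2real\<close> would return 0.\<close>

lemma mdist_le_set_diam:
  assumes "set_diam X A \<le> ennreal r" "r \<ge> 0" "x \<in> A" "y \<in> A"
  shows "mdist X x y \<le> enn2real (set_diam X A)"
proof -
  have "set_diam X A < \<infinity>" using order_le_less_trans[OF assms(1)] by simp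
  then have "set_diam X A = ennreal (enn2real (set_diam X A))" by simp
  then have "\<forall>x\<in>A. \<forall>y\<in>A. mdist X x y \<le> enn2real (set_diam X A)"
    using set_diam_le[of "enn2real (set_diam X A)" X A] by simp
  then show ?thesis using assms by blast
qed

lemma qi_quasi_inverse:
  assumes "quasi_isometry_with L e D X Y f"
  obtains f' L' e' where "f' \<in> mspace Y \<rightarrow> mspace X" "qi_embedding L' e' Y X f'"
    "\<And>x. x \<in> mspace X \<Longrightarrow> mdist X (f' (f x)) x \<le> D" "\<And>y. y \<in> mspace Y \<Longrightarrow> mdist Y (f (f' y)) y \<le> D"
proof -
  obtain f' where f': "f' \<in> mspace Y \<rightarrow> mspace X" "\<And>x. x \<in> mspace X \<Longrightarrow> mdist X (f' (f x)) x \<le> D"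
      "\<And>y. y \<in> mspace Y \<Longrightarrow> mdist Y (f (f' y)) y \<le> D"
    and f: "qi_embedding L e X Y f" and D: "D \<ge> 0"
    using assms unfolding quasi_isometry_with_def by blast
  have L: "L \<ge> 1" "e \<ge> 0" "f \<in> mspace X \<rightarrow> mspace Y" using f by (auto simp: qi_embedding_def)
  have "qi_embedding L (L * (2 * D + e)) Y X f'"
    unfolding qi_embedding_def
  proof (intro conjI ballI)
    show "L \<ge> 1" "0 \<le> L * (2 * D + e)" "f' \<in> mspace Y \<rightarrow> mspace X" using L D f' by auto
    fix y z assume yz: "y \<in> mspace Y" "z \<in> mspace Y"
    have X: "f' y \<in> mspace X" "f' z \<in> mspace X" using f' yz by auto
    have Y: "f (f' y) \<in> mspace Y" "f (f' z) \<in> mspace Y" using X L by auto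
    have low: "mdist X (f' y) (f' z) \<le> L * (mdist Y (f (f' y)) (f (f' z)) + e)"
      and up: "mdist Y (f (f' y)) (f (f' z)) \<le> L * mdist X (f' y) (f' z) + e"
      using f X L by (auto simp: qi_embedding_def field_simps)
    have a: "mdist Y (f (f' y)) (f (f' z)) \<le> mdist Y y z + 2 * D" "mdist Y y z \<le> mdist Y (f (f' y)) (f (f' z)) + 2 * D"
      using mdist_triangle[OF Y(1) yz(1) Y(2)] mdist_triangle[OF yz(1) yz(2) Y(2)] mdist_triangle[OF yz(1) Y(1) yz(2)]
        mdist_triangle[OF Y(1,2) yz(2)] f'(3)[OF yz(1)] f'(3)[OF yz(2)] by (simp_all add: mdist_commute)
    have "L * (mdist Y (f (f' y)) (f (f' z)) + e) \<le> L * (mdist Y y z + 2 * D + e)"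
      using a(1) L by (intro mult_left_mono) auto
    then show "mdist X (f' y) (f' z) \<le> L * mdist Y y z + L * (2 * D + e)" using low by (simp add: algebra_simps)
    have "mdist Y y z \<le> L * mdist X (f' y) (f' z) + (2 * D + e)" using a(2) up by simp
    also have "\<dots> \<le> L * (mdist X (f' y) (f' z) + L * (2 * D + e))"
    proof -
      have "1 * (2 * D + e) \<le> (L * L) * (2 * D + e)" using L D mult_mono[of 1 L 1 L] by (intro mult_right_mono) auto
      then show ?thesis by (simp add: algebra_simps)
    qed
    finally show "1 / L * mdist Y y z - L * (2 * D + e) \<le> mdist X (f' y) (f' z)" using L by (simp add: field_simps)
  qed
  with f' show ?thesis by (intro that)
qed

lemma qi_embedding_le:
  "qi_embedding L e X Y f \<Longrightarrow> x \<in> mspace X \<Longrightarrow> y \<in> mspace X \<Longrightarrow> mdist Y (f x) (f y) \<le> L * mdist X x y + e"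
  by (auto simp: qi_embedding_def)

lemma qi_embedding_ge:
  "qi_embedding L e X Y f \<Longrightarrow> x \<in> mspace X \<Longrightarrow> y \<in> mspace X \<Longrightarrow> mdist X x y \<le> L * (mdist Y (f x) (f y) + e)"
  by (auto simp: qi_embedding_def field_simps)

lemma qi_embedding_in: "qi_embedding L e X Y f \<Longrightarrow> x \<in> mspace X \<Longrightarrow> f x \<in> mspace Y"
  by (auto simp: qi_embedding_def)

lemma qi_embedding_geodesic:
  assumes f: "qi_embedding L e X Y f" and g: "geodesic X I \<gamma>"
  shows "qgeo Y L e I (\<lambda>t. f (\<gamma> t))"
proof -
  have "\<bar>s - t\<bar> \<le> L * (mdist Y (f (\<gamma> s)) (f (\<gamma> t)) + e) \<and> mdist Y (f (\<gamma> s)) (f (\<gamma> t)) \<le> L * \<bar>s - t\<bar> + e"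
    if st: "s \<in> I" "t \<in> I" for s t
    using qi_embedding_le[OF f geodesic_in[OF g st(1)] geodesic_in[OF g st(2)]]
      qi_embedding_ge[OF f geodesic_in[OF g st(1)] geodesic_in[OF g st(2)]] geodesic_dist[OF g st] by simp
  then show ?thesis using f geodesic_in[OF g] unfolding qgeo_def qi_embedding_def by auto
qed

lemma fhd_qi_image:
  assumes f: "qi_embedding L e X Y f" and AB: "finite_hausdorff_dist X A B"
  shows "finite_hausdorff_dist Y (f ` A) (f ` B)"
  by (rule fhd_coarse_image[OF _ _ _ AB, of Y f L e])
    (use f in \<open>auto intro: qi_embedding_le qi_embedding_in simp: qi_embedding_def\<close>)

text \<open>A form of \<open>induced_by\<close> that speaks of all sets heading to \<open>b\<close>,
  so that it applies to halves of lines and passes to quasi-inverses.\<close>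

definition tracks :: "'a metric \<Rightarrow> 'a \<Rightarrow> 'b metric \<Rightarrow> ('a bdpoint \<Rightarrow> 'b bdpoint) \<Rightarrow> ('a \<Rightarrow> 'b) \<Rightarrow> bool" where
  "tracks X p Y h f \<longleftrightarrow> (\<forall>b\<in>morse_boundary X p. \<forall>A. heads_to X b A \<longrightarrow> heads_to Y (h b) (f ` A))"

lemma induced_by_tracks:
  assumes f: "qi_embedding L e X Y f" and ind: "induced_by X p Y q h f"
    and h: "h ` morse_boundary X p \<subseteq> morse_boundary Y q"
  shows "tracks X p Y h f"
  unfolding tracks_def
proof (intro ballI allI impI)
  fix b A assume b: "b \<in> morse_boundary X p" and A: "heads_to X b A"
  have "h b \<in> visual_boundary Y q" by (rule morse_boundary_visual) (use h b in auto)
  then obtain \<eta> where \<eta>: "\<eta> \<in> h b" by (auto dest: visual_boundary_nonempty)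
  have "h b = induced_map X Y q f b" using ind b by (simp add: induced_by_def)
  then obtain \<gamma> where \<gamma>: "\<gamma> \<in> b" "finite_hausdorff_dist Y (\<eta> ` {0..}) (f ` \<gamma> ` {0..})"
    using \<eta> unfolding induced_map_def by auto
  note v = morse_boundary_visual[OF b]
  have "finite_hausdorff_dist X A (\<gamma> ` {0..})" by (rule heads_to_unique_set[OF v A heads_to_ray[OF v \<gamma>(1)]])
  from fhd_trans[OF fhd_qi_image[OF f this] fhd_sym[OF \<gamma>(2)]] \<eta> show "heads_to Y (h b) (f ` A)"
    unfolding heads_to_def by (rule bexI)
qed

text \<open>On a ray to \<open>b\<close> the map \<open>f'\<close> undoes \<open>f\<close> up to a
  bounded distance, and every set heading to \<open>h b\<close> is at finite distance from the image
  of this ray.\<close>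

lemma tracks_inverse:
  assumes f: "qi_embedding L e X Y f" and f': "qi_embedding L' e' Y X f'"
    and ff: "\<And>x. x \<in> mspace X \<Longrightarrow> mdist X (f' (f x)) x \<le> D"
    and tr: "tracks X p Y h f" and h: "bij_betw h (morse_boundary X p) (morse_boundary Y q)"
  shows "tracks Y q X (inv_into (morse_boundary X p) h) f'"
  unfolding tracks_def
proof (intro ballI allI impI)
  fix c A assume c: "c \<in> morse_boundary Y q" and A: "heads_to Y c A"
  define b where "b = inv_into (morse_boundary X p) h c"
  have b: "b \<in> morse_boundary X p" "h b = c"
    using h c unfolding b_def by (auto simp: bij_betw_def inv_into_into f_inv_into_f)
  obtain \<beta> where \<beta>: "\<beta> \<in> b" "\<beta> ` {0..} \<subseteq> mspace X" "heads_to X b (\<beta> ` {0..})"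
    using morse_boundary_ray[OF b(1)] stable_set_in by metis
  have "heads_to Y c (f ` \<beta> ` {0..})" using tr b \<beta>(3) by (auto simp: tracks_def)
  then have "finite_hausdorff_dist Y A (f ` \<beta> ` {0..})"
    by (rule heads_to_unique_set[OF morse_boundary_visual[OF c] A])
  then have 1: "finite_hausdorff_dist X (f' ` A) (f' ` f ` \<beta> ` {0..})" by (rule fhd_qi_image[OF f'])
  have in': "f' (f x) \<in> mspace X" if "x \<in> mspace X" for x
    using qi_embedding_in[OF f' qi_embedding_in[OF f that]] .
  have "f' ` f ` \<beta> ` {0..} \<subseteq> nbhd X D (\<beta> ` {0..})"
    using \<beta>(2) ff in' by (auto intro!: nbhdI)
  moreover have "\<beta> ` {0..} \<subseteq> nbhd X D (f' ` f ` \<beta> ` {0..})"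
  proof
    fix x assume x: "x \<in> \<beta> ` {0..}"
    then show "x \<in> nbhd X D (f' ` f ` \<beta> ` {0..})"
      using ff[of x] \<beta>(2) by (intro nbhdI[of _ _ "f' (f x)"]) (auto simp: mdist_commute)
  qed
  ultimately have "finite_hausdorff_dist X (f' ` f ` \<beta> ` {0..}) (\<beta> ` {0..})" by (rule fhdI)
  from fhd_trans[OF 1 this] \<beta>(1)
  show "heads_to X (inv_into (morse_boundary X p) h c) (f' ` A)" unfolding b_def[symmetric] heads_to_def by (rule bexI)
qed

locale morse_space_pair = X: morse_space X p KX + Y: morse_space Y q KY
  for X :: "'a metric" and p KX and Y :: "'b metric" and q KY
begin

lemma tracks_line_ends:
  assumes f: "qi_embedding L e X Y f" and tr: "tracks X p Y h f" and hX: "h ` morse_boundary X p \<subseteq> morse_boundary Y q"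
    and ab: "morse_pair X p N a b" and \<gamma>: "line_between X a b \<gamma>" and \<eta>: "line_between Y (h a) (h b) \<eta>"
  obtains R R' where "\<eta> ` {0..} \<subseteq> nbhd Y R ((\<lambda>t. f (\<gamma> t)) ` {0..})" "(\<lambda>t. f (\<gamma> t)) ` {0..} \<subseteq> nbhd Y R (\<eta> ` {0..})"
    "\<eta> ` {..0} \<subseteq> nbhd Y R' ((\<lambda>t. f (\<gamma> t)) ` {..0})" "(\<lambda>t. f (\<gamma> t)) ` {..0} \<subseteq> nbhd Y R' (\<eta> ` {..0})"
proof -
  have m: "a \<in> morse_boundary X p" "b \<in> morse_boundary X p" using ab by (auto simp: morse_pair_iff)
  then have v: "h a \<in> visual_boundary Y q" "h b \<in> visual_boundary Y q"
    using hX by (auto intro: morse_boundary_visual)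
  have "heads_to X a (\<gamma> ` {..0})" "heads_to X b (\<gamma> ` {0..})" using \<gamma> by (auto simp: line_between_iff)
  then have "heads_to Y (h b) (f ` \<gamma> ` {0..})" "heads_to Y (h a) (f ` \<gamma> ` {..0})"
    using tr m by (auto simp: tracks_def)
  then have "heads_to Y (h b) ((\<lambda>t. f (\<gamma> t)) ` {0..})" "heads_to Y (h a) ((\<lambda>t. f (\<gamma> t)) ` {..0})"
    by (simp_all add: image_image)
  then have "finite_hausdorff_dist Y (\<eta> ` {0..}) ((\<lambda>t. f (\<gamma> t)) ` {0..})"
    "finite_hausdorff_dist Y (\<eta> ` {..0}) ((\<lambda>t. f (\<gamma> t)) ` {..0})"
    using \<eta> heads_to_unique_set[OF v(2)] heads_to_unique_set[OF v(1)] unfolding line_between_iff by simp_all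
  then show ?thesis by (elim fhdE) (rule that)
qed

text \<open>A line between image points has the same ends as the image of a Morse line. The latter
  is a stable set, and lines near it are stable, hence Morse.\<close>

lemma tracks_two_stable:
  assumes f: "qi_embedding L e X Y f" and f': "qi_embedding L' e' Y X f'"
    and ff: "\<And>x. x \<in> mspace X \<Longrightarrow> mdist X (f' (f x)) x \<le> D"
    and tr: "tracks X p Y h f" and hX: "h ` morse_boundary X p \<subseteq> morse_boundary Y q" and inj: "inj_on h (morse_boundary X p)"
  shows "two_stable X p Y q h"
  unfolding two_stable_def two_stable_gauges_iff
proof
  fix N assume N: "N \<in> morse_gauges"
  have L: "L \<ge> 1" "e \<ge> 0" using f by (auto simp: qi_embedding_def)
  \<comment> \<open>\<open>D1\<close> is the stability of the image of a Morse line, as in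
    \<open>stable_set_qi_image\<close>; \<open>D2\<close> allows for the distance at which a
    geodesic line follows this image.\<close>
  define D1 where "D1 = (\<lambda>l s. L' * (morse_bound N (L' * l) (L' * s + e' + D) + e'))"
  define D2 where "D2 = (\<lambda>l s. D1 l (s + D1 (9 * L) (e + 2)))"
  have key: "morse_geodesic Y (gauge_of D2) UNIV \<eta>"
    if ab: "morse_pair X p N a b" and \<eta>: "line_between Y (h a) (h b) \<eta>" for a b \<eta>
  proof -
    obtain \<gamma> where \<gamma>: "line_between X a b \<gamma>" using X.pair_line[OF ab] by blast
    have f\<gamma>: "qgeo Y L e UNIV (\<lambda>t. f (\<gamma> t))" by (rule qi_embedding_geodesic[OF f X.line_geodesic[OF \<gamma>]])
    have "stable_set Y D1 (f ` range \<gamma>)" unfolding D1_def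
      by (rule stable_set_qi_image[OF _ f' ff X.pair_line_stable[OF ab \<gamma>]]) (use qi_embedding_in[OF f] in auto)
    then have st: "stable_set Y D1 (range (\<lambda>t. f (\<gamma> t)))" by (simp add: image_image)
    have \<eta>q: "qgeo Y L e UNIV \<eta>" by (rule qgeo_mono[OF geodesic_qgeo[OF Y.line_geodesic[OF \<eta>]]]) (use L in auto)
    obtain R R' where R: "\<eta> ` {0..} \<subseteq> nbhd Y R ((\<lambda>t. f (\<gamma> t)) ` {0..})" "\<eta> ` {..0} \<subseteq> nbhd Y R' ((\<lambda>t. f (\<gamma> t)) ` {..0})"
      by (rule tracks_line_ends[OF f tr hX ab \<gamma> \<eta>])
    have "stable_set Y D2 (range \<eta>)" unfolding D2_def
      by (rule stable_set_perturb[OF st stable_line_fellow_travel[OF Y.geodesic f\<gamma> st \<eta>q R]])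
    then show ?thesis by (rule stable_morse_geodesic[OF Y.line_geodesic[OF \<eta>]])
  qed
  have "morse_pair Y q (gauge_of D2) (h a) (h b)" if ab: "morse_pair X p N a b" for a b
    unfolding morse_pair_iff
  proof (intro conjI allI impI)
    have m: "a \<in> morse_boundary X p" "b \<in> morse_boundary X p" "a \<noteq> b" using ab by (auto simp: morse_pair_iff)
    then show "h a \<noteq> h b" "h a \<in> morse_boundary Y q" "h b \<in> morse_boundary Y q"
      using hX inj by (auto simp: inj_on_def)
    fix \<eta> assume "line_between Y (h a) (h b) \<eta> \<or> line_between Y (h b) (h a) \<eta>"
    then show "morse_geodesic Y (gauge_of D2) UNIV \<eta>" using key[OF ab] key[OF morse_pair_sym[OF ab]] by blast
  qed
  then show "\<exists>N'\<in>morse_gauges. \<forall>a b. morse_pair X p N a b \<longrightarrow> morse_pair Y q N' (h a) (h b)"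
    using gauge_of_in[of D2] by blast
qed

text \<open>Here the line in \<open>Y\<close> is the stable one: its gauge \<open>N'\<close> is
  prescribed by \<open>quasi_moebius\<close> and need not be the one produced in
  \<open>tracks_two_stable\<close>.\<close>

lemma tracks_near_line:
  assumes f: "qi_embedding L e X Y f" and tr: "tracks X p Y h f" and hX: "h ` morse_boundary X p \<subseteq> morse_boundary Y q"
    and ab: "morse_pair X p N a b" and hab: "morse_pair Y q N' (h a) (h b)"
    and x: "x \<in> mspace X" "near_line X R x a b"
  shows "near_line Y (L * R + e + morse_bound N' (9 * L) (e + 2)) (f x) (h a) (h b)"
proof -
  have L: "L \<ge> 1" "e \<ge> 0" using f by (auto simp: qi_embedding_def)
  obtain \<gamma> t where \<gamma>: "line_between X a b \<gamma>" "mdist X x (\<gamma> t) \<le> R" using x by (auto simp: near_line_def)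
  obtain \<eta> where \<eta>: "line_between Y (h a) (h b) \<eta>" using Y.pair_line[OF hab] by blast
  have f\<gamma>: "qgeo Y L e UNIV (\<lambda>t. f (\<gamma> t))" by (rule qi_embedding_geodesic[OF f X.line_geodesic[OF \<gamma>(1)]])
  have \<eta>q: "qgeo Y L e UNIV \<eta>" by (rule qgeo_mono[OF geodesic_qgeo[OF Y.line_geodesic[OF \<eta>]]]) (use L in auto)
  obtain S S' where S: "(\<lambda>t. f (\<gamma> t)) ` {0..} \<subseteq> nbhd Y S (\<eta> ` {0..})" "(\<lambda>t. f (\<gamma> t)) ` {..0} \<subseteq> nbhd Y S' (\<eta> ` {..0})"
    by (rule tracks_line_ends[OF f tr hX ab \<gamma>(1) \<eta>])
  have "f (\<gamma> t) \<in> nbhd Y (morse_bound N' (9 * L) (e + 2)) (range \<eta>)"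
    using stable_line_fellow_travel[OF Y.geodesic \<eta>q Y.pair_line_stable[OF hab \<eta>] f\<gamma> S] by blast
  then obtain u where u: "mdist Y (f (\<gamma> t)) (\<eta> u) \<le> morse_bound N' (9 * L) (e + 2)" by (auto elim: nbhdE)
  have gX: "\<gamma> t \<in> mspace X" by (rule X.line_in[OF \<gamma>(1)])
  have "L * mdist X x (\<gamma> t) \<le> L * R" using \<gamma>(2) L by (intro mult_left_mono) auto
  then have "mdist Y (f x) (f (\<gamma> t)) \<le> L * R + e" using qi_embedding_le[OF f x(1) gX] by simp
  then have "mdist Y (f x) (\<eta> u) \<le> L * R + e + morse_bound N' (9 * L) (e + 2)"
    using mdist_triangle[of "f x" Y "f (\<gamma> t)" "\<eta> u"] qi_embedding_in[OF f] x gX Y.line_in[OF \<eta>] u by simp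
  then show ?thesis using \<eta> unfolding near_line_def by blast
qed

lemma tracks_quasi_moebius:
  assumes f: "qi_embedding L e X Y f" and tr: "tracks X p Y h f" and hX: "h ` morse_boundary X p \<subseteq> morse_boundary Y q"
  shows "quasi_moebius X p KX Y q KY h"
  unfolding quasi_moebius_def two_stable_gauges_iff
proof (intro ballI impI)
  fix N N' assume N: "N \<in> morse_gauges" and N': "N' \<in> morse_gauges"
    and st: "\<forall>a b. morse_pair X p N a b \<longrightarrow> morse_pair Y q N' (h a) (h b)"
  have L: "L \<ge> 1" "e \<ge> 0" using f by (auto simp: qi_embedding_def)
  \<comment> \<open>Large enough for both the centers in the cross-ratio and the images of
    centers.\<close>
  define R where "R = max (KY N') (L * KX N + e + morse_bound N' (9 * L) (e + 2))"
  obtain B where B: "B \<ge> 0" "\<And>a b c x x'. [a, b, c] \<in> morse_tuples Y q 3 N' \<Longrightarrow>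
    x \<in> centers Y R a b c \<Longrightarrow> x' \<in> centers Y R a b c \<Longrightarrow> mdist Y x x' \<le> B" using Y.centers_bounded by metis
  obtain BX where BX: "BX \<ge> 0" "\<And>a b c x x'. [a, b, c] \<in> morse_tuples X p 3 N \<Longrightarrow>
    x \<in> centers X (KX N) a b c \<Longrightarrow> x' \<in> centers X (KX N) a b c \<Longrightarrow> mdist X x x' \<le> BX" using X.centers_bounded by metis
  \<comment> \<open>The slope comes from \<open>f\<close>; each of two centers in \<open>Y\<close>
    is replaced by the image of a center in \<open>X\<close> at cost \<open>B\<close>.\<close>
  define \<psi> where "\<psi> = (\<lambda>t. L * t + (2 * B + e))"
  have near: "mdist Y y (f x) \<le> B"
    if t: "[a, b, c] \<in> morse_tuples X p 3 N" and x: "x \<in> centers X (KX N) a b c" and y: "y \<in> centers Y (KY N') (h a) (h b) (h c)"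
    for a b c x y
  proof (rule B(2))
    have pr: "morse_pair X p N a b" "morse_pair X p N b c" "morse_pair X p N c a" using t by (simp_all add: morse_triple_iff)
    have hp: "morse_pair Y q N' (h a) (h b)" "morse_pair Y q N' (h b) (h c)" "morse_pair Y q N' (h c) (h a)"
      using pr st by blast+
    then show "[h a, h b, h c] \<in> morse_tuples Y q 3 N'" by (simp add: morse_triple_iff)
    show "y \<in> centers Y R (h a) (h b) (h c)" using y centers_mono[of "KY N'" R Y] by (auto simp: R_def)
    have xX: "x \<in> mspace X" "near_line X (KX N) x a b" "near_line X (KX N) x b c" "near_line X (KX N) x c a"
      using x by (simp_all add: centers_iff)
    have "f x \<in> centers Y (L * KX N + e + morse_bound N' (9 * L) (e + 2)) (h a) (h b) (h c)"
      unfolding centers_iff using tracks_near_line[OF f tr hX pr(1) hp(1) xX(1,2)]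
        tracks_near_line[OF f tr hX pr(2) hp(2) xX(1,3)] tracks_near_line[OF f tr hX pr(3) hp(3) xX(1,4)]
        qi_embedding_in[OF f xX(1)] by simp
    then show "f x \<in> centers Y R (h a) (h b) (h c)"
      using centers_mono[of "L * KX N + e + morse_bound N' (9 * L) (e + 2)" R Y] by (auto simp: R_def)
  qed
  have "cross_ratio Y KY N' (h a) (h b) (h c) (h d) \<le> ennreal (\<psi> (enn2real (cross_ratio X KX N a b c d)))"
    if q: "[a, b, c, d] \<in> morse_tuples X p 4 N" for a b c d
  proof -
    have t: "[a, b, c] \<in> morse_tuples X p 3 N" "[a, d, c] \<in> morse_tuples X p 3 N"
      using q by (auto simp: morse_quadruple_iff morse_triple_iff intro: morse_pair_sym)
    obtain x1 x2 where x: "x1 \<in> centers X (KX N) a b c" "x2 \<in> centers X (KX N) a d c"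
      using X.center_exists(1)[OF N t(1)] X.center_exists(1)[OF N t(2)] by blast
    let ?A = "centers X (KX N) a b c \<union> centers X (KX N) a d c"
    let ?cr = "enn2real (set_diam X ?A)"
    have inX: "z \<in> mspace X" if "z \<in> ?A" for z using that by (auto simp: centers_iff)
    have "mdist X z z' \<le> 2 * BX + mdist X x1 x2" if zz: "z \<in> ?A" "z' \<in> ?A" for z z'
    proof -
      have n: "\<exists>w\<in>{x1, x2}. mdist X u w \<le> BX" if "u \<in> ?A" for u
        using that BX(2)[OF t(1) _ x(1), of u] BX(2)[OF t(2) _ x(2), of u] by auto
      obtain w w' where w: "w \<in> {x1, x2}" "mdist X z w \<le> BX" "w' \<in> {x1, x2}" "mdist X z' w' \<le> BX"
        using n[OF zz(1)] n[OF zz(2)] by blast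
      have "mdist X w w' \<le> mdist X x1 x2" using w inX[of x1] inX[of x2] x by (auto simp: mdist_commute)
      moreover have "w \<in> mspace X" "w' \<in> mspace X" using w x inX by auto
      ultimately show ?thesis
        using mdist_triangle[of z X w z'] mdist_triangle[of w X w' z'] inX[OF that(1)] inX[OF that(2)] w
        by (simp add: mdist_commute)
    qed
    \<comment> \<open>Without finiteness of the diameter \<open>enn2real\<close> would say nothing
      about distances.\<close>
    then have fin: "set_diam X ?A \<le> ennreal (2 * BX + mdist X x1 x2)" using BX(1) by (subst set_diam_le) auto
    have cr: "mdist X z z' \<le> ?cr" if "z \<in> ?A" "z' \<in> ?A" for z z'
      by (rule mdist_le_set_diam[OF fin _ that]) (use BX(1) in simp)
    have "mdist Y y y' \<le> \<psi> ?cr"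
      if y: "y \<in> centers Y (KY N') (h a) (h b) (h c) \<union> centers Y (KY N') (h a) (h d) (h c)"
        "y' \<in> centers Y (KY N') (h a) (h b) (h c) \<union> centers Y (KY N') (h a) (h d) (h c)" for y y'
    proof -
      have n: "\<exists>w\<in>?A. mdist Y u (f w) \<le> B"
        if "u \<in> centers Y (KY N') (h a) (h b) (h c) \<union> centers Y (KY N') (h a) (h d) (h c)" for u
        using that near[OF t(1) x(1), of u] near[OF t(2) x(2), of u] x by auto
      obtain w w' where w: "w \<in> ?A" "mdist Y y (f w) \<le> B" "w' \<in> ?A" "mdist Y y' (f w') \<le> B"
        using n[OF y(1)] n[OF y(2)] by blast
      have Y: "y \<in> mspace Y" "y' \<in> mspace Y" using y by (auto simp: centers_iff)
      have "L * mdist X w w' \<le> L * ?cr" using cr[OF w(1,3)] L by (intro mult_left_mono) auto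
      then have "mdist Y (f w) (f w') \<le> L * ?cr + e" using qi_embedding_le[OF f inX[OF w(1)] inX[OF w(3)]] by simp
      moreover have "f w \<in> mspace Y" "f w' \<in> mspace Y" using qi_embedding_in[OF f] inX w by auto
      ultimately show ?thesis
        using mdist_triangle[of y Y "f w" y'] mdist_triangle[of "f w" Y "f w'" y'] Y w
        by (simp add: mdist_commute \<psi>_def)
    qed
    moreover have "\<psi> ?cr \<ge> 0" using L B(1) by (simp add: \<psi>_def)
    ultimately show ?thesis unfolding cross_ratio_def by (subst set_diam_le) auto
  qed
  moreover have "continuous_on {0..} \<psi>" unfolding \<psi>_def by (intro continuous_intros)
  moreover have "mono_on {0..} \<psi>" using L by (auto simp: \<psi>_def mono_on_def intro: mult_left_mono)
  moreover have "\<psi> ` {0..} \<subseteq> {0..}" using L B(1) by (auto simp: \<psi>_def)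
  ultimately show "\<exists>\<psi> :: real \<Rightarrow> real. continuous_on {0..} \<psi> \<and> mono_on {0..} \<psi> \<and> \<psi> ` {0..} \<subseteq> {0..} \<and>
    (\<forall>a b c d. [a, b, c, d] \<in> morse_tuples X p 4 N \<longrightarrow>
      cross_ratio Y KY N' (h a) (h b) (h c) (h d) \<le> ennreal (\<psi> (enn2real (cross_ratio X KX N a b c d))))"
    by blast
qed

end

section \<open>The quasi-isometry induced by a quasi-moebius map\<close>

context morse_space begin

text \<open>\<open>a\<close> and \<open>b\<close> lie in opposite directions as seen from
  \<open>x\<close>, with \<open>R\<close> as the tolerance.\<close>

definition far :: "real \<Rightarrow> 'a \<Rightarrow> 'a bdpoint \<Rightarrow> 'a bdpoint \<Rightarrow> bool" where
  "far R x a b \<longleftrightarrow> a \<noteq> b \<and> near_line X R x a b"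

lemma far_sym: "far R x a b \<Longrightarrow> far R x b a"
  by (auto simp: far_def intro: near_line_sym)

text \<open>By \<open>near_line_third\<close> a third point cannot lie in the direction of both
  \<open>a\<close> and \<open>b\<close> when these are opposite. \<open>N\<close> and
  \<open>R\<close> depend on \<open>D\<close> and \<open>C\<close> only, and \<open>d\<close> may
  coincide with \<open>a\<close> or \<open>b\<close>.\<close>

lemma far_exchange:
  obtains N R where "N \<in> morse_gauges" "R \<ge> C"
    "\<forall>a\<in>morse_boundary X p. \<forall>b\<in>morse_boundary X p. \<forall>x\<in>mspace X. a \<noteq> b \<longrightarrow>
      radial X D C x a \<longrightarrow> radial X D C x b \<longrightarrow> morse_pair X p N a b"
    "\<forall>a\<in>morse_boundary X p. \<forall>b\<in>morse_boundary X p. \<forall>d\<in>morse_boundary X p. \<forall>x\<in>mspace X.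
      radial X D C x a \<longrightarrow> radial X D C x b \<longrightarrow> radial X D C x d \<longrightarrow> far C x a b \<longrightarrow> far R x d a \<or> far R x d b"
proof -
  obtain N where N: "N \<in> morse_gauges"
    "\<And>a b x. a \<in> morse_boundary X p \<Longrightarrow> b \<in> morse_boundary X p \<Longrightarrow> a \<noteq> b \<Longrightarrow> x \<in> mspace X \<Longrightarrow>
      radial X D C x a \<Longrightarrow> radial X D C x b \<Longrightarrow> morse_pair X p N a b"
    using radial_pair by metis
  define R where "R = max C (C + ray_bound (morse_bound N) 1 0 (KX N))"
  have ex: "far R x d a \<or> far R x d b"
    if m: "a \<in> morse_boundary X p" "b \<in> morse_boundary X p" "d \<in> morse_boundary X p" "x \<in> mspace X"
      and r: "radial X D C x a" "radial X D C x b" "radial X D C x d" and far: "far C x a b" for a b d x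
  proof -
    have ab: "a \<noteq> b" "near_line X C x a b" using far by (auto simp: far_def)
    have R: "near_line X R x a b" by (rule near_line_mono[OF ab(2)]) (simp add: R_def)
    consider "d = a" | "d = b" | "d \<noteq> a" "d \<noteq> b" by blast
    then show ?thesis
    proof cases
      case 1 then show ?thesis using R ab(1) by (auto simp: far_def)
    next
      case 2 then show ?thesis using near_line_sym[OF R] ab(1) by (auto simp: far_def)
    next
      case 3
      have "[a, b, d] \<in> morse_tuples X p 3 N"
        unfolding morse_triple_iff using N(2)[OF m(1,2) ab(1) m(4) r(1,2)] N(2)[OF m(2,3) _ m(4) r(2,3)]
          N(2)[OF m(3,1) _ m(4) r(3,1)] 3 by auto
      from near_line_third[OF N(1) this m(4) ab(2)]
      have "near_line X R x d a \<or> near_line X R x d b"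
        unfolding R_def by (meson near_line_mono max.cobounded2)
      then show ?thesis using 3 by (auto simp: far_def)
    qed
  qed
  have "R \<ge> C" by (simp add: R_def)
  then show ?thesis using N ex by (intro that[of N R] ballI impI) simp_all
qed

text \<open>Rays from the base point represent both points; the larger of their stability functions
  makes both radial at \<open>p\<close>.\<close>

lemma exists_pair_gauge:
  assumes "a \<in> morse_boundary X p" "b \<in> morse_boundary X p" "a \<noteq> b"
  obtains N where "N \<in> morse_gauges" "morse_pair X p N a b"
proof -
  have r: "\<exists>D. radial X D 0 p c" if c: "c \<in> morse_boundary X p" for c
  proof -
    obtain \<beta> D where "geodesic X {0..} \<beta>" "\<beta> 0 = p" "stable_set X D (\<beta> ` {0..})" "heads_to X c (\<beta> ` {0..})"
      by (rule morse_boundary_ray[OF c])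
    moreover from this have "mdist X p (\<beta> 0) \<le> 0" using base by simp
    ultimately show ?thesis unfolding radial_def by blast
  qed
  obtain Da Db where D: "radial X Da 0 p a" "radial X Db 0 p b" using r assms by blast
  define D where "D = (\<lambda>L e. max (Da L e) (Db L e))"
  have D': "radial X D 0 p a" "radial X D 0 p b"
    by (rule radial_mono[OF D(1)] radial_mono[OF D(2)]; simp add: D_def)+
  obtain N where N: "N \<in> morse_gauges"
    "\<And>a b x. a \<in> morse_boundary X p \<Longrightarrow> b \<in> morse_boundary X p \<Longrightarrow> a \<noteq> b \<Longrightarrow> x \<in> mspace X \<Longrightarrow>
      radial X D 0 x a \<Longrightarrow> radial X D 0 x b \<Longrightarrow> morse_pair X p N a b"
    using radial_pair by metis
  from that[OF N(1) N(2)[OF assms base D']] show ?thesis .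
qed

lemma center_radial:
  assumes t: "[a, b, c] \<in> morse_tuples X p 3 N" and x: "x \<in> centers X C a b c" and v: "v \<in> {a, b, c}"
  shows "radial X (morse_bound N) C x v" "v \<in> morse_boundary X p"
proof -
  have pr: "morse_pair X p N a b" "morse_pair X p N b c" "morse_pair X p N c a"
    using t by (simp_all add: morse_triple_iff)
  have n: "near_line X C x a b" "near_line X C x b c" "near_line X C x c a" using x by (simp_all add: centers_iff)
  show "radial X (morse_bound N) C x v"
    using near_line_radial[OF pr(1) n(1)] near_line_radial[OF pr(2) n(2)] v by blast
  show "v \<in> morse_boundary X p" using t v by (auto simp: morse_tuples_def)
qed

lemma center_far:
  assumes t: "[a, b, c] \<in> morse_tuples X p 3 N" and x: "x \<in> centers X C a b c"
  shows "far C x a b" "far C x b c" "far C x c a"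
  using t x by (auto simp: morse_triple_iff centers_iff far_def morse_pair_iff)

end

definition dense_centers :: "'a metric \<Rightarrow> 'a \<Rightarrow> gauge \<Rightarrow> real \<Rightarrow> bool" where
  "dense_centers X p N C \<longleftrightarrow>
     (\<forall>x\<in>mspace X. \<exists>a b c. [a, b, c] \<in> morse_tuples X p 3 N \<and> x \<in> centers X C a b c)"

context morse_space_pair begin

lemma two_stable_pairs:
  assumes "two_stable X p Y q h" "N \<in> morse_gauges"
  obtains N' where "N' \<in> morse_gauges" "\<And>a b. morse_pair X p N a b \<Longrightarrow> morse_pair Y q N' (h a) (h b)"
  using assms unfolding two_stable_def two_stable_gauges_iff by blast

lemma quasi_moebius_bound:
  assumes qm: "quasi_moebius X p KX Y q KY h" and N: "N \<in> morse_gauges" "N' \<in> morse_gauges"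
    and st: "\<And>a b. morse_pair X p N a b \<Longrightarrow> morse_pair Y q N' (h a) (h b)"
  obtains \<psi> :: "real \<Rightarrow> real" where "mono_on {0..} \<psi>" "\<And>t. t \<ge> 0 \<Longrightarrow> \<psi> t \<ge> 0"
    "\<And>a b c d. [a, b, c, d] \<in> morse_tuples X p 4 N \<Longrightarrow>
      cross_ratio Y KY N' (h a) (h b) (h c) (h d) \<le> ennreal (\<psi> (enn2real (cross_ratio X KX N a b c d)))"
proof -
  obtain \<psi> :: "real \<Rightarrow> real" where "mono_on {0..} \<psi>" "\<psi> ` {0..} \<subseteq> {0..}"
    "\<forall>a b c d. [a, b, c, d] \<in> morse_tuples X p 4 N \<longrightarrow>
      cross_ratio Y KY N' (h a) (h b) (h c) (h d) \<le> ennreal (\<psi> (enn2real (cross_ratio X KX N a b c d)))"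
    using qm[unfolded quasi_moebius_def two_stable_gauges_iff, rule_format, OF N] st by blast
  then show ?thesis using that[of \<psi>] by auto
qed

text \<open>Two triples with the common center \<open>x\<close> are joined by a chain of triples that still have \<open>x\<close> as a
  coarse center, exchanging one point at a time. At each step the cross-ratio is bounded, hence so
  is that of the images.\<close>

lemma center_transfer:
  assumes ts: "two_stable X p Y q h" and qm: "quasi_moebius X p KX Y q KY h"
    and gN: "N \<in> morse_gauges" "N0 \<in> morse_gauges"
  obtains B where "\<And>a b c a' b' c' x y y'. [a, b, c] \<in> morse_tuples X p 3 N \<Longrightarrow> x \<in> centers X C a b c \<Longrightarrow>
     [a', b', c'] \<in> morse_tuples X p 3 N0 \<Longrightarrow> x \<in> centers X C a' b' c' \<Longrightarrow>
     y \<in> centers Y C' (h a) (h b) (h c) \<Longrightarrow> y' \<in> centers Y C' (h a') (h b') (h c') \<Longrightarrow> mdist Y y y' \<le> B"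
proof -
  define D where "D = (\<lambda>L e. max (morse_bound N L e) (morse_bound N0 L e))"
  obtain N2 R where N2: "N2 \<in> morse_gauges" and RC: "R \<ge> C"
    and pair2': "\<forall>a\<in>morse_boundary X p. \<forall>b\<in>morse_boundary X p. \<forall>x\<in>mspace X. a \<noteq> b \<longrightarrow>
      radial X D C x a \<longrightarrow> radial X D C x b \<longrightarrow> morse_pair X p N2 a b"
    and exch': "\<forall>a\<in>morse_boundary X p. \<forall>b\<in>morse_boundary X p. \<forall>d\<in>morse_boundary X p. \<forall>x\<in>mspace X.
      radial X D C x a \<longrightarrow> radial X D C x b \<longrightarrow> radial X D C x d \<longrightarrow> X.far C x a b \<longrightarrow> X.far R x d a \<or> X.far R x d b"
    by (rule X.far_exchange[of C D])
  note pair2 = pair2'[rule_format] and exch = exch'[rule_format]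
  obtain N' where N': "N' \<in> morse_gauges" and st: "\<And>a b. morse_pair X p N2 a b \<Longrightarrow> morse_pair Y q N' (h a) (h b)"
    using two_stable_pairs[OF ts N2] by metis
  obtain \<psi> :: "real \<Rightarrow> real" where \<psi>: "mono_on {0..} \<psi>" "\<And>t. t \<ge> 0 \<Longrightarrow> \<psi> t \<ge> 0"
    "\<And>a b c d. [a, b, c, d] \<in> morse_tuples X p 4 N2 \<Longrightarrow>
      cross_ratio Y KY N' (h a) (h b) (h c) (h d) \<le> ennreal (\<psi> (enn2real (cross_ratio X KX N2 a b c d)))"
    using quasi_moebius_bound[OF qm N2 N' st] by metis
  define RX where "RX = max R (KX N2)"
  obtain BX where BX: "BX \<ge> 0" "\<And>a b c x x'. [a, b, c] \<in> morse_tuples X p 3 N2 \<Longrightarrow>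
    x \<in> centers X RX a b c \<Longrightarrow> x' \<in> centers X RX a b c \<Longrightarrow> mdist X x x' \<le> BX" using X.centers_bounded by metis
  define RY where "RY = max C' (KY N')"
  obtain BY where BY: "BY \<ge> 0" "\<And>a b c x x'. [a, b, c] \<in> morse_tuples Y q 3 N' \<Longrightarrow>
    x \<in> centers Y RY a b c \<Longrightarrow> x' \<in> centers Y RY a b c \<Longrightarrow> mdist Y x x' \<le> BY" using Y.centers_bounded by metis
  define B where "B = \<psi> (2 * BX) + 2 * BY"
  have \<psi>0: "\<psi> (2 * BX) \<ge> 0" using \<psi>(2) BX(1) by simp
  have "mdist Y y y' \<le> 3 * B"
    if t: "[a, b, c] \<in> morse_tuples X p 3 N" "x \<in> centers X C a b c"
      "[a', b', c'] \<in> morse_tuples X p 3 N0" "x \<in> centers X C a' b' c'"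
      and y: "y \<in> centers Y C' (h a) (h b) (h c)" "y' \<in> centers Y C' (h a') (h b') (h c')" for a b c a' b' c' x y y'
  proof -
    define S where "S = {a, b, c} \<union> {a', b', c'}"
    have xX: "x \<in> mspace X" using t(2) by (simp add: centers_iff)
    have S: "v \<in> morse_boundary X p" "radial X D C x v" if vS: "v \<in> S" for v
    proof -
      consider "v \<in> {a, b, c}" | "v \<in> {a', b', c'}" using vS unfolding S_def by blast
      then have "v \<in> morse_boundary X p \<and> radial X D C x v"
      proof cases
        case 1
        have "radial X D C x v" by (rule radial_mono[OF X.center_radial(1)[OF t(1,2) 1]]) (auto simp: D_def)
        with X.center_radial(2)[OF t(1,2) 1] show ?thesis by simp
      next
        case 2
        have "radial X D C x v" by (rule radial_mono[OF X.center_radial(1)[OF t(3,4) 2]]) (auto simp: D_def)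
        with X.center_radial(2)[OF t(3,4) 2] show ?thesis by simp
      qed
      then show "v \<in> morse_boundary X p" "radial X D C x v" by auto
    qed
    have pr: "morse_pair X p N2 u v" if "u \<in> S" "v \<in> S" "u \<noteq> v" for u v
      by (rule pair2[OF S(1)[OF that(1)] S(1)[OF that(2)] xX that(3) S(2)[OF that(1)] S(2)[OF that(2)]])
    have ex: "X.far R x d u \<or> X.far R x d v" if "u \<in> S" "v \<in> S" "d \<in> S" "X.far C x u v" for u v d
      by (rule exch[OF S(1)[OF that(1)] S(1)[OF that(2)] S(1)[OF that(3)] xX S(2)[OF that(1)] S(2)[OF that(2)] S(2)[OF that(3)] that(4)])
    have farR: "X.far R x u v" if "X.far C x u v" for u v
      using that near_line_mono[OF _ RC, of X x u v] unfolding X.far_def by blast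
    \<comment> \<open>The triples allowed in the chain: pairwise opposite vertices make
      \<open>x\<close> a coarse center, and being seen radially from \<open>x\<close> gives them the
      common gauge \<open>N2\<close>.\<close>
    define good where "good = (\<lambda>u v w. u \<in> S \<and> v \<in> S \<and> w \<in> S \<and> X.far R x u v \<and> X.far R x v w \<and> X.far R x w u)"
    define Z where "Z = (\<lambda>u v w. centers Y RY (h u) (h v) (h w))"
    have Z_rot: "Z u v w = Z v w u" for u v w unfolding Z_def by (rule centers_rotate)
    have Z_flip: "Z u v w = Z v u w" for u v w unfolding Z_def by (rule centers_flip)
    have good_tri: "[u, v, w] \<in> morse_tuples X p 3 N2" "x \<in> centers X RX u v w"
      "[h u, h v, h w] \<in> morse_tuples Y q 3 N'" if "good u v w" for u v w
    proof -
      have g: "u \<in> S" "v \<in> S" "w \<in> S" "u \<noteq> v" "v \<noteq> w" "w \<noteq> u"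
        and n: "near_line X R x u v" "near_line X R x v w" "near_line X R x w u"
        using that by (auto simp: good_def X.far_def)
      have p3: "morse_pair X p N2 u v" "morse_pair X p N2 v w" "morse_pair X p N2 w u"
        using pr[OF g(1,2,4)] pr[OF g(2,3,5)] pr[OF g(3,1,6)] .
      then show "[u, v, w] \<in> morse_tuples X p 3 N2" "[h u, h v, h w] \<in> morse_tuples Y q 3 N'"
        using st by (simp_all add: morse_triple_iff)
      have "R \<le> RX" by (simp add: RX_def)
      then show "x \<in> centers X RX u v w" using n xX by (auto simp: centers_iff intro: near_line_mono)
    qed
    have Z_bd: "mdist Y z z' \<le> BY" if "good u v w" "z \<in> Z u v w" "z' \<in> Z u v w" for u v w z z'
      using BY(2)[OF good_tri(3)[OF that(1)]] that(2,3) by (simp add: Z_def)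
    have Z_ne: "\<exists>z. z \<in> centers Y (KY N') (h u) (h v) (h w)" if "good u v w" for u v w
      by (rule Y.center_exists(1)[OF N' good_tri(3)[OF that]])
    have KZ: "z \<in> Z u v w" if "z \<in> centers Y (KY N') (h u) (h v) (h w)" for z u v w
      using that centers_mono[of "KY N'" RY Y "h u" "h v" "h w"] by (auto simp: RY_def Z_def)
    have KX: "z \<in> centers X RX u v w" if "z \<in> centers X (KX N2) u v w" for z u v w
      using that centers_mono[of "KX N2" RX X u v w] by (auto simp: RX_def)
    have ZY: "z \<in> mspace Y" if "z \<in> Z u v w" for z u v w using that by (auto simp: Z_def centers_iff)
    \<comment> \<open>The middle vertex is exchanged because the cross-ratio of \<open>u\<close>,
      \<open>v\<close>, \<open>w\<close>, \<open>k\<close> compares centers of \<open>u\<close>,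
      \<open>v\<close>, \<open>w\<close> with centers of \<open>u\<close>, \<open>k\<close>,
      \<open>w\<close>; other positions are reached by \<open>Z_rot\<close> and
      \<open>Z_flip\<close>.\<close>
    have step: "mdist Y z z' \<le> B" if g: "good u v w" "good u k w" and z: "z \<in> Z u v w" "z' \<in> Z u k w" for u v w k z z'
    proof (cases "v = k")
      case True
      then have "z' \<in> Z u v w" using z(2) by simp
      from Z_bd[OF g(1) z(1) this] show ?thesis using \<psi>0 BY(1) by (simp add: B_def)
    next
      case False
      have "morse_pair X p N2 v k" using pr False g by (auto simp: good_def)
      then have quad: "[u, v, w, k] \<in> morse_tuples X p 4 N2"
        using good_tri(1)[OF g(1)] good_tri(1)[OF g(2)]
        by (auto simp: morse_quadruple_iff morse_triple_iff intro: morse_pair_sym)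
      let ?A = "centers X (KX N2) u v w \<union> centers X (KX N2) u k w"
      \<comment> \<open>All centers of both triples are near their common coarse center
        \<open>x\<close>, which bounds the cross-ratio in \<open>X\<close> by
        \<open>2 * BX\<close>.\<close>
      have nx: "mdist X s x \<le> BX \<and> s \<in> mspace X" if "s \<in> ?A" for s
      proof -
        consider "s \<in> centers X RX u v w" | "s \<in> centers X RX u k w"
          using KX[of s u v w] KX[of s u k w] \<open>s \<in> ?A\<close> by auto
        then show ?thesis
        proof cases
          case 1 then show ?thesis using BX(2)[OF good_tri(1)[OF g(1)] 1 good_tri(2)[OF g(1)]] by (simp add: centers_iff)
        next
          case 2 then show ?thesis using BX(2)[OF good_tri(1)[OF g(2)] 2 good_tri(2)[OF g(2)]] by (simp add: centers_iff)
        qed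
      qed
      have "mdist X s s' \<le> 2 * BX" if "s \<in> ?A" "s' \<in> ?A" for s s'
        using mdist_triangle[of s X x s'] nx[OF that(1)] nx[OF that(2)] xX by (simp add: mdist_commute)
      then have crX: "cross_ratio X KX N2 u v w k \<le> ennreal (2 * BX)"
        unfolding cross_ratio_def using BX(1) by (subst set_diam_le) auto
      then have "enn2real (cross_ratio X KX N2 u v w k) \<le> 2 * BX" using BX(1) by (simp add: enn2real_leI)
      then have "\<psi> (enn2real (cross_ratio X KX N2 u v w k)) \<le> \<psi> (2 * BX)"
        using BX(1) by (intro mono_onD[OF \<psi>(1)]) auto
      then have crY: "cross_ratio Y KY N' (h u) (h v) (h w) (h k) \<le> ennreal (\<psi> (2 * BX))"
        using \<psi>(3)[OF quad] by (meson ennreal_leI order_trans)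
      \<comment> \<open>The cross-ratio concerns centers of radius \<open>KY N'\<close>;
        \<open>z\<close> and \<open>z'\<close> have the larger radius \<open>RY\<close> and are
        compared with these at cost \<open>BY\<close> each.\<close>
      obtain z0 z1 where z01: "z0 \<in> centers Y (KY N') (h u) (h v) (h w)" "z1 \<in> centers Y (KY N') (h u) (h k) (h w)"
        using Z_ne[OF g(1)] Z_ne[OF g(2)] by blast
      have "mdist Y z0 z1 \<le> \<psi> (2 * BX)"
        using crY z01 unfolding cross_ratio_def set_diam_le[OF \<psi>0] by blast
      then show ?thesis
        using Z_bd[OF g(1) z(1) KZ[OF z01(1)]] Z_bd[OF g(2) KZ[OF z01(2)] z(2)]
          mdist_triangle[of z Y z0 z'] mdist_triangle[of z0 Y z1 z'] ZY z KZ[OF z01(1)] KZ[OF z01(2)]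
        by (simp add: B_def)
    qed
    have S6: "a \<in> S" "b \<in> S" "c \<in> S" "a' \<in> S" "b' \<in> S" "c' \<in> S" by (auto simp: S_def)
    note f = X.center_far[OF t(1,2)] and f' = X.center_far[OF t(3,4)]
    have good': "good a' b' c'" using S6 f'[THEN farR] by (simp add: good_def)
    have good0: "good a b c" using S6 f[THEN farR] by (simp add: good_def)
    have yZ: "y \<in> Z a b c" "y' \<in> Z a' b' c'"
      using y centers_mono[of C' RY Y] by (auto simp: Z_def RY_def)
    \<comment> \<open>With \<open>a'\<close> in place, \<open>b'\<close> is opposite to
      \<open>u\<close> or \<open>v\<close> and replaces the other one; then \<open>c'\<close>
      replaces the remaining old vertex.\<close>
    have tail: "mdist Y z y' \<le> 2 * B"
      if uv: "u \<in> S" "v \<in> S" "X.far C x u v" "X.far R x a' u" "X.far R x a' v" and z: "z \<in> Z a' u v" for u v z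
    proof -
      have one: "mdist Y z y' \<le> 2 * B"
        if uv: "u \<in> S" "v \<in> S" "X.far C x u v" "X.far R x a' u" "X.far R x a' v" and z: "z \<in> Z a' u v"
          and b: "X.far R x b' v" for u v
      proof -
        have g1: "good a' u v" using uv S6 farR X.far_sym by (simp add: good_def)
        have g2: "good a' b' v" using uv S6 b X.far_sym farR[OF f'(1)] by (simp add: good_def)
        obtain z2 where z2: "z2 \<in> Z a' b' v" using Z_ne[OF g2] KZ by blast
        have "mdist Y z z2 \<le> B" by (rule step[OF g1 g2 z z2])
        moreover have "mdist Y z2 y' \<le> B"
        proof (rule step)
          show "good b' v a'" "good b' c' a'" using g2 good' by (auto simp: good_def)
          show "z2 \<in> Z b' v a'" "y' \<in> Z b' c' a'" using z2 yZ(2) Z_rot[of a' b' v] Z_rot[of a' b' c'] by auto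
        qed
        ultimately show ?thesis using mdist_triangle[of z Y z2 y'] ZY[OF z] ZY[OF z2] ZY[OF yZ(2)] by simp
      qed
      from ex[OF uv(1,2) S6(5) uv(3)] show ?thesis
      proof
        assume "X.far R x b' v" then show ?thesis by (rule one[OF uv z])
      next
        assume "X.far R x b' u"
        moreover have "z \<in> Z a' v u" using z Z_rot[of a' u v] Z_flip[of u v a'] Z_rot[of a' v u] Z_rot[of v u a'] by simp
        ultimately show ?thesis by (intro one[OF uv(2,1) X.far_sym[OF uv(3)] uv(5,4)])
      qed
    qed
    have total: "mdist Y y y' \<le> 3 * B"
      if uv: "u \<in> S" "v \<in> S" "X.far C x u v" "X.far R x a' u" "X.far R x a' v"
        and w: "good u w v" and y: "y \<in> Z u w v" for u v w
    proof -
      have g: "good u a' v" using uv S6 farR X.far_sym by (simp add: good_def)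
      obtain z where z: "z \<in> Z u a' v" using Z_ne[OF g] KZ by blast
      have "mdist Y y z \<le> B" by (rule step[OF w g y z])
      moreover have "mdist Y z y' \<le> 2 * B" by (rule tail[OF uv]) (use z Z_flip in simp)
      ultimately show ?thesis using mdist_triangle[of y Y z y'] ZY[OF y] ZY[OF z] ZY[OF yZ(2)] by simp
    qed
    \<comment> \<open>\<open>a'\<close> is opposite to one vertex of each pair among
      \<open>a\<close>, \<open>b\<close>, \<open>c\<close>, hence to two of the three vertices, and
      replaces the third.\<close>
    consider "X.far R x a' a" "X.far R x a' b" | "X.far R x a' b" "X.far R x a' c" | "X.far R x a' c" "X.far R x a' a"
      using ex[OF S6(1,2,4) f(1)] ex[OF S6(2,3,4) f(2)] ex[OF S6(3,1,4) f(3)] by blast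
    then show ?thesis
    proof cases
      case 1
      have "good b c a" using good0 by (simp add: good_def)
      moreover have "y \<in> Z b c a" using yZ(1) Z_rot[of a b c] by simp
      ultimately show ?thesis by (rule total[OF S6(2,1) X.far_sym[OF f(1)] 1(2,1)])
    next
      case 2
      have "good c a b" using good0 by (simp add: good_def)
      moreover have "y \<in> Z c a b" using yZ(1) Z_rot[of a b c] Z_rot[of b c a] by simp
      ultimately show ?thesis by (rule total[OF S6(3,2) X.far_sym[OF f(2)] 2(2,1)])
    next
      case 3
      show ?thesis by (rule total[OF S6(1,3) X.far_sym[OF f(3)] 3(2,1) good0 yZ(1)])
    qed
  qed
  then show ?thesis by (rule that)
qed

text \<open>The final clause keeps gauge and radii arbitrary, since \<open>f\<close> will be tested
  on triples other than those provided by \<open>dense_centers\<close>, such as triples containing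
  the ends of a given line.\<close>

lemma center_map:
  assumes ts: "two_stable X p Y q h" and qm: "quasi_moebius X p KX Y q KY h"
    and N0: "N0 \<in> morse_gauges" and dense: "dense_centers X p N0 C0"
  obtains f N' C' where "f \<in> mspace X \<rightarrow> mspace Y" "N' \<in> morse_gauges"
    "\<And>a b. morse_pair X p N0 a b \<Longrightarrow> morse_pair Y q N' (h a) (h b)"
    "\<And>x. x \<in> mspace X \<Longrightarrow> \<exists>a b c. [a, b, c] \<in> morse_tuples X p 3 N0 \<and> x \<in> centers X C0 a b c \<and>
       f x \<in> centers Y C' (h a) (h b) (h c)"
    "\<And>N C C''. N \<in> morse_gauges \<Longrightarrow> \<exists>B. \<forall>a b c x y. [a, b, c] \<in> morse_tuples X p 3 N \<longrightarrow> x \<in> centers X C a b c \<longrightarrow>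
       y \<in> centers Y C'' (h a) (h b) (h c) \<longrightarrow> mdist Y y (f x) \<le> B"
proof -
  obtain N' where N': "N' \<in> morse_gauges" and st: "\<And>a b. morse_pair X p N0 a b \<Longrightarrow> morse_pair Y q N' (h a) (h b)"
    using two_stable_pairs[OF ts N0] by metis
  have "\<exists>y. \<exists>a b c. [a, b, c] \<in> morse_tuples X p 3 N0 \<and> x \<in> centers X C0 a b c \<and>
       y \<in> centers Y (KY N') (h a) (h b) (h c)" if x: "x \<in> mspace X" for x
  proof -
    obtain a b c where t: "[a, b, c] \<in> morse_tuples X p 3 N0" "x \<in> centers X C0 a b c"
      using dense x unfolding dense_centers_def by blast
    have "[h a, h b, h c] \<in> morse_tuples Y q 3 N'" using t(1) st by (simp add: morse_triple_iff)
    from Y.center_exists(1)[OF N' this] t show ?thesis by blast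
  qed
  then obtain f where f: "\<And>x. x \<in> mspace X \<Longrightarrow> \<exists>a b c. [a, b, c] \<in> morse_tuples X p 3 N0 \<and> x \<in> centers X C0 a b c \<and>
       f x \<in> centers Y (KY N') (h a) (h b) (h c)" by metis
  have fY: "f \<in> mspace X \<rightarrow> mspace Y" using f by (fastforce simp: centers_iff)
  have bd: "\<exists>B. \<forall>a b c x y. [a, b, c] \<in> morse_tuples X p 3 N \<longrightarrow> x \<in> centers X C a b c \<longrightarrow>
       y \<in> centers Y C'' (h a) (h b) (h c) \<longrightarrow> mdist Y y (f x) \<le> B" if N: "N \<in> morse_gauges" for N C C''
  proof -
    obtain B where B: "\<And>a b c a' b' c' x y y'. [a, b, c] \<in> morse_tuples X p 3 N \<Longrightarrow> x \<in> centers X (max C C0) a b c \<Longrightarrow>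
     [a', b', c'] \<in> morse_tuples X p 3 N0 \<Longrightarrow> x \<in> centers X (max C C0) a' b' c' \<Longrightarrow>
     y \<in> centers Y (max C'' (KY N')) (h a) (h b) (h c) \<Longrightarrow> y' \<in> centers Y (max C'' (KY N')) (h a') (h b') (h c') \<Longrightarrow> mdist Y y y' \<le> B"
      using center_transfer[OF ts qm N N0] by metis
    have "mdist Y y (f x) \<le> B" if t: "[a, b, c] \<in> morse_tuples X p 3 N" "x \<in> centers X C a b c"
       "y \<in> centers Y C'' (h a) (h b) (h c)" for a b c x y
    proof -
      have "x \<in> mspace X" using t(2) by (simp add: centers_iff)
      then obtain a' b' c' where t': "[a', b', c'] \<in> morse_tuples X p 3 N0" "x \<in> centers X C0 a' b' c'"
        "f x \<in> centers Y (KY N') (h a') (h b') (h c')" using f by blast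
      note m = max.cobounded1 max.cobounded2
      show ?thesis
        by (rule B[OF t(1) subsetD[OF centers_mono[OF m(1)] t(2)] t'(1) subsetD[OF centers_mono[OF m(2)] t'(2)]
            subsetD[OF centers_mono[OF m(1)] t(3)] subsetD[OF centers_mono[OF m(2)] t'(3)]])
    qed
    then show ?thesis by blast
  qed
  from that[OF fY N' st f bd] show ?thesis .
qed

end

text \<open>A geodesic is cut into unit steps; the induction splits off the last one, and at most
  \<open>mdist X x x' + 1\<close> steps are needed.\<close>

lemma coarse_lipschitz:
  assumes X: "geodesic_space X" and f: "f \<in> mspace X \<rightarrow> mspace Y" and B: "B \<ge> 0"
    and step: "\<And>x x'. x \<in> mspace X \<Longrightarrow> x' \<in> mspace X \<Longrightarrow> mdist X x x' \<le> 1 \<Longrightarrow> mdist Y (f x) (f x') \<le> B"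
    and x: "x \<in> mspace X" "x' \<in> mspace X"
  shows "mdist Y (f x) (f x') \<le> B * mdist X x x' + B"
proof -
  have fY: "f z \<in> mspace Y" if "z \<in> mspace X" for z using f that by auto
  have ind: "mdist Y (f x) (f x') \<le> real n * B"
    if "x' \<in> mspace X" "mdist X x x' \<le> real n" for n x'
    using that
  proof (induction n arbitrary: x')
    case 0
    then have "mdist X x x' = 0" by (metis mdist_nonneg of_nat_0 order_antisym)
    then have "x = x'" using x(1) 0(1) by simp
    then show ?case using fY[OF x(1)] by simp
  next
    case (Suc n)
    show ?case
    proof (cases "mdist X x x' \<le> 1")
      case True
      have "1 * B \<le> real (Suc n) * B" using B by (intro mult_right_mono) auto
      then show ?thesis using step[OF x(1) Suc.prems(1) True] by simp
    next
      case False
      obtain l \<gamma> where g: "geodesic X {0..l} \<gamma>" "\<gamma> 0 = x" "\<gamma> l = x'"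
        using X x(1) Suc.prems(1) unfolding geodesic_space_def geodesic_segment_def by meson
      have l0: "0 \<le> l" using g(1) by (simp add: geodesic_def)
      have l: "mdist X x x' = l" using geodesic_dist[OF g(1), of 0 l] g l0 by auto
      define z where "z = \<gamma> (l - 1)"
      have z: "z \<in> mspace X" "mdist X x z = l - 1" "mdist X z x' = 1"
        using geodesic_in[OF g(1), of "l - 1"] geodesic_dist[OF g(1), of 0 "l - 1"] geodesic_dist[OF g(1), of "l - 1" l] g l False
        by (auto simp: z_def)
      have "mdist Y (f x) (f z) \<le> real n * B" by (rule Suc.IH[OF z(1)]) (use z l Suc.prems in simp)
      moreover have "mdist Y (f z) (f x') \<le> B" by (rule step[OF z(1) Suc.prems(1)]) (use z in simp)
      ultimately show ?thesis
        using mdist_triangle[OF fY[OF x(1)] fY[OF z(1)] fY[OF Suc.prems(1)]] by (simp add: algebra_simps)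
    qed
  qed
  define n where "n = nat \<lceil>mdist X x x'\<rceil>"
  have n: "mdist X x x' \<le> real n" "real n \<le> mdist X x x' + 1"
    using mdist_nonneg[of X x x'] unfolding n_def by linarith+
  have "real n * B \<le> (mdist X x x' + 1) * B" using n B by (intro mult_right_mono) auto
  then show ?thesis using ind[OF x(2) n(1)] by (simp add: algebra_simps)
qed

section \<open>Coarse properties of center maps\<close>

lemma near_line_shift:
  assumes "near_line X R x a b" "x \<in> mspace X" "x' \<in> mspace X" "mdist X x x' \<le> r"
  shows "near_line X (R + r) x' a b"
proof -
  obtain \<gamma> t where \<gamma>: "line_between X a b \<gamma>" "mdist X x (\<gamma> t) \<le> R" using assms(1) by (auto simp: near_line_def)
  have "\<gamma> t \<in> mspace X" using \<gamma>(1) geodesic_in[of X UNIV \<gamma> t] by (simp add: line_between_iff)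
  then have "mdist X x' (\<gamma> t) \<le> R + r"
    using mdist_triangle[of x' X x "\<gamma> t"] assms \<gamma>(2) by (simp add: mdist_commute)
  then show ?thesis using \<gamma>(1) unfolding near_line_def by blast
qed

lemma centers_shift:
  assumes "x \<in> centers X R a b c" "x' \<in> mspace X" "mdist X x x' \<le> r"
  shows "x' \<in> centers X (R + r) a b c"
  using assms unfolding centers_iff by (blast intro: near_line_shift)

definition is_center_map ::
    "'a metric \<Rightarrow> 'a \<Rightarrow> 'b metric \<Rightarrow> ('a bdpoint \<Rightarrow> 'b bdpoint) \<Rightarrow> gauge \<Rightarrow> real \<Rightarrow> real \<Rightarrow> ('a \<Rightarrow> 'b) \<Rightarrow> bool" where
  "is_center_map X p Y h N0 C0 C' f \<longleftrightarrow> f \<in> mspace X \<rightarrow> mspace Y \<and>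
     (\<forall>x\<in>mspace X. \<exists>a b c. [a, b, c] \<in> morse_tuples X p 3 N0 \<and> x \<in> centers X C0 a b c \<and>
       f x \<in> centers Y C' (h a) (h b) (h c)) \<and>
     (\<forall>N\<in>morse_gauges. \<forall>C C''. \<exists>B. \<forall>a b c x y. [a, b, c] \<in> morse_tuples X p 3 N \<longrightarrow> x \<in> centers X C a b c \<longrightarrow>
       y \<in> centers Y C'' (h a) (h b) (h c) \<longrightarrow> mdist Y y (f x) \<le> B)"

context morse_space_pair begin

lemma is_center_map_bound:
  assumes "is_center_map X p Y h N0 C0 C' f" "N \<in> morse_gauges"
  obtains B where "B \<ge> 0" "\<And>a b c x y. [a, b, c] \<in> morse_tuples X p 3 N \<Longrightarrow> x \<in> centers X C a b c \<Longrightarrow>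
       y \<in> centers Y C'' (h a) (h b) (h c) \<Longrightarrow> mdist Y y (f x) \<le> B"
proof -
  obtain B where "\<forall>a b c x y. [a, b, c] \<in> morse_tuples X p 3 N \<longrightarrow> x \<in> centers X C a b c \<longrightarrow>
       y \<in> centers Y C'' (h a) (h b) (h c) \<longrightarrow> mdist Y y (f x) \<le> B"
    using assms unfolding is_center_map_def by blast
  then show ?thesis by (intro that[of "max 0 B"]) (auto simp: le_max_iff_disj)
qed

lemma is_center_map_triple:
  assumes "is_center_map X p Y h N0 C0 C' f" "x \<in> mspace X"
  obtains a b c where "[a, b, c] \<in> morse_tuples X p 3 N0" "x \<in> centers X C0 a b c"
       "f x \<in> centers Y C' (h a) (h b) (h c)"
  using assms unfolding is_center_map_def by blast

text \<open>A triple with coarse center \<open>x\<close> also has the coarse center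
  \<open>x'\<close>, with radius \<open>C0 + 1\<close>, if \<open>x'\<close> is within distance 1.
  The bound for \<open>f x'\<close> then applies to \<open>f x\<close>, which is a center of the
  image of the same triple.\<close>

lemma is_center_map_lipschitz:
  assumes f: "is_center_map X p Y h N0 C0 C' f" and N0: "N0 \<in> morse_gauges"
  obtains B where "B \<ge> 0" "\<And>x x'. x \<in> mspace X \<Longrightarrow> x' \<in> mspace X \<Longrightarrow> mdist Y (f x) (f x') \<le> B * mdist X x x' + B"
proof -
  obtain B where B: "B \<ge> 0" "\<And>a b c x y. [a, b, c] \<in> morse_tuples X p 3 N0 \<Longrightarrow> x \<in> centers X (C0 + 1) a b c \<Longrightarrow>
       y \<in> centers Y C' (h a) (h b) (h c) \<Longrightarrow> mdist Y y (f x) \<le> B"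
    using is_center_map_bound[OF f N0] by metis
  have step: "mdist Y (f x) (f x') \<le> B" if x: "x \<in> mspace X" "x' \<in> mspace X" "mdist X x x' \<le> 1" for x x'
  proof -
    obtain a b c where t: "[a, b, c] \<in> morse_tuples X p 3 N0" "x \<in> centers X C0 a b c" "f x \<in> centers Y C' (h a) (h b) (h c)"
      by (rule is_center_map_triple[OF f x(1)])
    show ?thesis by (rule B(2)[OF t(1) centers_shift[OF t(2) x(2,3)] t(3)])
  qed
  have fY: "f \<in> mspace X \<rightarrow> mspace Y" using f by (simp add: is_center_map_def)
  show ?thesis by (rule that[OF B(1)]) (rule coarse_lipschitz[OF X.geodesic fY B(1) step])
qed

text \<open>Points of a line from \<open>u\<close> to \<open>b\<close> are coarse centers of triples \<open>u, b, w\<close>, so their images lie near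
  a line from \<open>h u\<close> to \<open>h b\<close>.\<close>

lemma center_map_line:
  assumes f: "is_center_map X p Y h N0 C0 C' f" and N0: "N0 \<in> morse_gauges" and ts: "two_stable X p Y q h"
    and u: "u \<in> morse_boundary X p" and b: "b \<in> morse_boundary X p" and ub: "u \<noteq> b"
    and \<gamma>: "line_between X u b \<gamma>" and \<eta>: "line_between Y (h u) (h b) \<eta>"
  shows "\<exists>R. range (\<lambda>t. f (\<gamma> t)) \<subseteq> nbhd Y R (range \<eta>)"
proof -
  obtain N where N: "N \<in> morse_gauges" "morse_pair X p N u b" by (rule X.exists_pair_gauge[OF u b ub])
  \<comment> \<open>One radius for both the line, on which \<open>x\<close> lies exactly, and the
    triple around \<open>x\<close>.\<close>
  define C where "C = max 0 C0"
  define D where "D = (\<lambda>L e. max (morse_bound N L e) (morse_bound N0 L e))"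
  obtain N2 R where N2: "N2 \<in> morse_gauges" and RC: "R \<ge> C"
    and pair2': "\<forall>a\<in>morse_boundary X p. \<forall>b\<in>morse_boundary X p. \<forall>x\<in>mspace X. a \<noteq> b \<longrightarrow>
      radial X D C x a \<longrightarrow> radial X D C x b \<longrightarrow> morse_pair X p N2 a b"
    and exch': "\<forall>a\<in>morse_boundary X p. \<forall>b\<in>morse_boundary X p. \<forall>d\<in>morse_boundary X p. \<forall>x\<in>mspace X.
      radial X D C x a \<longrightarrow> radial X D C x b \<longrightarrow> radial X D C x d \<longrightarrow> X.far C x a b \<longrightarrow> X.far R x d a \<or> X.far R x d b"
    by (rule X.far_exchange[of C D])
  note pair2 = pair2'[rule_format] and exch = exch'[rule_format]
  obtain N' where N': "N' \<in> morse_gauges" and st: "\<And>a b. morse_pair X p N2 a b \<Longrightarrow> morse_pair Y q N' (h a) (h b)"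
    using two_stable_pairs[OF ts N2] by metis
  obtain B where B: "\<And>a b c x y. [a, b, c] \<in> morse_tuples X p 3 N2 \<Longrightarrow> x \<in> centers X R a b c \<Longrightarrow>
       y \<in> centers Y (KY N') (h a) (h b) (h c) \<Longrightarrow> mdist Y y (f x) \<le> B"
    using is_center_map_bound[OF f N2] by metis
  have "f (\<gamma> t) \<in> nbhd Y (B + (KY N' + morse_bound N' 9 2)) (range \<eta>)" for t
  proof -
    define x where "x = \<gamma> t"
    have xX: "x \<in> mspace X" unfolding x_def by (rule X.line_in[OF \<gamma>])
    have "mdist X x (\<gamma> t) \<le> 0" using xX by (simp add: x_def)
    then have ub0: "near_line X 0 x u b" using \<gamma> unfolding near_line_def by blast
    obtain w1 w2 w3 where w: "[w1, w2, w3] \<in> morse_tuples X p 3 N0" "x \<in> centers X C0 w1 w2 w3"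
      by (rule is_center_map_triple[OF f xX])
    have wC: "x \<in> centers X C w1 w2 w3" using w(2) centers_mono[of C0 C X w1 w2 w3] by (auto simp: C_def)
    have ubC: "near_line X C x u b" by (rule near_line_mono[OF ub0]) (simp add: C_def)
    have ru: "radial X D C x u" "radial X D C x b"
      by (rule radial_mono[OF X.near_line_radial(1)[OF N(2) ubC]] radial_mono[OF X.near_line_radial(2)[OF N(2) ubC]]; simp add: D_def)+
    have rw: "radial X D C x v" "v \<in> morse_boundary X p" if v: "v \<in> {w1, w2, w3}" for v
      using X.center_radial(2)[OF w(1) wC v]
      by (auto intro: radial_mono[OF X.center_radial(1)[OF w(1) wC v]] simp: D_def)
    note fw = X.center_far[OF w(1) wC]
    have m: "w1 \<in> {w1, w2, w3}" "w2 \<in> {w1, w2, w3}" "w3 \<in> {w1, w2, w3}" by auto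
    have two: "(X.far R x v w1 \<or> X.far R x v w2) \<and> (X.far R x v w2 \<or> X.far R x v w3) \<and> (X.far R x v w3 \<or> X.far R x v w1)"
      if v: "v \<in> morse_boundary X p" "radial X D C x v" for v
      using exch[OF rw(2)[OF m(1)] rw(2)[OF m(2)] v(1) xX rw(1)[OF m(1)] rw(1)[OF m(2)] v(2) fw(1)]
        exch[OF rw(2)[OF m(2)] rw(2)[OF m(3)] v(1) xX rw(1)[OF m(2)] rw(1)[OF m(3)] v(2) fw(2)]
        exch[OF rw(2)[OF m(3)] rw(2)[OF m(1)] v(1) xX rw(1)[OF m(3)] rw(1)[OF m(1)] v(2) fw(3)] by blast
    \<comment> \<open>At least two of the three vertices are opposite to \<open>u\<close> and at
      least two are opposite to \<open>b\<close>, so some vertex is opposite to both.\<close>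
    obtain v where v: "v \<in> {w1, w2, w3}" "X.far R x u v" "X.far R x b v"
      using two[OF u ru(1)] two[OF b ru(2)] by blast
    have dist: "u \<noteq> v" "b \<noteq> v" using v by (auto simp only: X.far_def)
    have t3: "[u, b, v] \<in> morse_tuples X p 3 N2"
      unfolding morse_triple_iff
      using pair2[OF u b xX ub ru] pair2[OF b rw(2)[OF v(1)] xX dist(2) ru(2) rw(1)[OF v(1)]]
        morse_pair_sym[OF pair2[OF u rw(2)[OF v(1)] xX dist(1) ru(1) rw(1)[OF v(1)]]] by blast
    have c3: "x \<in> centers X R u b v"
      unfolding centers_iff using v xX near_line_mono[OF ubC RC] near_line_sym[of X R x u v] unfolding X.far_def by blast
    have pr: "morse_pair Y q N' (h u) (h b)" and t3': "[h u, h b, h v] \<in> morse_tuples Y q 3 N'"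
      using t3 st by (simp_all add: morse_triple_iff)
    obtain y where y: "y \<in> centers Y (KY N') (h u) (h b) (h v)" using Y.center_exists(1)[OF N' t3'] by blast
    have yY: "y \<in> mspace Y" "near_line Y (KY N') y (h u) (h b)" using y by (simp_all add: centers_iff)
    obtain s where s: "mdist Y y (\<eta> s) \<le> KY N' + morse_bound N' 9 2"
      using Y.near_every_line[OF pr \<eta> yY(2,1)] by blast
    have fx: "f x \<in> mspace Y" using f xX by (auto simp: is_center_map_def)
    have "mdist Y (f x) (\<eta> s) \<le> B + (KY N' + morse_bound N' 9 2)"
      using mdist_triangle[OF fx yY(1) Y.line_in[OF \<eta>, of s]] B[OF t3 c3 y] s by (simp add: mdist_commute)
    then show ?thesis using fx unfolding x_def by (intro nbhdI) auto
  qed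
  then show ?thesis by blast
qed

text \<open>Nearness to the line from \<open>h u\<close> to \<open>h b\<close> leaves open in which
  direction it is followed, hence the alternative.\<close>

lemma center_map_heads_to:
  assumes f: "is_center_map X p Y h N0 C0 C' f" and N0: "N0 \<in> morse_gauges" and ts: "two_stable X p Y q h"
    and qi: "qi_embedding L e X Y f" and h: "bij_betw h (morse_boundary X p) (morse_boundary Y q)"
    and u: "u \<in> morse_boundary X p" and b: "b \<in> morse_boundary X p" and ub: "u \<noteq> b" and \<beta>: "\<beta> \<in> b"
  shows "heads_to Y (h b) (f ` \<beta> ` {0..}) \<or> heads_to Y (h u) (f ` \<beta> ` {0..})"
proof -
  have hm: "h u \<in> morse_boundary Y q" "h b \<in> morse_boundary Y q" "h u \<noteq> h b"
    using h u b ub by (auto simp: bij_betw_def inj_on_def)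
  obtain \<gamma> where \<gamma>: "line_between X u b \<gamma>" using morse_line_exists[OF X.geodesic X.proper u b ub] by blast
  obtain \<eta> where \<eta>: "line_between Y (h u) (h b) \<eta>" using morse_line_exists[OF Y.geodesic Y.proper hm] by blast
  obtain R where R: "range (\<lambda>t. f (\<gamma> t)) \<subseteq> nbhd Y R (range \<eta>)" using center_map_line[OF f N0 ts u b ub \<gamma> \<eta>] by blast
  have q: "qgeo Y L e {0..} (\<lambda>t. f (\<gamma> t))"
    by (rule qgeo_mono[OF qi_embedding_geodesic[OF qi X.line_geodesic[OF \<gamma>]]]) (use qi in \<open>auto simp: qi_embedding_def\<close>)
  have near: "(\<lambda>t. f (\<gamma> t)) ` {0..} \<subseteq> nbhd Y R (range \<eta>)" using R by auto
  have "heads_to X b (\<gamma> ` {0..})" using \<gamma> by (simp add: line_between_iff)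
  then have "finite_hausdorff_dist X (\<gamma> ` {0..}) (\<beta> ` {0..})"
    by (rule heads_to_unique_set[OF morse_boundary_visual[OF b] _ heads_to_ray[OF morse_boundary_visual[OF b] \<beta>]])
  from fhd_qi_image[OF qi this] have 1: "finite_hausdorff_dist Y ((\<lambda>t. f (\<gamma> t)) ` {0..}) (f ` \<beta> ` {0..})"
    by (simp add: image_image)
  have e: "heads_to Y (h b) (\<eta> ` {0..})" "heads_to Y (h u) (\<eta> ` {..0})" using \<eta> by (auto simp: line_between_iff)
  from qgeo_ray_near_line[OF q Y.line_geodesic[OF \<eta>] near] show ?thesis
  proof
    assume "finite_hausdorff_dist Y ((\<lambda>t. f (\<gamma> t)) ` {0..}) (\<eta> ` {0..})"
    from heads_to_fhd[OF e(1) fhd_trans[OF fhd_sym[OF this] 1]] show ?thesis by blast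
  next
    assume "finite_hausdorff_dist Y ((\<lambda>t. f (\<gamma> t)) ` {0..}) (\<eta> ` {..0})"
    from heads_to_fhd[OF e(2) fhd_trans[OF fhd_sym[OF this] 1]] show ?thesis by blast
  qed
qed

text \<open>The triple behind \<open>f x\<close> is used a second time: its image has the coarse
  center \<open>f x\<close>, and \<open>k\<close> maps the image back to the triple itself, of which
  \<open>x\<close> is a center. So \<open>x\<close> is an admissible value for \<open>g\<close> at
  \<open>f x\<close>.\<close>

lemma quasi_inverse_center_maps:
  assumes f: "is_center_map X p Y h N0 C0 C' f"
    and g: "is_center_map Y q X k M0 E0 E' g" and N': "N' \<in> morse_gauges"
    and st: "\<And>a b. morse_pair X p N0 a b \<Longrightarrow> morse_pair Y q N' (h a) (h b)"
    and kh: "\<And>a. a \<in> morse_boundary X p \<Longrightarrow> k (h a) = a"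
  shows "\<exists>B. \<forall>x\<in>mspace X. mdist X x (g (f x)) \<le> B"
proof -
  interpret YX: morse_space_pair Y q KY X p KX ..
  obtain B where B: "\<And>a b c x y. [a, b, c] \<in> morse_tuples Y q 3 N' \<Longrightarrow> x \<in> centers Y C' a b c \<Longrightarrow>
       y \<in> centers X C0 (k a) (k b) (k c) \<Longrightarrow> mdist X y (g x) \<le> B"
    using YX.is_center_map_bound[OF g N'] by metis
  have "mdist X x (g (f x)) \<le> B" if x: "x \<in> mspace X" for x
  proof -
    obtain a b c where t: "[a, b, c] \<in> morse_tuples X p 3 N0" "x \<in> centers X C0 a b c" "f x \<in> centers Y C' (h a) (h b) (h c)"
      by (rule is_center_map_triple[OF f x])
    have ht: "[h a, h b, h c] \<in> morse_tuples Y q 3 N'" using t(1) st by (simp add: morse_triple_iff)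
    have "x \<in> centers X C0 (k (h a)) (k (h b)) (k (h c))" using t(1,2) kh by (simp add: morse_tuples_def)
    from B[OF ht t(3) this] show ?thesis .
  qed
  then show ?thesis by blast
qed

lemma quasi_isometry_of_center_maps:
  assumes f: "f \<in> mspace X \<rightarrow> mspace Y" and g: "g \<in> mspace Y \<rightarrow> mspace X"
    and fl: "A \<ge> 0" "\<And>x x'. x \<in> mspace X \<Longrightarrow> x' \<in> mspace X \<Longrightarrow> mdist Y (f x) (f x') \<le> A * mdist X x x' + A"
    and gl: "B \<ge> 0" "\<And>y y'. y \<in> mspace Y \<Longrightarrow> y' \<in> mspace Y \<Longrightarrow> mdist X (g y) (g y') \<le> B * mdist Y y y' + B"
    and gf: "\<And>x. x \<in> mspace X \<Longrightarrow> mdist X x (g (f x)) \<le> D" and fg: "\<And>y. y \<in> mspace Y \<Longrightarrow> mdist Y y (f (g y)) \<le> D"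
    and D: "D \<ge> 0"
  shows "\<exists>L e. quasi_isometry_with L e D X Y f"
proof -
  define L where "L = 1 + A + B"
  define e where "e = A + B + 2 * D"
  have "qi_embedding L e X Y f"
    unfolding qi_embedding_def
  proof (intro conjI ballI)
    show "1 \<le> L" "0 \<le> e" using fl gl D by (auto simp: L_def e_def)
    show "f \<in> mspace X \<rightarrow> mspace Y" by fact
    fix x x' assume x: "x \<in> mspace X" "x' \<in> mspace X"
    have Y: "f x \<in> mspace Y" "f x' \<in> mspace Y" using f x by auto
    have G: "g (f x) \<in> mspace X" "g (f x') \<in> mspace X" using g Y by auto
    have "A * mdist X x x' \<le> L * mdist X x x'" using gl by (intro mult_right_mono) (auto simp: L_def)
    then show "mdist Y (f x) (f x') \<le> L * mdist X x x' + e" using fl(2)[OF x] gl(1) D by (simp add: e_def)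
    have "mdist X x x' \<le> 2 * D + mdist X (g (f x)) (g (f x'))"
      using mdist_triangle[OF x(1) G(1) x(2)] mdist_triangle[OF G(1,2) x(2)] gf[OF x(1)] gf[OF x(2)]
      by (simp add: mdist_commute)
    also have "\<dots> \<le> B * mdist Y (f x) (f x') + (B + 2 * D)" using gl(2)[OF Y] by simp
    also have "B * mdist Y (f x) (f x') \<le> L * mdist Y (f x) (f x')" using fl by (intro mult_right_mono) (auto simp: L_def)
    also have "B + 2 * D \<le> L * e"
    proof -
      have "1 * e \<le> L * e" using fl gl D by (intro mult_right_mono) (auto simp: L_def e_def)
      then show ?thesis using fl by (simp add: e_def)
    qed
    finally have "mdist X x x' \<le> L * (mdist Y (f x) (f x') + e)" by (simp add: algebra_simps)
    then show "1 / L * mdist X x x' - e \<le> mdist Y (f x) (f x')" using fl gl by (simp add: field_simps L_def)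
  qed
  then show ?thesis unfolding quasi_isometry_with_def using g gf fg D by (metis mdist_commute)
qed

lemma quasi_moebius_induced:
  assumes h: "bij_betw h (morse_boundary X p) (morse_boundary Y q)"
    and k: "k = inv_into (morse_boundary X p) h"
    and ts: "two_stable X p Y q h" "two_stable Y q X p k"
    and qm: "quasi_moebius X p KX Y q KY h" "quasi_moebius Y q KY X p KX k"
    and dX: "NX \<in> morse_gauges" "dense_centers X p NX CX" and dY: "NY \<in> morse_gauges" "dense_centers Y q NY CY"
    and three: "\<exists>A\<subseteq>morse_boundary X p. card A = 3"
  shows "\<exists>f. quasi_isometry X Y f \<and> induced_by X p Y q h f"
proof -
  interpret YX: morse_space_pair Y q KY X p KX ..
  have kh: "k (h a) = a" if "a \<in> morse_boundary X p" for a
    using h that unfolding k bij_betw_def by (simp add: inv_into_f_f)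
  have hk: "h (k a) = a" if "a \<in> morse_boundary Y q" for a
    using h that unfolding k bij_betw_def by (simp add: f_inv_into_f)
  obtain f N' C' where f0: "is_center_map X p Y h NX CX C' f" and N': "N' \<in> morse_gauges"
    and st: "\<And>a b. morse_pair X p NX a b \<Longrightarrow> morse_pair Y q N' (h a) (h b)"
    using center_map[OF ts(1) qm(1) dX] unfolding is_center_map_def by metis
  obtain g M' E' where g0: "is_center_map Y q X k NY CY E' g" and M': "M' \<in> morse_gauges"
    and st': "\<And>a b. morse_pair Y q NY a b \<Longrightarrow> morse_pair X p M' (k a) (k b)"
    using YX.center_map[OF ts(2) qm(2) dY] unfolding is_center_map_def by metis
  obtain D1 where D1: "\<And>x. x \<in> mspace X \<Longrightarrow> mdist X x (g (f x)) \<le> D1"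
    using quasi_inverse_center_maps[OF f0 g0 N' st kh] by blast
  obtain D2 where D2: "\<And>y. y \<in> mspace Y \<Longrightarrow> mdist Y y (f (g y)) \<le> D2"
    using YX.quasi_inverse_center_maps[OF g0 f0 M' st' hk] by blast
  define D where "D = max 0 (max D1 D2)"
  obtain A where A: "A \<ge> 0" "\<And>x x'. x \<in> mspace X \<Longrightarrow> x' \<in> mspace X \<Longrightarrow> mdist Y (f x) (f x') \<le> A * mdist X x x' + A"
    using is_center_map_lipschitz[OF f0 dX(1)] by metis
  obtain B where B: "B \<ge> 0" "\<And>y y'. y \<in> mspace Y \<Longrightarrow> y' \<in> mspace Y \<Longrightarrow> mdist X (g y) (g y') \<le> B * mdist Y y y' + B"
    using YX.is_center_map_lipschitz[OF g0 dY(1)] by metis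
  have fY: "f \<in> mspace X \<rightarrow> mspace Y" "g \<in> mspace Y \<rightarrow> mspace X"
    using f0 g0 by (simp_all add: is_center_map_def is_center_map_def)
  have "mdist X x (g (f x)) \<le> D" if "x \<in> mspace X" for x using D1[OF that] by (simp add: D_def)
  moreover have "mdist Y y (f (g y)) \<le> D" if "y \<in> mspace Y" for y using D2[OF that] by (simp add: D_def)
  ultimately obtain L e where qi: "quasi_isometry_with L e D X Y f"
    using quasi_isometry_of_center_maps[OF fY A B, of D] by (auto simp: D_def)
  then have emb: "qi_embedding L e X Y f" by (simp add: quasi_isometry_with_def)
  have heads: "heads_to Y (h b) (f ` \<beta> ` {0..})" if b: "b \<in> morse_boundary X p" "\<beta> \<in> b" for b \<beta>
  proof -
    obtain T where T: "T \<subseteq> morse_boundary X p" "card T = 3" using three by blast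
    have "card (T - {b}) \<ge> 2" using T(2) card_Diff1_le[of T b] by (cases "b \<in> T") auto
    then obtain u v where uv: "u \<in> T - {b}" "v \<in> T - {b}" "u \<noteq> v"
      by (meson card_2_iff' ex_card obtain_subset_with_card_n subset_iff)
    have m: "u \<in> morse_boundary X p" "v \<in> morse_boundary X p" "u \<noteq> b" "v \<noteq> b" using uv T by auto
    show ?thesis
    proof (rule ccontr)
      assume "\<not> ?thesis"
      then have "heads_to Y (h u) (f ` \<beta> ` {0..})" "heads_to Y (h v) (f ` \<beta> ` {0..})"
        using center_map_heads_to[OF f0 dX(1) ts(1) emb h m(1) b(1) m(3) b(2)]
          center_map_heads_to[OF f0 dX(1) ts(1) emb h m(2) b(1) m(4) b(2)] by blast+
      moreover have "h u \<in> morse_boundary Y q" "h v \<in> morse_boundary Y q" using h m by (auto simp: bij_betw_def)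
      ultimately have "h u = h v"
        by (intro heads_to_unique_point[OF morse_boundary_visual morse_boundary_visual])
      then show False using kh[OF m(1)] kh[OF m(2)] uv(3) by simp
    qed
  qed
  have "induced_by X p Y q h f"
    unfolding induced_by_def
  proof
    fix b assume b: "b \<in> morse_boundary X p"
    have hb: "h b \<in> visual_boundary Y q" using h b by (auto simp: bij_betw_def intro: morse_boundary_visual)
    obtain \<beta> where \<beta>: "\<beta> \<in> b" using visual_boundary_nonempty[OF morse_boundary_visual[OF b]] by blast
    show "h b = induced_map X Y q f b"
      unfolding induced_map_def
    proof (rule subset_antisym; rule subsetI)
      fix \<eta> assume \<eta>: "\<eta> \<in> h b"
      have "\<exists>\<gamma>\<in>b. finite_hausdorff_dist Y (\<eta> ` {0..}) (f ` \<gamma> ` {0..})"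
        using heads_to_unique_set[OF hb heads_to_ray[OF hb \<eta>] heads[OF b \<beta>]] \<beta> by blast
      then show "\<eta> \<in> {\<eta> \<in> rays Y q. \<exists>\<gamma>\<in>b. finite_hausdorff_dist Y (\<eta> ` {0..}) (f ` \<gamma> ` {0..})}"
        using visual_boundary_mem(1)[OF hb \<eta>] by blast
    next
      fix \<eta> assume "\<eta> \<in> {\<eta> \<in> rays Y q. \<exists>\<gamma>\<in>b. finite_hausdorff_dist Y (\<eta> ` {0..}) (f ` \<gamma> ` {0..})}"
      then obtain \<gamma> where \<gamma>: "\<eta> \<in> rays Y q" "\<gamma> \<in> b" "finite_hausdorff_dist Y (\<eta> ` {0..}) (f ` \<gamma> ` {0..})" by blast
      from heads_to_mem[OF hb heads_to_fhd[OF heads[OF b \<gamma>(2)] fhd_sym[OF \<gamma>(3)]] \<gamma>(1)] show "\<eta> \<in> h b" .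
    qed
  qed
  then show ?thesis using qi unfolding quasi_isometry_def by blast
qed

lemma induced_quasi_moebius:
  assumes h: "bij_betw h (morse_boundary X p) (morse_boundary Y q)"
    and k: "k = inv_into (morse_boundary X p) h"
    and f: "quasi_isometry X Y f" and ind: "induced_by X p Y q h f"
  shows "two_stable X p Y q h \<and> quasi_moebius X p KX Y q KY h \<and> two_stable Y q X p k \<and> quasi_moebius Y q KY X p KX k"
proof -
  interpret YX: morse_space_pair Y q KY X p KX ..
  obtain L e D where qi: "quasi_isometry_with L e D X Y f" using f by (auto simp: quasi_isometry_def)
  then have emb: "qi_embedding L e X Y f" by (simp add: quasi_isometry_with_def)
  obtain f' L' e' where f': "qi_embedding L' e' Y X f'" and ff: "\<And>x. x \<in> mspace X \<Longrightarrow> mdist X (f' (f x)) x \<le> D"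
    "\<And>y. y \<in> mspace Y \<Longrightarrow> mdist Y (f (f' y)) y \<le> D"
    using qi_quasi_inverse[OF qi] by metis
  have hX: "h ` morse_boundary X p \<subseteq> morse_boundary Y q" and inj: "inj_on h (morse_boundary X p)"
    using h by (auto simp: bij_betw_def)
  have k': "bij_betw k (morse_boundary Y q) (morse_boundary X p)" unfolding k by (rule bij_betw_inv_into[OF h])
  have kX: "k ` morse_boundary Y q \<subseteq> morse_boundary X p" and kinj: "inj_on k (morse_boundary Y q)"
    using k' by (auto simp: bij_betw_def)
  have tr: "tracks X p Y h f" by (rule induced_by_tracks[OF emb ind hX])
  have tr': "tracks Y q X k f'" unfolding k by (rule tracks_inverse[OF emb f' ff(1) tr h])
  show ?thesis
    using tracks_two_stable[OF emb f' ff(1) tr hX inj] tracks_quasi_moebius[OF emb tr hX]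
      YX.tracks_two_stable[OF f' emb ff(2) tr' kX kinj] YX.tracks_quasi_moebius[OF f' tr' kX] by blast
qed

end

section \<open>Cayley graphs\<close>

definition lipschitz_path :: "'a metric \<Rightarrow> real \<Rightarrow> (real \<Rightarrow> 'a) \<Rightarrow> bool" where
  "lipschitz_path X l c \<longleftrightarrow> 0 \<le> l \<and> c ` {0..l} \<subseteq> mspace X \<and>
     (\<forall>s\<in>{0..l}. \<forall>t\<in>{0..l}. mdist X (c s) (c t) \<le> \<bar>s - t\<bar>)"

text \<open>Nearly shortest 1-Lipschitz paths from \<open>x\<close> to \<open>y\<close> have a
  pointwise cluster point that is again 1-Lipschitz and reaches \<open>y\<close> at time
  \<open>d\<close>. Since \<open>d\<close> is the distance from \<open>x\<close> to
  \<open>y\<close>, it must be a geodesic.\<close>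

lemma proper_length_space_geodesic:
  assumes X: "proper_space X"
    and length: "\<And>x y \<epsilon>. x \<in> mspace X \<Longrightarrow> y \<in> mspace X \<Longrightarrow> \<epsilon> > 0 \<Longrightarrow>
      \<exists>l c. lipschitz_path X l c \<and> c 0 = x \<and> c l = y \<and> l < mdist X x y + \<epsilon>"
  shows "geodesic_space X"
  unfolding geodesic_space_def
proof (intro ballI)
  fix x y assume x: "x \<in> mspace X" and y: "y \<in> mspace X"
  define d where "d = mdist X x y"
  have "\<forall>n. \<exists>l c. lipschitz_path X l c \<and> c 0 = x \<and> c l = y \<and> l < d + 1 / (real n + 1)"
    using length[OF x y] by (simp add: d_def)
  then obtain l c where c: "\<And>n. lipschitz_path X (l n) (c n)" "\<And>n. c n 0 = x" "\<And>n. c n (l n) = y"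
    "\<And>n. l n < d + 1 / (real n + 1)" by metis
  \<comment> \<open>Clamping the parameter extends all paths to the whole real line, as their
    lengths \<open>l n\<close> differ.\<close>
  define k where "k = (\<lambda>n t. max 0 (min (l n) t))"
  define c' where "c' = (\<lambda>n t. c n (k n t))"
  have l0: "0 \<le> l n" for n using c(1)[of n] by (simp add: lipschitz_path_def)
  have k: "k n t \<in> {0..l n}" for n t using l0[of n] by (auto simp: k_def)
  have lip: "mdist X (c' n s) (c' n t) \<le> \<bar>s - t\<bar>" for n s t
  proof -
    have "mdist X (c' n s) (c' n t) \<le> \<bar>k n s - k n t\<bar>"
      using c(1)[of n] k unfolding lipschitz_path_def c'_def by blast
    also have "\<dots> \<le> \<bar>s - t\<bar>" by (auto simp: k_def)
    finally show ?thesis .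
  qed
  have c'X: "c' n t \<in> mspace X" for n t
    using c(1)[of n] k unfolding lipschitz_path_def c'_def by blast
  have c'0: "c' n 0 = x" for n using c(2)[of n] l0[of n] by (simp add: c'_def k_def)
  define B where "B = (\<lambda>t. mcball_of X x \<bar>t :: real\<bar>)"
  have B: "compactin (mtopology_of X) (B t)" for t using X x by (simp add: proper_space_def B_def)
  have "c' n t \<in> B t" for n t using lip[of n 0 t] c'0[of n] c'X[of n t] x by (simp add: B_def)
  then obtain \<gamma> where \<gamma>: "\<And>t. \<gamma> t \<in> B t"
    "\<And>F \<epsilon> n. finite F \<Longrightarrow> \<epsilon> > 0 \<Longrightarrow> \<exists>m\<ge>n. \<forall>t\<in>F. mdist X (\<gamma> t) (c' m t) < \<epsilon>"
    using cluster_function[of X B c', OF B] by metis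
  have \<gamma>X: "\<gamma> t \<in> mspace X" for t using \<gamma>(1)[of t] by (auto simp: B_def)
  have \<gamma>lip: "mdist X (\<gamma> s) (\<gamma> t) \<le> \<bar>s - t\<bar>" for s t
  proof (rule field_le_epsilon)
    fix \<epsilon> :: real assume "\<epsilon> > 0"
    then obtain m where "\<forall>u\<in>{s, t}. mdist X (\<gamma> u) (c' m u) < \<epsilon> / 2" using \<gamma>(2)[of "{s, t}" "\<epsilon> / 2" 0] by auto
    then show "mdist X (\<gamma> s) (\<gamma> t) \<le> \<bar>s - t\<bar> + \<epsilon>"
      using mdist_triangle[of "\<gamma> s" X "c' m s" "\<gamma> t"] mdist_triangle[of "c' m s" X "c' m t" "\<gamma> t"] lip[of m s t] \<gamma>X c'X
      by (simp add: mdist_commute)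
  qed
  have "mdist X x (\<gamma> 0) = 0" using \<gamma>(1)[of 0] mdist_nonneg[of X x "\<gamma> 0"] by (simp add: B_def)
  then have \<gamma>0: "\<gamma> 0 = x" using x \<gamma>X[of 0] by simp
  have "mdist X (\<gamma> d) y \<le> 0"
  proof (rule field_le_epsilon)
    fix \<epsilon> :: real assume e: "\<epsilon> > 0"
    obtain n :: nat where n: "2 / \<epsilon> < real n" using reals_Archimedean2 by blast
    obtain m where m: "m \<ge> n" "mdist X (\<gamma> d) (c' m d) < \<epsilon> / 2" using \<gamma>(2)[of "{d}" "\<epsilon> / 2" n] e by auto
    have "1 / (real m + 1) \<le> \<epsilon> / 2"
    proof -
      have "2 / \<epsilon> \<le> real m + 1" using n m(1) by linarith
      then show ?thesis using e by (simp add: field_simps)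
    qed
    moreover have "mdist X (c' m d) (c' m (l m)) \<le> \<bar>d - l m\<bar>" by (rule lip)
    moreover have e': "c' m (l m) = y" using c(3)[of m] l0[of m] by (simp add: c'_def k_def)
    moreover have "d \<le> l m" using lip[of m 0 "l m"] c'0[of m] e' l0[of m] by (simp add: d_def)
    ultimately show "mdist X (\<gamma> d) y \<le> 0 + \<epsilon>"
      using mdist_triangle[of "\<gamma> d" X "c' m d" y] \<gamma>X c'X y m(2) c(4)[of m] by simp
  qed
  then have "mdist X (\<gamma> d) y = 0" using mdist_nonneg[of X "\<gamma> d" y] by linarith
  then have \<gamma>d: "\<gamma> d = y" using y \<gamma>X[of d] by simp
  have d0: "d \<ge> 0" by (simp add: d_def)
  \<comment> \<open>The three upper bounds \<open>s\<close>, \<open>t - s\<close> and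
    \<open>d - t\<close> add up to \<open>d\<close>, so none of them can be strict.\<close>
  have "mdist X (\<gamma> s) (\<gamma> t) = \<bar>s - t\<bar>" if st: "s \<in> {0..d}" "t \<in> {0..d}" "s \<le> t" for s t
    using mdist_triangle[OF x \<gamma>X[of s] y] mdist_triangle[OF \<gamma>X[of s] \<gamma>X[of t] y] \<gamma>lip[of 0 s] \<gamma>lip[of s t] \<gamma>lip[of t d]
      \<gamma>0 \<gamma>d st by (simp add: d_def)
  then have "mdist X (\<gamma> s) (\<gamma> t) = \<bar>s - t\<bar>" if "s \<in> {0..d}" "t \<in> {0..d}" for s t
    using that by (metis abs_minus_commute mdist_commute nle_le)
  then have "geodesic X {0..d} \<gamma>" using d0 \<gamma>X by (auto simp: geodesic_def)
  then show "\<exists>A. geodesic_segment X x y A" unfolding geodesic_segment_def using \<gamma>0 \<gamma>d by blast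
qed

context group begin

section \<open>Cayley graphs as length spaces\<close>

lemma cayley_dist_le:
  assumes "finite_generating_set G S" "cayley_path G S x y l"
  shows "mdist (cayley_graph G S) x y \<le> l"
proof -
  have "bdd_below {l. cayley_path G S x y l}"
    using cayley_path_points[of G S] by (intro bdd_belowI[of _ 0]) auto
  then have "Inf {l. cayley_path G S x y l} \<le> l" using assms(2) by (intro cInf_lower) auto
  then show ?thesis
    using cayley_path_points[OF assms(2)] by (simp add: cayley_graph_simps[OF assms(1)] cayley_dist_def)
qed

lemma cayley_path_near:
  assumes S: "finite_generating_set G S" and x: "x \<in> cayley_points G S" "y \<in> cayley_points G S" and e: "\<epsilon> > 0"
  shows "\<exists>l. cayley_path G S x y l \<and> l < mdist (cayley_graph G S) x y + \<epsilon>"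
proof -
  have ne: "{l. cayley_path G S x y l} \<noteq> {}" using cayley_path_exists[OF S x] by auto
  have lt: "Inf {l. cayley_path G S x y l} < mdist (cayley_graph G S) x y + \<epsilon>"
    using x e by (simp add: cayley_graph_simps[OF S] cayley_dist_def)
  show ?thesis using cInf_lessD[OF ne lt] by auto
qed

lemma edge_point_pos: "edge_point g h t v > 0 \<Longrightarrow> v = g \<or> v = h"
  by (rule ccontr) (simp add: edge_point_def)

lemma edge_point_cayley:
  "g \<in> carrier G \<Longrightarrow> s \<in> S \<Longrightarrow> t \<in> {0..1} \<Longrightarrow> edge_point g (g \<otimes> s) t \<in> cayley_points G S"
  by (auto simp: cayley_points_def)

lemma vertex_cayley: "g \<in> carrier G \<Longrightarrow> edge_point g g 0 \<in> cayley_points G S"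
  by (auto simp: cayley_points_def)

text \<open>Parametrized by length, a chain of edge segments is 1-Lipschitz for the graph distance;
  together with \<open>cayley_path_near\<close> this makes the Cayley graph a length space.\<close>

lemma cayley_lipschitz_path:
  assumes S: "finite_generating_set G S" and p: "cayley_path G S x y l"
  shows "\<exists>c. lipschitz_path (cayley_graph G S) l c \<and> c 0 = x \<and> c l = y"
  using p
proof (induction rule: cayley_path.induct)
  case (refl x)
  then show ?case
    by (intro exI[of _ "\<lambda>_. x"]) (auto simp: lipschitz_path_def cayley_graph_simps[OF S] Metric_space.mdist_zero[OF Metric_space_cayley[OF S]])
next
  case (step x g s t l u)
  let ?X = "cayley_graph G S"
  obtain c where c: "lipschitz_path ?X l c" "c 0 = x" "c l = edge_point g (g \<otimes> s) t" using step.IH by blast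
  have l: "0 \<le> l" using c(1) by (simp add: lipschitz_path_def)
  define m where "m = \<bar>t - u\<bar>"
  \<comment> \<open>Unit speed from \<open>t\<close> to \<open>u\<close> on the last edge, in
    whichever direction is needed.\<close>
  define \<tau> where "\<tau> = (\<lambda>r. if u \<ge> t then t + (r - l) else t - (r - l))"
  define c' where "c' = (\<lambda>r. if r \<le> l then c r else edge_point g (g \<otimes> s) (\<tau> r))"
  have \<tau>: "\<tau> r \<in> {0..1}" "\<bar>\<tau> r - \<tau> r'\<bar> = \<bar>r - r'\<bar>" if "r \<in> {l..l + m}" "r' \<in> {l..l + m}" for r r'
    using that step.hyps by (auto simp: \<tau>_def m_def split: if_splits)
  have old: "c' r = c r" if "r \<le> l" for r using that by (simp add: c'_def)
  have new: "c' r = edge_point g (g \<otimes> s) (\<tau> r)" if "r \<in> {l..l + m}" for r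
    using that c(3) by (cases "r = l") (auto simp: c'_def \<tau>_def)
  have X: "c' r \<in> mspace ?X" if "r \<in> {0..l + m}" for r
  proof (cases "r \<le> l")
    case True then show ?thesis using c(1) that old by (auto simp: lipschitz_path_def)
  next
    case False
    then have r: "r \<in> {l..l + m}" using that by auto
    show ?thesis
      unfolding new[OF r] cayley_graph_simps[OF S] by (rule edge_point_cayley[OF step.hyps(2,3) \<tau>(1)[OF r r]])
  qed
  have d1: "mdist ?X (c' r) (c' r') \<le> \<bar>r - r'\<bar>" if "r \<in> {0..l}" "r' \<in> {0..l}" for r r'
    using c(1) that old by (simp add: lipschitz_path_def)
  have d2: "mdist ?X (c' r) (c' r') \<le> \<bar>r - r'\<bar>" if "r \<in> {l..l + m}" "r' \<in> {l..l + m}" for r r'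
    unfolding new[OF that(1)] new[OF that(2)] \<tau>(2)[OF that, symmetric]
    by (rule cayley_dist_le[OF S cayley_path_edge[OF step.hyps(2,3) \<tau>(1)[OF that(1,1)] \<tau>(1)[OF that(2,2)]]])
  have m0: "0 \<le> m" by (simp add: m_def)
  have d3: "mdist ?X (c' r) (c' r') \<le> \<bar>r - r'\<bar>" if "r \<in> {0..l}" "r' \<in> {l..l + m}" for r r'
    using mdist_triangle[OF X[of r] X[of l] X[of r']] d1[OF that(1), of l] d2[OF _ that(2), of l] that l m0 by auto
  have "mdist ?X (c' r) (c' r') \<le> \<bar>r - r'\<bar>" if r: "r \<in> {0..l + m}" "r' \<in> {0..l + m}" for r r'
  proof -
    consider "r \<in> {0..l}" "r' \<in> {0..l}" | "r \<in> {l..l + m}" "r' \<in> {l..l + m}" | "r \<in> {0..l}" "r' \<in> {l..l + m}"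
      | "r' \<in> {0..l}" "r \<in> {l..l + m}" using r by fastforce
    then show ?thesis
    proof cases
      case 4
      then show ?thesis using d3[OF 4] by (simp add: mdist_commute abs_minus_commute)
    qed (use d1 d2 d3 in auto)
  qed
  then have "lipschitz_path ?X (l + m) c'" using X l m0 by (auto simp: lipschitz_path_def)
  moreover have "c' 0 = x" using old[OF l] c(2) by simp
  moreover have "c' (l + m) = edge_point g (g \<otimes> s) u" using new[of "l + m"] m0 by (auto simp: \<tau>_def m_def)
  ultimately show ?case unfolding m_def by blast
qed

section \<open>Word balls and compactness of metric balls\<close>

primrec word_ball :: "'a set \<Rightarrow> nat \<Rightarrow> 'a set" where
  "word_ball S 0 = {\<one>}"
| "word_ball S (Suc n) = word_ball S n \<union> (\<lambda>(v, s). v \<otimes> s) ` (word_ball S n \<times> S) \<union>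
     (\<lambda>(v, s). v \<otimes> inv s) ` (word_ball S n \<times> S)"

lemma word_ball_mono: "m \<le> n \<Longrightarrow> word_ball S m \<subseteq> word_ball S n"
  by (induction rule: dec_induct) auto

text \<open>Edges are followed in both directions, as \<open>S\<close> need not be closed under
  inverses.\<close>

lemma word_ball_step:
  assumes "v \<in> word_ball S n" "s \<in> S"
  shows "v \<otimes> s \<in> word_ball S (Suc n)" "v \<otimes> inv s \<in> word_ball S (Suc n)"
  using assms by (auto intro!: image_eqI[of _ _ "(v, s)"])

lemma word_ball_finite:
  assumes "finite_generating_set G S"
  shows "finite (word_ball S n)" "word_ball S n \<subseteq> carrier G"
  using assms by (induction n) (auto simp: finite_generating_set_def)

text \<open>The number of vertices passed by a path is estimated through the vertex \<open>v\<close> of the edge that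
  contains its endpoint: leaving \<open>v\<close> completely costs length 1.\<close>

lemma cayley_path_word_ball:
  assumes S: "finite_generating_set G S" and p: "cayley_path G S z x l" and z: "z = edge_point \<one> \<one> 0"
  shows "\<exists>n v. v \<in> word_ball S n \<and> x v > 0 \<and> real n + 1 - x v \<le> l"
  using p z
proof (induction rule: cayley_path.induct)
  case (refl x)
  then show ?case by (intro exI[of _ 0] exI[of _ "\<one>"]) (auto simp: edge_point_def)
next
  case (step z g s t l u)
  let ?x = "edge_point g (g \<otimes> s) t" and ?y = "edge_point g (g \<otimes> s) u"
  obtain n v where v: "v \<in> word_ball S n" "?x v > 0" "real n + 1 - ?x v \<le> l" using step by blast
  have s: "s \<in> carrier G" using S step.hyps by (auto simp: finite_generating_set_def)
  have "v = g \<or> v = g \<otimes> s" by (rule edge_point_pos[OF v(2)])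
  have tu: "0 \<le> t" "t \<le> 1" "0 \<le> u" "u \<le> 1" using step.hyps by auto
  show ?case
  proof (cases "?y v > 0")
    case True
    have "\<bar>?x v - ?y v\<bar> \<le> \<bar>t - u\<bar>"
      using cayley_path_coord[OF cayley_path_edge[OF step.hyps(2-5)]] .
    then show ?thesis using v True by (intro exI[of _ n] exI[of _ v]) auto
  next
    case False
    \<comment> \<open>The weight of \<open>v\<close> can vanish only if the path has arrived at the
      other vertex of the edge, which then has weight 1; the length spent equals the weight that
      \<open>v\<close> has lost. On a loop the weight of \<open>v\<close> is always 1, which
      excludes the last case.\<close>
    consider "v = g" "g \<noteq> g \<otimes> s" | "v = g \<otimes> s" "g \<noteq> g \<otimes> s" | "v = g" "g = g \<otimes> s"
      using \<open>v = g \<or> v = g \<otimes> s\<close> by metis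
    then show ?thesis
    proof cases
      case 1
      have "g \<otimes> s \<in> word_ball S (Suc n)" using word_ball_step(1)[OF v(1) step.hyps(3)] 1 by simp
      then show ?thesis using 1 False v(3) tu
        by (intro exI[of _ "Suc n"] exI[of _ "g \<otimes> s"]) (auto simp: edge_point_def)
    next
      case 2
      have "g \<otimes> s \<otimes> inv s = g" using step.hyps s by (simp add: m_assoc)
      then have "g \<in> word_ball S (Suc n)" using word_ball_step(2)[OF v(1) step.hyps(3)] 2 by simp
      then show ?thesis using 2 False v(3) tu
        by (intro exI[of _ "Suc n"] exI[of _ g]) (auto simp: edge_point_def)
    next
      case 3
      then show ?thesis using False tu by (simp add: edge_point_def)
    qed
  qed
qed

lemma cayley_edge_compact:
  assumes S: "finite_generating_set G S" and g: "g \<in> carrier G" "s \<in> S"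
  shows "compactin (mtopology_of (cayley_graph G S)) (edge_point g (g \<otimes> s) ` {0..1})"
proof -
  let ?I = "submetric euclidean_metric {0..1 :: real}"
  have "Lipschitz_continuous_map ?I (cayley_graph G S) (edge_point g (g \<otimes> s))"
    unfolding Lipschitz_continuous_map_def
  proof (intro conjI exI[of _ 1] ballI)
    show "edge_point g (g \<otimes> s) \<in> mspace ?I \<rightarrow> mspace (cayley_graph G S)"
      using edge_point_cayley[OF g] by (auto simp: cayley_graph_simps[OF S])
    fix t u assume "t \<in> mspace ?I" "u \<in> mspace ?I"
    then show "mdist (cayley_graph G S) (edge_point g (g \<otimes> s) t) (edge_point g (g \<otimes> s) u) \<le> 1 * mdist ?I t u"
      using cayley_dist_le[OF S cayley_path_edge[OF g, of t u]] by (simp add: dist_real_def)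
  qed
  then have "continuous_map (mtopology_of ?I) (mtopology_of (cayley_graph G S)) (edge_point g (g \<otimes> s))"
    by (rule Lipschitz_continuous_imp_continuous_map)
  moreover have "compactin (mtopology_of ?I) {0..1}"
    by (simp add: mtopology_of_submetric compactin_subtopology compactin_euclidean_iff)
  ultimately show ?thesis by (intro image_compactin)
qed

text \<open>A point at bounded distance from the identity lies on an edge with a vertex in a fixed
  finite word ball, so a metric ball is a closed subset of finitely many compact edges.\<close>

lemma cayley_proper:
  assumes S: "finite_generating_set G S"
  shows "proper_space (cayley_graph G S)"
  unfolding proper_space_def
proof (intro ballI allI)
  let ?X = "cayley_graph G S"
  fix x r assume x: "x \<in> mspace ?X"
  define o' where "o' = edge_point \<one> \<one> (0 :: real)"
  have o': "o' \<in> mspace ?X" unfolding o'_def cayley_graph_simps[OF S] by (rule vertex_cayley) simp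
  define n where "n = nat \<lceil>mdist ?X o' x + r + 1\<rceil>"
  \<comment> \<open>\<open>Suc n\<close> because the vertex \<open>v\<close> found in
    \<open>word_ball S n\<close> may be the far end of the edge, whose base vertex is then one step
    away.\<close>
  define E where "E = (\<lambda>v. {edge_point v v (0 :: real)}) ` word_ball S (Suc n) \<union>
    (\<lambda>(v, s). edge_point v (v \<otimes> s) ` {0..1}) ` (word_ball S (Suc n) \<times> S)"
  have SG: "finite S" "S \<subseteq> carrier G" using S by (auto simp: finite_generating_set_def)
  have vX: "edge_point v v 0 \<in> mspace ?X" if "v \<in> word_ball S (Suc n)" for v
    unfolding cayley_graph_simps[OF S] by (rule vertex_cayley) (use word_ball_finite(2)[OF S] that in blast)
  have "compactin (mtopology_of ?X) (\<Union>E)"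
  proof (rule compactin_Union)
    show "finite E" unfolding E_def using word_ball_finite(1)[OF S] SG by blast
    fix A assume "A \<in> E"
    then consider v where "v \<in> word_ball S (Suc n)" "A = {edge_point v v 0}"
      | v s where "v \<in> word_ball S (Suc n)" "s \<in> S" "A = edge_point v (v \<otimes> s) ` {0..1}"
      unfolding E_def by blast
    then show "compactin (mtopology_of ?X) A"
    proof cases
      case 1 then show ?thesis using vX by simp
    next
      case 2
      have "v \<in> carrier G" using word_ball_finite(2)[OF S] 2(1) by blast
      then show ?thesis unfolding 2(3) by (intro cayley_edge_compact[OF S _ 2(2)])
    qed
  qed
  moreover have "mcball_of ?X x r \<subseteq> \<Union>E"
  proof
    fix y assume "y \<in> mcball_of ?X x r"
    then have y: "y \<in> mspace ?X" "mdist ?X x y \<le> r" by auto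
    have "mdist ?X o' y \<le> mdist ?X o' x + r" using mdist_triangle[OF o' x y(1)] y(2) by simp
    moreover obtain l where l: "cayley_path G S o' y l" "l < mdist ?X o' y + 1"
      using cayley_path_near[OF S, of o' y 1] o' y(1) by (auto simp: cayley_graph_simps[OF S])
    moreover obtain m v where m: "v \<in> word_ball S m" "y v > 0" "real m + 1 - y v \<le> l"
      using cayley_path_word_ball[OF S l(1) o'_def] by blast
    moreover have "y v \<le> 1"
      using y(1) by (auto simp: cayley_graph_simps[OF S] cayley_points_def edge_point_def)
    ultimately have "real m \<le> mdist ?X o' x + r + 1" by linarith
    then have "m \<le> n" unfolding n_def by linarith
    then have v: "v \<in> word_ball S n" "v \<in> word_ball S (Suc n)"
      using m(1) word_ball_mono[of m n S] word_ball_mono[of m "Suc n" S] by auto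
    consider g where "y = edge_point g g 0" | g s t where "y = edge_point g (g \<otimes> s) t" "g \<in> carrier G" "s \<in> S" "t \<in> {0..1}"
      using y(1) by (auto simp: cayley_graph_simps[OF S] cayley_points_def)
    then show "y \<in> \<Union>E"
    proof cases
      case 1
      then have "v = g" using m(2) edge_point_pos[of g g 0 v] by auto
      then show ?thesis using 1 v unfolding E_def by blast
    next
      case 2
      have "v = g \<or> v = g \<otimes> s" using m(2) edge_point_pos[of g "g \<otimes> s" t v] 2(1) by simp
      then have "g \<in> word_ball S (Suc n)"
      proof
        assume "v = g \<otimes> s"
        moreover have "g \<otimes> s \<otimes> inv s = g" using 2 SG by (auto simp: m_assoc)
        ultimately show ?thesis using word_ball_step(2)[OF v(1) 2(3)] by simp
      qed (use v in simp)
      then have "edge_point g (g \<otimes> s) ` {0..1} \<in> E" using 2(3) unfolding E_def by blast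
      moreover have "y \<in> edge_point g (g \<otimes> s) ` {0..1}" using 2 by blast
      ultimately show ?thesis by blast
    qed
  qed
  moreover have "closedin (mtopology_of ?X) (mcball_of ?X x r)"
    unfolding mtopology_of_def mcball_of_def by (rule Metric_space.closedin_mcball) simp
  ultimately show "compactin (mtopology_of ?X) (mcball_of ?X x r)" by (rule closed_compactin)
qed

lemma cayley_geodesic:
  assumes S: "finite_generating_set G S"
  shows "geodesic_space (cayley_graph G S)"
proof (rule proper_length_space_geodesic[OF cayley_proper[OF S]])
  fix x y and \<epsilon> :: real assume x: "x \<in> mspace (cayley_graph G S)" "y \<in> mspace (cayley_graph G S)" and e: "\<epsilon> > 0"
  obtain l where l: "cayley_path G S x y l" "l < mdist (cayley_graph G S) x y + \<epsilon>"
    using cayley_path_near[OF S _ _ e] x by (auto simp: cayley_graph_simps[OF S])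
  then show "\<exists>l c. lipschitz_path (cayley_graph G S) l c \<and> c 0 = x \<and> c l = y \<and> l < mdist (cayley_graph G S) x y + \<epsilon>"
    using cayley_lipschitz_path[OF S l(1)] by blast
qed

section \<open>Left translations of the Cayley graph\<close>

definition translate :: "'a \<Rightarrow> ('a \<Rightarrow> real) \<Rightarrow> 'a \<Rightarrow> real" where
  "translate g x = (\<lambda>v. if v \<in> carrier G then x (inv g \<otimes> v) else 0)"

text \<open>Outside the carrier both sides vanish; the value 0 in \<open>translate\<close> is set
  for this purpose, as \<open>inv g \<otimes> v\<close> has no meaning there.\<close>

lemma translate_edge_point:
  assumes "g \<in> carrier G" "a \<in> carrier G" "b \<in> carrier G"
  shows "translate g (edge_point a b t) = edge_point (g \<otimes> a) (g \<otimes> b) t"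
proof
  fix v
  show "translate g (edge_point a b t) v = edge_point (g \<otimes> a) (g \<otimes> b) t v"
  proof (cases "v \<in> carrier G")
    case True
    then have "(inv g \<otimes> v = c) = (v = g \<otimes> c)" if "c \<in> carrier G" for c
      using inv_solve_left'[of v g c] assms(1) that by (metis inv_solve_left)
    then show ?thesis using True assms by (simp add: translate_def edge_point_def)
  next
    case False
    then have "v \<noteq> g \<otimes> a" "v \<noteq> g \<otimes> b" using assms by auto
    then show ?thesis using False by (simp add: translate_def edge_point_def)
  qed
qed

lemma translate_path:
  assumes S: "S \<subseteq> carrier G" and g: "g \<in> carrier G" and "cayley_path G S x y l"
  shows "cayley_path G S (translate g x) (translate g y) l"
  using assms(3)
proof (induction rule: cayley_path.induct)
  case (refl x)
  have "translate g x \<in> cayley_points G S"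
    using refl unfolding cayley_points_def
  proof (elim UnE CollectE exE conjE)
    fix a assume "x = edge_point a a 0" "a \<in> carrier G"
    then show "translate g x \<in> {edge_point g g 0 |g. g \<in> carrier G} \<union>
           {edge_point g (g \<otimes> s) t |g s t. g \<in> carrier G \<and> s \<in> S \<and> t \<in> {0..1}}"
      using translate_edge_point[OF g, of a a] g by auto
  next
    fix a s t assume "x = edge_point a (a \<otimes> s) t" "a \<in> carrier G" "s \<in> S" "t \<in> {0..1 :: real}"
    moreover from this have "translate g x = edge_point (g \<otimes> a) (g \<otimes> a \<otimes> s) t"
      using translate_edge_point[OF g, of a "a \<otimes> s"] g S by (auto simp: m_assoc)
    ultimately show "translate g x \<in> {edge_point g g 0 |g. g \<in> carrier G} \<union>
           {edge_point g (g \<otimes> s) t |g s t. g \<in> carrier G \<and> s \<in> S \<and> t \<in> {0..1}}" using g by blast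
  qed
  then show ?case by (rule cayley_path.refl)
next
  case (step x a s t l u)
  have s: "s \<in> carrier G" using S step.hyps by auto
  have e: "translate g (edge_point a (a \<otimes> s) r) = edge_point (g \<otimes> a) (g \<otimes> a \<otimes> s) r" for r
    using translate_edge_point[OF g, of a "a \<otimes> s"] g s step.hyps by (simp add: m_assoc)
  show ?case unfolding e by (rule cayley_path.step) (use step e g in auto)
qed

lemma translate_inverse:
  assumes S: "S \<subseteq> carrier G" and g: "g \<in> carrier G" and x: "x \<in> cayley_points G S"
  shows "translate (inv g) (translate g x) = x"
proof -
  have t: "translate (inv g) (translate g (edge_point a b t)) = edge_point a b t"
    if ab: "a \<in> carrier G" "b \<in> carrier G" for a b t
  proof -
    have "inv g \<otimes> (g \<otimes> c) = c" if "c \<in> carrier G" for c using g that by (simp add: m_assoc[symmetric])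
    then show ?thesis using translate_edge_point g ab by simp
  qed
  show ?thesis using x S t unfolding cayley_points_def by auto
qed

text \<open>Paths are mapped to paths of the same length, so distances do not increase; applied to
  the inverse translation this gives equality.\<close>

lemma translate_isometry:
  assumes S: "finite_generating_set G S" and g: "g \<in> carrier G"
    and x: "x \<in> mspace (cayley_graph G S)" "y \<in> mspace (cayley_graph G S)"
  shows "translate g x \<in> mspace (cayley_graph G S)"
    "mdist (cayley_graph G S) (translate g x) (translate g y) = mdist (cayley_graph G S) x y"
proof -
  let ?X = "cayley_graph G S"
  have SG: "S \<subseteq> carrier G" using S by (auto simp: finite_generating_set_def)
  have pts: "translate h z \<in> mspace ?X" if "h \<in> carrier G" "z \<in> mspace ?X" for h z
    using cayley_path_points[OF translate_path[OF SG that(1) cayley_path.refl[of z G S]]] that(2)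
    by (simp add: cayley_graph_simps[OF S])
  then show "translate g x \<in> mspace ?X" using g x by blast
  have le: "mdist ?X (translate h z) (translate h w) \<le> mdist ?X z w"
    if zw: "h \<in> carrier G" "z \<in> mspace ?X" "w \<in> mspace ?X" for h z w
  proof (rule field_le_epsilon)
    fix \<epsilon> :: real assume "\<epsilon> > 0"
    then obtain l where "cayley_path G S z w l" "l < mdist ?X z w + \<epsilon>"
      using cayley_path_near[OF S, of z w \<epsilon>] zw by (auto simp: cayley_graph_simps[OF S])
    then show "mdist ?X (translate h z) (translate h w) \<le> mdist ?X z w + \<epsilon>"
      using cayley_dist_le[OF S translate_path[OF SG zw(1)], of z w l] by simp
  qed
  have "mdist ?X x y \<le> mdist ?X (translate g x) (translate g y)"
    using le[of "inv g" "translate g x" "translate g y"] translate_inverse[OF SG g] pts x g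
    by (simp add: cayley_graph_simps[OF S])
  then show "mdist ?X (translate g x) (translate g y) = mdist ?X x y" using le[OF g x] by simp
qed

lemma cayley_near_vertex:
  assumes S: "finite_generating_set G S" and x: "x \<in> mspace (cayley_graph G S)"
  shows "\<exists>g\<in>carrier G. mdist (cayley_graph G S) x (edge_point g g 0) \<le> 1"
proof -
  consider g where "g \<in> carrier G" "x = edge_point g g 0"
    | g s t where "x = edge_point g (g \<otimes> s) t" "g \<in> carrier G" "s \<in> S" "t \<in> {0..1}"
    using x by (auto simp: cayley_graph_simps[OF S] cayley_points_def)
  then show ?thesis
  proof cases
    case 1
    have "mdist (cayley_graph G S) x x = 0" using x by (rule mdist_self)
    then show ?thesis using 1 by (intro bexI[of _ g]) auto
  next
    case 2
    have "mdist (cayley_graph G S) x (edge_point g (g \<otimes> s) 0) \<le> \<bar>t - 0\<bar>"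
      unfolding 2(1) by (rule cayley_dist_le[OF S cayley_path_edge]) (use 2 in auto)
    then show ?thesis using 2 edge_point_0[of g "g \<otimes> s"] by (intro bexI[of _ g]) auto
  qed
qed

end

section \<open>Dense centers from a cobounded family of isometries\<close>

lemma isometry_qi_embedding:
  assumes "\<And>x. x \<in> mspace X \<Longrightarrow> \<phi> x \<in> mspace X"
    and "\<And>x y. x \<in> mspace X \<Longrightarrow> y \<in> mspace X \<Longrightarrow> mdist X (\<phi> x) (\<phi> y) = mdist X x y"
  shows "qi_embedding 1 0 X X \<phi>"
  using assms by (auto simp: qi_embedding_def)

text \<open>Isometries move the base point, so they do not act directly on boundary points: each
  vertex is replaced by the point to which the image of a representing ray heads. The gauge of the
  moved triple is the same for all isometries, because its vertices are seen from
  \<open>\<phi> p\<close> along the moved rays with one stability function.\<close>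

lemma (in morse_space) dense_centers_cobounded:
  assumes iso: "\<And>\<phi> x. \<phi> \<in> F \<Longrightarrow> x \<in> mspace X \<Longrightarrow> \<phi> x \<in> mspace X"
      "\<And>\<phi> x y. \<phi> \<in> F \<Longrightarrow> x \<in> mspace X \<Longrightarrow> y \<in> mspace X \<Longrightarrow> mdist X (\<phi> x) (\<phi> y) = mdist X x y"
    and inv: "\<And>\<phi>. \<phi> \<in> F \<Longrightarrow> \<exists>\<psi>\<in>F. \<forall>x\<in>mspace X. \<psi> (\<phi> x) = x"
    and cob: "\<And>x0. x0 \<in> mspace X \<Longrightarrow> \<exists>C. \<forall>x\<in>mspace X. \<exists>\<phi>\<in>F. mdist X (\<phi> x0) x \<le> C"
    and three: "\<exists>A\<subseteq>morse_boundary X p. card A = 3"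
  obtains N C where "N \<in> morse_gauges" "dense_centers X p N C"
proof -
  obtain a b c where abc: "a \<in> morse_boundary X p" "b \<in> morse_boundary X p" "c \<in> morse_boundary X p"
    "a \<noteq> b" "b \<noteq> c" "c \<noteq> a" using three by (auto simp: card_3_iff)
  have ray: "\<exists>\<beta> D. geodesic X {0..} \<beta> \<and> \<beta> 0 = p \<and> stable_set X D (\<beta> ` {0..}) \<and> heads_to X v (\<beta> ` {0..})"
    if v: "v \<in> morse_boundary X p" for v using morse_boundary_ray[OF v] by metis
  then obtain \<beta> Dv where \<beta>: "\<And>v. v \<in> morse_boundary X p \<Longrightarrow> geodesic X {0..} (\<beta> v) \<and> \<beta> v 0 = p \<and>
    stable_set X (Dv v) (\<beta> v ` {0..}) \<and> heads_to X v (\<beta> v ` {0..})" by metis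
  define D where "D = (\<lambda>L e. max (Dv a L e) (max (Dv b L e) (Dv c L e)))"
  have m: "v \<in> morse_boundary X p" if "v \<in> {a, b, c}" for v using that abc by auto
  have st: "stable_set X D (\<beta> v ` {0..})" if v: "v \<in> {a, b, c}" for v
  proof -
    have "stable_set X (Dv v) (\<beta> v ` {0..})" using \<beta>[OF m[OF v]] by blast
    then show ?thesis by (rule stable_set_mono) (use v in \<open>auto simp: D_def\<close>)
  qed
  obtain N1 where N1: "N1 \<in> morse_gauges"
    "\<And>a b x. a \<in> morse_boundary X p \<Longrightarrow> b \<in> morse_boundary X p \<Longrightarrow> a \<noteq> b \<Longrightarrow> x \<in> mspace X \<Longrightarrow>
      radial X D 0 x a \<Longrightarrow> radial X D 0 x b \<Longrightarrow> morse_pair X p N1 a b"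
    using radial_pair by metis
  have rad: "radial X D 0 p v" if v: "v \<in> {a, b, c}" for v
  proof -
    have "mdist X p (\<beta> v 0) \<le> 0" using \<beta>[OF m[OF v]] base by simp
    then show ?thesis unfolding radial_def using st[OF v] \<beta>[OF m[OF v]] by blast
  qed
  have "[a, b, c] \<in> morse_tuples X p 3 N1"
    unfolding morse_triple_iff
    using N1(2)[OF abc(1,2,4) base rad rad] N1(2)[OF abc(2,3,5) base rad rad] N1(2)[OF abc(3,1,6) base rad rad] by blast
  then obtain x0 where x0: "x0 \<in> centers X (KX N1) a b c" using center_exists(1)[OF N1(1)] by blast
  have x0X: "x0 \<in> mspace X" using x0 by (simp add: centers_iff)
  \<comment> \<open>The unsimplified form is that of \<open>stable_set_qi_image\<close> for an
    isometry with exact inverse, that is with \<open>L1 = 1\<close> and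
    \<open>e1 = D0 = 0\<close>.\<close>
  define D' where "D' = (\<lambda>L e. 1 * (D (1 * L) (1 * e + 0 + 0) + 0))"
  obtain N where N: "N \<in> morse_gauges"
    "\<And>a b x. a \<in> morse_boundary X p \<Longrightarrow> b \<in> morse_boundary X p \<Longrightarrow> a \<noteq> b \<Longrightarrow> x \<in> mspace X \<Longrightarrow>
      radial X D' 0 x a \<Longrightarrow> radial X D' 0 x b \<Longrightarrow> morse_pair X p N a b"
    using radial_pair by metis
  obtain C where C: "\<And>x. x \<in> mspace X \<Longrightarrow> \<exists>\<phi>\<in>F. mdist X (\<phi> x0) x \<le> C" using cob[OF x0X] by blast
  have "\<exists>a b c. [a, b, c] \<in> morse_tuples X p 3 N \<and> \<phi> x0 \<in> centers X (KX N1) a b c" if \<phi>: "\<phi> \<in> F" for \<phi>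
  proof -
    obtain \<psi> where \<psi>: "\<psi> \<in> F" "\<And>x. x \<in> mspace X \<Longrightarrow> \<psi> (\<phi> x) = x" using inv[OF \<phi>] by blast
    have q\<phi>: "qi_embedding 1 0 X X \<phi>" by (rule isometry_qi_embedding) (use iso \<phi> in auto)
    have q\<psi>: "qi_embedding 1 0 X X \<psi>" by (rule isometry_qi_embedding) (use iso \<psi> in auto)
    have geo: "geodesic X I (\<lambda>t. \<phi> (\<gamma> t))" if g: "geodesic X I \<gamma>" for I \<gamma>
      using g iso[OF \<phi>] unfolding geodesic_def Pi_iff by simp
    have st': "stable_set X D' (\<phi> ` A)" if A: "stable_set X D A" for A
      unfolding D'_def
      by (rule stable_set_qi_image[OF _ q\<psi> _ A]) (use iso(1)[OF \<phi>] \<psi>(2) in auto)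
    have "\<exists>w. w \<in> morse_boundary X p \<and> heads_to X w (\<phi> ` \<beta> v ` {0..})" if v: "v \<in> {a, b, c}" for v
    proof -
      have g: "geodesic X {0..} (\<lambda>t. \<phi> (\<beta> v t))" using geo \<beta>[OF m[OF v]] by blast
      have s: "stable_set X D' ((\<lambda>t. \<phi> (\<beta> v t)) ` {0..})" using st'[OF st[OF v]] by (simp add: image_image)
      obtain w where "w \<in> morse_boundary X p" "heads_to X w ((\<lambda>t. \<phi> (\<beta> v t)) ` {0..})"
        by (rule stable_ray_boundary_point[OF geodesic proper base g s])
      then show ?thesis by (auto simp: image_image)
    qed
    then obtain w where w: "\<And>v. v \<in> {a, b, c} \<Longrightarrow> w v \<in> morse_boundary X p \<and> heads_to X (w v) (\<phi> ` \<beta> v ` {0..})" by metis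
    have image_heads: "heads_to X (w v) (\<phi> ` A)" if v: "v \<in> {a, b, c}" and A: "heads_to X v A" for v A
    proof -
      have hv: "heads_to X v (\<beta> v ` {0..})" using \<beta>[OF m[OF v]] by blast
      have "finite_hausdorff_dist X (\<beta> v ` {0..}) A"
        by (rule heads_to_unique_set[OF morse_boundary_visual[OF m[OF v]] hv A])
      from heads_to_fhd[OF _ fhd_qi_image[OF q\<phi> this]] w[OF v] show ?thesis by blast
    qed
    \<comment> \<open>If two image rays headed to one point, applying the inverse isometry would put
      the original rays at finite distance.\<close>
    have w_ne: "w u \<noteq> w v" if uv: "u \<in> {a, b, c}" "v \<in> {a, b, c}" "u \<noteq> v" for u v
    proof
      assume eq: "w u = w v"
      have hw: "heads_to X (w u) (\<phi> ` \<beta> u ` {0..})" "heads_to X (w u) (\<phi> ` \<beta> v ` {0..})"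
        using w[OF uv(1)] w[OF uv(2)] eq by auto
      have "finite_hausdorff_dist X (\<phi> ` \<beta> u ` {0..}) (\<phi> ` \<beta> v ` {0..})"
        by (rule heads_to_unique_set[OF morse_boundary_visual hw]) (use w[OF uv(1)] in blast)
      from fhd_qi_image[OF q\<psi> this]
      have "finite_hausdorff_dist X (\<psi> ` \<phi> ` \<beta> u ` {0..}) (\<psi> ` \<phi> ` \<beta> v ` {0..})" .
      moreover have "\<psi> ` \<phi> ` \<beta> z ` {0..} = \<beta> z ` {0..}" if z: "z \<in> {a, b, c}" for z
      proof -
        have "\<beta> z t \<in> mspace X" if "t \<in> {0..}" for t using \<beta>[OF m[OF z]] geodesic_in that by metis
        then show ?thesis unfolding image_image using \<psi>(2) by (intro image_cong) auto
      qed
      ultimately have "finite_hausdorff_dist X (\<beta> u ` {0..}) (\<beta> v ` {0..})" using uv by simp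
      moreover have "heads_to X u (\<beta> u ` {0..})" "heads_to X v (\<beta> v ` {0..})"
        using \<beta>[OF m[OF uv(1)]] \<beta>[OF m[OF uv(2)]] by auto
      ultimately have "u = v"
        by (intro heads_to_unique_point[OF morse_boundary_visual[OF m[OF uv(1)]] morse_boundary_visual[OF m[OF uv(2)]]
              heads_to_fhd])
      with uv(3) show False by simp
    qed
    have pX: "\<phi> p \<in> mspace X" using iso(1)[OF \<phi> base] .
    have rad': "radial X D' 0 (\<phi> p) (w v)" if v: "v \<in> {a, b, c}" for v
    proof -
      have "geodesic X {0..} (\<lambda>t. \<phi> (\<beta> v t))" using geo \<beta>[OF m[OF v]] by blast
      moreover have "stable_set X D' ((\<lambda>t. \<phi> (\<beta> v t)) ` {0..})" using st'[OF st[OF v]] by (simp add: image_image)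
      moreover have "mdist X (\<phi> p) (\<phi> (\<beta> v 0)) \<le> 0" using \<beta>[OF m[OF v]] pX by simp
      moreover have "heads_to X (w v) ((\<lambda>t. \<phi> (\<beta> v t)) ` {0..})" using w[OF v] by (simp add: image_image)
      ultimately show ?thesis unfolding radial_def by blast
    qed
    have pair: "morse_pair X p N (w u) (w v)" if uv: "u \<in> {a, b, c}" "v \<in> {a, b, c}" "u \<noteq> v" for u v
      using w[OF uv(1)] w[OF uv(2)] by (intro N(2)[OF _ _ w_ne[OF uv] pX rad'[OF uv(1)] rad'[OF uv(2)]]) auto
    have near: "near_line X K (\<phi> x0) (w u) (w v)"
      if uv: "u \<in> {a, b, c}" "v \<in> {a, b, c}" and n: "near_line X K x0 u v" for u v K
    proof -
      obtain \<gamma> t where \<gamma>: "line_between X u v \<gamma>" "mdist X x0 (\<gamma> t) \<le> K" using n by (auto simp: near_line_def)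
      have "heads_to X (w u) (\<phi> ` \<gamma> ` {..0})" "heads_to X (w v) (\<phi> ` \<gamma> ` {0..})"
        using image_heads uv \<gamma>(1) by (simp_all add: line_between_iff)
      then have "line_between X (w u) (w v) (\<lambda>t. \<phi> (\<gamma> t))"
        using geo[OF line_geodesic[OF \<gamma>(1)]] by (simp add: line_between_iff image_image)
      moreover have "mdist X (\<phi> x0) (\<phi> (\<gamma> t)) \<le> K" using iso(2)[OF \<phi> x0X line_in[OF \<gamma>(1)]] \<gamma>(2) by simp
      ultimately show ?thesis unfolding near_line_def by blast
    qed
    have S: "a \<in> {a, b, c}" "b \<in> {a, b, c}" "c \<in> {a, b, c}" by auto
    have "[w a, w b, w c] \<in> morse_tuples X p 3 N"
      unfolding morse_triple_iff using pair[OF S(1,2) abc(4)] pair[OF S(2,3) abc(5)] pair[OF S(3,1) abc(6)] by blast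
    moreover have "\<phi> x0 \<in> centers X (KX N1) (w a) (w b) (w c)"
      using x0 near[OF S(1,2)] near[OF S(2,3)] near[OF S(3,1)] iso(1)[OF \<phi> x0X] unfolding centers_iff by blast
    ultimately show ?thesis by blast
  qed
  \<comment> \<open>A given point is only within \<open>C\<close> of some \<open>\<phi> x0\<close>,
    which adds \<open>C\<close> to the radius.\<close>
  then have "dense_centers X p N (KX N1 + C)"
    unfolding dense_centers_def using C centers_shift by metis
  with N(1) show ?thesis by (rule that)
qed

context group begin

lemma cayley_morse_space:
  assumes S: "finite_generating_set G S" and p: "p \<in> mspace (cayley_graph G S)"
    and K: "center_constants (cayley_graph G S) p K"
  shows "morse_space (cayley_graph G S) p K"
  using cayley_geodesic[OF S] cayley_proper[OF S] p K by unfold_locales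

lemma cayley_dense_centers:
  assumes S: "finite_generating_set G S" and p: "p \<in> mspace (cayley_graph G S)"
    and K: "center_constants (cayley_graph G S) p K"
    and three: "\<exists>A\<subseteq>morse_boundary (cayley_graph G S) p. card A = 3"
  obtains N C where "N \<in> morse_gauges" "dense_centers (cayley_graph G S) p N C"
proof -
  let ?X = "cayley_graph G S"
  interpret morse_space ?X p K by (rule cayley_morse_space[OF S p K])
  have SG: "S \<subseteq> carrier G" using S by (auto simp: finite_generating_set_def)
  show ?thesis
  proof (rule dense_centers_cobounded[of "translate ` carrier G"])
    fix \<phi> x y assume "\<phi> \<in> translate ` carrier G" and x: "x \<in> mspace ?X" "y \<in> mspace ?X"
    then obtain g where "g \<in> carrier G" "\<phi> = translate g" by blast
    then show "mdist ?X (\<phi> x) (\<phi> y) = mdist ?X x y" using translate_isometry(2)[OF S _ x] by simp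
  next
    fix \<phi> x assume "\<phi> \<in> translate ` carrier G" and x: "x \<in> mspace ?X"
    then obtain g where "g \<in> carrier G" "\<phi> = translate g" by blast
    then show "\<phi> x \<in> mspace ?X" using translate_isometry(1)[OF S _ x x] by simp
  next
    fix \<phi> assume "\<phi> \<in> translate ` carrier G"
    then obtain g where g: "g \<in> carrier G" "\<phi> = translate g" by blast
    then show "\<exists>\<psi>\<in>translate ` carrier G. \<forall>x\<in>mspace ?X. \<psi> (\<phi> x) = x"
      using translate_inverse[OF SG g(1)] by (intro bexI[of _ "translate (inv g)"]) (auto simp: cayley_graph_simps[OF S])
  next
    fix x0 assume x0: "x0 \<in> mspace ?X"
    \<comment> \<open>If \<open>g\<close> is a vertex near \<open>x\<close>, translation by
      \<open>g\<close> carries \<open>x0\<close> to a point as far from \<open>g\<close> as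
      \<open>x0\<close> is from the identity.\<close>
    have "\<exists>\<phi>\<in>translate ` carrier G. mdist ?X (\<phi> x0) x \<le> mdist ?X x0 (edge_point \<one> \<one> 0) + 1" if x: "x \<in> mspace ?X" for x
    proof -
      obtain g where g: "g \<in> carrier G" "mdist ?X x (edge_point g g 0) \<le> 1" using cayley_near_vertex[OF S x] by blast
      have v: "edge_point \<one> \<one> 0 \<in> mspace ?X" "edge_point g g 0 \<in> mspace ?X"
        unfolding cayley_graph_simps[OF S] using g by (auto intro: vertex_cayley)
      have "translate g (edge_point \<one> \<one> 0) = edge_point g g 0" using translate_edge_point[OF g(1), of \<one> \<one> 0] g by simp
      then have "mdist ?X (translate g x0) (edge_point g g 0) = mdist ?X x0 (edge_point \<one> \<one> 0)"
        using translate_isometry(2)[OF S g(1) x0 v(1)] by simp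
      then have "mdist ?X (translate g x0) x \<le> mdist ?X x0 (edge_point \<one> \<one> 0) + 1"
        using mdist_triangle[OF translate_isometry(1)[OF S g(1) x0 x0] v(2) x] g(2) by (simp add: mdist_commute)
      then show ?thesis using g(1) by blast
    qed
    then show "\<exists>C. \<forall>x\<in>mspace ?X. \<exists>\<phi>\<in>translate ` carrier G. mdist ?X (\<phi> x0) x \<le> C" by blast
  qed (use three that in auto)
qed

end

theorem mainTheorem1:
  fixes G :: "'g monoid" and H :: "'h monoid"
    and \<G> :: "('x1, 'i1, 'c1) hhs_data" and \<H> :: "('x2, 'i2, 'c2) hhs_data"
    and S :: "'g set" and T :: "'h set"
    and X :: "('g \<Rightarrow> real) metric" and Y :: "('h \<Rightarrow> real) metric"
    and p :: "'g \<Rightarrow> real" and q :: "'h \<Rightarrow> real"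
    and KX KY :: "gauge \<Rightarrow> real"
    and h :: "('g \<Rightarrow> real) bdpoint \<Rightarrow> ('h \<Rightarrow> real) bdpoint"
  assumes "hhg_structure G \<G>" and "hhg_structure H \<H>"
    and "finite_generating_set G S" and "finite_generating_set H T"
    and "X = cayley_graph G S" and "Y = cayley_graph H T"
    and "p \<in> mspace X" and "q \<in> mspace Y"
    and "center_constants X p KX" and "center_constants Y q KY"
    and "\<exists>A\<subseteq>morse_boundary X p. card A = 3" and "\<exists>B\<subseteq>morse_boundary Y q. card B = 3"
    and "homeomorphic_map (morse_topology X p) (morse_topology Y q) h"
  shows "(\<exists>f. quasi_isometry X Y f \<and> induced_by X p Y q h f) \<longleftrightarrow>
     (two_stable X p Y q h \<and> quasi_moebius X p KX Y q KY h \<and>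
      two_stable Y q X p (inv_into (morse_boundary X p) h) \<and>
      quasi_moebius Y q KY X p KX (inv_into (morse_boundary X p) h))"
proof -
  interpret G: group G using assms(1) by (simp add: hhg_structure_def)
  interpret H: group H using assms(2) by (simp add: hhg_structure_def)
  interpret X: morse_space X p KX
    unfolding assms(5) by (rule G.cayley_morse_space[OF assms(3)]) (use assms(5,7,9) in auto)
  interpret Y: morse_space Y q KY
    unfolding assms(6) by (rule H.cayley_morse_space[OF assms(4)]) (use assms(6,8,10) in auto)
  interpret morse_space_pair X p KX Y q KY ..
  obtain NX CX where dX: "NX \<in> morse_gauges" "dense_centers X p NX CX"
    using G.cayley_dense_centers[OF assms(3), of p KX] assms(5,7,9,11) by blast
  obtain NY CY where dY: "NY \<in> morse_gauges" "dense_centers Y q NY CY"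
    using H.cayley_dense_centers[OF assms(4), of q KY] assms(6,8,10,12) by blast
  \<comment> \<open>The underlying set of the direct limit topology is the whole boundary, so the
    homeomorphism is a bijection between the boundaries.\<close>
  have h: "bij_betw h (morse_boundary X p) (morse_boundary Y q)"
    using homeomorphic_imp_injective_map[OF assms(13)] homeomorphic_imp_surjective_map[OF assms(13)]
    by (simp add: topspace_morse bij_betw_def)
  show ?thesis
    using induced_quasi_moebius[OF h HOL.refl] quasi_moebius_induced[OF h HOL.refl _ _ _ _ dX dY assms(11)] by blast
qed

end
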